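(* Let $\mathbb{K}$ be a field and let $B$ be a brace algebra over $\mathbb{K}$. Then the dendriform enveloping algebra $\widetilde{\mathcal U}(B)$ is isomorphic, as a coalgebra, to the tensor coalgebra $T^c(B)$. Consequently $\operatorname{Prim}\widetilde{\mathcal U}(B)=B$ (i.e. the canonical map $B\to\widetilde{\mathcal U}(B)$ identifies $B$ with the space of primitive elements).
   Context: Work over a field $\mathbb{K}$. $T^c(V)=\bigoplus_{n\ge0}V^{\otimes n}$ is the tensor coalgebra with the deconcatenation coproduct. **Dendriform algebras.** A dendriform algebra is a vector space $W$ with bilinear products $\prec,\succ$ such that $(x\prec y)\prec z=x\prec(y\prec z)+x\prec(y\succ z)$, $(x\succ y)\prec z=x\succ(y\prec z)$ (written $x\succ y\prec z$), $x\succ(y\succ z)=(x\succ y)\succ z+(x\prec y)\succ z$. The product $x*y:=x\prec y+x\succ y$ is associative. $D(V)$ denotes the free dendriform algebra on $V$. Define $\nearrow(x_1)=x_1$, $\nearrow(x_1,\dots,x_n)=x_1\prec\nearrow(x_2,\dots,x_n)$, and $\searrow(x_1)=x_1$, $\searrow(x_1,\dots,x_{n+1})=\searrow(x_1,\dots,x_n)\succ x_{n+1}$. **Brace algebras.** A brace algebra is a vector space $B$ with multilinear operations $\{x_1\mid x_2,\dots,x_{n+1}\}$, $n\ge1$, such that for all $n,m\ge 1$ $$\{\{z\mid x_1,\dots,x_n\}\mid y_1,\dots,y_m\}=\sum\{z\mid Y_0,\{x_1\mid Y_1\},Y_2,\{x_2\mid Y_3\},Y_4,\dots,Y_{2n-2},\{x_n\mid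 Y_{2n-1}\},Y_{2n}\},$$ the sum being over partitions of the ordered sequence $y_1,\dots,y_m$ into successive, possibly empty, intervals $Y_0\sqcup\dots\sqcup Y_{2n}$, with $\{x\mid\ \}=x$. A dendriform algebra $D$ has an underlying brace algebra $D_{\mathrm{Brace}}$ with $$\{x_1\mid x_2,\dots,x_{n+1}\}=\sum_{i=1}^{n+1}(-1)^{i-1}\nearrow(x_2,\dots,x_i)\succ x_1\prec\searrow(x_{i+1},\dots,x_{n+1}),$$ where the terms $i=1$ and $i=n+1$ are read as $x_1\prec\searrow(x_2,\dots,x_{n+1})$ and $(-1)^n\nearrow(x_2,\dots,x_{n+1})\succ x_1$. **Unital dendriform algebras.** A unital dendriform algebra is a vector space $W=\mathbb{K}\cdot1\oplus V$ with maps $\prec,\succ:V\otimes W+W\otimes V\to V$ such that $(V,\prec,\succ)$ is a dendriform algebra and $1\prec x=x\succ1=0$, $x\prec1=1\succ x=x$ for $x\in V$; put $1*1=1$. For a dendriform algebra $D$, $\widetilde D:=\mathbb{K}\cdot1\oplus D$. **Dendriform bialgebras.** A dendriform bialgebra is a unital dendriform algebra $W=\mathbb{K}\cdot1\oplus V$ with a coassociative coproduct $\Delta:W\to W\otimes W$ such that $\Delta(1)=1\otimes1$, the projection onto $\mathbb{K}\cdot 1$ along $V$ is a counit, and for all $x,y\in V$ (Sweedler notation) $$\Delta(x\succ y)=(x_{(1)}*y_{(1)})\otimes(x_{(2)}\succ y_{(2)})-(x*y)\otimes(1\succ1)+(x\succ y)\otimes1,$$ $$\Delta(x\prec y)=(x_{(1)}*y_{(1)})\otimes(x_{(2)}\prec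 y_{(2)})-(x*y)\otimes(1\prec1)+(x\prec y)\otimes1,$$ where subtracting the undefined terms $1\succ1$, $1\prec1$ means that in the Sweedler sum the single term with $x_{(2)}=y_{(2)}=1$ is omitted. $\operatorname{Prim}(W)=\{x:\Delta(x)=x\otimes1+1\otimes x\}$. **Enveloping algebra.** For a brace algebra $B$, $\mathcal U(B)$ is the quotient of $D(B)$ by the dendriform ideal generated by the differences between the brace operation $\{x_1\mid x_2,\dots,x_{n+1}\}$ computed in $D(B)_{\mathrm{Brace}}$ and the one computed in $B$, for $n\ge1$, $x_i\in B$. Put $\widetilde{\mathcal U}(B)=\mathbb{K}\cdot1\oplus\mathcal U(B)$. It is a dendriform bialgebra, with the coproduct induced from the dendriform bialgebra structure on $\widetilde D(B)$ for which the elements of $B$ are primitive. *)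

theory Defs
  imports Complex_Main "HOL-Library.Poly_Mapping" "HOL-Algebra.Module" "HOL-Algebra.AbelCoset"
begin

section \<open>Linear algebra\<close>

text \<open>
  Scalars are a type of class \<^class>\<open>field\<close>. The vector spaces constructed below are records of
  type \<^type>\<open>module\<close> from HOL-Algebra over \<open>ground\<close>, the field regarded as a ring and as a module
  over itself. The ring components \<open>mult\<close> and \<open>one\<close> of a module record play no role for the
  linear structure.
\<close>

definition ground :: "('k::field, 'k) module" where
  "ground = \<lparr>carrier = UNIV, mult = (*), one = 1, zero = 0, add = (+), smult = (*)\<rparr>"

definition lin_hom ::
    "('k, 'v, 'm) module_scheme \<Rightarrow> ('k::field, 'w, 'n) module_scheme \<Rightarrow> ('v \<Rightarrow> 'w) set" where
  "lin_hom M N = {f \<in> carrier M \<rightarrow> carrier N.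
     (\<forall>x\<in>carrier M. \<forall>y\<in>carrier M. f (x \<oplus>\<^bsub>M\<^esub> y) = f x \<oplus>\<^bsub>N\<^esub> f y) \<and>
     (\<forall>c. \<forall>x\<in>carrier M. f (c \<odot>\<^bsub>M\<^esub> x) = c \<odot>\<^bsub>N\<^esub> f x)}"

definition lin_span :: "('k::field, 'v, 'm) module_scheme \<Rightarrow> 'v set \<Rightarrow> 'v set" where
  "lin_span M S = \<Inter>{N. submodule N ground M \<and> S \<subseteq> N}"

definition quot_space :: "('k::field, 'v, 'm) module_scheme \<Rightarrow> 'v set \<Rightarrow> ('k, 'v set) module" where
  "quot_space M N = \<lparr>carrier = a_rcosets\<^bsub>M\<^esub> N, mult = undefined, one = undefined,
     zero = N, add = set_add M, smult = (\<lambda>c X. \<Union>x\<in>X. N +>\<^bsub>M\<^esub> (c \<odot>\<^bsub>M\<^esub> x))\<rparr>"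

text \<open>The vector space with basis \<open>X\<close>.\<close>

definition free_space :: "'x set \<Rightarrow> ('k::field, 'x \<Rightarrow>\<^sub>0 'k) module" where
  "free_space X = \<lparr>carrier = {f. Poly_Mapping.keys f \<subseteq> X}, mult = undefined, one = undefined,
     zero = 0, add = (+), smult = (\<lambda>c. Poly_Mapping.map ((*) c))\<rparr>"

abbreviation gen :: "'x \<Rightarrow> 'x \<Rightarrow>\<^sub>0 'k::field" where
  "gen x \<equiv> Poly_Mapping.single x 1"

definition lin_ext ::
    "('k::field, 'v, 'm) module_scheme \<Rightarrow> ('x \<Rightarrow> 'v) \<Rightarrow> ('x \<Rightarrow>\<^sub>0 'k) \<Rightarrow> 'v" where
  "lin_ext M g f = (\<Oplus>\<^bsub>M\<^esub>x\<in>Poly_Mapping.keys f. Poly_Mapping.lookup f x \<odot>\<^bsub>M\<^esub> g x)"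

subsection \<open>Tensor products\<close>

definition tensor_rel ::
    "('k::field, 'v, 'm) module_scheme \<Rightarrow> ('k, 'w, 'n) module_scheme \<Rightarrow> ('v \<times> 'w \<Rightarrow>\<^sub>0 'k) set" where
  "tensor_rel M N = lin_span (free_space (carrier M \<times> carrier N))
     ({gen (x \<oplus>\<^bsub>M\<^esub> x', y) - gen (x, y) - gen (x', y) | x x' y.
         x \<in> carrier M \<and> x' \<in> carrier M \<and> y \<in> carrier N} \<union>
      {gen (x, y \<oplus>\<^bsub>N\<^esub> y') - gen (x, y) - gen (x, y') | x y y'.
         x \<in> carrier M \<and> y \<in> carrier N \<and> y' \<in> carrier N} \<union>
      {gen (c \<odot>\<^bsub>M\<^esub> x, y) - Poly_Mapping.single (x, y) c | c x y.
         x \<in> carrier M \<and> y \<in> carrier N} \<union>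
      {gen (x, c \<odot>\<^bsub>N\<^esub> y) - Poly_Mapping.single (x, y) c | c x y.
         x \<in> carrier M \<and> y \<in> carrier N})"

definition tensor ::
    "('k::field, 'v, 'm) module_scheme \<Rightarrow> ('k, 'w, 'n) module_scheme
      \<Rightarrow> ('k, ('v \<times> 'w \<Rightarrow>\<^sub>0 'k) set) module" where
  "tensor M N = quot_space (free_space (carrier M \<times> carrier N)) (tensor_rel M N)"

definition pure_tensor ::
    "('k::field, 'v, 'm) module_scheme \<Rightarrow> ('k, 'w, 'n) module_scheme
      \<Rightarrow> 'v \<Rightarrow> 'w \<Rightarrow> ('v \<times> 'w \<Rightarrow>\<^sub>0 'k) set" where
  "pure_tensor M N x y =
     tensor_rel M N +>\<^bsub>free_space (carrier M \<times> carrier N)\<^esub> gen (x, y)"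

text \<open>
  For a bilinear map \<open>\<beta>\<close> into \<open>P\<close>, the linear map on the tensor product sending the pure tensor
  of \<open>x\<close> and \<open>y\<close> to \<open>\<beta> x y\<close>: the common value on all representatives of a coset.
\<close>

definition tensor_lift ::
    "('k::field, 'u, 'p) module_scheme \<Rightarrow> ('v \<Rightarrow> 'w \<Rightarrow> 'u) \<Rightarrow> ('v \<times> 'w \<Rightarrow>\<^sub>0 'k) set \<Rightarrow> 'u" where
  "tensor_lift P \<beta> t = the_elem (lin_ext P (\<lambda>(x, y). \<beta> x y) ` t)"

definition tensor_map ::
    "('k::field, 'v', 'm) module_scheme \<Rightarrow> ('k, 'w', 'n) module_scheme \<Rightarrow> ('v \<Rightarrow> 'v') \<Rightarrow> ('w \<Rightarrow> 'w')
      \<Rightarrow> ('v \<times> 'w \<Rightarrow>\<^sub>0 'k) set \<Rightarrow> ('v' \<times> 'w' \<Rightarrow>\<^sub>0 'k) set" where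
  "tensor_map M' N' f g =
     tensor_lift (tensor M' N') (\<lambda>x y. pure_tensor M' N' (f x) (g y))"

definition tensor_assoc ::
    "('k::field, 'u, 'l) module_scheme \<Rightarrow> ('k, 'v, 'm) module_scheme \<Rightarrow> ('k, 'w, 'n) module_scheme
      \<Rightarrow> (('u \<times> 'v \<Rightarrow>\<^sub>0 'k) set \<times> 'w \<Rightarrow>\<^sub>0 'k) set \<Rightarrow> ('u \<times> ('v \<times> 'w \<Rightarrow>\<^sub>0 'k) set \<Rightarrow>\<^sub>0 'k) set" where
  "tensor_assoc L M N =
     tensor_lift (tensor L (tensor M N))
       (\<lambda>t z. tensor_lift (tensor L (tensor M N))
          (\<lambda>x y. pure_tensor L (tensor M N) x (pure_tensor M N y z)) t)"

section \<open>Coalgebras\<close>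

definition coalgebra ::
    "('k::field, 'v, 'm) module_scheme \<Rightarrow> ('v \<Rightarrow> ('v \<times> 'v \<Rightarrow>\<^sub>0 'k) set) \<Rightarrow> ('v \<Rightarrow> 'k) \<Rightarrow> bool" where
  "coalgebra C \<Delta> \<epsilon> \<longleftrightarrow>
     Module.module ground C \<and> \<Delta> \<in> lin_hom C (tensor C C) \<and> \<epsilon> \<in> lin_hom C ground \<and>
     (\<forall>x\<in>carrier C.
        tensor_assoc C C C (tensor_map (tensor C C) C \<Delta> id (\<Delta> x)) =
        tensor_map C (tensor C C) id \<Delta> (\<Delta> x)) \<and>
     (\<forall>x\<in>carrier C. tensor_lift C (\<lambda>y z. \<epsilon> y \<odot>\<^bsub>C\<^esub> z) (\<Delta> x) = x) \<and>
     (\<forall>x\<in>carrier C. tensor_lift C (\<lambda>y z. \<epsilon> z \<odot>\<^bsub>C\<^esub> y) (\<Delta> x) = x)"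

definition coalgebra_hom where
  "coalgebra_hom C \<Delta> \<epsilon> C' \<Delta>' \<epsilon>' =
     {f \<in> lin_hom C C'.
        \<forall>x\<in>carrier C. \<Delta>' (f x) = tensor_map C' C' f f (\<Delta> x) \<and> \<epsilon>' (f x) = \<epsilon> x}"

definition coalgebra_iso where
  "coalgebra_iso C \<Delta> \<epsilon> C' \<Delta>' \<epsilon>' =
     {f \<in> coalgebra_hom C \<Delta> \<epsilon> C' \<Delta>' \<epsilon>'. bij_betw f (carrier C) (carrier C')}"

subsection \<open>The tensor coalgebra\<close>

text \<open>
  The direct sum of the tensor powers of \<open>V\<close>, presented as the space spanned by all words in \<open>V\<close>
  (the word \<open>[x\<^sub>1, \<dots>, x\<^sub>n]\<close> standing for \<open>x\<^sub>1 \<otimes> \<dots> \<otimes> x\<^sub>n\<close>) modulo multilinearity in each letter.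
\<close>

definition word_rel ::
    "('k::field \<Rightarrow> 'b::ab_group_add \<Rightarrow> 'b) \<Rightarrow> ('b list \<Rightarrow>\<^sub>0 'k) set" where
  "word_rel scale = lin_span (free_space UNIV)
     ({gen (us @ (x + y) # vs) - gen (us @ x # vs) - gen (us @ y # vs) | us vs x y. True} \<union>
      {gen (us @ scale c x # vs) - Poly_Mapping.single (us @ x # vs) c | us vs c x. True})"

definition tensor_words ::
    "('k::field \<Rightarrow> 'b::ab_group_add \<Rightarrow> 'b) \<Rightarrow> ('k, ('b list \<Rightarrow>\<^sub>0 'k) set) module" where
  "tensor_words scale = quot_space (free_space UNIV) (word_rel scale)"

definition word ::
    "('k::field \<Rightarrow> 'b::ab_group_add \<Rightarrow> 'b) \<Rightarrow> 'b list \<Rightarrow> ('b list \<Rightarrow>\<^sub>0 'k) set" where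
  "word scale w = word_rel scale +>\<^bsub>free_space UNIV\<^esub> gen w"

definition deconcatenation where
  "deconcatenation scale t =
     (let T = tensor_words scale in
      the_elem (lin_ext (tensor T T)
        (\<lambda>w. \<Oplus>\<^bsub>tensor T T\<^esub>i\<in>{..length w}.
                pure_tensor T T (word scale (take i w)) (word scale (drop i w))) ` t))"

text \<open>The counit is the projection onto words of length zero.\<close>

definition word_counit :: "('b list \<Rightarrow>\<^sub>0 'k::field) set \<Rightarrow> 'k" where
  "word_counit t = the_elem ((\<lambda>f. Poly_Mapping.lookup f []) ` t)"

section \<open>Dendriform algebras\<close>

record ('k, 'v) dendriform = "('k, 'v) module" +
  dprec :: "'v \<Rightarrow> 'v \<Rightarrow> 'v"  (infixl \<open>\<prec>\<index>\<close> 70)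
  dsucc :: "'v \<Rightarrow> 'v \<Rightarrow> 'v"  (infixl \<open>\<succ>\<index>\<close> 70)

definition dstar :: "('k::field, 'v, 'm) dendriform_scheme \<Rightarrow> 'v \<Rightarrow> 'v \<Rightarrow> 'v" where
  "dstar A x y = (x \<prec>\<^bsub>A\<^esub> y) \<oplus>\<^bsub>A\<^esub> (x \<succ>\<^bsub>A\<^esub> y)"

definition bilinear_op :: "('k::field, 'v, 'm) module_scheme \<Rightarrow> ('v \<Rightarrow> 'v \<Rightarrow> 'v) \<Rightarrow> bool" where
  "bilinear_op M f \<longleftrightarrow>
     (\<forall>x\<in>carrier M. (\<lambda>y. f x y) \<in> lin_hom M M \<and> (\<lambda>y. f y x) \<in> lin_hom M M)"

definition dendriform_algebra :: "('k::field, 'v, 'm) dendriform_scheme \<Rightarrow> bool" where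
  "dendriform_algebra A \<longleftrightarrow>
     Module.module ground A \<and> bilinear_op A (dprec A) \<and> bilinear_op A (dsucc A) \<and>
     (\<forall>x\<in>carrier A. \<forall>y\<in>carrier A. \<forall>z\<in>carrier A.
        (x \<prec>\<^bsub>A\<^esub> y) \<prec>\<^bsub>A\<^esub> z = (x \<prec>\<^bsub>A\<^esub> (y \<prec>\<^bsub>A\<^esub> z)) \<oplus>\<^bsub>A\<^esub> (x \<prec>\<^bsub>A\<^esub> (y \<succ>\<^bsub>A\<^esub> z)) \<and>
        (x \<succ>\<^bsub>A\<^esub> y) \<prec>\<^bsub>A\<^esub> z = x \<succ>\<^bsub>A\<^esub> (y \<prec>\<^bsub>A\<^esub> z) \<and>
        x \<succ>\<^bsub>A\<^esub> (y \<succ>\<^bsub>A\<^esub> z) = ((x \<succ>\<^bsub>A\<^esub> y) \<succ>\<^bsub>A\<^esub> z) \<oplus>\<^bsub>A\<^esub> ((x \<prec>\<^bsub>A\<^esub> y) \<succ>\<^bsub>A\<^esub> z))"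

definition dend_ideal :: "('k::field, 'v, 'm) dendriform_scheme \<Rightarrow> 'v set \<Rightarrow> bool" where
  "dend_ideal A I \<longleftrightarrow> submodule I ground A \<and>
     (\<forall>x\<in>carrier A. \<forall>i\<in>I.
        x \<prec>\<^bsub>A\<^esub> i \<in> I \<and> i \<prec>\<^bsub>A\<^esub> x \<in> I \<and> x \<succ>\<^bsub>A\<^esub> i \<in> I \<and> i \<succ>\<^bsub>A\<^esub> x \<in> I)"

definition dend_ideal_gen :: "('k::field, 'v, 'm) dendriform_scheme \<Rightarrow> 'v set \<Rightarrow> 'v set" where
  "dend_ideal_gen A S = \<Inter>{I. dend_ideal A I \<and> S \<subseteq> I}"

definition dend_quot ::
    "('k::field, 'v, 'm) dendriform_scheme \<Rightarrow> 'v set \<Rightarrow> ('k, 'v set) dendriform" where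
  "dend_quot A I = module.extend (quot_space A I)
     (dendriform.fields
        (\<lambda>X Y. \<Union>x\<in>X. \<Union>y\<in>Y. I +>\<^bsub>A\<^esub> (x \<prec>\<^bsub>A\<^esub> y))
        (\<lambda>X Y. \<Union>x\<in>X. \<Union>y\<in>Y. I +>\<^bsub>A\<^esub> (x \<succ>\<^bsub>A\<^esub> y)))"

text \<open>
  The unital dendriform algebra \<open>K \<cdot> 1 \<oplus> A\<close>, on pairs of a scalar and an element of \<open>A\<close>; the
  components \<open>mult\<close> and \<open>one\<close> are the product \<open>*\<close> and its unit. The products \<open>\<prec>\<close> and \<open>\<succ>\<close> are
  only meaningful when one argument lies in \<open>A\<close>. Here they are extended to total bilinear maps
  by \<open>1 \<prec> 1 = 1 \<succ> 1 = 0\<close>, so that a Sweedler sum of such products automatically omits the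
  undefined terms.
\<close>

definition unital :: "('k::field, 'v, 'm) dendriform_scheme \<Rightarrow> ('k, 'k \<times> 'v) dendriform" where
  "unital A = \<lparr>carrier = UNIV \<times> carrier A,
     mult = (\<lambda>(a, x) (b, y). (a * b, (a \<odot>\<^bsub>A\<^esub> y) \<oplus>\<^bsub>A\<^esub> (b \<odot>\<^bsub>A\<^esub> x) \<oplus>\<^bsub>A\<^esub> dstar A x y)),
     one = (1, \<zero>\<^bsub>A\<^esub>),
     zero = (0, \<zero>\<^bsub>A\<^esub>),
     add = (\<lambda>(a, x) (b, y). (a + b, x \<oplus>\<^bsub>A\<^esub> y)),
     smult = (\<lambda>c (a, x). (c * a, c \<odot>\<^bsub>A\<^esub> x)),
     dprec = (\<lambda>(a, x) (b, y). (0, (b \<odot>\<^bsub>A\<^esub> x) \<oplus>\<^bsub>A\<^esub> (x \<prec>\<^bsub>A\<^esub> y))),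
     dsucc = (\<lambda>(a, x) (b, y). (0, (a \<odot>\<^bsub>A\<^esub> y) \<oplus>\<^bsub>A\<^esub> (x \<succ>\<^bsub>A\<^esub> y)))\<rparr>"

definition primitive ::
    "('k::field, 'v, 'm) module_scheme \<Rightarrow> ('v \<Rightarrow> ('v \<times> 'v \<Rightarrow>\<^sub>0 'k) set) \<Rightarrow> 'v set" where
  "primitive W \<Delta> = {x \<in> carrier W.
     \<Delta> x = pure_tensor W W x \<one>\<^bsub>W\<^esub> \<oplus>\<^bsub>tensor W W\<^esub> pure_tensor W W \<one>\<^bsub>W\<^esub> x}"

text \<open>
  \<open>sweedler_op W f \<Delta> x y\<close> is \<open>\<Sum> (x\<^sub>1 * y\<^sub>1) \<otimes> f x\<^sub>2 y\<^sub>2\<close> in Sweedler notation.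
\<close>

definition sweedler_op where
  "sweedler_op W f \<Delta> x y =
     tensor_lift (tensor W W)
       (\<lambda>x1 x2. tensor_lift (tensor W W)
          (\<lambda>y1 y2. pure_tensor W W (x1 \<otimes>\<^bsub>W\<^esub> y1) (f x2 y2)) (\<Delta> y)) (\<Delta> x)"

definition dendriform_bialgebra ::
    "('k::field, 'v) dendriform \<Rightarrow> ('k \<times> 'v \<Rightarrow> (('k \<times> 'v) \<times> ('k \<times> 'v) \<Rightarrow>\<^sub>0 'k) set) \<Rightarrow> bool" where
  "dendriform_bialgebra A \<Delta> \<longleftrightarrow>
     (let W = unital A in
      dendriform_algebra A \<and> coalgebra W \<Delta> fst \<and>
      \<Delta> \<one>\<^bsub>W\<^esub> = pure_tensor W W \<one>\<^bsub>W\<^esub> \<one>\<^bsub>W\<^esub> \<and>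
      (\<forall>x\<in>{0} \<times> carrier A. \<forall>y\<in>{0} \<times> carrier A.
         \<Delta> (x \<succ>\<^bsub>W\<^esub> y) =
           sweedler_op W (dsucc W) \<Delta> x y \<oplus>\<^bsub>tensor W W\<^esub> pure_tensor W W (x \<succ>\<^bsub>W\<^esub> y) \<one>\<^bsub>W\<^esub> \<and>
         \<Delta> (x \<prec>\<^bsub>W\<^esub> y) =
           sweedler_op W (dprec W) \<Delta> x y \<oplus>\<^bsub>tensor W W\<^esub> pure_tensor W W (x \<prec>\<^bsub>W\<^esub> y) \<one>\<^bsub>W\<^esub>))"

subsection \<open>Free dendriform algebras\<close>

datatype 'b dterm = Gen 'b | Prec "'b dterm" "'b dterm" | Succ "'b dterm" "'b dterm"

definition bilin_ext ::
    "('x \<Rightarrow> 'x \<Rightarrow> 'x) \<Rightarrow> ('x \<Rightarrow>\<^sub>0 'k::field) \<Rightarrow> ('x \<Rightarrow>\<^sub>0 'k) \<Rightarrow> ('x \<Rightarrow>\<^sub>0 'k)" where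
  "bilin_ext h f g = (\<Sum>s\<in>Poly_Mapping.keys f. \<Sum>t\<in>Poly_Mapping.keys g.
     Poly_Mapping.single (h s t) (Poly_Mapping.lookup f s * Poly_Mapping.lookup g t))"

text \<open>
  The space spanned by all formal terms, with two bilinear products satisfying no relations.
\<close>

definition term_algebra :: "('k::field, 'b dterm \<Rightarrow>\<^sub>0 'k) dendriform" where
  "term_algebra = module.extend (free_space UNIV)
     (dendriform.fields (bilin_ext Prec) (bilin_ext Succ))"

definition free_dend_rel ::
    "('k::field \<Rightarrow> 'b::ab_group_add \<Rightarrow> 'b) \<Rightarrow> ('b dterm \<Rightarrow>\<^sub>0 'k) set" where
  "free_dend_rel scale =
     (let p = dprec term_algebra; s = dsucc term_algebra in
      dend_ideal_gen term_algebra
        ({gen (Gen (x + y)) - gen (Gen x) - gen (Gen y) | x y. True} \<union>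
         {gen (Gen (scale c x)) - Poly_Mapping.single (Gen x) c | c x. True} \<union>
         {p (p x y) z - p x (p y z) - p x (s y z) | x y z. True} \<union>
         {p (s x y) z - s x (p y z) | x y z. True} \<union>
         {s x (s y z) - s (s x y) z - s (p x y) z | x y z. True}))"

definition free_dend ::
    "('k::field \<Rightarrow> 'b::ab_group_add \<Rightarrow> 'b) \<Rightarrow> ('k, ('b dterm \<Rightarrow>\<^sub>0 'k) set) dendriform" where
  "free_dend scale = dend_quot term_algebra (free_dend_rel scale)"

definition free_dend_in ::
    "('k::field \<Rightarrow> 'b::ab_group_add \<Rightarrow> 'b) \<Rightarrow> 'b \<Rightarrow> ('b dterm \<Rightarrow>\<^sub>0 'k) set" where
  "free_dend_in scale x = free_dend_rel scale +>\<^bsub>term_algebra\<^esub> gen (Gen x)"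

text \<open>
  The coproduct on \<open>K \<cdot> 1 \<oplus> D(V)\<close>: it is determined on the carrier by being a dendriform
  bialgebra structure for which the generators are primitive.
\<close>

definition free_dend_coproduct where
  "free_dend_coproduct scale =
     (SOME \<Delta>. dendriform_bialgebra (free_dend scale) \<Delta> \<and>
        (\<forall>x. (0, free_dend_in scale x) \<in> primitive (unital (free_dend scale)) \<Delta>))"

section \<open>Brace algebras\<close>

text \<open>
  \<open>brace_args br [x\<^sub>1, \<dots>, x\<^sub>n] [Y\<^sub>0, \<dots>, Y\<^sub>2\<^sub>n]\<close> is the list
  \<open>Y\<^sub>0, {x\<^sub>1 | Y\<^sub>1}, Y\<^sub>2, \<dots>, {x\<^sub>n | Y\<^sub>2\<^sub>n\<^sub>-\<^sub>1}, Y\<^sub>2\<^sub>n\<close>.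
\<close>

fun brace_args :: "('b \<Rightarrow> 'b list \<Rightarrow> 'b) \<Rightarrow> 'b list \<Rightarrow> 'b list list \<Rightarrow> 'b list" where
  "brace_args br [] [Y] = Y"
| "brace_args br (x # xs) (Y # Y' # Ys) = Y @ br x Y' # brace_args br xs Ys"
| "brace_args br _ _ = undefined"

text \<open>
  \<open>brace x ys\<close> is \<open>{x | ys}\<close>. A partition of \<open>ys\<close> into successive, possibly empty, intervals is
  a list of lists with concatenation \<open>ys\<close>; by convention \<open>{x | } = x\<close>.
\<close>

locale brace_algebra = vector_space scale
  for scale :: "'k::field \<Rightarrow> 'b::ab_group_add \<Rightarrow> 'b" +
  fixes brace :: "'b \<Rightarrow> 'b list \<Rightarrow> 'b"
  assumes brace_Nil: "brace x [] = x"
    and brace_add_left: "brace (x + x') ys = brace x ys + brace x' ys"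
    and brace_scale_left: "brace (scale c x) ys = scale c (brace x ys)"
    and brace_add: "brace x (us @ (y + y') # vs) = brace x (us @ y # vs) + brace x (us @ y' # vs)"
    and brace_scale: "brace x (us @ scale c y # vs) = scale c (brace x (us @ y # vs))"
    and brace_brace: "xs \<noteq> [] \<Longrightarrow> ys \<noteq> [] \<Longrightarrow>
      brace (brace z xs) ys =
        (\<Sum>Y\<in>{Y. length Y = 2 * length xs + 1 \<and> concat Y = ys}. brace z (brace_args brace xs Y))"

fun nearrow :: "('k::field, 'v, 'm) dendriform_scheme \<Rightarrow> 'v list \<Rightarrow> 'v" where
  "nearrow A [] = undefined"
| "nearrow A [x] = x"
| "nearrow A (x # y # ys) = x \<prec>\<^bsub>A\<^esub> nearrow A (y # ys)"

definition searrow :: "('k::field, 'v, 'm) dendriform_scheme \<Rightarrow> 'v list \<Rightarrow> 'v" where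
  "searrow A xs = foldl (dsucc A) (hd xs) (tl xs)"

text \<open>
  The brace \<open>{x | ys}\<close> in the underlying brace algebra of a dendriform algebra; the summation index
  \<open>i\<close> is the number of entries of \<open>ys\<close> to the left of \<open>x\<close>.
\<close>

definition dend_brace :: "('k::field, 'v, 'm) dendriform_scheme \<Rightarrow> 'v \<Rightarrow> 'v list \<Rightarrow> 'v" where
  "dend_brace A x ys = (\<Oplus>\<^bsub>A\<^esub>i\<in>{..length ys}. (- 1) ^ i \<odot>\<^bsub>A\<^esub>
     (let l = (if i = 0 then x else nearrow A (take i ys) \<succ>\<^bsub>A\<^esub> x)
      in if i = length ys then l else l \<prec>\<^bsub>A\<^esub> searrow A (drop i ys)))"

section \<open>The dendriform enveloping algebra of a brace algebra\<close>

definition env_ideal ::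
    "('k::field \<Rightarrow> 'b::ab_group_add \<Rightarrow> 'b) \<Rightarrow> ('b \<Rightarrow> 'b list \<Rightarrow> 'b) \<Rightarrow> ('b dterm \<Rightarrow>\<^sub>0 'k) set set" where
  "env_ideal scale brace =
     (let D = free_dend scale; \<iota> = free_dend_in scale in
      dend_ideal_gen D {dend_brace D (\<iota> x) (map \<iota> ys) \<ominus>\<^bsub>D\<^esub> \<iota> (brace x ys) | x ys. ys \<noteq> []})"

definition env ::
    "('k::field \<Rightarrow> 'b::ab_group_add \<Rightarrow> 'b) \<Rightarrow> ('b \<Rightarrow> 'b list \<Rightarrow> 'b)
      \<Rightarrow> ('k, ('b dterm \<Rightarrow>\<^sub>0 'k) set set) dendriform" where
  "env scale brace = dend_quot (free_dend scale) (env_ideal scale brace)"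

definition env1 where
  "env1 scale brace = unital (env scale brace)"

text \<open>The map induced by the quotient map, from \<open>K \<cdot> 1 \<oplus> D(B)\<close> onto \<open>K \<cdot> 1 \<oplus> U(B)\<close>.\<close>

definition env1_proj where
  "env1_proj scale brace = (\<lambda>(a, x). (a, env_ideal scale brace +>\<^bsub>free_dend scale\<^esub> x))"

definition env1_in where
  "env1_in scale brace x = env1_proj scale brace (0, free_dend_in scale x)"

text \<open>
  The induced coproduct: the unique \<open>\<Delta>\<^sub>U\<close> with \<open>\<Delta>\<^sub>U \<circ> \<pi> = (\<pi> \<otimes> \<pi>) \<circ> \<Delta>\<^sub>D\<close> for the projection \<open>\<pi>\<close>.
\<close>

definition env1_coproduct where
  "env1_coproduct scale brace u =
     (let \<pi> = env1_proj scale brace; W = env1 scale brace in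
      the_elem ((\<lambda>x. tensor_map W W \<pi> \<pi> (free_dend_coproduct scale x)) `
        {x \<in> carrier (unital (free_dend scale)). \<pi> x = u}))"

end

theory Submission
  imports Defs
begin

text \<open>
  Words over \<open>B\<close>, with deconcatenation, carry a dendriform bialgebra structure: \<open>t \<succ> s y = (t * s) y\<close>, and
  \<open>t x \<prec> s = \<Sum> (t * s\<^sub>1) {x | s\<^sub>2}\<close> over the deconcatenations of \<open>s\<close>. A word is thus the left-nested
  \<open>\<succ>\<close>-product of its letters, and the dendriform brace of letters is the given brace, so there is a morphism
  from the enveloping algebra onto words.

  Conversely, in any dendriform algebra the series of the signed \<open>\<nearrow>\<close> and of the \<open>\<searrow>\<close> are inverse for
  convolution, hence \<open>x \<prec> \<searrow>(t) = \<Sum> \<searrow>(t\<^sub>1) \<succ> {x | t\<^sub>2}\<close>. In the enveloping algebra the braces of elements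
  of \<open>B\<close> lie in \<open>B\<close>, so \<open>\<searrow>\<close> is a dendriform morphism from words, inverse to the first one. Both coproducts
  are morphisms of augmented dendriform algebras and agree on \<open>B\<close>; the primitives of the tensor coalgebra
  are the letters.
\<close>

section \<open>Linear algebra over a field\<close>

text \<open>That words span U(B) is a matter of rewriting; that distinct words stay distinct needs a
  model, and the algebra on words is this model. In it the brace identity enters once, in the form
  {{z | s} | t} = {z | s * t}: B is a right module over words with the product \<open>star\<close>.
  The relation (x \<prec> s) \<prec> r = x \<prec> (s * r) compares cuts of s and of r with cuts of
  s * r, so multiplicativity of deconcatenation has to precede associativity and is proved without
  it. The coproduct of U(B) is defined through the fibres of the quotient map. Its compatibility
  with the brace relations is not checked inside D(B): the coproduct of D(B) and deconcatenation
  correspond under the morphism to words because the two composites agree on generators, and the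
  inverse morphism carries this back to U(B).\<close>

abbreviation vs :: "('k::field, 'v, 'm) module_scheme \<Rightarrow> bool" where
  "vs M \<equiv> Module.module ground M"

lemma ground_simps [simp]:
  "carrier ground = UNIV" "add ground = (+)" "zero ground = 0"
  "mult ground = (*)" "one ground = 1" "smult ground = (*)"
  by (simp_all add: ground_def)

lemma cring_ground: "cring (ground :: ('k::field, 'k) module)"
proof (rule cringI)
  show "abelian_group (ground :: ('k, 'k) module)"
  proof (rule abelian_groupI)
    fix x :: 'k
    have "- x + x = 0" by simp
    then show "\<exists>y\<in>carrier ground. y \<oplus>\<^bsub>ground\<^esub> x = \<zero>\<^bsub>ground\<^esub>" by (metis UNIV_I ground_simps(1,2,3))
  qed (auto simp: ac_simps)
  show "comm_monoid (ground :: ('k, 'k) module)"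
    by (rule comm_monoidI) (auto simp: ac_simps)
qed (auto simp: algebra_simps)

text \<open>Additive inverses come from the scalar -1, so that every axiom is an equation or a
  closure condition.\<close>

lemma vsI:
  fixes M :: "('k::field, 'v, 'm) module_scheme"
  assumes "\<And>x y. x \<in> carrier M \<Longrightarrow> y \<in> carrier M \<Longrightarrow> x \<oplus>\<^bsub>M\<^esub> y \<in> carrier M"
    and "\<zero>\<^bsub>M\<^esub> \<in> carrier M"
    and "\<And>c x. x \<in> carrier M \<Longrightarrow> c \<odot>\<^bsub>M\<^esub> x \<in> carrier M"
    and "\<And>x y z. x \<in> carrier M \<Longrightarrow> y \<in> carrier M \<Longrightarrow> z \<in> carrier M \<Longrightarrow>
      (x \<oplus>\<^bsub>M\<^esub> y) \<oplus>\<^bsub>M\<^esub> z = x \<oplus>\<^bsub>M\<^esub> (y \<oplus>\<^bsub>M\<^esub> z)"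
    and "\<And>x y. x \<in> carrier M \<Longrightarrow> y \<in> carrier M \<Longrightarrow> x \<oplus>\<^bsub>M\<^esub> y = y \<oplus>\<^bsub>M\<^esub> x"
    and "\<And>x. x \<in> carrier M \<Longrightarrow> \<zero>\<^bsub>M\<^esub> \<oplus>\<^bsub>M\<^esub> x = x"
    and "\<And>x. x \<in> carrier M \<Longrightarrow> (- 1) \<odot>\<^bsub>M\<^esub> x \<oplus>\<^bsub>M\<^esub> x = \<zero>\<^bsub>M\<^esub>"
    and "\<And>a b x. x \<in> carrier M \<Longrightarrow> (a + b) \<odot>\<^bsub>M\<^esub> x = a \<odot>\<^bsub>M\<^esub> x \<oplus>\<^bsub>M\<^esub> b \<odot>\<^bsub>M\<^esub> x"
    and "\<And>a x y. x \<in> carrier M \<Longrightarrow> y \<in> carrier M \<Longrightarrow>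
      a \<odot>\<^bsub>M\<^esub> (x \<oplus>\<^bsub>M\<^esub> y) = a \<odot>\<^bsub>M\<^esub> x \<oplus>\<^bsub>M\<^esub> a \<odot>\<^bsub>M\<^esub> y"
    and "\<And>a b x. x \<in> carrier M \<Longrightarrow> (a * b) \<odot>\<^bsub>M\<^esub> x = a \<odot>\<^bsub>M\<^esub> (b \<odot>\<^bsub>M\<^esub> x)"
    and "\<And>x. x \<in> carrier M \<Longrightarrow> 1 \<odot>\<^bsub>M\<^esub> x = x"
  shows "vs M"
proof (rule moduleI)
  show "abelian_group M"
    by (rule abelian_groupI) (use assms in blast)+
qed (simp_all add: cring_ground assms)

context
  fixes M :: "('k::field, 'v, 'm) module_scheme"
  assumes M: "vs M"
begin

interpretation Module.module ground M by (rule M)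

lemma vs_add_closed [simp]: "x \<in> carrier M \<Longrightarrow> y \<in> carrier M \<Longrightarrow> x \<oplus>\<^bsub>M\<^esub> y \<in> carrier M"
  by simp
lemma vs_zero_closed [simp]: "\<zero>\<^bsub>M\<^esub> \<in> carrier M" by simp
lemma vs_smult_closed [simp]: "x \<in> carrier M \<Longrightarrow> c \<odot>\<^bsub>M\<^esub> x \<in> carrier M" by (simp)
lemma vs_l_zero [simp]: "x \<in> carrier M \<Longrightarrow> \<zero>\<^bsub>M\<^esub> \<oplus>\<^bsub>M\<^esub> x = x" by simp
lemma vs_r_zero [simp]: "x \<in> carrier M \<Longrightarrow> x \<oplus>\<^bsub>M\<^esub> \<zero>\<^bsub>M\<^esub> = x" by simp
lemma vs_assoc: "x \<in> carrier M \<Longrightarrow> y \<in> carrier M \<Longrightarrow> z \<in> carrier M \<Longrightarrow>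
    (x \<oplus>\<^bsub>M\<^esub> y) \<oplus>\<^bsub>M\<^esub> z = x \<oplus>\<^bsub>M\<^esub> (y \<oplus>\<^bsub>M\<^esub> z)" by (rule M.a_assoc)
lemma vs_comm: "x \<in> carrier M \<Longrightarrow> y \<in> carrier M \<Longrightarrow> x \<oplus>\<^bsub>M\<^esub> y = y \<oplus>\<^bsub>M\<^esub> x" by (rule M.a_comm)
lemma vs_lcomm: "x \<in> carrier M \<Longrightarrow> y \<in> carrier M \<Longrightarrow> z \<in> carrier M \<Longrightarrow>
    x \<oplus>\<^bsub>M\<^esub> (y \<oplus>\<^bsub>M\<^esub> z) = y \<oplus>\<^bsub>M\<^esub> (x \<oplus>\<^bsub>M\<^esub> z)" by (rule M.a_lcomm)
lemma vs_smult_add: "x \<in> carrier M \<Longrightarrow> y \<in> carrier M \<Longrightarrow>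
    c \<odot>\<^bsub>M\<^esub> (x \<oplus>\<^bsub>M\<^esub> y) = c \<odot>\<^bsub>M\<^esub> x \<oplus>\<^bsub>M\<^esub> c \<odot>\<^bsub>M\<^esub> y" using smult_r_distr by simp
lemma vs_add_smult: "x \<in> carrier M \<Longrightarrow> (a + b) \<odot>\<^bsub>M\<^esub> x = a \<odot>\<^bsub>M\<^esub> x \<oplus>\<^bsub>M\<^esub> b \<odot>\<^bsub>M\<^esub> x"
  using smult_l_distr[of a b x] by simp
lemma vs_smult_smult [simp]: "x \<in> carrier M \<Longrightarrow> a \<odot>\<^bsub>M\<^esub> (b \<odot>\<^bsub>M\<^esub> x) = (a * b) \<odot>\<^bsub>M\<^esub> x"
  using smult_assoc1[of a b x] by simp
lemma vs_smult_one [simp]: "x \<in> carrier M \<Longrightarrow> 1 \<odot>\<^bsub>M\<^esub> x = x" using smult_one[of x] by simp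
lemma vs_zero_smult [simp]: "x \<in> carrier M \<Longrightarrow> 0 \<odot>\<^bsub>M\<^esub> x = \<zero>\<^bsub>M\<^esub>" using smult_l_null[of x] by simp
lemma vs_smult_zero [simp]: "c \<odot>\<^bsub>M\<^esub> \<zero>\<^bsub>M\<^esub> = \<zero>\<^bsub>M\<^esub>" using smult_r_null[of c] by simp
lemma vs_minus_eq: "x \<in> carrier M \<Longrightarrow> \<ominus>\<^bsub>M\<^esub> x = (- 1) \<odot>\<^bsub>M\<^esub> x"
proof -
  assume x: "x \<in> carrier M"
  have "(- 1) \<odot>\<^bsub>M\<^esub> x \<oplus>\<^bsub>M\<^esub> x = \<zero>\<^bsub>M\<^esub>"
    using x vs_add_smult[OF x, of "- 1" 1] vs_smult_one[OF x] vs_zero_smult[OF x] by (simp del: vs_zero_smult)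
  then show ?thesis using x vs_smult_closed by (metis M.add.inv_equality)
qed
lemma vs_diff_eq: "x \<in> carrier M \<Longrightarrow> y \<in> carrier M \<Longrightarrow> x \<ominus>\<^bsub>M\<^esub> y = x \<oplus>\<^bsub>M\<^esub> (- 1) \<odot>\<^bsub>M\<^esub> y"
  by (simp add: a_minus_def vs_minus_eq)
lemma vs_neg_add [simp]: "x \<in> carrier M \<Longrightarrow> (- 1) \<odot>\<^bsub>M\<^esub> x \<oplus>\<^bsub>M\<^esub> x = \<zero>\<^bsub>M\<^esub>"
  using vs_minus_eq M.l_neg by metis
lemma vs_add_neg [simp]: "x \<in> carrier M \<Longrightarrow> x \<oplus>\<^bsub>M\<^esub> (- 1) \<odot>\<^bsub>M\<^esub> x = \<zero>\<^bsub>M\<^esub>"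
  using vs_minus_eq M.r_neg by metis
lemma vs_left_cancel: "x \<in> carrier M \<Longrightarrow> y \<in> carrier M \<Longrightarrow> z \<in> carrier M \<Longrightarrow>
    x \<oplus>\<^bsub>M\<^esub> y = x \<oplus>\<^bsub>M\<^esub> z \<longleftrightarrow> y = z"
  by (metis vs_assoc vs_l_zero vs_neg_add vs_smult_closed)
lemma vs_right_cancel: "x \<in> carrier M \<Longrightarrow> y \<in> carrier M \<Longrightarrow> z \<in> carrier M \<Longrightarrow>
    y \<oplus>\<^bsub>M\<^esub> x = z \<oplus>\<^bsub>M\<^esub> x \<longleftrightarrow> y = z"
  by (metis vs_comm vs_left_cancel)
text \<open>Differences are written with the scalar -1: linear maps then respect them by additivity
  and homogeneity alone.\<close>

lemma vs_eq_iff_diff: "x \<in> carrier M \<Longrightarrow> y \<in> carrier M \<Longrightarrow> x = y \<longleftrightarrow> x \<oplus>\<^bsub>M\<^esub> (- 1) \<odot>\<^bsub>M\<^esub> y = \<zero>\<^bsub>M\<^esub>"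
  by (metis vs_add_neg vs_right_cancel vs_smult_closed)

lemma vs_finsum_closed: "(\<And>i. i \<in> A \<Longrightarrow> f i \<in> carrier M) \<Longrightarrow> finsum M f A \<in> carrier M"
  by (rule M.finsum_closed) auto
lemma vs_finsum_add: "(\<And>i. i \<in> A \<Longrightarrow> f i \<in> carrier M) \<Longrightarrow> (\<And>i. i \<in> A \<Longrightarrow> g i \<in> carrier M) \<Longrightarrow>
    finsum M (\<lambda>i. f i \<oplus>\<^bsub>M\<^esub> g i) A = finsum M f A \<oplus>\<^bsub>M\<^esub> finsum M g A"
  by (rule M.finsum_addf) auto
lemma vs_finsum_smult: "finite A \<Longrightarrow> (\<And>i. i \<in> A \<Longrightarrow> f i \<in> carrier M) \<Longrightarrow>
    finsum M (\<lambda>i. c \<odot>\<^bsub>M\<^esub> f i) A = c \<odot>\<^bsub>M\<^esub> finsum M f A"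
  using finsum_smult_ldistr[of A c f] by auto
lemma vs_finsum_cong: "A = B \<Longrightarrow> (\<And>i. i \<in> B \<Longrightarrow> g i \<in> carrier M) \<Longrightarrow> (\<And>i. i \<in> B \<Longrightarrow> f i = g i) \<Longrightarrow>
    finsum M f A = finsum M g B"
  by (rule M.finsum_cong') auto
lemma vs_finsum_mono_neutral: "finite B \<Longrightarrow> A \<subseteq> B \<Longrightarrow> (\<And>i. i \<in> A \<Longrightarrow> f i \<in> carrier M) \<Longrightarrow>
    (\<And>i. i \<in> B - A \<Longrightarrow> f i = \<zero>\<^bsub>M\<^esub>) \<Longrightarrow> finsum M f A = finsum M f B"
  by (rule M.add.finprod_mono_neutral_cong_left) (auto, metis M.zero_closed)
lemma vs_finsum_singleton: "f i \<in> carrier M \<Longrightarrow> finsum M f {i} = f i"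
  using M.finsum_insert[of "{}" i f] by (simp)
lemma vs_finsum_empty: "finsum M f {} = \<zero>\<^bsub>M\<^esub>"
  by (simp)
lemma vs_finsum_insert: "finite A \<Longrightarrow> a \<notin> A \<Longrightarrow> f a \<in> carrier M \<Longrightarrow> (\<And>i. i \<in> A \<Longrightarrow> f i \<in> carrier M) \<Longrightarrow>
    finsum M f (insert a A) = f a \<oplus>\<^bsub>M\<^esub> finsum M f A"
  by (rule M.finsum_insert) auto
lemma vs_finsum_Suc: "(\<And>i. i \<le> Suc n \<Longrightarrow> f i \<in> carrier M) \<Longrightarrow>
    finsum M f {..Suc n} = f (Suc n) \<oplus>\<^bsub>M\<^esub> finsum M f {..n}"
  by (rule M.finsum_Suc) auto
lemma vs_finsum_Suc2: "(\<And>i. i \<le> Suc n \<Longrightarrow> f i \<in> carrier M) \<Longrightarrow>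
    finsum M f {..Suc n} = finsum M (\<lambda>i. f (Suc i)) {..n} \<oplus>\<^bsub>M\<^esub> f 0"
  by (rule M.finsum_Suc2) auto

lemma submodule_vsI:
  assumes "N \<subseteq> carrier M" "\<zero>\<^bsub>M\<^esub> \<in> N" "\<And>a b. a \<in> N \<Longrightarrow> b \<in> N \<Longrightarrow> a \<oplus>\<^bsub>M\<^esub> b \<in> N"
    "\<And>c a. a \<in> N \<Longrightarrow> c \<odot>\<^bsub>M\<^esub> a \<in> N"
  shows "submodule N ground M"
  by (rule submoduleI) (use assms vs_minus_eq in \<open>auto simp: subset_iff\<close>)

lemma submoduleD:
  assumes "submodule N ground M"
  shows "N \<subseteq> carrier M" "\<zero>\<^bsub>M\<^esub> \<in> N" "\<And>a b. a \<in> N \<Longrightarrow> b \<in> N \<Longrightarrow> a \<oplus>\<^bsub>M\<^esub> b \<in> N"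
    "\<And>c a. a \<in> N \<Longrightarrow> c \<odot>\<^bsub>M\<^esub> a \<in> N"
proof -
  note * = submoduleE[OF assms]
  show "N \<subseteq> carrier M" "\<And>a b. a \<in> N \<Longrightarrow> b \<in> N \<Longrightarrow> a \<oplus>\<^bsub>M\<^esub> b \<in> N"
    "\<And>c a. a \<in> N \<Longrightarrow> c \<odot>\<^bsub>M\<^esub> a \<in> N" using * by simp_all
  obtain x where "x \<in> N" using *(2) by auto
  then show "\<zero>\<^bsub>M\<^esub> \<in> N" using *(1) *(4)[of 0 x] vs_zero_smult by auto
qed

lemma submodule_Inter:
  assumes "F \<noteq> {}" "\<And>N. N \<in> F \<Longrightarrow> submodule N ground M"
  shows "submodule (\<Inter>F) ground M"
  proof (rule submodule_vsI)
  note * = submoduleD[OF assms(2)]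
  show "\<Inter>F \<subseteq> carrier M" using assms(1) *(1) by blast
  show "\<zero>\<^bsub>M\<^esub> \<in> \<Inter>F" using *(2) by blast
  show "a \<oplus>\<^bsub>M\<^esub> b \<in> \<Inter>F" if "a \<in> \<Inter>F" "b \<in> \<Inter>F" for a b using that *(3) by blast
  show "c \<odot>\<^bsub>M\<^esub> a \<in> \<Inter>F" if "a \<in> \<Inter>F" for a c using that *(4) by blast
qed

lemma lin_span_submodule: "S \<subseteq> carrier M \<Longrightarrow> submodule (lin_span M S) ground M"
  unfolding lin_span_def by (rule submodule_Inter) (use carrier_is_submodule in auto)

lemma lin_span_superset: "S \<subseteq> lin_span M S"
  unfolding lin_span_def by auto

lemma lin_span_least: "submodule N ground M \<Longrightarrow> S \<subseteq> N \<Longrightarrow> lin_span M S \<subseteq> N"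
  unfolding lin_span_def by auto

end

subsection \<open>Linear and bilinear maps\<close>

named_theorems lin

lemma lin_homI:
  assumes "\<And>x. x \<in> carrier M \<Longrightarrow> f x \<in> carrier N"
    "\<And>x y. x \<in> carrier M \<Longrightarrow> y \<in> carrier M \<Longrightarrow> f (x \<oplus>\<^bsub>M\<^esub> y) = f x \<oplus>\<^bsub>N\<^esub> f y"
    "\<And>c x. x \<in> carrier M \<Longrightarrow> f (c \<odot>\<^bsub>M\<^esub> x) = c \<odot>\<^bsub>N\<^esub> f x"
  shows "f \<in> lin_hom M N"
  using assms by (auto simp: lin_hom_def)

lemma lin_homD:
  assumes "f \<in> lin_hom M N"
  shows lin_hom_closed: "x \<in> carrier M \<Longrightarrow> f x \<in> carrier N"
    and lin_hom_add: "x \<in> carrier M \<Longrightarrow> y \<in> carrier M \<Longrightarrow> f (x \<oplus>\<^bsub>M\<^esub> y) = f x \<oplus>\<^bsub>N\<^esub> f y"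
    and lin_hom_smult: "x \<in> carrier M \<Longrightarrow> f (c \<odot>\<^bsub>M\<^esub> x) = c \<odot>\<^bsub>N\<^esub> f x"
  using assms by (auto simp: lin_hom_def)

lemma lin_hom_zero:
  assumes "vs M" "vs N" "f \<in> lin_hom M N" shows "f \<zero>\<^bsub>M\<^esub> = \<zero>\<^bsub>N\<^esub>"
  using lin_hom_smult[OF assms(3), of "\<zero>\<^bsub>M\<^esub>" 0] lin_hom_closed[OF assms(3), of "\<zero>\<^bsub>M\<^esub>"] assms(1,2)
  by simp

lemma lin_hom_finsum:
  assumes M: "vs M" and N: "vs N" and f: "f \<in> lin_hom M N"
    and "finite A" "\<And>i. i \<in> A \<Longrightarrow> g i \<in> carrier M"
  shows "f (finsum M g A) = finsum N (\<lambda>i. f (g i)) A"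
  using assms(4,5)
  by (induction A rule: finite_induct)
     (auto simp: vs_finsum_empty[OF M] vs_finsum_empty[OF N] vs_finsum_insert[OF M] vs_finsum_insert[OF N]
        lin_hom_zero[OF M N f] lin_hom_add[OF f] lin_hom_closed[OF f] vs_finsum_closed[OF M])

lemma lin_hom_id [lin]: "(\<lambda>x. x) \<in> lin_hom M M"
  by (simp add: lin_hom_def)

lemma lin_hom_sum [lin]:
  "vs N \<Longrightarrow> f \<in> lin_hom M N \<Longrightarrow> g \<in> lin_hom M N \<Longrightarrow> (\<lambda>x. f x \<oplus>\<^bsub>N\<^esub> g x) \<in> lin_hom M N"
  by (rule lin_homI) (auto simp: lin_homD vs_smult_add vs_assoc vs_lcomm)

lemma lin_hom_smult' [lin]:
  "vs N \<Longrightarrow> f \<in> lin_hom M N \<Longrightarrow> (\<lambda>x. c \<odot>\<^bsub>N\<^esub> f x) \<in> lin_hom M N"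
  by (rule lin_homI) (auto simp: lin_homD vs_smult_add mult.commute)

lemma lin_hom_smult_left [lin]:
  "vs N \<Longrightarrow> f \<in> lin_hom M ground \<Longrightarrow> y \<in> carrier N \<Longrightarrow> (\<lambda>x. f x \<odot>\<^bsub>N\<^esub> y) \<in> lin_hom M N"
  by (rule lin_homI) (auto simp: lin_homD vs_add_smult)

lemma lin_hom_const_zero [lin]: "vs N \<Longrightarrow> (\<lambda>x. \<zero>\<^bsub>N\<^esub>) \<in> lin_hom M N"
  by (rule lin_homI) auto

lemma lin_hom_comp:
  "f \<in> lin_hom N P \<Longrightarrow> g \<in> lin_hom M N \<Longrightarrow> (\<lambda>x. f (g x)) \<in> lin_hom M P"
  by (auto simp: lin_hom_def Pi_iff)

lemma lin_hom_ground_mult [lin]: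
  "f \<in> lin_hom M ground \<Longrightarrow> (\<lambda>x. f x * c) \<in> lin_hom M ground"
  "f \<in> lin_hom M ground \<Longrightarrow> (\<lambda>x. c * f x) \<in> lin_hom M ground"
  by (auto simp: lin_hom_def algebra_simps)

lemma vs_ground [simp]: "vs ground"
  by (rule vsI) (auto simp: algebra_simps)

lemma submodule_kernel:
  assumes M: "vs M" and N: "vs N" and f: "f \<in> lin_hom M N"
  shows "submodule {x \<in> carrier M. f x = \<zero>\<^bsub>N\<^esub>} ground M"
  by (rule submodule_vsI) (use assms in \<open>auto simp: lin_homD lin_hom_zero\<close>)

definition bilin ::
    "('k::field, 'u, 'l) module_scheme \<Rightarrow> ('k, 'v, 'm) module_scheme \<Rightarrow> ('k, 'w, 'n) module_scheme
      \<Rightarrow> ('u \<Rightarrow> 'v \<Rightarrow> 'w) \<Rightarrow> bool" where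
  "bilin M N P \<beta> \<longleftrightarrow> (\<forall>x\<in>carrier M. (\<lambda>y. \<beta> x y) \<in> lin_hom N P) \<and> (\<forall>y\<in>carrier N. (\<lambda>x. \<beta> x y) \<in> lin_hom M P)"

lemma bilinI:
  "(\<And>x. x \<in> carrier M \<Longrightarrow> (\<lambda>y. \<beta> x y) \<in> lin_hom N P) \<Longrightarrow> (\<And>y. y \<in> carrier N \<Longrightarrow> (\<lambda>x. \<beta> x y) \<in> lin_hom M P)
    \<Longrightarrow> bilin M N P \<beta>"
  by (auto simp: bilin_def)

lemma bilin_right: "bilin M N P \<beta> \<Longrightarrow> x \<in> carrier M \<Longrightarrow> f \<in> lin_hom Q N \<Longrightarrow> (\<lambda>y. \<beta> x (f y)) \<in> lin_hom Q P"
  by (auto simp: bilin_def intro: lin_hom_comp)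

lemma bilin_left: "bilin M N P \<beta> \<Longrightarrow> y \<in> carrier N \<Longrightarrow> f \<in> lin_hom Q M \<Longrightarrow> (\<lambda>x. \<beta> (f x) y) \<in> lin_hom Q P"
  by (rule lin_hom_comp[where f = "\<lambda>x. \<beta> x y"]) (auto simp: bilin_def)

lemma bilinD:
  assumes "bilin M N P \<beta>"
  shows bilin_closed: "x \<in> carrier M \<Longrightarrow> y \<in> carrier N \<Longrightarrow> \<beta> x y \<in> carrier P"
    and bilin_add_left: "x \<in> carrier M \<Longrightarrow> x' \<in> carrier M \<Longrightarrow> y \<in> carrier N \<Longrightarrow>
      \<beta> (x \<oplus>\<^bsub>M\<^esub> x') y = \<beta> x y \<oplus>\<^bsub>P\<^esub> \<beta> x' y"
    and bilin_add_right: "x \<in> carrier M \<Longrightarrow> y \<in> carrier N \<Longrightarrow> y' \<in> carrier N \<Longrightarrow>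
      \<beta> x (y \<oplus>\<^bsub>N\<^esub> y') = \<beta> x y \<oplus>\<^bsub>P\<^esub> \<beta> x y'"
    and bilin_smult_left: "x \<in> carrier M \<Longrightarrow> y \<in> carrier N \<Longrightarrow> \<beta> (c \<odot>\<^bsub>M\<^esub> x) y = c \<odot>\<^bsub>P\<^esub> \<beta> x y"
    and bilin_smult_right: "x \<in> carrier M \<Longrightarrow> y \<in> carrier N \<Longrightarrow> \<beta> x (c \<odot>\<^bsub>N\<^esub> y) = c \<odot>\<^bsub>P\<^esub> \<beta> x y"
proof -
  assume x: "x \<in> carrier M"
  then have r: "(\<lambda>y. \<beta> x y) \<in> lin_hom N P" using assms by (simp add: bilin_def)
  { assume y: "y \<in> carrier N"
    then have l: "(\<lambda>x. \<beta> x y) \<in> lin_hom M P" using assms by (simp add: bilin_def)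
    show "\<beta> x y \<in> carrier P" using lin_homD(1)[OF r y] .
    show "\<beta> (c \<odot>\<^bsub>M\<^esub> x) y = c \<odot>\<^bsub>P\<^esub> \<beta> x y" using lin_homD(3)[OF l x] .
    show "\<beta> x (c \<odot>\<^bsub>N\<^esub> y) = c \<odot>\<^bsub>P\<^esub> \<beta> x y" using lin_homD(3)[OF r y] .
    show "x' \<in> carrier M \<Longrightarrow> \<beta> (x \<oplus>\<^bsub>M\<^esub> x') y = \<beta> x y \<oplus>\<^bsub>P\<^esub> \<beta> x' y" using lin_homD(2)[OF l x] .
    show "y' \<in> carrier N \<Longrightarrow> \<beta> x (y \<oplus>\<^bsub>N\<^esub> y') = \<beta> x y \<oplus>\<^bsub>P\<^esub> \<beta> x y'" using lin_homD(2)[OF r y] . }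
qed

lemma bilin_zero:
  assumes "bilin M N P \<beta>" "vs M" "vs N" "vs P"
  shows bilin_zero_left: "y \<in> carrier N \<Longrightarrow> \<beta> \<zero>\<^bsub>M\<^esub> y = \<zero>\<^bsub>P\<^esub>"
    and bilin_zero_right: "x \<in> carrier M \<Longrightarrow> \<beta> x \<zero>\<^bsub>N\<^esub> = \<zero>\<^bsub>P\<^esub>"
  using assms lin_hom_zero[of M P "\<lambda>x. \<beta> x y"] lin_hom_zero[of N P "\<lambda>y. \<beta> x y"] by (auto simp: bilin_def)

subsection \<open>Quotients\<close>

context
  fixes M :: "('k::field, 'v, 'm) module_scheme" and N :: "'v set"
  assumes M: "vs M" and N: "submodule N ground M"
begin

interpretation Module.module ground M by (rule M)

lemma abelian_subgroup_submodule: "abelian_subgroup N M"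
  by (rule abelian_subgroupI3)
     (use submodule.axioms(1)[OF N] M.abelian_group_axioms in \<open>auto intro: additive_subgroup.intro\<close>)

interpretation S: abelian_subgroup N M by (rule abelian_subgroup_submodule)

lemma quot_space_simps:
  "carrier (quot_space M N) = a_rcosets\<^bsub>M\<^esub> N"
  "zero (quot_space M N) = N"
  "add (quot_space M N) = set_add M"
  "smult (quot_space M N) = (\<lambda>c X. \<Union>x\<in>X. N +>\<^bsub>M\<^esub> (c \<odot>\<^bsub>M\<^esub> x))"
  by (simp_all add: quot_space_def)

lemma coset_eq_iff:
  assumes "x \<in> carrier M" "y \<in> carrier M"
  shows "N +>\<^bsub>M\<^esub> x = N +>\<^bsub>M\<^esub> y \<longleftrightarrow> x \<oplus>\<^bsub>M\<^esub> (- 1) \<odot>\<^bsub>M\<^esub> y \<in> N"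
proof -
  have "N +>\<^bsub>M\<^esub> x = N +>\<^bsub>M\<^esub> y \<longleftrightarrow> x \<in> N +>\<^bsub>M\<^esub> y"
    by (metis S.a_rcos_self S.a_repr_independence' assms)
  also have "\<dots> \<longleftrightarrow> x \<ominus>\<^bsub>M\<^esub> y \<in> N"
    using S.a_rcos_module_minus assms M.abelian_group_axioms by (metis M.minus_eq S.a_rcos_module)
  finally show ?thesis using assms by (simp add: vs_diff_eq[OF M])
qed

lemma mem_coset_iff:
  assumes "x \<in> carrier M"
  shows "y \<in> N +>\<^bsub>M\<^esub> x \<longleftrightarrow> y \<in> carrier M \<and> N +>\<^bsub>M\<^esub> y = N +>\<^bsub>M\<^esub> x"
  by (metis S.a_elemrcos_carrier S.a_rcos_self S.a_repr_independence' assms)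

lemma carrier_quot: "carrier (quot_space M N) = (\<lambda>x. N +>\<^bsub>M\<^esub> x) ` carrier M"
  by (auto simp: quot_space_simps A_RCOSETS_def')

lemma zero_quot: "\<zero>\<^bsub>quot_space M N\<^esub> = N +>\<^bsub>M\<^esub> \<zero>\<^bsub>M\<^esub>"
  using submoduleD[OF M N] by (simp add: quot_space_simps)

lemma add_quot: "x \<in> carrier M \<Longrightarrow> y \<in> carrier M \<Longrightarrow>
    (N +>\<^bsub>M\<^esub> x) \<oplus>\<^bsub>quot_space M N\<^esub> (N +>\<^bsub>M\<^esub> y) = N +>\<^bsub>M\<^esub> (x \<oplus>\<^bsub>M\<^esub> y)"
  by (simp add: quot_space_simps S.a_rcos_sum)

text \<open>The scalar action is a union over all representatives. It is one coset because scaling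
  the difference of two representatives stays in N.\<close>

lemma smult_quot:
  assumes "x \<in> carrier M"
  shows "c \<odot>\<^bsub>quot_space M N\<^esub> (N +>\<^bsub>M\<^esub> x) = N +>\<^bsub>M\<^esub> (c \<odot>\<^bsub>M\<^esub> x)"
proof -
  have eq: "N +>\<^bsub>M\<^esub> (c \<odot>\<^bsub>M\<^esub> y) = N +>\<^bsub>M\<^esub> (c \<odot>\<^bsub>M\<^esub> x)" if "y \<in> N +>\<^bsub>M\<^esub> x" for y
  proof -
    have y: "y \<in> carrier M" "y \<oplus>\<^bsub>M\<^esub> (- 1) \<odot>\<^bsub>M\<^esub> x \<in> N"
      using that assms coset_eq_iff by (auto simp: mem_coset_iff)
    have "c \<odot>\<^bsub>M\<^esub> (y \<oplus>\<^bsub>M\<^esub> (- 1) \<odot>\<^bsub>M\<^esub> x) \<in> N" using y submoduleD[OF M N] by blast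
    then show ?thesis using y assms M by (subst coset_eq_iff) (auto simp: vs_smult_add)
  qed
  have "(\<Union>y\<in>N +>\<^bsub>M\<^esub> x. N +>\<^bsub>M\<^esub> (c \<odot>\<^bsub>M\<^esub> y)) = (\<Union>y\<in>N +>\<^bsub>M\<^esub> x. N +>\<^bsub>M\<^esub> (c \<odot>\<^bsub>M\<^esub> x))"
    by (rule SUP_cong) (use eq in auto)
  moreover have "x \<in> N +>\<^bsub>M\<^esub> x" using assms by (simp add: mem_coset_iff)
  ultimately show ?thesis unfolding quot_space_simps by blast
qed

lemma vs_quot: "vs (quot_space M N)"
proof (rule vsI)
  fix X Y assume "X \<in> carrier (quot_space M N)" "Y \<in> carrier (quot_space M N)"
  then obtain x y where [simp]: "X = N +>\<^bsub>M\<^esub> x" "Y = N +>\<^bsub>M\<^esub> y" "x \<in> carrier M" "y \<in> carrier M"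
    by (auto simp: carrier_quot)
  show "X \<oplus>\<^bsub>quot_space M N\<^esub> Y = Y \<oplus>\<^bsub>quot_space M N\<^esub> X"
    using vs_comm[OF M, of x y] by (simp add: add_quot)
  fix a b :: 'k
  show "(a * b) \<odot>\<^bsub>quot_space M N\<^esub> X = a \<odot>\<^bsub>quot_space M N\<^esub> (b \<odot>\<^bsub>quot_space M N\<^esub> X)"
    using M by (simp add: smult_quot)
qed (use M in \<open>auto simp: carrier_quot zero_quot add_quot smult_quot vs_assoc vs_smult_add vs_add_smult\<close>)

lemma quot_proj: "(\<lambda>x. N +>\<^bsub>M\<^esub> x) \<in> lin_hom M (quot_space M N)"
  by (rule lin_homI) (auto simp: carrier_quot add_quot smult_quot)

lemma quot_proj_eq_zero_iff:
  "x \<in> carrier M \<Longrightarrow> N +>\<^bsub>M\<^esub> x = \<zero>\<^bsub>quot_space M N\<^esub> \<longleftrightarrow> x \<in> N"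
  using M by (simp add: zero_quot coset_eq_iff)

text \<open>A linear map that kills N is constant on cosets. This gives meaning to
  \<open>the_elem\<close> of an image, the form in which all induced maps are defined.\<close>

lemma image_coset:
  assumes P: "vs P" and f: "f \<in> lin_hom M P" and "\<And>n. n \<in> N \<Longrightarrow> f n = \<zero>\<^bsub>P\<^esub>" and x: "x \<in> carrier M"
  shows "f ` (N +>\<^bsub>M\<^esub> x) = {f x}"
proof -
  have eq: "f y = f x" if "y \<in> N +>\<^bsub>M\<^esub> x" for y
  proof -
    have y: "y \<in> carrier M" "y \<oplus>\<^bsub>M\<^esub> (- 1) \<odot>\<^bsub>M\<^esub> x \<in> N"
      using that x coset_eq_iff by (auto simp: mem_coset_iff)
    have "f y \<oplus>\<^bsub>P\<^esub> (- 1) \<odot>\<^bsub>P\<^esub> f x = \<zero>\<^bsub>P\<^esub>"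
      using y x M assms(3)[OF y(2)] lin_homD[OF f] by simp
    then show ?thesis using vs_eq_iff_diff[OF P] y x lin_homD(1)[OF f] by metis
  qed
  have "f ` (N +>\<^bsub>M\<^esub> x) = (\<lambda>_. f x) ` (N +>\<^bsub>M\<^esub> x)"
    by (rule image_cong) (use eq in auto)
  moreover have "x \<in> N +>\<^bsub>M\<^esub> x" using x by (simp add: mem_coset_iff)
  ultimately show ?thesis by blast
qed

lemma quot_lift:
  assumes P: "vs P" and f: "f \<in> lin_hom M P" and "\<And>n. n \<in> N \<Longrightarrow> f n = \<zero>\<^bsub>P\<^esub>"
  shows "(\<lambda>X. the_elem (f ` X)) \<in> lin_hom (quot_space M N) P"
  using M P by (intro lin_homI)
    (auto simp: carrier_quot add_quot smult_quot image_coset[OF assms] lin_homD[OF f])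

lemma quot_lin_eqI:
  assumes "f \<in> lin_hom (quot_space M N) P" "g \<in> lin_hom (quot_space M N) P"
    "\<And>x. x \<in> carrier M \<Longrightarrow> f (N +>\<^bsub>M\<^esub> x) = g (N +>\<^bsub>M\<^esub> x)" "X \<in> carrier (quot_space M N)"
  shows "f X = g X"
  using assms by (auto simp: carrier_quot)

end

subsection \<open>Free spaces\<close>

lemma lookup_map_mult [simp]: "Poly_Mapping.lookup (Poly_Mapping.map ((*) c) f) x = c * Poly_Mapping.lookup f x"
  for c :: "'k::field"
  by (transfer) (auto simp: when_def)

lemma keys_map_mult: "Poly_Mapping.keys (Poly_Mapping.map ((*) c) f) \<subseteq> Poly_Mapping.keys f" for c :: "'k::field"
  by (auto simp: in_keys_iff)

lemma free_space_simps [simp]: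
  "carrier (free_space X) = {f. Poly_Mapping.keys f \<subseteq> X}"
  "add (free_space X) = (+)" "zero (free_space X) = 0"
  "smult (free_space X) = (\<lambda>c. Poly_Mapping.map ((*) c))"
  by (simp_all add: free_space_def)

lemma vs_free_space [simp]: "vs (free_space X :: ('k::field, 'x \<Rightarrow>\<^sub>0 'k) module)"
proof (rule vsI)
  fix f g :: "'x \<Rightarrow>\<^sub>0 'k" and c
  assume f: "f \<in> carrier (free_space X)" and g: "g \<in> carrier (free_space X)"
  show "f \<oplus>\<^bsub>free_space X\<^esub> g \<in> carrier (free_space X)"
    using f g Poly_Mapping.keys_add[of f g] by auto
  show "c \<odot>\<^bsub>free_space X\<^esub> f \<in> carrier (free_space X)"
    using f keys_map_mult[of c f] by auto
qed (auto simp: algebra_simps lookup_add intro!: poly_mapping_eqI)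

lemma map_mult_single [simp]: "Poly_Mapping.map ((*) c) (Poly_Mapping.single x a) = Poly_Mapping.single x (c * a)"
  for c :: "'k::field"
  by (rule poly_mapping_eqI) (simp add: lookup_single when_def)

lemma map_mult_minus_one: "Poly_Mapping.map ((*) (- 1)) f = - f" for f :: "'x \<Rightarrow>\<^sub>0 'k::field"
  by (rule poly_mapping_eqI) simp

lemma single_in_free_space: "x \<in> X \<Longrightarrow> Poly_Mapping.single x c \<in> carrier (free_space X)"
  by auto

text \<open>Combinations with different supports can be added only after their sums are enlarged to
  a common finite index set; the new terms have coefficient zero.\<close>

lemma lin_ext_superset:
  assumes P: "vs P" and g: "\<And>x. x \<in> X \<Longrightarrow> g x \<in> carrier P" and "finite A" "Poly_Mapping.keys f \<subseteq> A" "A \<subseteq> X"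
  shows "lin_ext P g f = (\<Oplus>\<^bsub>P\<^esub>x\<in>A. Poly_Mapping.lookup f x \<odot>\<^bsub>P\<^esub> g x)"
  unfolding lin_ext_def
  by (rule vs_finsum_mono_neutral[OF P]) (use assms in \<open>auto simp: in_keys_iff subset_iff\<close>)

lemma lin_ext_lin_hom:
  fixes P :: "('k::field, 'v, 'm) module_scheme" and X :: "'x set"
  assumes P: "vs P" and g: "\<And>x. x \<in> X \<Longrightarrow> g x \<in> carrier P"
  shows "lin_ext P g \<in> lin_hom (free_space X) P"
proof (rule lin_homI)
  fix f :: "'x \<Rightarrow>\<^sub>0 'k" assume f: "f \<in> carrier (free_space X)"
  then show "lin_ext P g f \<in> carrier P"
    using P g by (auto simp: lin_ext_def intro!: vs_finsum_closed)
  {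
    fix f' :: "'x \<Rightarrow>\<^sub>0 'k" assume f': "f' \<in> carrier (free_space X)"
    define A where "A = Poly_Mapping.keys f \<union> Poly_Mapping.keys f'"
    have A: "finite A" "A \<subseteq> X" using f f' by (auto simp: A_def)
    have "lin_ext P g (f + f') = (\<Oplus>\<^bsub>P\<^esub>x\<in>A. Poly_Mapping.lookup (f + f') x \<odot>\<^bsub>P\<^esub> g x)"
      using A Poly_Mapping.keys_add[of f f'] by (intro lin_ext_superset[OF P g]) (auto simp: A_def)
    also have "\<dots> = (\<Oplus>\<^bsub>P\<^esub>x\<in>A. Poly_Mapping.lookup f x \<odot>\<^bsub>P\<^esub> g x \<oplus>\<^bsub>P\<^esub> Poly_Mapping.lookup f' x \<odot>\<^bsub>P\<^esub> g x)"
      using A g P by (intro vs_finsum_cong) (auto simp: lookup_add vs_add_smult)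
    also have "\<dots> = lin_ext P g f \<oplus>\<^bsub>P\<^esub> lin_ext P g f'"
      using A g P lin_ext_superset[where f = f and A = A and P = P and g = g and X = X] lin_ext_superset[where f = f' and A = A and P = P and g = g and X = X]
      by (subst vs_finsum_add) (auto simp: A_def)
    finally show "lin_ext P g (f \<oplus>\<^bsub>free_space X\<^esub> f') = lin_ext P g f \<oplus>\<^bsub>P\<^esub> lin_ext P g f'" by simp
  }
  fix c
  have "lin_ext P g (Poly_Mapping.map ((*) c) f) =
      (\<Oplus>\<^bsub>P\<^esub>x\<in>Poly_Mapping.keys f. Poly_Mapping.lookup (Poly_Mapping.map ((*) c) f) x \<odot>\<^bsub>P\<^esub> g x)"
    using f keys_map_mult[of c f] by (intro lin_ext_superset[OF P g]) auto
  also have "\<dots> = (\<Oplus>\<^bsub>P\<^esub>x\<in>Poly_Mapping.keys f. c \<odot>\<^bsub>P\<^esub> (Poly_Mapping.lookup f x \<odot>\<^bsub>P\<^esub> g x))"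
    using f g P by (intro vs_finsum_cong) auto
  also have "\<dots> = c \<odot>\<^bsub>P\<^esub> lin_ext P g f"
    unfolding lin_ext_def using f g P by (intro vs_finsum_smult) auto
  finally show "lin_ext P g (c \<odot>\<^bsub>free_space X\<^esub> f) = c \<odot>\<^bsub>P\<^esub> lin_ext P g f" by simp
qed

lemma lin_ext_single:
  assumes "vs P" "g x \<in> carrier P"
  shows "lin_ext P g (Poly_Mapping.single x c) = c \<odot>\<^bsub>P\<^esub> g x"
  using assms by (cases "c = 0") (auto simp: lin_ext_def vs_finsum_singleton vs_finsum_empty)

text \<open>Induction on the size of the support: subtracting the component at one basis element
  removes it from the support and adds nothing new.\<close>

lemma free_space_lin_eqI:
  assumes P: "vs P" and f: "f \<in> lin_hom (free_space X) P" and g: "g \<in> lin_hom (free_space X) P"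
    and eq: "\<And>x. x \<in> X \<Longrightarrow> f (gen x) = g (gen x)" and h: "h \<in> carrier (free_space X)"
  shows "f h = g h"
proof -
  have "f h = g h" if "Poly_Mapping.keys h \<subseteq> X" for h
    using that
  proof (induction "card (Poly_Mapping.keys h)" arbitrary: h rule: less_induct)
    case less
    show ?case
    proof (cases "Poly_Mapping.keys h = {}")
      case True
      then have "h = \<zero>\<^bsub>free_space X\<^esub>" by simp
      then show ?thesis using lin_hom_zero[OF vs_free_space P] f g by metis
    next
      case False
      then obtain x where x: "x \<in> Poly_Mapping.keys h" by blast
      let ?c = "Poly_Mapping.lookup h x"
      let ?h = "h - Poly_Mapping.single x ?c"
      have k: "Poly_Mapping.keys ?h \<subseteq> Poly_Mapping.keys h - {x}"
        by (auto simp: in_keys_iff lookup_minus lookup_single when_def split: if_splits)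
      have IH: "f ?h = g ?h" 
        using less.prems k x by (intro less.hyps psubset_card_mono) auto
      have sc: "Poly_Mapping.single x ?c = ?c \<odot>\<^bsub>free_space X\<^esub> gen x" by simp
      have xs: "gen x \<in> carrier (free_space X)" "?h \<in> carrier (free_space X)"
        using x less.prems k by auto
      have dec: "?h \<oplus>\<^bsub>free_space X\<^esub> ?c \<odot>\<^bsub>free_space X\<^esub> gen x = h" by simp
      have "\<phi> h = \<phi> ?h \<oplus>\<^bsub>P\<^esub> ?c \<odot>\<^bsub>P\<^esub> \<phi> (gen x)" if "\<phi> \<in> lin_hom (free_space X) P" for \<phi>
        using lin_homD(2)[OF that xs(2) vs_smult_closed[OF vs_free_space xs(1)], of ?c]
          lin_homD(3)[OF that xs(1), of ?c] unfolding dec by metis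
      from this[OF f] this[OF g] show ?thesis using IH eq[of x] x less.prems by auto
    qed
  qed
  then show ?thesis using h by simp
qed

text \<open>Tensor products and words are both quotients of free spaces, so this is the common
  source of the two principles that test a linear map on pure tensors or on words.\<close>

lemma quot_free_lin_eqI:
  assumes P: "vs P" and N: "submodule N ground (free_space X)"
    and f: "f \<in> lin_hom (quot_space (free_space X) N) P"
    and g: "g \<in> lin_hom (quot_space (free_space X) N) P"
    and eq: "\<And>x. x \<in> X \<Longrightarrow> f (N +>\<^bsub>free_space X\<^esub> gen x) = g (N +>\<^bsub>free_space X\<^esub> gen x)"
    and h: "h \<in> carrier (quot_space (free_space X) N)"
  shows "f h = g h"
proof -
  note q = quot_proj[OF vs_free_space N]
  have "f (N +>\<^bsub>free_space X\<^esub> u) = g (N +>\<^bsub>free_space X\<^esub> u)" if "u \<in> carrier (free_space X)" for u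
    by (rule free_space_lin_eqI[OF P lin_hom_comp[OF f q] lin_hom_comp[OF g q]]) (use eq that in auto)
  then show ?thesis by (rule quot_lin_eqI[OF vs_free_space N f g _ h])
qed

subsection \<open>Universal property of tensor products\<close>

lemma free_space_diff_closed:
  "f \<in> carrier (free_space X) \<Longrightarrow> g \<in> carrier (free_space X) \<Longrightarrow> f - g \<in> carrier (free_space X)"
  using Poly_Mapping.keys_diff[of f g] by auto

lemma gen_add_closed: "x \<in> X \<Longrightarrow> y \<in> X \<Longrightarrow> gen x + gen y \<in> carrier (free_space X)"
  using Poly_Mapping.keys_add[of "gen x" "gen y"] by (auto simp: subset_iff)

lemma lin_hom_free_diff:
  assumes f: "f \<in> lin_hom (free_space X) P" and P: "vs P"
    and x: "x \<in> carrier (free_space X)" and y: "y \<in> carrier (free_space X)"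
  shows "f (x - y) = f x \<oplus>\<^bsub>P\<^esub> (- 1) \<odot>\<^bsub>P\<^esub> f y"
proof -
  have d: "x - y = x \<oplus>\<^bsub>free_space X\<^esub> (- 1) \<odot>\<^bsub>free_space X\<^esub> y" by (simp add: map_mult_minus_one)
  show ?thesis unfolding d
    using lin_homD(2)[OF f x vs_smult_closed[OF vs_free_space y], of "- 1"] lin_homD(3)[OF f y, of "- 1"]
    by simp
qed

text \<open>Relations are imposed as generators u - v of a subspace; this turns membership in a
  kernel into an equation between values.\<close>

lemma lin_hom_free_diff_zero_iff:
  assumes "f \<in> lin_hom (free_space X) P" "vs P" "x \<in> carrier (free_space X)" "y \<in> carrier (free_space X)"
  shows "f (x - y) = \<zero>\<^bsub>P\<^esub> \<longleftrightarrow> f x = f y"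
  using lin_hom_free_diff[OF assms] vs_eq_iff_diff[OF assms(2), of "f x" "f y"] lin_homD(1)[OF assms(1)] assms(3,4)
  by metis

lemma bilin_comp: "bilin M N P \<beta> \<Longrightarrow> f \<in> lin_hom P Q \<Longrightarrow> bilin M N Q (\<lambda>x y. f (\<beta> x y))"
  by (rule bilinI; rule lin_hom_comp[of f P Q]) (auto simp: bilin_def)

lemma bilin_arg: "bilin M' N' P \<beta> \<Longrightarrow> f \<in> lin_hom M M' \<Longrightarrow> g \<in> lin_hom N N' \<Longrightarrow> bilin M N P (\<lambda>x y. \<beta> (f x) (g y))"
  by (rule bilinI) (auto intro: bilin_right[of M' N' P \<beta>] bilin_left[of M' N' P \<beta>] simp: lin_homD)

lemma bilin_sum: "vs P \<Longrightarrow> bilin M N P \<beta> \<Longrightarrow> bilin M N P \<gamma> \<Longrightarrow> bilin M N P (\<lambda>x y. \<beta> x y \<oplus>\<^bsub>P\<^esub> \<gamma> x y)"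
  by (auto simp: bilin_def intro: lin_hom_sum)

lemma bilin_smult: "vs P \<Longrightarrow> bilin M N P \<beta> \<Longrightarrow> bilin M N P (\<lambda>x y. c \<odot>\<^bsub>P\<^esub> \<beta> x y)"
  by (auto simp: bilin_def intro: lin_hom_smult')

context
  fixes M :: "('k::field, 'v, 'm) module_scheme" and N :: "('k, 'w, 'n) module_scheme"
  assumes M: "vs M" and N: "vs N"
begin

lemma submodule_tensor_rel: "submodule (tensor_rel M N) ground (free_space (carrier M \<times> carrier N))"
  unfolding tensor_rel_def
  by (rule lin_span_submodule[OF vs_free_space])
     (use M N in \<open>auto simp del: free_space_simps intro!: free_space_diff_closed single_in_free_space\<close>)

lemma vs_tensor [simp]: "vs (tensor M N)"
  unfolding tensor_def by (rule vs_quot[OF vs_free_space submodule_tensor_rel])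

lemma tensor_proj: "(\<lambda>f. tensor_rel M N +>\<^bsub>free_space (carrier M \<times> carrier N)\<^esub> f)
    \<in> lin_hom (free_space (carrier M \<times> carrier N)) (tensor M N)"
  unfolding tensor_def by (rule quot_proj[OF vs_free_space submodule_tensor_rel])

lemma tensor_proj_zero:
  "f \<in> tensor_rel M N \<Longrightarrow> tensor_rel M N +>\<^bsub>free_space (carrier M \<times> carrier N)\<^esub> f = \<zero>\<^bsub>tensor M N\<^esub>"
  unfolding tensor_def
  using quot_proj_eq_zero_iff[OF vs_free_space submodule_tensor_rel]
    submoduleD(1)[OF vs_free_space submodule_tensor_rel] by blast

lemma tensor_proj_eqI:
  assumes "f - g \<in> tensor_rel M N" "f \<in> carrier (free_space (carrier M \<times> carrier N))"
    "g \<in> carrier (free_space (carrier M \<times> carrier N))"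
  shows "tensor_rel M N +>\<^bsub>free_space (carrier M \<times> carrier N)\<^esub> f =
    tensor_rel M N +>\<^bsub>free_space (carrier M \<times> carrier N)\<^esub> g"
  using lin_hom_free_diff_zero_iff[OF tensor_proj vs_tensor assms(2,3)] tensor_proj_zero[OF assms(1)] by blast

lemma pure_closed [simp]: "x \<in> carrier M \<Longrightarrow> y \<in> carrier N \<Longrightarrow> pure_tensor M N x y \<in> carrier (tensor M N)"
  unfolding pure_tensor_def by (rule lin_homD(1)[OF tensor_proj]) auto

lemma tensor_proj_single:
  "x \<in> carrier M \<Longrightarrow> y \<in> carrier N \<Longrightarrow>
    tensor_rel M N +>\<^bsub>free_space (carrier M \<times> carrier N)\<^esub> Poly_Mapping.single (x, y) c =
      c \<odot>\<^bsub>tensor M N\<^esub> pure_tensor M N x y"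
  unfolding pure_tensor_def
  using lin_homD(3)[OF tensor_proj, of "gen (x, y)" c] by simp

lemma tensor_proj_gen:
  "tensor_rel M N +>\<^bsub>free_space (carrier M \<times> carrier N)\<^esub> gen (x, y) = pure_tensor M N x y"
  by (simp add: pure_tensor_def)

lemma tensor_proj_add_gen:
  "x \<in> carrier M \<Longrightarrow> y \<in> carrier N \<Longrightarrow> x' \<in> carrier M \<Longrightarrow> y' \<in> carrier N \<Longrightarrow>
    tensor_rel M N +>\<^bsub>free_space (carrier M \<times> carrier N)\<^esub> (gen (x, y) + gen (x', y')) =
      pure_tensor M N x y \<oplus>\<^bsub>tensor M N\<^esub> pure_tensor M N x' y'"
  using lin_homD(2)[OF tensor_proj, of "gen (x, y)" "gen (x', y')"] by (simp add: tensor_proj_gen)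

lemma bilin_pure: "bilin M N (tensor M N) (pure_tensor M N)"
proof (rule bilinI; rule lin_homI)
  note sup = lin_span_superset[OF vs_free_space, THEN subsetD]
  note add = free_space_simps(2)
  fix x y assume x: "x \<in> carrier M" and y: "y \<in> carrier N"
  show "pure_tensor M N x y \<in> carrier (tensor M N)" "pure_tensor M N x y \<in> carrier (tensor M N)"
    using x y by auto
  { fix y' assume y': "y' \<in> carrier N"
    \<comment> \<open>The generators have the form u - v - w, while comparing cosets requires u - (v
      + w).\<close>
    have "gen (x, y \<oplus>\<^bsub>N\<^esub> y') - (gen (x, y) + gen (x, y')) \<in> tensor_rel M N"
      unfolding tensor_rel_def diff_diff_eq[symmetric]
      by (rule sup) (use x y y' in blast)
    from tensor_proj_eqI[OF this single_in_free_space gen_add_closed]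
    show "pure_tensor M N x (y \<oplus>\<^bsub>N\<^esub> y') = pure_tensor M N x y \<oplus>\<^bsub>tensor M N\<^esub> pure_tensor M N x y'"
      using x y y' N
      by (simp add: tensor_proj_add_gen tensor_proj_gen) }
  { fix x' assume x': "x' \<in> carrier M"
    have "gen (x \<oplus>\<^bsub>M\<^esub> x', y) - (gen (x, y) + gen (x', y)) \<in> tensor_rel M N"
      unfolding tensor_rel_def diff_diff_eq[symmetric]
      by (rule sup) (use x y x' in blast)
    from tensor_proj_eqI[OF this single_in_free_space gen_add_closed]
    show "pure_tensor M N (x \<oplus>\<^bsub>M\<^esub> x') y = pure_tensor M N x y \<oplus>\<^bsub>tensor M N\<^esub> pure_tensor M N x' y"
      using x y x' M
      by (simp add: tensor_proj_add_gen tensor_proj_gen) }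
  fix c
  have "gen (c \<odot>\<^bsub>M\<^esub> x, y) - Poly_Mapping.single (x, y) c \<in> tensor_rel M N"
    unfolding tensor_rel_def by (rule sup) (use x y in blast)
  from tensor_proj_eqI[OF this]
  show "pure_tensor M N (c \<odot>\<^bsub>M\<^esub> x) y = c \<odot>\<^bsub>tensor M N\<^esub> pure_tensor M N x y"
    using x y M by (simp add: tensor_proj_single tensor_proj_gen)
  have "gen (x, c \<odot>\<^bsub>N\<^esub> y) - Poly_Mapping.single (x, y) c \<in> tensor_rel M N"
    unfolding tensor_rel_def by (rule sup) (use x y in blast)
  from tensor_proj_eqI[OF this]
  show "pure_tensor M N x (c \<odot>\<^bsub>N\<^esub> y) = c \<odot>\<^bsub>tensor M N\<^esub> pure_tensor M N x y"
    using x y N by (simp add: tensor_proj_single tensor_proj_gen)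
qed

lemma tensor_lin_eqI:
  assumes "vs P" "f \<in> lin_hom (tensor M N) P" "g \<in> lin_hom (tensor M N) P"
    "\<And>x y. x \<in> carrier M \<Longrightarrow> y \<in> carrier N \<Longrightarrow> f (pure_tensor M N x y) = g (pure_tensor M N x y)"
    "t \<in> carrier (tensor M N)"
  shows "f t = g t"
  by (rule quot_free_lin_eqI[OF assms(1) submodule_tensor_rel])
     (use assms in \<open>auto simp: tensor_def pure_tensor_def\<close>)

context
  fixes P :: "('k, 'u, 'p) module_scheme" and \<beta> :: "'v \<Rightarrow> 'w \<Rightarrow> 'u"
  assumes P: "vs P" and \<beta>: "bilin M N P \<beta>"
begin

lemma lin_ext_bilin: "lin_ext P (\<lambda>(x, y). \<beta> x y) \<in> lin_hom (free_space (carrier M \<times> carrier N)) P"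
  by (rule lin_ext_lin_hom[OF P]) (use bilinD(1)[OF \<beta>] in auto)

text \<open>The kernel of the extension is a subspace; bilinearity puts the generating relations
  into it, hence their whole span.\<close>

lemma lin_ext_tensor_rel: "f \<in> tensor_rel M N \<Longrightarrow> lin_ext P (\<lambda>(x, y). \<beta> x y) f = \<zero>\<^bsub>P\<^esub>"
proof -
  let ?F = "free_space (carrier M \<times> carrier N)"
  let ?e = "lin_ext P (\<lambda>(x, y). \<beta> x y)"
  have single: "?e (Poly_Mapping.single (x, y) c) = c \<odot>\<^bsub>P\<^esub> \<beta> x y"
    if "x \<in> carrier M" "y \<in> carrier N" for x y c
    by (subst lin_ext_single[OF P]) (use bilinD(1)[OF \<beta>] that in auto)
  have add: "?e (u - v - w) = \<zero>\<^bsub>P\<^esub>" if "?e u = ?e v \<oplus>\<^bsub>P\<^esub> ?e w" "u \<in> carrier ?F" "v \<in> carrier ?F" "w \<in> carrier ?F" for u v w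
    using that lin_hom_free_diff_zero_iff[OF lin_ext_bilin P, of u "v + w"] lin_homD(2)[OF lin_ext_bilin, of v w]
      Poly_Mapping.keys_add[of v w]
    by (auto simp: diff_diff_eq)
  have dif: "?e (gen u - Poly_Mapping.single v c) = \<zero>\<^bsub>P\<^esub>"
    if "?e (gen u) = ?e (Poly_Mapping.single v c)" "gen u \<in> carrier ?F" "Poly_Mapping.single v c \<in> carrier ?F" for u v c
    using that lin_hom_free_diff_zero_iff[OF lin_ext_bilin P, of "gen u" "Poly_Mapping.single v c"] by simp
  have "tensor_rel M N \<subseteq> {f \<in> carrier ?F. ?e f = \<zero>\<^bsub>P\<^esub>}"
    unfolding tensor_rel_def
    by (rule lin_span_least[OF vs_free_space submodule_kernel[OF vs_free_space P lin_ext_bilin]])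
       (use M N P bilinD[OF \<beta>] in \<open>auto simp del: free_space_simps
          intro!: add dif free_space_diff_closed single_in_free_space simp: single\<close>)
  then show "f \<in> tensor_rel M N \<Longrightarrow> lin_ext P (\<lambda>(x, y). \<beta> x y) f = \<zero>\<^bsub>P\<^esub>" by auto
qed

lemma tensor_lift_lin_hom: "tensor_lift P \<beta> \<in> lin_hom (tensor M N) P"
  using quot_lift[OF vs_free_space submodule_tensor_rel P lin_ext_bilin lin_ext_tensor_rel]
  by (simp add: tensor_lift_def[abs_def] tensor_def)

lemma tensor_lift_pure:
  assumes "x \<in> carrier M" "y \<in> carrier N"
  shows "tensor_lift P \<beta> (pure_tensor M N x y) = \<beta> x y"
proof -
  have "lin_ext P (\<lambda>(x, y). \<beta> x y) ` pure_tensor M N x y = {lin_ext P (\<lambda>(x, y). \<beta> x y) (gen (x, y))}"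
    unfolding pure_tensor_def
    by (rule image_coset[OF vs_free_space submodule_tensor_rel P lin_ext_bilin lin_ext_tensor_rel])
       (use assms in auto)
  also have "lin_ext P (\<lambda>(x, y). \<beta> x y) (gen (x, y)) = \<beta> x y"
    using lin_ext_single[OF P, of "\<lambda>(x, y). \<beta> x y" "(x, y)" 1] bilinD(1)[OF \<beta> assms] P by simp
  finally show ?thesis by (simp add: tensor_lift_def)
qed

lemma tensor_lift_closed: "t \<in> carrier (tensor M N) \<Longrightarrow> tensor_lift P \<beta> t \<in> carrier P"
  by (rule lin_homD(1)[OF tensor_lift_lin_hom])

lemma tensor_lift_unique:
  assumes "f \<in> lin_hom (tensor M N) P"
    "\<And>x y. x \<in> carrier M \<Longrightarrow> y \<in> carrier N \<Longrightarrow> f (pure_tensor M N x y) = \<beta> x y"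
    "t \<in> carrier (tensor M N)"
  shows "f t = tensor_lift P \<beta> t"
  by (rule tensor_lin_eqI[OF P assms(1) tensor_lift_lin_hom _ assms(3)])
     (simp add: assms(2) tensor_lift_pure)

text \<open>All members of a coset are supported on pairs from the two carriers, so the integrands
  may differ elsewhere, and bilinearity is asked of only one of them.\<close>

lemma tensor_lift_cong:
  assumes "\<And>x y. x \<in> carrier M \<Longrightarrow> y \<in> carrier N \<Longrightarrow> \<gamma> x y = \<beta> x y" "t \<in> carrier (tensor M N)"
  shows "tensor_lift P \<gamma> t = tensor_lift P \<beta> t"
proof -
  obtain f where t: "t = tensor_rel M N +>\<^bsub>free_space (carrier M \<times> carrier N)\<^esub> f"
    and f: "f \<in> carrier (free_space (carrier M \<times> carrier N))"
    using assms(2) unfolding tensor_def carrier_quot[OF vs_free_space submodule_tensor_rel] by blast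
  have "lin_ext P (\<lambda>(x, y). \<gamma> x y) g = lin_ext P (\<lambda>(x, y). \<beta> x y) g" if "g \<in> t" for g
  proof -
    have "g \<in> carrier (free_space (carrier M \<times> carrier N))"
      using that f unfolding t by (simp add: mem_coset_iff[OF vs_free_space submodule_tensor_rel])
    then show ?thesis unfolding lin_ext_def
      by (intro vs_finsum_cong[OF P]) (use assms(1) P bilinD(1)[OF \<beta>] in auto)
  qed
  then show ?thesis by (simp add: tensor_lift_def cong: image_cong)
qed

end

end

lemma tensor_lift_comp:
  assumes "vs M" "vs N" "vs P" "bilin M N P \<beta>" "vs Q" "f \<in> lin_hom P Q" "t \<in> carrier (tensor M N)"
  shows "f (tensor_lift P \<beta> t) = tensor_lift Q (\<lambda>x y. f (\<beta> x y)) t"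
  by (rule tensor_lin_eqI[OF assms(1,2,5) lin_hom_comp[OF assms(6) tensor_lift_lin_hom[OF assms(1-4)]]
        tensor_lift_lin_hom[OF assms(1,2,5) bilin_comp[OF assms(4,6)]]])
     (use assms in \<open>auto simp: tensor_lift_pure bilin_comp\<close>)

lemma tensor_lift_sum:
  assumes "vs M" "vs N" "vs P" "bilin M N P \<beta>" "bilin M N P \<gamma>" "t \<in> carrier (tensor M N)"
  shows "tensor_lift P (\<lambda>x y. \<beta> x y \<oplus>\<^bsub>P\<^esub> \<gamma> x y) t = tensor_lift P \<beta> t \<oplus>\<^bsub>P\<^esub> tensor_lift P \<gamma> t"
  by (rule tensor_lift_unique[symmetric])
     (use assms in \<open>auto simp: tensor_lift_pure intro!: bilin_sum lin_hom_sum tensor_lift_lin_hom\<close>)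

lemma tensor_lift_smult:
  assumes "vs M" "vs N" "vs P" "bilin M N P \<beta>" "t \<in> carrier (tensor M N)"
  shows "tensor_lift P (\<lambda>x y. c \<odot>\<^bsub>P\<^esub> \<beta> x y) t = c \<odot>\<^bsub>P\<^esub> tensor_lift P \<beta> t"
  by (rule tensor_lift_unique[symmetric])
     (use assms in \<open>auto simp: tensor_lift_pure intro!: bilin_smult lin_hom_smult' tensor_lift_lin_hom\<close>)

text \<open>Linear dependence on a parameter survives the lift. Iterated Sweedler sums are
  recognised as bilinear by this rule.\<close>

lemma tensor_lift_param:
  assumes M: "vs M" and N: "vs N" and P: "vs P" and Q: "vs Q"
    and \<beta>: "\<And>q. q \<in> carrier Q \<Longrightarrow> bilin M N P (\<beta> q)"
    and l: "\<And>x y. x \<in> carrier M \<Longrightarrow> y \<in> carrier N \<Longrightarrow> (\<lambda>q. \<beta> q x y) \<in> lin_hom Q P"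
    and t: "t \<in> carrier (tensor M N)"
  shows "(\<lambda>q. tensor_lift P (\<beta> q) t) \<in> lin_hom Q P"
proof (rule lin_homI)
  fix q assume q: "q \<in> carrier Q"
  show "tensor_lift P (\<beta> q) t \<in> carrier P" by (rule tensor_lift_closed[OF M N P \<beta>[OF q] t])
  { fix q' assume q': "q' \<in> carrier Q"
    have "tensor_lift P (\<beta> (q \<oplus>\<^bsub>Q\<^esub> q')) t = tensor_lift P (\<lambda>x y. \<beta> q x y \<oplus>\<^bsub>P\<^esub> \<beta> q' x y) t"
      by (rule tensor_lift_cong[OF M N P bilin_sum[OF P \<beta>[OF q] \<beta>[OF q']] _ t]) (simp add: lin_homD(2)[OF l] q q')
    then show "tensor_lift P (\<beta> (q \<oplus>\<^bsub>Q\<^esub> q')) t = tensor_lift P (\<beta> q) t \<oplus>\<^bsub>P\<^esub> tensor_lift P (\<beta> q') t"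
      using tensor_lift_sum[OF M N P \<beta>[OF q] \<beta>[OF q'] t] by simp }
  fix c
  have "tensor_lift P (\<beta> (c \<odot>\<^bsub>Q\<^esub> q)) t = tensor_lift P (\<lambda>x y. c \<odot>\<^bsub>P\<^esub> \<beta> q x y) t"
    by (rule tensor_lift_cong[OF M N P bilin_smult[OF P \<beta>[OF q]] _ t]) (simp add: lin_homD(3)[OF l] q)
  then show "tensor_lift P (\<beta> (c \<odot>\<^bsub>Q\<^esub> q)) t = c \<odot>\<^bsub>P\<^esub> tensor_lift P (\<beta> q) t"
    using tensor_lift_smult[OF M N P \<beta>[OF q] t] by simp
qed

text \<open>The construction reads only carrier, sum and scalar action, so records that differ in
  their products have literally equal tensor products.\<close>

lemma tensor_cong:
  assumes "carrier M = carrier M'" "add M = add M'" "smult M = smult M'"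
    "carrier N = carrier N'" "add N = add N'" "smult N = smult N'"
  shows tensor_rel_cong: "tensor_rel M N = tensor_rel M' N'"
    and "tensor M N = tensor M' N'" and "pure_tensor M N = pure_tensor M' N'"
proof -
  show *: "tensor_rel M N = tensor_rel M' N'"
    unfolding tensor_rel_def by (simp only: assms)
  show "tensor M N = tensor M' N'" "pure_tensor M N = pure_tensor M' N'"
    unfolding tensor_def pure_tensor_def[abs_def] by (simp_all only: * assms)
qed

subsection \<open>Maps of tensor products\<close>

context
  fixes M :: "('k::field, 'v, 'm) module_scheme" and N :: "('k, 'w, 'n) module_scheme"
    and M' :: "('k, 'v2, 'm2) module_scheme" and N' :: "('k, 'w2, 'n2) module_scheme"
    and f g
  assumes M: "vs M" and N: "vs N" and M': "vs M'" and N': "vs N'"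
    and f: "f \<in> lin_hom M M'" and g: "g \<in> lin_hom N N'"
begin

lemma bilin_tensor_map: "bilin M N (tensor M' N') (\<lambda>x y. pure_tensor M' N' (f x) (g y))"
  by (rule bilin_arg[OF bilin_pure[OF M' N'] f g])

lemma tensor_map_lin_hom: "tensor_map M' N' f g \<in> lin_hom (tensor M N) (tensor M' N')"
  unfolding tensor_map_def by (rule tensor_lift_lin_hom[OF M N vs_tensor[OF M' N'] bilin_tensor_map])

lemma tensor_map_pure: "x \<in> carrier M \<Longrightarrow> y \<in> carrier N \<Longrightarrow>
    tensor_map M' N' f g (pure_tensor M N x y) = pure_tensor M' N' (f x) (g y)"
  unfolding tensor_map_def by (rule tensor_lift_pure[OF M N vs_tensor[OF M' N'] bilin_tensor_map])

lemma tensor_map_closed: "t \<in> carrier (tensor M N) \<Longrightarrow> tensor_map M' N' f g t \<in> carrier (tensor M' N')"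
  by (rule lin_homD(1)[OF tensor_map_lin_hom])

end

context
  fixes L :: "('k::field, 'u, 'l) module_scheme" and M :: "('k, 'v, 'm) module_scheme"
    and N :: "('k, 'w, 'n) module_scheme"
  assumes L: "vs L" and M: "vs M" and N: "vs N"
begin

private lemma b1: "z \<in> carrier N \<Longrightarrow> bilin L M (tensor L (tensor M N)) (\<lambda>x y. pure_tensor L (tensor M N) x (pure_tensor M N y z))"
  by (rule bilin_arg[OF bilin_pure[OF L vs_tensor[OF M N]] lin_hom_id bilin_left[OF bilin_pure[OF M N] _ lin_hom_id]])

private lemma b2: "bilin (tensor L M) N (tensor L (tensor M N))
    (\<lambda>t z. tensor_lift (tensor L (tensor M N)) (\<lambda>x y. pure_tensor L (tensor M N) x (pure_tensor M N y z)) t)"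
proof (rule bilinI)
  show "tensor_lift (tensor L (tensor M N)) (\<lambda>x y. pure_tensor L (tensor M N) x (pure_tensor M N y z))
      \<in> lin_hom (tensor L M) (tensor L (tensor M N))" if "z \<in> carrier N" for z
    by (rule tensor_lift_lin_hom[OF L M vs_tensor[OF L vs_tensor[OF M N]] b1[OF that]])
  show "(\<lambda>z. tensor_lift (tensor L (tensor M N)) (\<lambda>x y. pure_tensor L (tensor M N) x (pure_tensor M N y z)) t)
      \<in> lin_hom N (tensor L (tensor M N))" if "t \<in> carrier (tensor L M)" for t
    by (rule tensor_lift_param[OF L M vs_tensor[OF L vs_tensor[OF M N]] N b1 _ that])
       (auto intro!: bilin_right[OF bilin_pure[OF L vs_tensor[OF M N]]] bilin_right[OF bilin_pure[OF M N]] lin_hom_id)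
qed

lemma tensor_assoc_lin_hom: "tensor_assoc L M N \<in> lin_hom (tensor (tensor L M) N) (tensor L (tensor M N))"
  unfolding tensor_assoc_def
  by (rule tensor_lift_lin_hom[OF vs_tensor[OF L M] N vs_tensor[OF L vs_tensor[OF M N]] b2])

lemma tensor_assoc_pure:
  assumes "x \<in> carrier L" "y \<in> carrier M" "z \<in> carrier N"
  shows "tensor_assoc L M N (pure_tensor (tensor L M) N (pure_tensor L M x y) z) =
    pure_tensor L (tensor M N) x (pure_tensor M N y z)"
  unfolding tensor_assoc_def
    tensor_lift_pure[OF vs_tensor[OF L M] N vs_tensor[OF L vs_tensor[OF M N]] b2 pure_closed[OF L M assms(1,2)] assms(3)]
  by (rule tensor_lift_pure[OF L M vs_tensor[OF L vs_tensor[OF M N]] b1[OF assms(3)] assms(1,2)])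

end

text \<open>A map of four arguments is extended by two nested lifts rather than by one lift on a
  fourfold tensor product. This is the shape of \<open>sweedler_op\<close>, which thereby becomes an
  instance by unfolding.\<close>

definition tensor_bil ::
    "('k::field, 'u, 'p) module_scheme \<Rightarrow> ('v \<Rightarrow> 'w \<Rightarrow> 'v2 \<Rightarrow> 'w2 \<Rightarrow> 'u)
      \<Rightarrow> ('v \<times> 'w \<Rightarrow>\<^sub>0 'k) set \<Rightarrow> ('v2 \<times> 'w2 \<Rightarrow>\<^sub>0 'k) set \<Rightarrow> 'u" where
  "tensor_bil P F t s = tensor_lift P (\<lambda>a b. tensor_lift P (\<lambda>a' b'. F a b a' b') s) t"

definition quadlin where
  "quadlin M N M' N' P F \<longleftrightarrow>
     (\<forall>a\<in>carrier M. \<forall>b\<in>carrier N. bilin M' N' P (F a b)) \<and>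
     (\<forall>a'\<in>carrier M'. \<forall>b'\<in>carrier N'. bilin M N P (\<lambda>a b. F a b a' b'))"

context
  fixes M :: "('k::field, 'v, 'm) module_scheme" and N :: "('k, 'w, 'n) module_scheme"
    and M' :: "('k, 'v2, 'm2) module_scheme" and N' :: "('k, 'w2, 'n2) module_scheme"
    and P :: "('k, 'u, 'p) module_scheme" and F
  assumes M: "vs M" and N: "vs N" and M': "vs M'" and N': "vs N'" and P: "vs P"
    and F: "quadlin M N M' N' P F"
begin

private lemma F1: "a \<in> carrier M \<Longrightarrow> b \<in> carrier N \<Longrightarrow> bilin M' N' P (F a b)"
  and F2: "a' \<in> carrier M' \<Longrightarrow> b' \<in> carrier N' \<Longrightarrow> bilin M N P (\<lambda>a b. F a b a' b')"
  using F by (auto simp: quadlin_def)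

private lemma b: "s \<in> carrier (tensor M' N') \<Longrightarrow> bilin M N P (\<lambda>a b. tensor_lift P (F a b) s)"
  by (rule bilinI; rule tensor_lift_param[OF M' N' P])
     (use M N F1 F2 in \<open>auto simp: bilin_def\<close>)

lemma tensor_bil_pure_left:
  assumes "a \<in> carrier M" "b \<in> carrier N" "s \<in> carrier (tensor M' N')"
  shows "tensor_bil P F (pure_tensor M N a b) s = tensor_lift P (F a b) s"
  unfolding tensor_bil_def by (rule tensor_lift_pure[OF M N P b[OF assms(3)] assms(1,2)])

lemma tensor_bil_pure:
  assumes "a \<in> carrier M" "b \<in> carrier N" "a' \<in> carrier M'" "b' \<in> carrier N'"
  shows "tensor_bil P F (pure_tensor M N a b) (pure_tensor M' N' a' b') = F a b a' b'"
  using tensor_bil_pure_left[OF assms(1,2) pure_closed[OF M' N' assms(3,4)]]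
    tensor_lift_pure[OF M' N' P F1[OF assms(1,2)] assms(3,4)] by simp

lemma bilin_tensor_bil: "bilin (tensor M N) (tensor M' N') P (tensor_bil P F)"
proof (rule bilinI)
  fix s assume s: "s \<in> carrier (tensor M' N')"
  show "(\<lambda>t. tensor_bil P F t s) \<in> lin_hom (tensor M N) P"
    unfolding tensor_bil_def by (rule tensor_lift_lin_hom[OF M N P b[OF s]])
next
  fix t assume t: "t \<in> carrier (tensor M N)"
  show "tensor_bil P F t \<in> lin_hom (tensor M' N') P"
    unfolding tensor_bil_def
    by (rule tensor_lift_param[OF M N P vs_tensor[OF M' N'] b _ t])
       (auto intro: tensor_lift_lin_hom[OF M' N' P F1])
qed

end

section \<open>Augmented dendriform algebras\<close>

subsection \<open>Structures on the same vector space\<close>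

text \<open>Several records with different products live on one space. The zero is included because
  finite sums, and hence \<open>tensor_lift\<close>, refer to it.\<close>

definition same_space where
  "same_space M M' \<longleftrightarrow> carrier M = carrier M' \<and> add M = add M' \<and> zero M = zero M' \<and> smult M = smult M'"

lemma same_space_vs: "same_space M M' \<Longrightarrow> vs M' \<Longrightarrow> vs M"
  by (rule vsI) (auto simp: same_space_def vs_assoc vs_smult_add vs_add_smult intro: vs_comm)

lemma same_space_lin_hom:
  "same_space M M' \<Longrightarrow> lin_hom M N = lin_hom M' N"
  "same_space M M' \<Longrightarrow> lin_hom N M = lin_hom N M'"
  by (simp_all add: same_space_def lin_hom_def)

lemma same_space_bilin:
  "same_space M M' \<Longrightarrow> bilin M N P \<beta> = bilin M' N P \<beta>"
  "same_space M M' \<Longrightarrow> bilin N M P \<beta> = bilin N M' P \<beta>"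
  "same_space M M' \<Longrightarrow> bilin N P M \<beta> = bilin N P M' \<beta>"
  by (simp_all add: same_space_def lin_hom_def bilin_def)

lemma same_space_tensor_lift: "same_space M M' \<Longrightarrow> tensor_lift M = tensor_lift M'"
  by (intro ext) (simp add: same_space_def tensor_lift_def lin_ext_def[abs_def] finsum_def finprod_def)

lemma same_space_tensor:
  assumes "same_space M M'"
  shows "tensor M N = tensor M' N" "tensor N M = tensor N M'"
    "pure_tensor M N = pure_tensor M' N" "pure_tensor N M = pure_tensor N M'"
  using assms by (auto simp: same_space_def intro!: tensor_cong)

lemma vs_smult_cancel [simp]:
  assumes "vs M" "y \<in> carrier M"
  shows "c \<odot>\<^bsub>M\<^esub> y \<oplus>\<^bsub>M\<^esub> (- c) \<odot>\<^bsub>M\<^esub> y = \<zero>\<^bsub>M\<^esub>" "(- c) \<odot>\<^bsub>M\<^esub> y \<oplus>\<^bsub>M\<^esub> c \<odot>\<^bsub>M\<^esub> y = \<zero>\<^bsub>M\<^esub>"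
  using vs_add_smult[OF assms, of c "- c"] vs_add_smult[OF assms, of "- c" c] vs_zero_smult[OF assms] by simp_all

lemma vs_smult_cancel' [simp]:
  assumes "vs M" "y \<in> carrier M" "z \<in> carrier M"
  shows "c \<odot>\<^bsub>M\<^esub> y \<oplus>\<^bsub>M\<^esub> ((- c) \<odot>\<^bsub>M\<^esub> y \<oplus>\<^bsub>M\<^esub> z) = z" "(- c) \<odot>\<^bsub>M\<^esub> y \<oplus>\<^bsub>M\<^esub> (c \<odot>\<^bsub>M\<^esub> y \<oplus>\<^bsub>M\<^esub> z) = z"
  using assms by (simp_all flip: vs_assoc)

subsection \<open>The axioms\<close>

text \<open>
  The total products on \<open>K \<cdot> 1 \<oplus> A\<close> with \<open>1 \<prec> 1 = 1 \<succ> 1 = 0\<close> satisfy the dendriform axioms on the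
  nose once \<open>y \<prec> z + y \<succ> z\<close> is replaced by \<open>y * z\<close>, which differs from it by \<open>\<epsilon>(y) \<epsilon>(z) 1\<close>. In this
  form the axioms are stable under tensor products, and dendriform bialgebras are exactly those
  coalgebras whose coproduct is a morphism into the tensor square.
\<close>

record ('k, 'v) augd = "('k, 'v) dendriform" +
  counit :: "'v \<Rightarrow> 'k"

locale augmented =
  fixes W :: "('k::field, 'v, 'm) augd_scheme" (structure)
  assumes vs [simp]: "vs W"
    and bilin_star: "bilin W W W (mult W)"
    and bilin_prec: "bilin W W W (dprec W)"
    and bilin_succ: "bilin W W W (dsucc W)"
    and counit_lin: "counit W \<in> lin_hom W ground"
    and one_closed [simp]: "\<one> \<in> carrier W"
    and counit_one [simp]: "counit W \<one> = 1"
    and counit_prec [simp]: "x \<in> carrier W \<Longrightarrow> y \<in> carrier W \<Longrightarrow> counit W (x \<prec> y) = 0"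
    and counit_succ [simp]: "x \<in> carrier W \<Longrightarrow> y \<in> carrier W \<Longrightarrow> counit W (x \<succ> y) = 0"
    and star_eq: "x \<in> carrier W \<Longrightarrow> y \<in> carrier W \<Longrightarrow>
      x \<otimes> y = (x \<prec> y) \<oplus> (x \<succ> y) \<oplus> (counit W x * counit W y) \<odot>\<^bsub>W\<^esub> \<one>"
    and prec_one: "x \<in> carrier W \<Longrightarrow> x \<prec> \<one> = x \<oplus> (- counit W x) \<odot>\<^bsub>W\<^esub> \<one>"
    and one_succ: "x \<in> carrier W \<Longrightarrow> \<one> \<succ> x = x \<oplus> (- counit W x) \<odot>\<^bsub>W\<^esub> \<one>"
    and one_prec [simp]: "x \<in> carrier W \<Longrightarrow> \<one> \<prec> x = \<zero>"
    and succ_one [simp]: "x \<in> carrier W \<Longrightarrow> x \<succ> \<one> = \<zero>"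
    and prec_prec: "x \<in> carrier W \<Longrightarrow> y \<in> carrier W \<Longrightarrow> z \<in> carrier W \<Longrightarrow> (x \<prec> y) \<prec> z = x \<prec> (y \<otimes> z)"
    and succ_prec: "x \<in> carrier W \<Longrightarrow> y \<in> carrier W \<Longrightarrow> z \<in> carrier W \<Longrightarrow> (x \<succ> y) \<prec> z = x \<succ> (y \<prec> z)"
    and succ_succ: "x \<in> carrier W \<Longrightarrow> y \<in> carrier W \<Longrightarrow> z \<in> carrier W \<Longrightarrow> x \<succ> (y \<succ> z) = (x \<otimes> y) \<succ> z"
begin

lemmas star_simps = bilinD[OF bilin_star] bilin_zero[OF bilin_star vs vs vs]
  and prec_simps = bilinD[OF bilin_prec] bilin_zero[OF bilin_prec vs vs vs]
  and succ_simps = bilinD[OF bilin_succ] bilin_zero[OF bilin_succ vs vs vs]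
declare star_simps [simp] prec_simps [simp] succ_simps [simp]

lemma counit_add [simp]: "x \<in> carrier W \<Longrightarrow> y \<in> carrier W \<Longrightarrow> counit W (x \<oplus> y) = counit W x + counit W y"
  and counit_smult [simp]: "x \<in> carrier W \<Longrightarrow> counit W (c \<odot>\<^bsub>W\<^esub> x) = c * counit W x"
  and counit_zero [simp]: "counit W \<zero> = 0"
  using lin_homD(2,3)[OF counit_lin] lin_hom_zero[OF vs vs_ground counit_lin] by auto

lemma counit_star [simp]: "x \<in> carrier W \<Longrightarrow> y \<in> carrier W \<Longrightarrow> counit W (x \<otimes> y) = counit W x * counit W y"
  by (simp add: star_eq)

lemma one_star [simp]: assumes x: "x \<in> carrier W" shows "\<one> \<otimes> x = x"
proof -
  have "\<one> \<otimes> x = x \<oplus> ((- counit W x) \<odot>\<^bsub>W\<^esub> \<one> \<oplus> counit W x \<odot>\<^bsub>W\<^esub> \<one>)"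
    using x by (simp add: star_eq one_succ vs_assoc[OF vs])
  also have "(- counit W x) \<odot>\<^bsub>W\<^esub> \<one> \<oplus> counit W x \<odot>\<^bsub>W\<^esub> \<one> = \<zero>"
    by simp
  finally show ?thesis using x by simp
qed

lemma star_one [simp]: assumes x: "x \<in> carrier W" shows "x \<otimes> \<one> = x"
proof -
  have "x \<otimes> \<one> = x \<oplus> ((- counit W x) \<odot>\<^bsub>W\<^esub> \<one> \<oplus> counit W x \<odot>\<^bsub>W\<^esub> \<one>)"
    using x by (simp add: star_eq prec_one vs_assoc[OF vs])
  also have "(- counit W x) \<odot>\<^bsub>W\<^esub> \<one> \<oplus> counit W x \<odot>\<^bsub>W\<^esub> \<one> = \<zero>"
    by simp
  finally show ?thesis using x by simp
qed

text \<open>Adding the three axioms: both sides expand to x \<prec> (y * z), x \<succ> (y \<prec>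
  z), (x * y) \<succ> z and the same multiple of the unit.\<close>

lemma star_assoc:
  assumes x: "x \<in> carrier W" and y: "y \<in> carrier W" and z: "z \<in> carrier W"
  shows "(x \<otimes> y) \<otimes> z = x \<otimes> (y \<otimes> z)"
proof -
  let ?c = "(counit W x * counit W y * counit W z) \<odot>\<^bsub>W\<^esub> \<one>"
  have "(x \<otimes> y) \<otimes> z = (x \<otimes> y) \<prec> z \<oplus> (x \<otimes> y) \<succ> z \<oplus> ?c"
    using assms by (subst star_eq) auto
  also have "(x \<otimes> y) \<prec> z = x \<prec> (y \<otimes> z) \<oplus> x \<succ> (y \<prec> z)"
    using assms by (simp add: star_eq[of x y] prec_prec succ_prec)
  finally have l: "(x \<otimes> y) \<otimes> z = x \<prec> (y \<otimes> z) \<oplus> x \<succ> (y \<prec> z) \<oplus> (x \<otimes> y) \<succ> z \<oplus> ?c" .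
  have "x \<otimes> (y \<otimes> z) = x \<prec> (y \<otimes> z) \<oplus> x \<succ> (y \<otimes> z) \<oplus> ?c"
    using assms by (subst star_eq) (auto simp: mult.assoc)
  also have "x \<succ> (y \<otimes> z) = x \<succ> (y \<prec> z) \<oplus> (x \<otimes> y) \<succ> z"
    using assms by (simp add: star_eq[of y z] succ_succ)
  finally show ?thesis using assms l by (simp add: vs_assoc[OF vs])
qed

lemma decompose:
  assumes "x \<in> carrier W"
  obtains x' where "x' \<in> carrier W" "counit W x' = 0" "x = x' \<oplus> counit W x \<odot>\<^bsub>W\<^esub> \<one>"
proof -
  have "x = (x \<oplus> (- counit W x) \<odot>\<^bsub>W\<^esub> \<one>) \<oplus> counit W x \<odot>\<^bsub>W\<^esub> \<one>"
    using assms by (simp add: vs_assoc[OF vs])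
  then show ?thesis using assms that[of "x \<oplus> (- counit W x) \<odot>\<^bsub>W\<^esub> \<one>"] by simp
qed

end

definition aug_hom where
  "aug_hom W W' = {f \<in> lin_hom W W'. f \<one>\<^bsub>W\<^esub> = \<one>\<^bsub>W'\<^esub> \<and>
     (\<forall>x\<in>carrier W. counit W' (f x) = counit W x) \<and>
     (\<forall>x\<in>carrier W. \<forall>y\<in>carrier W. f (x \<prec>\<^bsub>W\<^esub> y) = f x \<prec>\<^bsub>W'\<^esub> f y \<and> f (x \<succ>\<^bsub>W\<^esub> y) = f x \<succ>\<^bsub>W'\<^esub> f y)}"

lemma aug_homD:
  assumes "f \<in> aug_hom W W'"
  shows "f \<in> lin_hom W W'" "f \<one>\<^bsub>W\<^esub> = \<one>\<^bsub>W'\<^esub>"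
    "x \<in> carrier W \<Longrightarrow> counit W' (f x) = counit W x"
    "x \<in> carrier W \<Longrightarrow> y \<in> carrier W \<Longrightarrow> f (x \<prec>\<^bsub>W\<^esub> y) = f x \<prec>\<^bsub>W'\<^esub> f y"
    "x \<in> carrier W \<Longrightarrow> y \<in> carrier W \<Longrightarrow> f (x \<succ>\<^bsub>W\<^esub> y) = f x \<succ>\<^bsub>W'\<^esub> f y"
    "x \<in> carrier W \<Longrightarrow> f x \<in> carrier W'"
  using assms by (auto simp: aug_hom_def lin_homD)

lemma aug_hom_star:
  assumes "augmented W" "augmented W'" "f \<in> aug_hom W W'" "x \<in> carrier W" "y \<in> carrier W"
  shows "f (x \<otimes>\<^bsub>W\<^esub> y) = f x \<otimes>\<^bsub>W'\<^esub> f y"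
proof -
  interpret W: augmented W by fact
  interpret W': augmented W' by fact
  note f = aug_homD[OF assms(3)]
  show ?thesis using assms(4,5) by (simp add: W.star_eq W'.star_eq f lin_homD[OF f(1)])
qed

lemma aug_hom_comp:
  assumes "g \<in> aug_hom V W" "f \<in> aug_hom W X"
  shows "(\<lambda>x. f (g x)) \<in> aug_hom V X"
  using lin_hom_comp[OF aug_homD(1)[OF assms(2)] aug_homD(1)[OF assms(1)]] aug_homD[OF assms(1)] aug_homD[OF assms(2)]
  by (auto simp: aug_hom_def)

lemma aug_hom_id: "(\<lambda>x. x) \<in> aug_hom W W"
  by (simp add: aug_hom_def lin_hom_id)

text \<open>Products need checking only on the kernel of the counit: each element is such an element
  plus a multiple of the unit, and products with the unit are forced by the axioms.\<close>

lemma aug_homI: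
  assumes W: "augmented W" and W': "augmented W'" and f: "f \<in> lin_hom W W'" and one: "f \<one>\<^bsub>W\<^esub> = \<one>\<^bsub>W'\<^esub>"
    and counit: "\<And>x. x \<in> carrier W \<Longrightarrow> counit W' (f x) = counit W x"
    and prec: "\<And>x y. x \<in> carrier W \<Longrightarrow> y \<in> carrier W \<Longrightarrow> counit W x = 0 \<Longrightarrow> counit W y = 0 \<Longrightarrow>
      f (x \<prec>\<^bsub>W\<^esub> y) = f x \<prec>\<^bsub>W'\<^esub> f y"
    and succ: "\<And>x y. x \<in> carrier W \<Longrightarrow> y \<in> carrier W \<Longrightarrow> counit W x = 0 \<Longrightarrow> counit W y = 0 \<Longrightarrow>
      f (x \<succ>\<^bsub>W\<^esub> y) = f x \<succ>\<^bsub>W'\<^esub> f y"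
  shows "f \<in> aug_hom W W'"
proof -
  interpret W: augmented W by fact
  interpret W': augmented W' by fact
  note fs = lin_homD[OF f] one counit lin_hom_zero[OF W.vs W'.vs f]
  have "f (x \<prec>\<^bsub>W\<^esub> y) = f x \<prec>\<^bsub>W'\<^esub> f y \<and> f (x \<succ>\<^bsub>W\<^esub> y) = f x \<succ>\<^bsub>W'\<^esub> f y"
    if x: "x \<in> carrier W" and y: "y \<in> carrier W" for x y
  proof -
    obtain x' where x': "x' \<in> carrier W" "counit W x' = 0" "x = x' \<oplus>\<^bsub>W\<^esub> counit W x \<odot>\<^bsub>W\<^esub> \<one>\<^bsub>W\<^esub>"
      using W.decompose[OF x] .
    obtain y' where y': "y' \<in> carrier W" "counit W y' = 0" "y = y' \<oplus>\<^bsub>W\<^esub> counit W y \<odot>\<^bsub>W\<^esub> \<one>\<^bsub>W\<^esub>"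
      using W.decompose[OF y] .
    let ?a = "counit W x" let ?b = "counit W y"
    have "f ((x' \<oplus>\<^bsub>W\<^esub> ?a \<odot>\<^bsub>W\<^esub> \<one>\<^bsub>W\<^esub>) \<prec>\<^bsub>W\<^esub> (y' \<oplus>\<^bsub>W\<^esub> ?b \<odot>\<^bsub>W\<^esub> \<one>\<^bsub>W\<^esub>)) =
        f (x' \<oplus>\<^bsub>W\<^esub> ?a \<odot>\<^bsub>W\<^esub> \<one>\<^bsub>W\<^esub>) \<prec>\<^bsub>W'\<^esub> f (y' \<oplus>\<^bsub>W\<^esub> ?b \<odot>\<^bsub>W\<^esub> \<one>\<^bsub>W\<^esub>)"
      using x'(1,2) y'(1,2) by (simp add: fs prec W.prec_one W'.prec_one W.one_succ W'.one_succ)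
    moreover have "f ((x' \<oplus>\<^bsub>W\<^esub> ?a \<odot>\<^bsub>W\<^esub> \<one>\<^bsub>W\<^esub>) \<succ>\<^bsub>W\<^esub> (y' \<oplus>\<^bsub>W\<^esub> ?b \<odot>\<^bsub>W\<^esub> \<one>\<^bsub>W\<^esub>)) =
        f (x' \<oplus>\<^bsub>W\<^esub> ?a \<odot>\<^bsub>W\<^esub> \<one>\<^bsub>W\<^esub>) \<succ>\<^bsub>W'\<^esub> f (y' \<oplus>\<^bsub>W\<^esub> ?b \<odot>\<^bsub>W\<^esub> \<one>\<^bsub>W\<^esub>)"
      using x'(1,2) y'(1,2) by (simp add: fs succ W.prec_one W'.prec_one W.one_succ W'.one_succ)
    ultimately show ?thesis using x'(3) y'(3) by simp
  qed
  then show ?thesis using f one counit by (simp add: aug_hom_def)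
qed

subsection \<open>Tensor products\<close>

text \<open>A half-product acts by \<open>*\<close> on the first factors and by itself on the
  second. When both second factors are 1 this would need the undefined 1 \<prec> 1, and the intended
  value is (a \<prec> a') \<otimes> 1; the summand weighted by the two counits supplies it.\<close>

definition aug_tensor ::
    "('k::field, 'v, 'm) augd_scheme \<Rightarrow> ('k, 'w, 'n) augd_scheme \<Rightarrow> ('k, ('v \<times> 'w \<Rightarrow>\<^sub>0 'k) set) augd" where
  "aug_tensor M N = (let T = tensor M N; p = pure_tensor M N in
     \<lparr>carrier = carrier T,
      mult = tensor_bil T (\<lambda>a b a' b'. p (a \<otimes>\<^bsub>M\<^esub> a') (b \<otimes>\<^bsub>N\<^esub> b')),
      one = p \<one>\<^bsub>M\<^esub> \<one>\<^bsub>N\<^esub>, zero = \<zero>\<^bsub>T\<^esub>, add = add T, smult = smult T,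
      dprec = tensor_bil T (\<lambda>a b a' b'. p (a \<otimes>\<^bsub>M\<^esub> a') (b \<prec>\<^bsub>N\<^esub> b') \<oplus>\<^bsub>T\<^esub>
        (counit N b * counit N b') \<odot>\<^bsub>T\<^esub> p (a \<prec>\<^bsub>M\<^esub> a') \<one>\<^bsub>N\<^esub>),
      dsucc = tensor_bil T (\<lambda>a b a' b'. p (a \<otimes>\<^bsub>M\<^esub> a') (b \<succ>\<^bsub>N\<^esub> b') \<oplus>\<^bsub>T\<^esub>
        (counit N b * counit N b') \<odot>\<^bsub>T\<^esub> p (a \<succ>\<^bsub>M\<^esub> a') \<one>\<^bsub>N\<^esub>),
      counit = tensor_lift ground (\<lambda>a b. counit M a * counit N b)\<rparr>)"

lemma same_space_aug_tensor: "same_space (aug_tensor M N) (tensor M N)"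
  by (simp add: same_space_def aug_tensor_def Let_def)

lemmas aug_tensor_space [simp] =
  same_space_aug_tensor[unfolded same_space_def, THEN conjunct1]
  same_space_aug_tensor[unfolded same_space_def, THEN conjunct2, THEN conjunct1]
  same_space_aug_tensor[unfolded same_space_def, THEN conjunct2, THEN conjunct2, THEN conjunct1]
  same_space_aug_tensor[unfolded same_space_def, THEN conjunct2, THEN conjunct2, THEN conjunct2]
  same_space_lin_hom[OF same_space_aug_tensor] same_space_tensor[OF same_space_aug_tensor]
  same_space_bilin[OF same_space_aug_tensor] same_space_tensor_lift[OF same_space_aug_tensor]

lemma one_aug_tensor [simp]: "\<one>\<^bsub>aug_tensor M N\<^esub> = pure_tensor M N \<one>\<^bsub>M\<^esub> \<one>\<^bsub>N\<^esub>"
  by (simp add: aug_tensor_def Let_def)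

lemma trilin_tensor_eqI:
  assumes V: "vs M" "vs N" "vs P"
    and F: "\<And>s r. s \<in> carrier (tensor M N) \<Longrightarrow> r \<in> carrier (tensor M N) \<Longrightarrow> (\<lambda>t. F t s r) \<in> lin_hom (tensor M N) P"
      "\<And>t r. t \<in> carrier (tensor M N) \<Longrightarrow> r \<in> carrier (tensor M N) \<Longrightarrow> (\<lambda>s. F t s r) \<in> lin_hom (tensor M N) P"
      "\<And>t s. t \<in> carrier (tensor M N) \<Longrightarrow> s \<in> carrier (tensor M N) \<Longrightarrow> (\<lambda>r. F t s r) \<in> lin_hom (tensor M N) P"
    and G: "\<And>s r. s \<in> carrier (tensor M N) \<Longrightarrow> r \<in> carrier (tensor M N) \<Longrightarrow> (\<lambda>t. G t s r) \<in> lin_hom (tensor M N) P"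
      "\<And>t r. t \<in> carrier (tensor M N) \<Longrightarrow> r \<in> carrier (tensor M N) \<Longrightarrow> (\<lambda>s. G t s r) \<in> lin_hom (tensor M N) P"
      "\<And>t s. t \<in> carrier (tensor M N) \<Longrightarrow> s \<in> carrier (tensor M N) \<Longrightarrow> (\<lambda>r. G t s r) \<in> lin_hom (tensor M N) P"
    and eq: "\<And>a b a' b' a'' b''. a \<in> carrier M \<Longrightarrow> b \<in> carrier N \<Longrightarrow> a' \<in> carrier M \<Longrightarrow> b' \<in> carrier N \<Longrightarrow>
      a'' \<in> carrier M \<Longrightarrow> b'' \<in> carrier N \<Longrightarrow>
      F (pure_tensor M N a b) (pure_tensor M N a' b') (pure_tensor M N a'' b'') =
      G (pure_tensor M N a b) (pure_tensor M N a' b') (pure_tensor M N a'' b'')"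
    and t: "t \<in> carrier (tensor M N)" and s: "s \<in> carrier (tensor M N)" and r: "r \<in> carrier (tensor M N)"
  shows "F t s r = G t s r"
proof -
  note p = pure_closed[OF V(1,2)]
  have 1: "F (pure_tensor M N a b) (pure_tensor M N a' b') r = G (pure_tensor M N a b) (pure_tensor M N a' b') r"
    if "a \<in> carrier M" "b \<in> carrier N" "a' \<in> carrier M" "b' \<in> carrier N" for a b a' b'
    by (rule tensor_lin_eqI[OF V F(3) G(3) _ r]) (use that eq p in auto)
  have 2: "F (pure_tensor M N a b) s r = G (pure_tensor M N a b) s r"
    if "a \<in> carrier M" "b \<in> carrier N" for a b
    by (rule tensor_lin_eqI[OF V F(2) G(2) _ s]) (use that 1 p r in auto)
  show ?thesis
    by (rule tensor_lin_eqI[OF V F(1) G(1) _ t]) (use 2 s r in auto)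
qed

lemma bilin_tensor_eqI:
  assumes V: "vs M" "vs N" "vs P"
    and F: "bilin (tensor M N) (tensor M N) P F" and G: "bilin (tensor M N) (tensor M N) P G"
    and t: "t \<in> carrier (tensor M N)" and s: "s \<in> carrier (tensor M N)"
    and eq: "\<And>a b a' b'. a \<in> carrier M \<Longrightarrow> b \<in> carrier N \<Longrightarrow> a' \<in> carrier M \<Longrightarrow> b' \<in> carrier N \<Longrightarrow>
      F (pure_tensor M N a b) (pure_tensor M N a' b') = G (pure_tensor M N a b) (pure_tensor M N a' b')"
  shows "F t s = G t s"
proof -
  note p = pure_closed[OF V(1,2)]
  have 1: "F (pure_tensor M N a b) s = G (pure_tensor M N a b) s" if "a \<in> carrier M" "b \<in> carrier N" for a b
    by (rule tensor_lin_eqI[OF V _ _ _ s]) (use that eq p F G in \<open>auto simp: bilin_def\<close>)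
  show ?thesis
    by (rule tensor_lin_eqI[OF V, where f = "\<lambda>t. F t s" and g = "\<lambda>t. G t s", OF _ _ _ t])
       (use 1 F G s in \<open>auto simp: bilin_def\<close>)
qed

lemma quadlin_pure:
  assumes "vs M" "vs N" "bilin M M M p" "bilin N N N q"
  shows "quadlin M N M N (tensor M N) (\<lambda>a b a' b'. pure_tensor M N (p a a') (q b b'))"
  using assms(3,4) unfolding quadlin_def
  by (intro conjI ballI bilin_arg[OF bilin_pure[OF assms(1,2)]]) (auto simp: bilin_def)

lemma quadlin_pure_one:
  assumes "vs M" "vs N" "bilin M M M p" "e \<in> lin_hom N ground" "u \<in> carrier N"
  shows "quadlin M N M N (tensor M N) (\<lambda>a b a' b'. (e b * e b') \<odot>\<^bsub>tensor M N\<^esub> pure_tensor M N (p a a') u)"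
  unfolding quadlin_def
  by (intro conjI ballI bilinI lin_hom_smult_left lin_hom_smult' lin_hom_ground_mult
        bilin_left[OF bilin_pure[OF assms(1,2)]] bilin_left[OF assms(3)] bilin_right[OF assms(3)] lin_hom_id)
     (use assms bilinD(1)[OF assms(3)] in auto)

lemma quadlin_sum: "vs P \<Longrightarrow> quadlin M N M' N' P F \<Longrightarrow> quadlin M N M' N' P G \<Longrightarrow>
    quadlin M N M' N' P (\<lambda>a b a' b'. F a b a' b' \<oplus>\<^bsub>P\<^esub> G a b a' b')"
  by (auto simp: quadlin_def intro: bilin_sum)

context
  fixes M :: "('k::field, 'v, 'm) augd_scheme" and N :: "('k, 'w, 'n) augd_scheme"
  assumes aug_M: "augmented M" and aug_N: "augmented N"
begin

interpretation M: augmented M by (rule aug_M)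
interpretation N: augmented N by (rule aug_N)

private abbreviation (input) TT where "TT \<equiv> tensor M N"
private abbreviation (input) AT where "AT \<equiv> aug_tensor M N"
private abbreviation (input) pt where "pt \<equiv> pure_tensor M N"

private lemmas vsT = vs_tensor[OF M.vs N.vs]
private lemmas pc = pure_closed[OF M.vs N.vs]
private lemmas bp = bilin_pure[OF M.vs N.vs]

private lemmas q1 = quadlin_pure[OF M.vs N.vs M.bilin_star N.bilin_star]
private lemmas q2 = quadlin_sum[OF vsT quadlin_pure[OF M.vs N.vs M.bilin_star N.bilin_prec]
  quadlin_pure_one[OF M.vs N.vs M.bilin_prec N.counit_lin N.one_closed]]
private lemmas q3 = quadlin_sum[OF vsT quadlin_pure[OF M.vs N.vs M.bilin_star N.bilin_succ]
  quadlin_pure_one[OF M.vs N.vs M.bilin_succ N.counit_lin N.one_closed]]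

lemma aug_tensor_bilin:
  "bilin TT TT TT (mult AT)" "bilin TT TT TT (dprec AT)" "bilin TT TT TT (dsucc AT)"
  using bilin_tensor_bil[OF M.vs N.vs M.vs N.vs vsT q1] bilin_tensor_bil[OF M.vs N.vs M.vs N.vs vsT q2]
    bilin_tensor_bil[OF M.vs N.vs M.vs N.vs vsT q3]
  by (simp_all add: aug_tensor_def Let_def)

lemma aug_tensor_pure:
  assumes "a \<in> carrier M" "b \<in> carrier N" "a' \<in> carrier M" "b' \<in> carrier N"
  shows "pt a b \<otimes>\<^bsub>AT\<^esub> pt a' b' = pt (a \<otimes>\<^bsub>M\<^esub> a') (b \<otimes>\<^bsub>N\<^esub> b')"
    "pt a b \<prec>\<^bsub>AT\<^esub> pt a' b' = pt (a \<otimes>\<^bsub>M\<^esub> a') (b \<prec>\<^bsub>N\<^esub> b') \<oplus>\<^bsub>TT\<^esub>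
        (counit N b * counit N b') \<odot>\<^bsub>TT\<^esub> pt (a \<prec>\<^bsub>M\<^esub> a') \<one>\<^bsub>N\<^esub>"
    "pt a b \<succ>\<^bsub>AT\<^esub> pt a' b' = pt (a \<otimes>\<^bsub>M\<^esub> a') (b \<succ>\<^bsub>N\<^esub> b') \<oplus>\<^bsub>TT\<^esub>
        (counit N b * counit N b') \<odot>\<^bsub>TT\<^esub> pt (a \<succ>\<^bsub>M\<^esub> a') \<one>\<^bsub>N\<^esub>"
  using tensor_bil_pure[OF M.vs N.vs M.vs N.vs vsT q1 assms] tensor_bil_pure[OF M.vs N.vs M.vs N.vs vsT q2 assms]
    tensor_bil_pure[OF M.vs N.vs M.vs N.vs vsT q3 assms]
  by (simp_all add: aug_tensor_def Let_def)

private lemma bilin_counits: "bilin M N ground (\<lambda>a b. counit M a * counit N b)"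
  by (intro bilinI lin_hom_ground_mult M.counit_lin N.counit_lin)

lemma aug_tensor_counit_lin: "counit AT \<in> lin_hom TT ground"
  and aug_tensor_counit_pure: "a \<in> carrier M \<Longrightarrow> b \<in> carrier N \<Longrightarrow> counit AT (pt a b) = counit M a * counit N b"
  using tensor_lift_lin_hom[OF M.vs N.vs vs_ground bilin_counits] tensor_lift_pure[OF M.vs N.vs vs_ground bilin_counits]
  by (simp_all add: aug_tensor_def Let_def)

private lemmas bT = aug_tensor_bilin
private lemmas bz = bilin_zero[OF bT(1) vsT vsT vsT] bilin_zero[OF bT(2) vsT vsT vsT] bilin_zero[OF bT(3) vsT vsT vsT]
private lemmas pz = bilin_zero[OF bp M.vs N.vs vsT]

private lemmas opT = bilinD[OF bT(1)] bilinD[OF bT(2)] bilinD[OF bT(3)] bz bilinD[OF bp] pz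
  lin_homD[OF aug_tensor_counit_lin] aug_tensor_pure aug_tensor_counit_pure

private lemmas lins = bilin_left[OF bT(1)] bilin_right[OF bT(1)] bilin_left[OF bT(2)] bilin_right[OF bT(2)]
  bilin_left[OF bT(3)] bilin_right[OF bT(3)] bilin_left[OF bp] bilin_right[OF bp] lin_hom_id
  lin_hom_sum[OF vsT] lin_hom_smult'[OF vsT] lin_hom_smult_left[OF vsT]
  lin_hom_comp[OF aug_tensor_counit_lin] lin_hom_const_zero

text \<open>Every axiom is multilinear, so pure tensors suffice. There the main terms reduce to the
  axiom in N together with associativity of \<open>*\<close> in M, and the counit-weighted terms
  reduce to the axiom in M.\<close>

lemma augmented_tensor: "augmented (aug_tensor M N)"
proof -
  note eq1 = tensor_lin_eqI[OF M.vs N.vs]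
  note bil_eqI = bilin_tensor_eqI[OF M.vs N.vs]
  show ?thesis
  proof (rule augmented.intro, unfold aug_tensor_space one_aug_tensor)
    show "vs (aug_tensor M N)" by (rule same_space_vs[OF same_space_aug_tensor vsT])
    show "bilin TT TT TT (mult AT)" "bilin TT TT TT (dprec AT)" "bilin TT TT TT (dsucc AT)" by (rule bT)+
    show "counit AT \<in> lin_hom TT ground" by (rule aug_tensor_counit_lin)
    show "pt \<one>\<^bsub>M\<^esub> \<one>\<^bsub>N\<^esub> \<in> carrier TT" by (simp add: pc)
    show "counit AT (pt \<one>\<^bsub>M\<^esub> \<one>\<^bsub>N\<^esub>) = 1" by (simp add: opT)
  next
    fix x y assume x: "x \<in> carrier TT" and y: "y \<in> carrier TT"
    show "counit AT (x \<prec>\<^bsub>AT\<^esub> y) = 0"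
      by (rule bil_eqI[OF vs_ground bilin_comp[OF bT(2) aug_tensor_counit_lin] _ x y])
         (auto simp: opT pc vsT bilin_def intro!: lin_homI)
    show "counit AT (x \<succ>\<^bsub>AT\<^esub> y) = 0"
      by (rule bil_eqI[OF vs_ground bilin_comp[OF bT(3) aug_tensor_counit_lin] _ x y])
         (auto simp: opT pc vsT bilin_def intro!: lin_homI)
    have b: "bilin TT TT TT (\<lambda>x y. (counit AT x * counit AT y) \<odot>\<^bsub>TT\<^esub> pt \<one>\<^bsub>M\<^esub> \<one>\<^bsub>N\<^esub>)"
      by (intro bilinI lin_hom_smult_left[OF vsT] lin_hom_ground_mult aug_tensor_counit_lin pc) auto
    show "x \<otimes>\<^bsub>AT\<^esub> y = x \<prec>\<^bsub>AT\<^esub> y \<oplus>\<^bsub>TT\<^esub> x \<succ>\<^bsub>AT\<^esub> y \<oplus>\<^bsub>TT\<^esub> (counit AT x * counit AT y) \<odot>\<^bsub>TT\<^esub> pt \<one>\<^bsub>M\<^esub> \<one>\<^bsub>N\<^esub>"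
      by (rule bil_eqI[OF vsT bT(1) bilin_sum[OF vsT bilin_sum[OF vsT bT(2,3)] b] x y])
         (simp add: opT pc vsT M.star_eq N.star_eq vs_smult_add vs_assoc[OF vsT] vs_lcomm[OF vsT] vs_comm[OF vsT] mult.commute mult.left_commute)
  next
    fix x assume x: "x \<in> carrier TT"
    have o: "pt \<one>\<^bsub>M\<^esub> \<one>\<^bsub>N\<^esub> \<in> carrier TT" by (simp add: pc)
    have l: "(\<lambda>x. x \<oplus>\<^bsub>TT\<^esub> (- counit AT x) \<odot>\<^bsub>TT\<^esub> pt \<one>\<^bsub>M\<^esub> \<one>\<^bsub>N\<^esub>) \<in> lin_hom TT TT"
      using lin_hom_sum[OF vsT lin_hom_id lin_hom_smult_left[OF vsT lin_hom_ground_mult(2)[OF aug_tensor_counit_lin] o], of "- 1"] by simp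
    have z: "(\<lambda>x. \<zero>\<^bsub>TT\<^esub>) \<in> lin_hom TT TT" by (rule lin_hom_const_zero[OF vsT])
    show "x \<prec>\<^bsub>AT\<^esub> pt \<one>\<^bsub>M\<^esub> \<one>\<^bsub>N\<^esub> = x \<oplus>\<^bsub>TT\<^esub> (- counit AT x) \<odot>\<^bsub>TT\<^esub> pt \<one>\<^bsub>M\<^esub> \<one>\<^bsub>N\<^esub>"
      by (rule eq1[OF vsT bilin_left[OF bT(2) o lin_hom_id] l _ x])
         (simp add: opT pc vsT M.prec_one N.prec_one, simp add: opT pc vsT vs_smult_add[OF vsT] vs_assoc[OF vsT] mult.commute)
    show "pt \<one>\<^bsub>M\<^esub> \<one>\<^bsub>N\<^esub> \<succ>\<^bsub>AT\<^esub> x = x \<oplus>\<^bsub>TT\<^esub> (- counit AT x) \<odot>\<^bsub>TT\<^esub> pt \<one>\<^bsub>M\<^esub> \<one>\<^bsub>N\<^esub>"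
      by (rule eq1[OF vsT bilin_right[OF bT(3) o lin_hom_id] l _ x])
         (simp add: opT pc vsT M.one_succ N.one_succ, simp add: opT pc vsT vs_smult_add[OF vsT] vs_assoc[OF vsT] mult.commute)
    show "pt \<one>\<^bsub>M\<^esub> \<one>\<^bsub>N\<^esub> \<prec>\<^bsub>AT\<^esub> x = \<zero>\<^bsub>TT\<^esub>"
      by (rule eq1[OF vsT bilin_right[OF bT(2) o lin_hom_id] z _ x]) (simp add: opT pc vsT)
    show "x \<succ>\<^bsub>AT\<^esub> pt \<one>\<^bsub>M\<^esub> \<one>\<^bsub>N\<^esub> = \<zero>\<^bsub>TT\<^esub>"
      by (rule eq1[OF vsT bilin_left[OF bT(3) o lin_hom_id] z _ x]) (simp add: opT pc vsT)
  next
    fix x y z assume x: "x \<in> carrier TT" and y: "y \<in> carrier TT" and z: "z \<in> carrier TT"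
    show "x \<prec>\<^bsub>AT\<^esub> y \<prec>\<^bsub>AT\<^esub> z = x \<prec>\<^bsub>AT\<^esub> (y \<otimes>\<^bsub>AT\<^esub> z)"
      by (rule trilin_tensor_eqI[OF M.vs N.vs vsT, where F = "\<lambda>x y z. x \<prec>\<^bsub>AT\<^esub> y \<prec>\<^bsub>AT\<^esub> z"
            and G = "\<lambda>x y z. x \<prec>\<^bsub>AT\<^esub> (y \<otimes>\<^bsub>AT\<^esub> z)", OF _ _ _ _ _ _ _ x y z]; (intro lins)?)
         (simp_all add: opT pc vsT M.prec_prec N.prec_prec M.star_assoc mult.assoc)
    show "x \<succ>\<^bsub>AT\<^esub> y \<prec>\<^bsub>AT\<^esub> z = x \<succ>\<^bsub>AT\<^esub> (y \<prec>\<^bsub>AT\<^esub> z)"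
      by (rule trilin_tensor_eqI[OF M.vs N.vs vsT, where F = "\<lambda>x y z. x \<succ>\<^bsub>AT\<^esub> y \<prec>\<^bsub>AT\<^esub> z"
            and G = "\<lambda>x y z. x \<succ>\<^bsub>AT\<^esub> (y \<prec>\<^bsub>AT\<^esub> z)", OF _ _ _ _ _ _ _ x y z]; (intro lins)?)
         (simp_all add: opT pc vsT M.succ_prec N.succ_prec M.star_assoc mult.assoc mult.commute mult.left_commute)
    show "x \<succ>\<^bsub>AT\<^esub> (y \<succ>\<^bsub>AT\<^esub> z) = (x \<otimes>\<^bsub>AT\<^esub> y) \<succ>\<^bsub>AT\<^esub> z"
      by (rule trilin_tensor_eqI[OF M.vs N.vs vsT, where F = "\<lambda>x y z. x \<succ>\<^bsub>AT\<^esub> (y \<succ>\<^bsub>AT\<^esub> z)"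
            and G = "\<lambda>x y z. (x \<otimes>\<^bsub>AT\<^esub> y) \<succ>\<^bsub>AT\<^esub> z", OF _ _ _ _ _ _ _ x y z]; (intro lins)?)
         (simp_all add: opT pc vsT M.succ_succ N.succ_succ M.star_assoc mult.assoc mult.commute mult.left_commute)
  qed
qed

end

lemma aug_tensor_map:
  assumes M: "augmented M" and N: "augmented N" and M': "augmented M'" and N': "augmented N'"
    and f: "f \<in> aug_hom M M'" and g: "g \<in> aug_hom N N'"
  shows "tensor_map M' N' f g \<in> aug_hom (aug_tensor M N) (aug_tensor M' N')"
proof -
  interpret M: augmented M by fact
  interpret N: augmented N by fact
  interpret M': augmented M' by fact
  interpret N': augmented N' by fact
  note lf = aug_homD(1)[OF f] and lg = aug_homD(1)[OF g]
  note v = M.vs N.vs M'.vs N'.vs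
  note tm = tensor_map_pure[OF v lf lg] and tl = tensor_map_lin_hom[OF v lf lg]
  note v1 = vs_tensor[OF M.vs N.vs] and v2 = vs_tensor[OF M'.vs N'.vs]
  note b = aug_tensor_bilin[OF M N] and b' = aug_tensor_bilin[OF M' N']
  note ss = tm tensor_map_closed[OF v lf lg] aug_tensor_pure[OF M N] aug_tensor_pure[OF M' N'] aug_homD[OF f] aug_homD[OF g]
    aug_hom_star[OF M M' f] aug_hom_star[OF N N' g] v1 v2 lin_homD[OF tl]
    pure_closed[OF M.vs N.vs] pure_closed[OF M'.vs N'.vs]
  have "counit (aug_tensor M' N') (tensor_map M' N' f g x) = counit (aug_tensor M N) x" if "x \<in> carrier (tensor M N)" for x
    by (rule tensor_lin_eqI[OF M.vs N.vs vs_ground lin_hom_comp[OF aug_tensor_counit_lin[OF M' N'] tl] aug_tensor_counit_lin[OF M N] _ that])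
       (simp add: ss aug_tensor_counit_pure M N M' N')
  moreover have "tensor_map M' N' f g (x \<prec>\<^bsub>aug_tensor M N\<^esub> y) = tensor_map M' N' f g x \<prec>\<^bsub>aug_tensor M' N'\<^esub> tensor_map M' N' f g y"
    if "x \<in> carrier (tensor M N)" "y \<in> carrier (tensor M N)" for x y
    by (rule bilin_tensor_eqI[OF M.vs N.vs v2 bilin_comp[OF b(2) tl] bilin_arg[OF b'(2) tl tl] that])
       (simp add: ss)
  moreover have "tensor_map M' N' f g (x \<succ>\<^bsub>aug_tensor M N\<^esub> y) = tensor_map M' N' f g x \<succ>\<^bsub>aug_tensor M' N'\<^esub> tensor_map M' N' f g y"
    if "x \<in> carrier (tensor M N)" "y \<in> carrier (tensor M N)" for x y
    by (rule bilin_tensor_eqI[OF M.vs N.vs v2 bilin_comp[OF b(3) tl] bilin_arg[OF b'(3) tl tl] that])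
       (simp add: ss)
  ultimately show ?thesis using tl by (simp add: aug_hom_def tm aug_homD[OF f] aug_homD[OF g])
qed

lemma tensor3_lin_eqI:
  assumes L: "vs L" and M: "vs M" and N: "vs N" and P: "vs P"
    and F: "F \<in> lin_hom (tensor (tensor L M) N) P" and G: "G \<in> lin_hom (tensor (tensor L M) N) P"
    and x: "x \<in> carrier (tensor (tensor L M) N)"
    and eq: "\<And>a b c. a \<in> carrier L \<Longrightarrow> b \<in> carrier M \<Longrightarrow> c \<in> carrier N \<Longrightarrow>
      F (pure_tensor (tensor L M) N (pure_tensor L M a b) c) = G (pure_tensor (tensor L M) N (pure_tensor L M a b) c)"
  shows "F x = G x"
proof (rule tensor_lin_eqI[OF vs_tensor[OF L M] N P F G _ x])
  note bp = bilin_pure[OF vs_tensor[OF L M] N]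
  fix t c assume t: "t \<in> carrier (tensor L M)" and c: "c \<in> carrier N"
  show "F (pure_tensor (tensor L M) N t c) = G (pure_tensor (tensor L M) N t c)"
    by (rule tensor_lin_eqI[OF L M P lin_hom_comp[OF F bilin_left[OF bp c lin_hom_id]]
           lin_hom_comp[OF G bilin_left[OF bp c lin_hom_id]] _ t]) (use c eq in auto)
qed

lemma tensor3_bilin_eqI:
  assumes L: "vs L" and M: "vs M" and N: "vs N" and P: "vs P"
    and F: "bilin (tensor (tensor L M) N) (tensor (tensor L M) N) P F"
    and G: "bilin (tensor (tensor L M) N) (tensor (tensor L M) N) P G"
    and x: "x \<in> carrier (tensor (tensor L M) N)" and y: "y \<in> carrier (tensor (tensor L M) N)"
    and eq: "\<And>a b c a' b' c'. a \<in> carrier L \<Longrightarrow> b \<in> carrier M \<Longrightarrow> c \<in> carrier N \<Longrightarrow>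
      a' \<in> carrier L \<Longrightarrow> b' \<in> carrier M \<Longrightarrow> c' \<in> carrier N \<Longrightarrow>
      F (pure_tensor (tensor L M) N (pure_tensor L M a b) c) (pure_tensor (tensor L M) N (pure_tensor L M a' b') c') =
      G (pure_tensor (tensor L M) N (pure_tensor L M a b) c) (pure_tensor (tensor L M) N (pure_tensor L M a' b') c')"
  shows "F x y = G x y"
proof -
  note pc = pure_closed[OF L M] pure_closed[OF vs_tensor[OF L M] N]
  have 1: "F (pure_tensor (tensor L M) N (pure_tensor L M a b) c) y = G (pure_tensor (tensor L M) N (pure_tensor L M a b) c) y"
    if "a \<in> carrier L" "b \<in> carrier M" "c \<in> carrier N" for a b c
    by (rule tensor3_lin_eqI[OF L M N P _ _ y]) (use that F G eq pc in \<open>auto simp: bilin_def\<close>)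
  show ?thesis
    by (rule tensor3_lin_eqI[OF L M N P, where F = "\<lambda>x. F x y" and G = "\<lambda>x. G x y", OF _ _ x])
       (use 1 F G y in \<open>auto simp: bilin_def\<close>)
qed

text \<open>With rebracketing a morphism, coassociativity becomes an equality of two morphisms out
  of the free algebra and can be tested on generators.\<close>

lemma aug_tensor_assoc:
  assumes L: "augmented L" and M: "augmented M" and N: "augmented N"
  shows "tensor_assoc L M N \<in> aug_hom (aug_tensor (aug_tensor L M) N) (aug_tensor L (aug_tensor M N))"
proof -
  interpret L: augmented L by fact
  interpret M: augmented M by fact
  interpret N: augmented N by fact
  let ?D = "tensor (tensor L M) N" and ?E = "tensor L (tensor M N)" and ?f = "tensor_assoc L M N"
  let ?p = "pure_tensor (tensor L M) N"
  note LM = augmented_tensor[OF L M] and MN = augmented_tensor[OF M N]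
  note vLM = vs_tensor[OF L.vs M.vs] and vMN = vs_tensor[OF M.vs N.vs]
  note vD = vs_tensor[OF vLM N.vs] and vE = vs_tensor[OF L.vs vMN]
  note fl = tensor_assoc_lin_hom[OF L.vs M.vs N.vs]
  note b1 = aug_tensor_bilin[OF LM N, unfolded aug_tensor_space] and b2 = aug_tensor_bilin[OF L MN, unfolded aug_tensor_space]
  note bLM = aug_tensor_bilin[OF L M] and bMN = aug_tensor_bilin[OF M N]
  note pc = pure_closed[OF L.vs M.vs] pure_closed[OF M.vs N.vs] pure_closed[OF vLM N.vs] pure_closed[OF L.vs vMN]
  note bp = bilin_pure[OF L.vs M.vs] bilin_pure[OF M.vs N.vs] bilin_pure[OF vLM N.vs] bilin_pure[OF L.vs vMN]
  note bps = bilinD[OF bp(1)] bilinD[OF bp(2)] bilinD[OF bp(3)] bilinD[OF bp(4)]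
  note as = tensor_assoc_pure[OF L.vs M.vs N.vs]
  note ops = aug_tensor_pure[OF L M] aug_tensor_pure[OF M N]
    aug_tensor_pure[OF LM N, unfolded aug_tensor_space] aug_tensor_pure[OF L MN, unfolded aug_tensor_space]
    aug_tensor_counit_pure[OF L M] aug_tensor_counit_pure[OF M N]
    aug_tensor_counit_pure[OF LM N, unfolded aug_tensor_space] aug_tensor_counit_pure[OF L MN, unfolded aug_tensor_space]
  note ss = pc vD vE vLM vMN as ops bps lin_homD[OF fl]
  note cD = aug_tensor_counit_lin[OF LM N, unfolded aug_tensor_space] and cE = aug_tensor_counit_lin[OF L MN, unfolded aug_tensor_space]
  note eq1 = tensor3_lin_eqI[OF L.vs M.vs N.vs] and eq2 = tensor3_bilin_eqI[OF L.vs M.vs N.vs]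
  have "counit (aug_tensor L (aug_tensor M N)) (?f x) = counit (aug_tensor (aug_tensor L M) N) x" if "x \<in> carrier ?D" for x
    by (rule eq1[OF vs_ground lin_hom_comp[OF cE fl] cD that]) (simp add: ss mult.assoc)
  moreover have "?f (x \<prec>\<^bsub>aug_tensor (aug_tensor L M) N\<^esub> y) = ?f x \<prec>\<^bsub>aug_tensor L (aug_tensor M N)\<^esub> ?f y"
    if "x \<in> carrier ?D" "y \<in> carrier ?D" for x y
    by (rule eq2[OF vE bilin_comp[OF b1(2) fl] bilin_arg[OF b2(2) fl fl] that])
       (simp add: ss vs_assoc[OF vE] vs_smult_add[OF vE] mult.assoc mult.commute mult.left_commute)
  moreover have "?f (x \<succ>\<^bsub>aug_tensor (aug_tensor L M) N\<^esub> y) = ?f x \<succ>\<^bsub>aug_tensor L (aug_tensor M N)\<^esub> ?f y"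
    if "x \<in> carrier ?D" "y \<in> carrier ?D" for x y
    by (rule eq2[OF vE bilin_comp[OF b1(3) fl] bilin_arg[OF b2(3) fl fl] that])
       (simp add: ss vs_assoc[OF vE] vs_smult_add[OF vE] mult.assoc mult.commute mult.left_commute)
  ultimately show ?thesis using fl by (simp add: aug_hom_def as)
qed

context augmented
begin

lemma bilin_counit_left: "bilin W W W (\<lambda>y z. counit W y \<odot>\<^bsub>W\<^esub> z)"
  by (intro bilinI lin_hom_smult_left lin_hom_smult' counit_lin lin_hom_id vs)

lemma bilin_counit_right: "bilin W W W (\<lambda>y z. counit W z \<odot>\<^bsub>W\<^esub> y)"
  by (intro bilinI lin_hom_smult_left lin_hom_smult' counit_lin lin_hom_id vs)

abbreviation (input) "counit_left \<equiv> tensor_lift W (\<lambda>y z. counit W y \<odot>\<^bsub>W\<^esub> z)"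
abbreviation (input) "counit_right \<equiv> tensor_lift W (\<lambda>y z. counit W z \<odot>\<^bsub>W\<^esub> y)"

lemmas counit_left_lin = tensor_lift_lin_hom[OF vs vs vs bilin_counit_left]
lemmas counit_left_pure = tensor_lift_pure[OF vs vs vs bilin_counit_left]
lemmas counit_right_lin = tensor_lift_lin_hom[OF vs vs vs bilin_counit_right]
lemmas counit_right_pure = tensor_lift_pure[OF vs vs vs bilin_counit_right]

lemma counit_counit_left:
  assumes "t \<in> carrier (tensor W W)"
  shows "counit W (counit_left t) = counit (aug_tensor W W) t"
  by (rule tensor_lin_eqI[OF vs vs vs_ground lin_hom_comp[OF counit_lin counit_left_lin]
        aug_tensor_counit_lin[OF augmented_axioms augmented_axioms] _ assms])
     (simp add: counit_left_pure aug_tensor_counit_pure[OF augmented_axioms augmented_axioms])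

text \<open>For the same purpose as \<open>tensor_assoc\<close>: the counit laws become equalities
  with the identity morphism, which need only be tested on generators.\<close>

lemma counit_left_aug_hom: "counit_left \<in> aug_hom (aug_tensor W W) W"
  and counit_right_aug_hom: "counit_right \<in> aug_hom (aug_tensor W W) W"
proof -
  note A = augmented_axioms augmented_axioms
  note b = aug_tensor_bilin[OF A]
  note l = counit_left_lin and r = counit_right_lin
  note ss = aug_tensor_pure[OF A] aug_tensor_counit_pure[OF A] counit_left_pure counit_right_pure
    pure_closed[OF vs vs] vs_tensor[OF vs vs] lin_homD[OF l] lin_homD[OF r]
  have c: "counit W (counit_right t) = counit (aug_tensor W W) t" if "t \<in> carrier (tensor W W)" for t
    by (rule tensor_lin_eqI[OF vs vs vs_ground lin_hom_comp[OF counit_lin r] aug_tensor_counit_lin[OF A] _ that])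
       (simp add: ss mult.commute)
  have "f \<in> aug_hom (aug_tensor W W) W" if f: "f = counit_left \<or> f = counit_right" for f
  proof -
    have fl: "f \<in> lin_hom (tensor W W) W" using f l r by auto
    have "f (x \<prec>\<^bsub>aug_tensor W W\<^esub> y) = f x \<prec> f y" if "x \<in> carrier (tensor W W)" "y \<in> carrier (tensor W W)" for x y
      by (rule bilin_tensor_eqI[OF vs vs vs bilin_comp[OF b(2) fl] bilin_arg[OF bilin_prec fl fl] that])
         (use f in \<open>auto simp: ss mult.commute\<close>)
    moreover have "f (x \<succ>\<^bsub>aug_tensor W W\<^esub> y) = f x \<succ> f y" if "x \<in> carrier (tensor W W)" "y \<in> carrier (tensor W W)" for x y
      by (rule bilin_tensor_eqI[OF vs vs vs bilin_comp[OF b(3) fl] bilin_arg[OF bilin_succ fl fl] that])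
         (use f in \<open>auto simp: ss mult.commute\<close>)
    ultimately show ?thesis using fl f c counit_counit_left by (auto simp: aug_hom_def ss)
  qed
  then show "counit_left \<in> aug_hom (aug_tensor W W) W" "counit_right \<in> aug_hom (aug_tensor W W) W" by auto
qed

text \<open>The counit-weighted term of the tensor square collects to a single pure tensor. For t =
  \<Delta> x the counit law reads \<open>counit_right t = x\<close>, so that this term is the
  summand (x \<prec> y) \<otimes> 1 of the bialgebra axiom.\<close>

lemma sweedler_prec:
  assumes "t \<in> carrier (tensor W W)" "s \<in> carrier (tensor W W)"
  shows "t \<prec>\<^bsub>aug_tensor W W\<^esub> s = tensor_bil (tensor W W) (\<lambda>a b a' b'. pure_tensor W W (a \<otimes> a') (b \<prec> b')) t s
      \<oplus>\<^bsub>tensor W W\<^esub> pure_tensor W W (counit_right t \<prec> counit_right s) \<one>"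
    and "t \<succ>\<^bsub>aug_tensor W W\<^esub> s = tensor_bil (tensor W W) (\<lambda>a b a' b'. pure_tensor W W (a \<otimes> a') (b \<succ> b')) t s
      \<oplus>\<^bsub>tensor W W\<^esub> pure_tensor W W (counit_right t \<succ> counit_right s) \<one>"
proof -
  note A = augmented_axioms augmented_axioms
  note v = vs_tensor[OF vs vs]
  note b = aug_tensor_bilin[OF A] and bp = bilin_pure[OF vs vs]
  note ss = aug_tensor_pure[OF A] counit_right_pure pure_closed[OF vs vs] bilinD[OF bp] mult.commute v
  have c: "bilin (tensor W W) (tensor W W) (tensor W W) (\<lambda>t s. pure_tensor W W (counit_right t \<prec> counit_right s) \<one>)"
    "bilin (tensor W W) (tensor W W) (tensor W W) (\<lambda>t s. pure_tensor W W (counit_right t \<succ> counit_right s) \<one>)"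
    using bilin_comp[OF bilin_arg[OF bilin_prec counit_right_lin counit_right_lin] bilin_left[OF bp one_closed lin_hom_id]]
      bilin_comp[OF bilin_arg[OF bilin_succ counit_right_lin counit_right_lin] bilin_left[OF bp one_closed lin_hom_id]]
    by simp_all
  note q = quadlin_pure[OF vs vs bilin_star bilin_prec] quadlin_pure[OF vs vs bilin_star bilin_succ]
  note tp = tensor_bil_pure[OF vs vs vs vs v q(1)] tensor_bil_pure[OF vs vs vs vs v q(2)]
  note tb = bilin_tensor_bil[OF vs vs vs vs v q(1)] bilin_tensor_bil[OF vs vs vs vs v q(2)]
  show "t \<prec>\<^bsub>aug_tensor W W\<^esub> s = tensor_bil (tensor W W) (\<lambda>a b a' b'. pure_tensor W W (a \<otimes> a') (b \<prec> b')) t s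
      \<oplus>\<^bsub>tensor W W\<^esub> pure_tensor W W (counit_right t \<prec> counit_right s) \<one>"
    by (rule bilin_tensor_eqI[OF vs vs v b(2) bilin_sum[OF v tb(1) c(1)] assms]) (simp add: ss tp)
  show "t \<succ>\<^bsub>aug_tensor W W\<^esub> s = tensor_bil (tensor W W) (\<lambda>a b a' b'. pure_tensor W W (a \<otimes> a') (b \<succ> b')) t s
      \<oplus>\<^bsub>tensor W W\<^esub> pure_tensor W W (counit_right t \<succ> counit_right s) \<one>"
    by (rule bilin_tensor_eqI[OF vs vs v b(3) bilin_sum[OF v tb(2) c(2)] assms]) (simp add: ss tp)
qed

end

section \<open>Free dendriform algebras\<close>

subsection \<open>Adjoining a unit\<close>

lemma bilinear_op_iff: "bilinear_op M f \<longleftrightarrow> bilin M M M f"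
  by (auto simp: bilinear_op_def bilin_def)

definition uaug :: "('k::field, 'v, 'm) dendriform_scheme \<Rightarrow> ('k, 'k \<times> 'v) augd" where
  "uaug A = (let U = unital A in \<lparr>carrier = carrier U, mult = mult U, one = \<one>\<^bsub>U\<^esub>, zero = \<zero>\<^bsub>U\<^esub>,
     add = add U, smult = smult U, dprec = dprec U, dsucc = dsucc U, counit = fst\<rparr>)"

lemma same_space_uaug: "same_space (unital A) (uaug A)"
  by (simp add: same_space_def uaug_def Let_def)

lemmas unital_space =
  same_space_lin_hom[OF same_space_uaug] same_space_tensor[OF same_space_uaug]
  same_space_bilin[OF same_space_uaug] same_space_tensor_lift[OF same_space_uaug]

text \<open>Oriented from \<open>unital\<close> to \<open>uaug\<close>, so that the bialgebra
  definitions are read in the record to which the facts about augmented algebras apply.\<close>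

lemma uaug_ops [simp]:
  "mult (unital A) = mult (uaug A)" "one (unital A) = one (uaug A)"
  "dprec (unital A) = dprec (uaug A)" "dsucc (unital A) = dsucc (uaug A)" "carrier (unital A) = carrier (uaug A)"
  "add (unital A) = add (uaug A)" "smult (unital A) = smult (uaug A)" "zero (unital A) = zero (uaug A)"
  by (simp_all add: uaug_def Let_def)

lemma uaug_simps [simp]:
  "carrier (uaug A) = UNIV \<times> carrier A"
  "(a, x) \<otimes>\<^bsub>uaug A\<^esub> (b, y) = (a * b, (a \<odot>\<^bsub>A\<^esub> y) \<oplus>\<^bsub>A\<^esub> (b \<odot>\<^bsub>A\<^esub> x) \<oplus>\<^bsub>A\<^esub> dstar A x y)"
  "\<one>\<^bsub>uaug A\<^esub> = (1, \<zero>\<^bsub>A\<^esub>)" "\<zero>\<^bsub>uaug A\<^esub> = (0, \<zero>\<^bsub>A\<^esub>)"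
  "(a, x) \<oplus>\<^bsub>uaug A\<^esub> (b, y) = (a + b, x \<oplus>\<^bsub>A\<^esub> y)"
  "c \<odot>\<^bsub>uaug A\<^esub> (a, x) = (c * a, c \<odot>\<^bsub>A\<^esub> x)"
  "(a, x) \<prec>\<^bsub>uaug A\<^esub> (b, y) = (0, (b \<odot>\<^bsub>A\<^esub> x) \<oplus>\<^bsub>A\<^esub> (x \<prec>\<^bsub>A\<^esub> y))"
  "(a, x) \<succ>\<^bsub>uaug A\<^esub> (b, y) = (0, (a \<odot>\<^bsub>A\<^esub> y) \<oplus>\<^bsub>A\<^esub> (x \<succ>\<^bsub>A\<^esub> y))"
  "counit (uaug A) = fst"
  by (simp_all add: uaug_def unital_def)

lemma vs_uaug: assumes "vs A" shows "vs (uaug A)"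
  by (rule vsI) (use assms in \<open>auto simp: vs_assoc vs_smult_add vs_add_smult algebra_simps intro: vs_comm\<close>)

lemma dendriform_algebraD:
  assumes "dendriform_algebra A"
  shows "vs A" "bilin A A A (dprec A)" "bilin A A A (dsucc A)"
    "x \<in> carrier A \<Longrightarrow> y \<in> carrier A \<Longrightarrow> z \<in> carrier A \<Longrightarrow>
      (x \<prec>\<^bsub>A\<^esub> y) \<prec>\<^bsub>A\<^esub> z = (x \<prec>\<^bsub>A\<^esub> (y \<prec>\<^bsub>A\<^esub> z)) \<oplus>\<^bsub>A\<^esub> (x \<prec>\<^bsub>A\<^esub> (y \<succ>\<^bsub>A\<^esub> z))"
    "x \<in> carrier A \<Longrightarrow> y \<in> carrier A \<Longrightarrow> z \<in> carrier A \<Longrightarrow> (x \<succ>\<^bsub>A\<^esub> y) \<prec>\<^bsub>A\<^esub> z = x \<succ>\<^bsub>A\<^esub> (y \<prec>\<^bsub>A\<^esub> z)"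
    "x \<in> carrier A \<Longrightarrow> y \<in> carrier A \<Longrightarrow> z \<in> carrier A \<Longrightarrow>
      x \<succ>\<^bsub>A\<^esub> (y \<succ>\<^bsub>A\<^esub> z) = ((x \<succ>\<^bsub>A\<^esub> y) \<succ>\<^bsub>A\<^esub> z) \<oplus>\<^bsub>A\<^esub> ((x \<prec>\<^bsub>A\<^esub> y) \<succ>\<^bsub>A\<^esub> z)"
  using assms by (auto simp: dendriform_algebra_def bilinear_op_iff)

lemma augmented_uaug:
  assumes A: "dendriform_algebra A"
  shows "augmented (uaug A)"
proof -
  note D = dendriform_algebraD[OF A]
  note v = D(1)
  note ops = bilinD[OF D(2)] bilinD[OF D(3)] bilin_zero[OF D(2) v v v] bilin_zero[OF D(3) v v v]
  note ss = v ops vs_smult_add[OF v] vs_add_smult[OF v] dstar_def vs_assoc[OF v]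
  show ?thesis
  proof (rule augmented.intro)
    show "vs (uaug A)" by (rule vs_uaug[OF v])
    show "bilin (uaug A) (uaug A) (uaug A) (mult (uaug A))"
      by (rule bilinI; rule lin_homI) (auto simp: ss vs_lcomm[OF v] vs_comm[OF v] algebra_simps)
    show "bilin (uaug A) (uaug A) (uaug A) (dprec (uaug A))"
      by (rule bilinI; rule lin_homI) (auto simp: ss vs_lcomm[OF v] vs_comm[OF v] algebra_simps)
    show "bilin (uaug A) (uaug A) (uaug A) (dsucc (uaug A))"
      by (rule bilinI; rule lin_homI) (auto simp: ss vs_lcomm[OF v] vs_comm[OF v] algebra_simps)
    show "counit (uaug A) \<in> lin_hom (uaug A) ground"
      by (rule lin_homI) auto
    fix x y z assume "x \<in> carrier (uaug A)" "y \<in> carrier (uaug A)" "z \<in> carrier (uaug A)"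
    then obtain a x' b y' c z' where [simp]: "x = (a, x')" "y = (b, y')" "z = (c, z')"
      and c: "x' \<in> carrier A" "y' \<in> carrier A" "z' \<in> carrier A" by (auto)
    show "(x \<prec>\<^bsub>uaug A\<^esub> y) \<prec>\<^bsub>uaug A\<^esub> z = x \<prec>\<^bsub>uaug A\<^esub> (y \<otimes>\<^bsub>uaug A\<^esub> z)"
      using c by (simp add: ss D(4)) (simp add: ss vs_lcomm[OF v] vs_comm[OF v] algebra_simps)
    show "(x \<succ>\<^bsub>uaug A\<^esub> y) \<prec>\<^bsub>uaug A\<^esub> z = x \<succ>\<^bsub>uaug A\<^esub> (y \<prec>\<^bsub>uaug A\<^esub> z)"
      using c by (simp add: ss D(5)) (simp add: ss vs_lcomm[OF v] vs_comm[OF v] algebra_simps)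
    show "x \<succ>\<^bsub>uaug A\<^esub> (y \<succ>\<^bsub>uaug A\<^esub> z) = (x \<otimes>\<^bsub>uaug A\<^esub> y) \<succ>\<^bsub>uaug A\<^esub> z"
      using c by (simp add: ss D(6)) (simp add: ss vs_lcomm[OF v] vs_comm[OF v] algebra_simps)
  qed (auto simp: ss vs_lcomm[OF v] vs_comm[OF v])
qed

lemma unital_extension:
  assumes A: "dendriform_algebra A" and W: "augmented W" and h: "h \<in> lin_hom A W"
    and prec: "\<And>x y. x \<in> carrier A \<Longrightarrow> y \<in> carrier A \<Longrightarrow> h (x \<prec>\<^bsub>A\<^esub> y) = h x \<prec>\<^bsub>W\<^esub> h y"
    and succ: "\<And>x y. x \<in> carrier A \<Longrightarrow> y \<in> carrier A \<Longrightarrow> h (x \<succ>\<^bsub>A\<^esub> y) = h x \<succ>\<^bsub>W\<^esub> h y"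
    and counit: "\<And>x. x \<in> carrier A \<Longrightarrow> counit W (h x) = 0"
  shows "(\<lambda>(a, x). a \<odot>\<^bsub>W\<^esub> \<one>\<^bsub>W\<^esub> \<oplus>\<^bsub>W\<^esub> h x) \<in> aug_hom (uaug A) W"
proof (rule aug_homI[OF augmented_uaug[OF A] W])
  interpret W: augmented W by fact
  note D = dendriform_algebraD[OF A]
  note hs = lin_homD[OF h] lin_hom_zero[OF D(1) W.vs h] counit prec succ
  show "(\<lambda>(a, x). a \<odot>\<^bsub>W\<^esub> \<one>\<^bsub>W\<^esub> \<oplus>\<^bsub>W\<^esub> h x) \<in> lin_hom (uaug A) W"
    by (rule lin_homI)
       (auto simp: hs vs_add_smult[OF W.vs] vs_smult_add[OF W.vs] vs_assoc[OF W.vs] vs_lcomm[OF W.vs])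
  let ?f = "\<lambda>(a, x). a \<odot>\<^bsub>W\<^esub> \<one>\<^bsub>W\<^esub> \<oplus>\<^bsub>W\<^esub> h x"
  show "?f \<one>\<^bsub>uaug A\<^esub> = \<one>\<^bsub>W\<^esub>" by (simp add: hs)
  fix x assume x: "x \<in> carrier (uaug A)"
  show "counit W (?f x) = counit (uaug A) x" using x by (auto simp: hs)
  fix y assume y: "y \<in> carrier (uaug A)"
  assume "counit (uaug A) x = 0" "counit (uaug A) y = 0"
  then obtain x' y' where "x = (0, x')" "y = (0, y')" "x' \<in> carrier A" "y' \<in> carrier A"
    using x y by auto
  then show "?f (x \<prec>\<^bsub>uaug A\<^esub> y) = ?f x \<prec>\<^bsub>W\<^esub> ?f y" "?f (x \<succ>\<^bsub>uaug A\<^esub> y) = ?f x \<succ>\<^bsub>W\<^esub> ?f y"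
    using bilinD(1)[OF D(2)] bilinD(1)[OF D(3)] by (auto simp: hs D(1))
qed

subsection \<open>Dendriform bialgebras as augmented morphisms\<close>

lemma coalgebra_unital_iff:
  assumes "augmented (uaug A)"
  shows "coalgebra (unital A) \<Delta> fst \<longleftrightarrow> \<Delta> \<in> lin_hom (uaug A) (tensor (uaug A) (uaug A)) \<and>
    (\<forall>x\<in>carrier (uaug A).
        tensor_assoc (uaug A) (uaug A) (uaug A) (tensor_map (tensor (uaug A) (uaug A)) (uaug A) \<Delta> id (\<Delta> x)) =
        tensor_map (uaug A) (tensor (uaug A) (uaug A)) id \<Delta> (\<Delta> x)) \<and>
     (\<forall>x\<in>carrier (uaug A). tensor_lift (uaug A) (\<lambda>y z. fst y \<odot>\<^bsub>uaug A\<^esub> z) (\<Delta> x) = x) \<and>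
     (\<forall>x\<in>carrier (uaug A). tensor_lift (uaug A) (\<lambda>y z. fst z \<odot>\<^bsub>uaug A\<^esub> y) (\<Delta> x) = x)"
  unfolding coalgebra_def unital_space tensor_assoc_def tensor_map_def uaug_ops
  using same_space_vs[OF same_space_uaug augmented.vs[OF assms]] augmented.counit_lin[OF assms] by auto

lemma sweedler_op_eq:
  "sweedler_op (unital A) f \<Delta> x y =
    tensor_bil (tensor (uaug A) (uaug A)) (\<lambda>a b a' b'. pure_tensor (uaug A) (uaug A) (a \<otimes>\<^bsub>uaug A\<^esub> a') (f b b')) (\<Delta> x) (\<Delta> y)"
  by (simp only: sweedler_op_def tensor_bil_def unital_space uaug_ops)

text \<open>The right counit law identifies the correction term of \<open>sweedler_prec\<close> with
  the last summand of the compatibility formula; on the kernel of the counit the two conditions are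
  then the same.\<close>

lemma dendriform_bialgebra_imp_aug_hom:
  assumes "dendriform_bialgebra A \<Delta>"
  shows "\<Delta> \<in> aug_hom (uaug A) (aug_tensor (uaug A) (uaug A))"
proof -
  have A: "dendriform_algebra A" and co: "coalgebra (unital A) \<Delta> fst"
    and one: "\<Delta> \<one>\<^bsub>uaug A\<^esub> = pure_tensor (uaug A) (uaug A) \<one>\<^bsub>uaug A\<^esub> \<one>\<^bsub>uaug A\<^esub>"
    using assms by (simp_all add: dendriform_bialgebra_def Let_def unital_space)
  interpret W: augmented "uaug A" by (rule augmented_uaug[OF A])
  note co' = co[unfolded coalgebra_unital_iff[OF W.augmented_axioms]]
  have l: "\<Delta> \<in> lin_hom (uaug A) (tensor (uaug A) (uaug A))" using co' by blast
  have cl: "tensor_lift (uaug A) (\<lambda>y z. counit (uaug A) y \<odot>\<^bsub>uaug A\<^esub> z) (\<Delta> x) = x"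
    "tensor_lift (uaug A) (\<lambda>y z. counit (uaug A) z \<odot>\<^bsub>uaug A\<^esub> y) (\<Delta> x) = x" if "x \<in> carrier (uaug A)" for x
    using co' that by auto
  show ?thesis
  proof (rule aug_homI[OF W.augmented_axioms augmented_tensor[OF W.augmented_axioms W.augmented_axioms]])
    show "\<Delta> \<in> lin_hom (uaug A) (aug_tensor (uaug A) (uaug A))" using l by simp
    show "\<Delta> \<one>\<^bsub>uaug A\<^esub> = \<one>\<^bsub>aug_tensor (uaug A) (uaug A)\<^esub>" using one by simp
    show "counit (aug_tensor (uaug A) (uaug A)) (\<Delta> x) = counit (uaug A) x" if "x \<in> carrier (uaug A)" for x
      using W.counit_counit_left[OF lin_homD(1)[OF l that]] cl[OF that] by simp
    fix x y assume x: "x \<in> carrier (uaug A)" and y: "y \<in> carrier (uaug A)"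
      and e: "counit (uaug A) x = 0" "counit (uaug A) y = 0"
    have xy: "x \<in> {0} \<times> carrier A" "y \<in> {0} \<times> carrier A" using x y e by auto
    note t = lin_homD(1)[OF l x] lin_homD(1)[OF l y]
    have "\<forall>x\<in>{0} \<times> carrier A. \<forall>y\<in>{0} \<times> carrier A.
       \<Delta> (x \<succ>\<^bsub>uaug A\<^esub> y) =
         sweedler_op (unital A) (dsucc (uaug A)) \<Delta> x y \<oplus>\<^bsub>tensor (uaug A) (uaug A)\<^esub> pure_tensor (uaug A) (uaug A) (x \<succ>\<^bsub>uaug A\<^esub> y) \<one>\<^bsub>uaug A\<^esub> \<and>
       \<Delta> (x \<prec>\<^bsub>uaug A\<^esub> y) =
         sweedler_op (unital A) (dprec (uaug A)) \<Delta> x y \<oplus>\<^bsub>tensor (uaug A) (uaug A)\<^esub> pure_tensor (uaug A) (uaug A) (x \<prec>\<^bsub>uaug A\<^esub> y) \<one>\<^bsub>uaug A\<^esub>"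
      using assms unfolding dendriform_bialgebra_def Let_def unital_space uaug_ops by blast
    note this[rule_format, OF xy]
    then show "\<Delta> (x \<prec>\<^bsub>uaug A\<^esub> y) = \<Delta> x \<prec>\<^bsub>aug_tensor (uaug A) (uaug A)\<^esub> \<Delta> y"
      "\<Delta> (x \<succ>\<^bsub>uaug A\<^esub> y) = \<Delta> x \<succ>\<^bsub>aug_tensor (uaug A) (uaug A)\<^esub> \<Delta> y"
      unfolding W.sweedler_prec[OF t] cl[OF x] cl[OF y] sweedler_op_eq by blast+
  qed
qed

lemma aug_hom_imp_dendriform_bialgebra:
  assumes A: "dendriform_algebra A" and \<Delta>: "\<Delta> \<in> aug_hom (uaug A) (aug_tensor (uaug A) (uaug A))"
    and co: "coalgebra (unital A) \<Delta> fst"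
  shows "dendriform_bialgebra A \<Delta>"
proof -
  interpret W: augmented "uaug A" by (rule augmented_uaug[OF A])
  note co' = co[unfolded coalgebra_unital_iff[OF W.augmented_axioms]]
  note D = aug_homD[OF \<Delta>]
  have l: "\<Delta> \<in> lin_hom (uaug A) (tensor (uaug A) (uaug A))" using co' by blast
  have cl: "tensor_lift (uaug A) (\<lambda>y z. counit (uaug A) z \<odot>\<^bsub>uaug A\<^esub> y) (\<Delta> x) = x" if "x \<in> carrier (uaug A)" for x
    using co' that by auto
  have *: "\<Delta> (x \<succ>\<^bsub>uaug A\<^esub> y) = sweedler_op (unital A) (dsucc (uaug A)) \<Delta> x y \<oplus>\<^bsub>tensor (uaug A) (uaug A)\<^esub>
        pure_tensor (uaug A) (uaug A) (x \<succ>\<^bsub>uaug A\<^esub> y) \<one>\<^bsub>uaug A\<^esub> \<and>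
      \<Delta> (x \<prec>\<^bsub>uaug A\<^esub> y) = sweedler_op (unital A) (dprec (uaug A)) \<Delta> x y \<oplus>\<^bsub>tensor (uaug A) (uaug A)\<^esub>
        pure_tensor (uaug A) (uaug A) (x \<prec>\<^bsub>uaug A\<^esub> y) \<one>\<^bsub>uaug A\<^esub>"
    if x: "x \<in> carrier (uaug A)" and y: "y \<in> carrier (uaug A)" for x y
    using D(4,5)[OF x y] W.sweedler_prec[OF lin_homD(1)[OF l x] lin_homD(1)[OF l y]]
    unfolding cl[OF x] cl[OF y] sweedler_op_eq by metis
  show ?thesis
    unfolding dendriform_bialgebra_def Let_def unital_space uaug_ops
    using A co D(2) * by auto
qed

subsection \<open>Dendriform ideals and quotients\<close>

lemma dend_ideal_gen_ideal:
  assumes A: "vs A" and bil: "bilin A A A (dprec A)" "bilin A A A (dsucc A)" and S: "S \<subseteq> carrier A"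
  shows "dend_ideal A (dend_ideal_gen A S)"
proof -
  have "dend_ideal A (carrier A)"
    unfolding dend_ideal_def
    by (intro conjI submodule_vsI[OF A]) (use A bilinD(1)[OF bil(1)] bilinD(1)[OF bil(2)] in auto)
  then have ne: "{I. dend_ideal A I \<and> S \<subseteq> I} \<noteq> {}" using S by blast
  show ?thesis unfolding dend_ideal_def
  proof
    show "submodule (dend_ideal_gen A S) ground A" unfolding dend_ideal_gen_def
      by (rule submodule_Inter[OF A ne]) (auto simp: dend_ideal_def)
    show "\<forall>x\<in>carrier A. \<forall>i\<in>dend_ideal_gen A S. x \<prec>\<^bsub>A\<^esub> i \<in> dend_ideal_gen A S \<and> i \<prec>\<^bsub>A\<^esub> x \<in> dend_ideal_gen A S \<and>
        x \<succ>\<^bsub>A\<^esub> i \<in> dend_ideal_gen A S \<and> i \<succ>\<^bsub>A\<^esub> x \<in> dend_ideal_gen A S"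
      unfolding dend_ideal_gen_def dend_ideal_def by blast
  qed
qed

lemma dend_ideal_gen_superset: "S \<subseteq> dend_ideal_gen A S"
  by (auto simp: dend_ideal_gen_def)

lemma dend_ideal_gen_least: "dend_ideal A I \<Longrightarrow> S \<subseteq> I \<Longrightarrow> dend_ideal_gen A S \<subseteq> I"
  by (auto simp: dend_ideal_gen_def)

lemma same_space_dend_quot: "same_space (dend_quot A I) (quot_space A I)"
  by (simp add: same_space_def dend_quot_def module.extend_def dendriform.fields_def)

lemmas dend_quot_space = same_space_lin_hom[OF same_space_dend_quot] same_space_bilin[OF same_space_dend_quot]

lemma dend_quot_simps:
  "carrier (dend_quot A I) = carrier (quot_space A I)" "add (dend_quot A I) = add (quot_space A I)"
  "zero (dend_quot A I) = zero (quot_space A I)" "smult (dend_quot A I) = smult (quot_space A I)"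
  using same_space_dend_quot[of A I] by (auto simp: same_space_def)

lemma dend_ideal_kernel:
  assumes A: "vs A" and B: "vs B" and f: "f \<in> lin_hom A B"
    and bil: "bilin A A A (dprec A)" "bilin A A A (dsucc A)" and p: "bilin B B B p" and q: "bilin B B B q"
    and fp: "\<And>x y. x \<in> carrier A \<Longrightarrow> y \<in> carrier A \<Longrightarrow> f (x \<prec>\<^bsub>A\<^esub> y) = p (f x) (f y)"
    and fq: "\<And>x y. x \<in> carrier A \<Longrightarrow> y \<in> carrier A \<Longrightarrow> f (x \<succ>\<^bsub>A\<^esub> y) = q (f x) (f y)"
  shows "dend_ideal A {x \<in> carrier A. f x = \<zero>\<^bsub>B\<^esub>}"
  unfolding dend_ideal_def
  by (intro conjI submodule_kernel[OF A B f])
     (auto simp: bilinD(1)[OF bil(1)] bilinD(1)[OF bil(2)] fp fq bilin_zero[OF p B B B] bilin_zero[OF q B B B] lin_homD[OF f])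

context
  fixes A :: "('k::field, 'v, 'm) dendriform_scheme" and I
  assumes A: "vs A" and bil: "bilin A A A (dprec A)" "bilin A A A (dsucc A)" and I: "dend_ideal A I"
begin

private lemma sub: "submodule I ground A"
  using I by (simp add: dend_ideal_def)

lemma vs_dend_quot: "vs (dend_quot A I)"
  by (rule same_space_vs[OF same_space_dend_quot vs_quot[OF A sub]])

lemma dend_quot_proj: "(\<lambda>x. I +>\<^bsub>A\<^esub> x) \<in> lin_hom A (dend_quot A I)"
  using quot_proj[OF A sub] by (simp add: dend_quot_space)

lemma carrier_dend_quot: "carrier (dend_quot A I) = (\<lambda>x. I +>\<^bsub>A\<^esub> x) ` carrier A"
  by (simp add: dend_quot_simps carrier_quot[OF A sub])

lemma dend_quot_proj_zero_iff: "x \<in> carrier A \<Longrightarrow> I +>\<^bsub>A\<^esub> x = \<zero>\<^bsub>dend_quot A I\<^esub> \<longleftrightarrow> x \<in> I"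
  by (simp add: dend_quot_simps quot_proj_eq_zero_iff[OF A sub])

text \<open>One factor is exchanged at a time: f x' y' - f x y' = f (x' - x) y' lies in the ideal,
  and likewise for the second factor.\<close>

private lemma well_defined:
  assumes f: "bilin A A A f" and id: "\<And>x i. x \<in> carrier A \<Longrightarrow> i \<in> I \<Longrightarrow> f x i \<in> I \<and> f i x \<in> I"
    and x: "x \<in> carrier A" and y: "y \<in> carrier A"
  shows "(\<Union>x\<in>I +>\<^bsub>A\<^esub> x. \<Union>y\<in>I +>\<^bsub>A\<^esub> y. I +>\<^bsub>A\<^esub> f x y) = I +>\<^bsub>A\<^esub> f x y"
proof -
  have eq: "I +>\<^bsub>A\<^esub> f x' y' = I +>\<^bsub>A\<^esub> f x y" if "x' \<in> I +>\<^bsub>A\<^esub> x" "y' \<in> I +>\<^bsub>A\<^esub> y" for x' y'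
  proof -
    have x': "x' \<in> carrier A" "x' \<oplus>\<^bsub>A\<^esub> (- 1) \<odot>\<^bsub>A\<^esub> x \<in> I" and y': "y' \<in> carrier A" "y' \<oplus>\<^bsub>A\<^esub> (- 1) \<odot>\<^bsub>A\<^esub> y \<in> I"
      using that x y coset_eq_iff[OF A sub] by (auto simp: mem_coset_iff[OF A sub])
    have "I +>\<^bsub>A\<^esub> f x' y' = I +>\<^bsub>A\<^esub> f x y'"
      using id[OF y'(1) x'(2)] x x' y' A by (subst coset_eq_iff[OF A sub]) (auto simp: bilinD[OF f])
    also have "\<dots> = I +>\<^bsub>A\<^esub> f x y"
      using id[OF x y'(2)] x y y' A by (subst coset_eq_iff[OF A sub]) (auto simp: bilinD[OF f])
    finally show ?thesis .
  qed
  have "(\<Union>x'\<in>I +>\<^bsub>A\<^esub> x. \<Union>y'\<in>I +>\<^bsub>A\<^esub> y. I +>\<^bsub>A\<^esub> f x' y') = (\<Union>x'\<in>I +>\<^bsub>A\<^esub> x. \<Union>y'\<in>I +>\<^bsub>A\<^esub> y. I +>\<^bsub>A\<^esub> f x y)"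
    by (intro SUP_cong refl) (use eq in auto)
  moreover have "x \<in> I +>\<^bsub>A\<^esub> x" "y \<in> I +>\<^bsub>A\<^esub> y" using x y by (simp_all add: mem_coset_iff[OF A sub])
  ultimately show ?thesis by blast
qed

lemma dend_quot_ops:
  assumes x: "x \<in> carrier A" and y: "y \<in> carrier A"
  shows "(I +>\<^bsub>A\<^esub> x) \<prec>\<^bsub>dend_quot A I\<^esub> (I +>\<^bsub>A\<^esub> y) = I +>\<^bsub>A\<^esub> (x \<prec>\<^bsub>A\<^esub> y)"
    "(I +>\<^bsub>A\<^esub> x) \<succ>\<^bsub>dend_quot A I\<^esub> (I +>\<^bsub>A\<^esub> y) = I +>\<^bsub>A\<^esub> (x \<succ>\<^bsub>A\<^esub> y)"
proof -
  show "(I +>\<^bsub>A\<^esub> x) \<prec>\<^bsub>dend_quot A I\<^esub> (I +>\<^bsub>A\<^esub> y) = I +>\<^bsub>A\<^esub> (x \<prec>\<^bsub>A\<^esub> y)"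
    using well_defined[OF bil(1) _ x y] I
    by (simp add: dend_quot_def module.extend_def dendriform.fields_def dend_ideal_def)
  show "(I +>\<^bsub>A\<^esub> x) \<succ>\<^bsub>dend_quot A I\<^esub> (I +>\<^bsub>A\<^esub> y) = I +>\<^bsub>A\<^esub> (x \<succ>\<^bsub>A\<^esub> y)"
    using well_defined[OF bil(2) _ x y] I
    by (simp add: dend_quot_def module.extend_def dendriform.fields_def dend_ideal_def)
qed

lemma bilin_dend_quot:
  "bilin (dend_quot A I) (dend_quot A I) (dend_quot A I) (dprec (dend_quot A I))"
  "bilin (dend_quot A I) (dend_quot A I) (dend_quot A I) (dsucc (dend_quot A I))"
  by (rule bilinI; rule lin_homI;
      auto simp: carrier_dend_quot dend_quot_ops bilinD[OF bil(1)] bilinD[OF bil(2)] A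
        simp flip: lin_homD(2,3)[OF dend_quot_proj])+

lemma dend_quot_lift:
  assumes P: "vs P" and f: "f \<in> lin_hom A P" and z: "\<And>n. n \<in> I \<Longrightarrow> f n = \<zero>\<^bsub>P\<^esub>"
  obtains g where "g \<in> lin_hom (dend_quot A I) P" "\<And>x. x \<in> carrier A \<Longrightarrow> g (I +>\<^bsub>A\<^esub> x) = f x"
proof (rule that)
  show "(\<lambda>X. the_elem (f ` X)) \<in> lin_hom (dend_quot A I) P"
    unfolding dend_quot_space by (rule quot_lift[OF A sub P f z])
  show "the_elem (f ` (I +>\<^bsub>A\<^esub> x)) = f x" if "x \<in> carrier A" for x
    by (simp add: image_coset[OF A sub P f z that])
qed

lemma dendriform_dend_quot:
  assumes "\<And>x y z. x \<in> carrier A \<Longrightarrow> y \<in> carrier A \<Longrightarrow> z \<in> carrier A \<Longrightarrow>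
      I +>\<^bsub>A\<^esub> ((x \<prec>\<^bsub>A\<^esub> y) \<prec>\<^bsub>A\<^esub> z) = I +>\<^bsub>A\<^esub> ((x \<prec>\<^bsub>A\<^esub> (y \<prec>\<^bsub>A\<^esub> z)) \<oplus>\<^bsub>A\<^esub> (x \<prec>\<^bsub>A\<^esub> (y \<succ>\<^bsub>A\<^esub> z)))"
    "\<And>x y z. x \<in> carrier A \<Longrightarrow> y \<in> carrier A \<Longrightarrow> z \<in> carrier A \<Longrightarrow>
      I +>\<^bsub>A\<^esub> ((x \<succ>\<^bsub>A\<^esub> y) \<prec>\<^bsub>A\<^esub> z) = I +>\<^bsub>A\<^esub> (x \<succ>\<^bsub>A\<^esub> (y \<prec>\<^bsub>A\<^esub> z))"
    "\<And>x y z. x \<in> carrier A \<Longrightarrow> y \<in> carrier A \<Longrightarrow> z \<in> carrier A \<Longrightarrow>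
      I +>\<^bsub>A\<^esub> (x \<succ>\<^bsub>A\<^esub> (y \<succ>\<^bsub>A\<^esub> z)) = I +>\<^bsub>A\<^esub> (((x \<succ>\<^bsub>A\<^esub> y) \<succ>\<^bsub>A\<^esub> z) \<oplus>\<^bsub>A\<^esub> ((x \<prec>\<^bsub>A\<^esub> y) \<succ>\<^bsub>A\<^esub> z))"
  shows "dendriform_algebra (dend_quot A I)"
  unfolding dendriform_algebra_def bilinear_op_iff
  using vs_dend_quot bilin_dend_quot assms
  by (auto simp: carrier_dend_quot dend_quot_ops bilinD(1)[OF bil(1)] bilinD(1)[OF bil(2)] A
        simp flip: lin_homD(2)[OF dend_quot_proj])

end

subsection \<open>The algebra of formal terms\<close>

lemma finsum_free_space: "finite A \<Longrightarrow> finsum (free_space UNIV) f A = sum f A"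
  by (induction A rule: finite_induct)
     (simp_all add: vs_finsum_empty[OF vs_free_space] vs_finsum_insert[OF vs_free_space])

lemma lin_ext_free_space:
  "lin_ext (free_space UNIV) g f = (\<Sum>x\<in>Poly_Mapping.keys f. Poly_Mapping.map ((*) (Poly_Mapping.lookup f x)) (g x))"
  by (simp add: lin_ext_def finsum_free_space)

text \<open>As a nested linear extension the product inherits linearity in each argument from the
  general facts about \<open>lin_ext\<close>.\<close>

lemma bilin_ext_eq:
  "bilin_ext h f g = lin_ext (free_space UNIV) (\<lambda>s. lin_ext (free_space UNIV) (\<lambda>t. gen (h s t)) g) f"
proof -
  have "(\<Sum>t\<in>Poly_Mapping.keys g. Poly_Mapping.single (h s t) (c * Poly_Mapping.lookup g t)) =
      Poly_Mapping.map ((*) c) (\<Sum>t\<in>Poly_Mapping.keys g. Poly_Mapping.single (h s t) (Poly_Mapping.lookup g t))" for c s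
    by (rule poly_mapping_eqI) (simp add: lookup_sum lookup_single sum_distrib_left when_def if_distrib cong: if_cong)
  then show ?thesis by (simp add: bilin_ext_def lin_ext_free_space)
qed

lemma lin_ext_param:
  assumes P: "vs P" and G: "\<And>s. (\<lambda>q. G q s) \<in> lin_hom Q P"
  shows "(\<lambda>q. lin_ext P (G q) f) \<in> lin_hom Q P"
proof (rule lin_homI)
  note g = lin_homD[OF G]
  fix q assume q: "q \<in> carrier Q"
  show "lin_ext P (G q) f \<in> carrier P"
    unfolding lin_ext_def by (rule vs_finsum_closed[OF P]) (use q g P in auto)
  show "lin_ext P (G (q \<oplus>\<^bsub>Q\<^esub> q')) f = lin_ext P (G q) f \<oplus>\<^bsub>P\<^esub> lin_ext P (G q') f" if "q' \<in> carrier Q" for q'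
    unfolding lin_ext_def
    by (subst vs_finsum_add[OF P, symmetric]) (use q that g P in \<open>auto simp: vs_smult_add intro!: vs_finsum_cong\<close>)
  show "lin_ext P (G (c \<odot>\<^bsub>Q\<^esub> q)) f = c \<odot>\<^bsub>P\<^esub> lin_ext P (G q) f" for c
    unfolding lin_ext_def
    by (subst vs_finsum_smult[OF P, symmetric]) (use q g P in \<open>auto simp: mult.commute intro!: vs_finsum_cong\<close>)
qed

lemma bilin_bilin_ext: "bilin (free_space UNIV) (free_space UNIV) (free_space UNIV) (bilin_ext h)"
proof (rule bilinI)
  let ?F = "free_space UNIV"
  show "(\<lambda>f. bilin_ext h f g) \<in> lin_hom ?F ?F" for g
    unfolding bilin_ext_eq by (rule lin_ext_lin_hom[OF vs_free_space]) simp
  show "bilin_ext h f \<in> lin_hom ?F ?F" for f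
    unfolding bilin_ext_eq
    by (rule lin_ext_param[OF vs_free_space], rule lin_ext_lin_hom[OF vs_free_space]) simp
qed

lemma bilin_ext_gen: "bilin_ext h (gen s) (gen t) = gen (h s t)"
  by (simp add: bilin_ext_def)

lemma free_bilin_eqI:
  assumes P: "vs P" and F: "bilin (free_space UNIV) (free_space UNIV) P F" and G: "bilin (free_space UNIV) (free_space UNIV) P G"
    and eq: "\<And>s t. F (gen s) (gen t) = G (gen s) (gen t)"
  shows "F f g = G f g"
proof -
  have 1: "F (gen s) g = G (gen s) g" for s
    by (rule free_space_lin_eqI[OF P, where X = UNIV]) (use F G eq in \<open>auto simp: bilin_def\<close>)
  show ?thesis
    by (rule free_space_lin_eqI[OF P, where X = UNIV and f = "\<lambda>f. F f g" and g = "\<lambda>f. G f g"])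
       (use F G 1 in \<open>auto simp: bilin_def\<close>)
qed

lemma same_space_term_algebra: "same_space term_algebra (free_space UNIV)"
  by (simp add: same_space_def term_algebra_def module.extend_def dendriform.fields_def free_space_def)

lemma term_algebra_simps [simp]:
  "carrier term_algebra = UNIV" "add term_algebra = (+)" "zero term_algebra = 0"
  "smult term_algebra = (\<lambda>c. Poly_Mapping.map ((*) c))"
  "dprec term_algebra = bilin_ext Prec" "dsucc term_algebra = bilin_ext Succ"
  by (simp_all add: term_algebra_def module.extend_def dendriform.fields_def free_space_def)

lemmas term_space [simp] = same_space_lin_hom[OF same_space_term_algebra] same_space_bilin[OF same_space_term_algebra]

lemma vs_term_algebra [simp]: "vs term_algebra"
  by (rule same_space_vs[OF same_space_term_algebra vs_free_space])

lemma bilin_term_algebra: "bilin term_algebra term_algebra term_algebra (dprec term_algebra)"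
  "bilin term_algebra term_algebra term_algebra (dsucc term_algebra)"
  by (simp_all add: bilin_bilin_ext)

primrec eval_term :: "('v \<Rightarrow> 'v \<Rightarrow> 'v) \<Rightarrow> ('v \<Rightarrow> 'v \<Rightarrow> 'v) \<Rightarrow> ('b \<Rightarrow> 'v) \<Rightarrow> 'b dterm \<Rightarrow> 'v" where
  "eval_term p q g (Gen b) = g b"
| "eval_term p q g (Prec s t) = p (eval_term p q g s) (eval_term p q g t)"
| "eval_term p q g (Succ s t) = q (eval_term p q g s) (eval_term p q g t)"

lemma term_algebra_universal:
  assumes P: "vs P" and p: "bilin P P P p" and q: "bilin P P P q" and g: "\<And>b. g b \<in> carrier P"
  obtains E where "E \<in> lin_hom term_algebra P" "\<And>x y. E (x \<prec>\<^bsub>term_algebra\<^esub> y) = p (E x) (E y)"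
    "\<And>x y. E (x \<succ>\<^bsub>term_algebra\<^esub> y) = q (E x) (E y)" "\<And>b. E (gen (Gen b)) = g b"
proof (rule that)
  let ?E = "lin_ext P (eval_term p q g)"
  have c: "eval_term p q g t \<in> carrier P" for t
    by (induction t) (auto simp: g bilinD(1)[OF p] bilinD(1)[OF q])
  have l: "?E \<in> lin_hom (free_space UNIV) P" by (rule lin_ext_lin_hom[OF P c])
  have gn: "?E (gen t) = eval_term p q g t" for t
    using lin_ext_single[where g = "eval_term p q g", OF P c, of t 1] c[of t] P by simp
  show "?E \<in> lin_hom term_algebra P" using l by simp
  show "?E (gen (Gen b)) = g b" for b by (simp add: gn)
  show "?E (x \<prec>\<^bsub>term_algebra\<^esub> y) = p (?E x) (?E y)" for x y
    by (rule free_bilin_eqI[OF P, where F = "\<lambda>x y. ?E (x \<prec>\<^bsub>term_algebra\<^esub> y)"])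
       (auto intro!: bilin_comp[OF bilin_bilin_ext l] bilin_arg[OF p l l] simp: bilin_ext_gen gn)
  show "?E (x \<succ>\<^bsub>term_algebra\<^esub> y) = q (?E x) (?E y)" for x y
    by (rule free_bilin_eqI[OF P, where F = "\<lambda>x y. ?E (x \<succ>\<^bsub>term_algebra\<^esub> y)"])
       (auto intro!: bilin_comp[OF bilin_bilin_ext l] bilin_arg[OF q l l] simp: bilin_ext_gen gn)
qed

lemma term_algebra_eqI:
  assumes P: "vs P" and f: "f \<in> lin_hom term_algebra P" and g: "g \<in> lin_hom term_algebra P"
    and "\<And>x y. f (x \<prec>\<^bsub>term_algebra\<^esub> y) = p (f x) (f y)" "\<And>x y. f (x \<succ>\<^bsub>term_algebra\<^esub> y) = q (f x) (f y)"
    and "\<And>x y. g (x \<prec>\<^bsub>term_algebra\<^esub> y) = p (g x) (g y)" "\<And>x y. g (x \<succ>\<^bsub>term_algebra\<^esub> y) = q (g x) (g y)"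
    and eq: "\<And>b. f (gen (Gen b)) = g (gen (Gen b))"
  shows "f x = g x"
proof (rule free_space_lin_eqI[OF P, where X = UNIV])
  show "f (gen t) = g (gen t)" for t
  proof (induction t)
    case (Prec s t)
    then show ?case using assms(4,6)[of "gen s" "gen t"] by (simp add: bilin_ext_gen)
  next
    case (Succ s t)
    then show ?case using assms(5,7)[of "gen s" "gen t"] by (simp add: bilin_ext_gen)
  qed (rule eq)
qed (use f g in auto)

subsection \<open>The universal property\<close>

definition vec_module :: "('k::field \<Rightarrow> 'b::ab_group_add \<Rightarrow> 'b) \<Rightarrow> ('k, 'b) module" where
  "vec_module scale = \<lparr>carrier = UNIV, mult = undefined, one = undefined, zero = 0, add = (+), smult = scale\<rparr>"

lemma vec_module_simps [simp]:
  "carrier (vec_module scale) = UNIV" "zero (vec_module scale) = 0" "add (vec_module scale) = (+)"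
  "smult (vec_module scale) = scale"
  by (simp_all add: vec_module_def)

lemma vs_vec_module: assumes "vector_space scale" shows "vs (vec_module scale)"
proof -
  interpret vector_space scale by fact
  show ?thesis
    by (rule vsI) (auto simp: scale_right_distrib scale_left_distrib)
qed

definition free_dend_gens :: "('k::field \<Rightarrow> 'b::ab_group_add \<Rightarrow> 'b) \<Rightarrow> ('b dterm \<Rightarrow>\<^sub>0 'k) set" where
  "free_dend_gens scale = (let p = dprec term_algebra; s = dsucc term_algebra in
        ({gen (Gen (x + y)) - gen (Gen x) - gen (Gen y) | x y. True} \<union>
         {gen (Gen (scale c x)) - Poly_Mapping.single (Gen x) c | c x. True} \<union>
         {p (p x y) z - p x (p y z) - p x (s y z) | x y z. True} \<union>
         {p (s x y) z - s x (p y z) | x y z. True} \<union>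
         {s x (s y z) - s (s x y) z - s (p x y) z | x y z. True}))"

lemma free_dend_rel_eq: "free_dend_rel scale = dend_ideal_gen term_algebra (free_dend_gens scale)"
  by (simp add: free_dend_rel_def free_dend_gens_def Let_def)

lemma free_dend_ideal: "dend_ideal term_algebra (free_dend_rel scale)"
  unfolding free_dend_rel_eq by (rule dend_ideal_gen_ideal[OF vs_term_algebra bilin_term_algebra]) auto

lemmas free_dend_facts =
  vs_dend_quot[OF vs_term_algebra bilin_term_algebra free_dend_ideal, folded free_dend_def]
  dend_quot_proj[OF vs_term_algebra bilin_term_algebra free_dend_ideal, folded free_dend_def]
  carrier_dend_quot[OF vs_term_algebra bilin_term_algebra free_dend_ideal, folded free_dend_def]
  dend_quot_proj_zero_iff[OF vs_term_algebra bilin_term_algebra free_dend_ideal, folded free_dend_def]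
  dend_quot_ops[OF vs_term_algebra bilin_term_algebra free_dend_ideal, folded free_dend_def]
  bilin_dend_quot[OF vs_term_algebra bilin_term_algebra free_dend_ideal, folded free_dend_def]

lemma free_dend_coset_eqI:
  "f - g \<in> free_dend_gens scale \<Longrightarrow> free_dend_rel scale +>\<^bsub>term_algebra\<^esub> f = free_dend_rel scale +>\<^bsub>term_algebra\<^esub> g"
proof -
  assume "f - g \<in> free_dend_gens scale"
  then have "f - g \<in> free_dend_rel scale"
    unfolding free_dend_rel_eq using dend_ideal_gen_superset[of "free_dend_gens scale" term_algebra] by blast
  then have z: "free_dend_rel scale +>\<^bsub>term_algebra\<^esub> (f - g) = \<zero>\<^bsub>free_dend scale\<^esub>"
    using free_dend_facts(4)[of "f - g" scale] by simp
  show ?thesis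
    using lin_hom_free_diff_zero_iff[OF free_dend_facts(2)[of scale, unfolded term_space] free_dend_facts(1), of f g] z by simp
qed

lemma dendriform_free_dend: "dendriform_algebra (free_dend scale)"
  unfolding free_dend_def
proof (rule dendriform_dend_quot[OF vs_term_algebra bilin_term_algebra free_dend_ideal];
    rule free_dend_coset_eqI)
  fix x y z
  show "x \<prec>\<^bsub>term_algebra\<^esub> y \<prec>\<^bsub>term_algebra\<^esub> z - (x \<prec>\<^bsub>term_algebra\<^esub> (y \<prec>\<^bsub>term_algebra\<^esub> z) \<oplus>\<^bsub>term_algebra\<^esub>
      x \<prec>\<^bsub>term_algebra\<^esub> (y \<succ>\<^bsub>term_algebra\<^esub> z)) \<in> free_dend_gens scale"
    unfolding free_dend_gens_def Let_def term_algebra_simps(2) diff_diff_eq[symmetric] by blast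
  show "x \<succ>\<^bsub>term_algebra\<^esub> y \<prec>\<^bsub>term_algebra\<^esub> z - x \<succ>\<^bsub>term_algebra\<^esub> (y \<prec>\<^bsub>term_algebra\<^esub> z) \<in> free_dend_gens scale"
    unfolding free_dend_gens_def Let_def by blast
  show "x \<succ>\<^bsub>term_algebra\<^esub> (y \<succ>\<^bsub>term_algebra\<^esub> z) - (x \<succ>\<^bsub>term_algebra\<^esub> y \<succ>\<^bsub>term_algebra\<^esub> z \<oplus>\<^bsub>term_algebra\<^esub>
      x \<prec>\<^bsub>term_algebra\<^esub> y \<succ>\<^bsub>term_algebra\<^esub> z) \<in> free_dend_gens scale"
    unfolding free_dend_gens_def Let_def term_algebra_simps(2) diff_diff_eq[symmetric] by blast
qed

lemma free_dend_in_lin: "free_dend_in scale \<in> lin_hom (vec_module scale) (free_dend scale)"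
proof (rule lin_homI)
  note P = lin_homD[OF free_dend_facts(2)[of scale]]
  show "free_dend_in scale x \<in> carrier (free_dend scale)" for x
    unfolding free_dend_in_def by (rule P(1)) simp
  show "free_dend_in scale (x \<oplus>\<^bsub>vec_module scale\<^esub> y) = free_dend_in scale x \<oplus>\<^bsub>free_dend scale\<^esub> free_dend_in scale y" for x y
  proof -
    have "free_dend_rel scale +>\<^bsub>term_algebra\<^esub> gen (Gen (x + y)) = free_dend_rel scale +>\<^bsub>term_algebra\<^esub> (gen (Gen x) + gen (Gen y))"
      by (rule free_dend_coset_eqI) (auto simp: free_dend_gens_def Let_def diff_diff_eq[symmetric])
    then show ?thesis using P(2)[of "gen (Gen x)" "gen (Gen y)"] by (simp add: free_dend_in_def)
  qed
  show "free_dend_in scale (c \<odot>\<^bsub>vec_module scale\<^esub> x) = c \<odot>\<^bsub>free_dend scale\<^esub> free_dend_in scale x" for c x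
  proof -
    have "free_dend_rel scale +>\<^bsub>term_algebra\<^esub> gen (Gen (scale c x)) = free_dend_rel scale +>\<^bsub>term_algebra\<^esub> Poly_Mapping.single (Gen x) c"
      by (rule free_dend_coset_eqI) (auto simp: free_dend_gens_def Let_def)
    then show ?thesis using P(3)[of "gen (Gen x)" c] by (simp add: free_dend_in_def)
  qed
qed

text \<open>The generators are sent into the kernel of the counit. On that kernel x * y is just x
  \<prec> y + x \<succ> y, so the axioms of W specialise to the dendriform relations and the
  evaluation of formal terms factors through the quotient.\<close>

lemma free_dend_lift:
  assumes W: "augmented W" and g: "g \<in> lin_hom (vec_module scale) W" and e: "\<And>x. counit W (g x) = 0"
  obtains h where "h \<in> aug_hom (uaug (free_dend scale)) W" "\<And>x. h (0, free_dend_in scale x) = g x"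
proof -
  interpret W: augmented W by fact
  have gc: "g b \<in> carrier W" for b using lin_homD(1)[OF g] by simp
  obtain E where E: "E \<in> lin_hom term_algebra W" and Ep: "\<And>x y. E (x \<prec>\<^bsub>term_algebra\<^esub> y) = E x \<prec>\<^bsub>W\<^esub> E y"
    and Es: "\<And>x y. E (x \<succ>\<^bsub>term_algebra\<^esub> y) = E x \<succ>\<^bsub>W\<^esub> E y" and Eg: "\<And>b. E (gen (Gen b)) = g b"
    using term_algebra_universal[where g = g, OF W.vs W.bilin_prec W.bilin_succ gc] by metis
  have Ec: "E x \<in> carrier W" for x using lin_homD(1)[OF E] by simp
  \<comment> \<open>The counit after E and the zero map agree on letters and both turn products into
    0, hence agree on all terms.\<close>
  have Ez: "counit W (E x) = 0" for x
  proof (rule term_algebra_eqI[OF vs_ground lin_hom_comp[OF W.counit_lin E], where p = "\<lambda>_ _. 0" and q = "\<lambda>_ _. 0" and g = "\<lambda>_. 0"])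
    show "(\<lambda>_. 0) \<in> lin_hom term_algebra ground" using lin_hom_const_zero[OF vs_ground] by simp
  qed (simp_all only: Ep Es Ec Eg e W.counit_prec W.counit_succ)
  have El: "E \<in> lin_hom (free_space UNIV) W" using E by simp
  have Ea: "E (x + y) = E x \<oplus>\<^bsub>W\<^esub> E y" for x y using lin_homD(2)[OF El, of x y] by simp
  have Esc: "E (Poly_Mapping.single (Gen x) c) = c \<odot>\<^bsub>W\<^esub> g x" for x c using lin_homD(3)[OF El, of "gen (Gen x)" c] by (simp add: Eg)
  have d: "E (u - v) = \<zero>\<^bsub>W\<^esub> \<longleftrightarrow> E u = E v" for u v using lin_hom_free_diff_zero_iff[OF El W.vs, of u v] by simp
  have ker: "dend_ideal term_algebra {x \<in> carrier term_algebra. E x = \<zero>\<^bsub>W\<^esub>}"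
    by (rule dend_ideal_kernel[OF vs_term_algebra W.vs E bilin_term_algebra W.bilin_prec W.bilin_succ Ep Es])
  have star: "E x \<otimes>\<^bsub>W\<^esub> E y = (E x \<prec>\<^bsub>W\<^esub> E y) \<oplus>\<^bsub>W\<^esub> (E x \<succ>\<^bsub>W\<^esub> E y)" for x y
    by (simp add: W.star_eq Ec Ez)
  have ax: "(E x \<prec>\<^bsub>W\<^esub> E y) \<prec>\<^bsub>W\<^esub> E z = (E x \<prec>\<^bsub>W\<^esub> (E y \<prec>\<^bsub>W\<^esub> E z)) \<oplus>\<^bsub>W\<^esub> (E x \<prec>\<^bsub>W\<^esub> (E y \<succ>\<^bsub>W\<^esub> E z))"
    "(E x \<succ>\<^bsub>W\<^esub> E y) \<prec>\<^bsub>W\<^esub> E z = E x \<succ>\<^bsub>W\<^esub> (E y \<prec>\<^bsub>W\<^esub> E z)"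
    "E x \<succ>\<^bsub>W\<^esub> (E y \<succ>\<^bsub>W\<^esub> E z) = ((E x \<succ>\<^bsub>W\<^esub> E y) \<succ>\<^bsub>W\<^esub> E z) \<oplus>\<^bsub>W\<^esub> ((E x \<prec>\<^bsub>W\<^esub> E y) \<succ>\<^bsub>W\<^esub> E z)" for x y z
    by (simp_all add: W.prec_prec W.succ_prec W.succ_succ star Ec vs_comm[OF W.vs, of "(E x \<prec>\<^bsub>W\<^esub> E y) \<succ>\<^bsub>W\<^esub> E z"])
  have ga: "g (x + y) = g x \<oplus>\<^bsub>W\<^esub> g y" "g (scale c x) = c \<odot>\<^bsub>W\<^esub> g x" for x y c
    using lin_homD(2)[OF g, of x y] lin_homD(3)[OF g, of x c] by simp_all
  have "free_dend_gens scale \<subseteq> {x. E x = \<zero>\<^bsub>W\<^esub>}"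
    unfolding free_dend_gens_def Let_def diff_diff_eq
    by (intro Un_least subsetI; elim CollectE exE conjE; rule CollectI; simp only: d Ea Esc Ep Es ax ga vs_smult_one[OF W.vs] vs_add_closed[OF W.vs] vs_smult_closed[OF W.vs] gc)
  then have "free_dend_gens scale \<subseteq> {x \<in> carrier term_algebra. E x = \<zero>\<^bsub>W\<^esub>}" by simp
  then have z: "E x = \<zero>\<^bsub>W\<^esub>" if "x \<in> free_dend_rel scale" for x
    using subsetD[OF dend_ideal_gen_least[OF ker] that[unfolded free_dend_rel_eq]] by simp
  obtain h where h: "h \<in> lin_hom (free_dend scale) W"
    and h': "\<And>x. x \<in> carrier term_algebra \<Longrightarrow> h (free_dend_rel scale +>\<^bsub>term_algebra\<^esub> x) = E x"
    using dend_quot_lift[OF vs_term_algebra bilin_term_algebra free_dend_ideal W.vs E z, folded free_dend_def] by blast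
  note hE = h'[unfolded term_algebra_simps(1), OF UNIV_I]
  have "(\<lambda>(a, x). a \<odot>\<^bsub>W\<^esub> \<one>\<^bsub>W\<^esub> \<oplus>\<^bsub>W\<^esub> h x) \<in> aug_hom (uaug (free_dend scale)) W"
    by (rule unital_extension[OF dendriform_free_dend W h])
       (auto simp: free_dend_facts(3) free_dend_facts(5,6) hE Ep[simplified] Es[simplified] Ez)
  moreover have "(\<lambda>(a, x). a \<odot>\<^bsub>W\<^esub> \<one>\<^bsub>W\<^esub> \<oplus>\<^bsub>W\<^esub> h x) (0, free_dend_in scale x) = g x" for x
    by (simp add: free_dend_in_def hE Eg gc)
  ultimately show ?thesis using that by blast
qed

lemma free_dend_hom_eqI:
  assumes W: "augmented W" and f: "f \<in> aug_hom (uaug (free_dend scale)) W" and g: "g \<in> aug_hom (uaug (free_dend scale)) W"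
    and eq: "\<And>x. f (0, free_dend_in scale x) = g (0, free_dend_in scale x)" and x: "x \<in> carrier (uaug (free_dend scale))"
  shows "f x = g x"
proof -
  interpret W: augmented W by fact
  interpret D: augmented "uaug (free_dend scale)" by (rule augmented_uaug[OF dendriform_free_dend])
  let ?D = "free_dend scale" and ?p = "\<lambda>t. (0, free_dend_rel scale +>\<^bsub>term_algebra\<^esub> t)"
  note v = free_dend_facts(1)[of scale]
  note P = lin_homD[OF free_dend_facts(2)[of scale]]
  have pl: "?p \<in> lin_hom term_algebra (uaug ?D)"
    by (rule lin_homI) (use P in auto)
  have pp: "?p (s \<prec>\<^bsub>term_algebra\<^esub> t) = ?p s \<prec>\<^bsub>uaug ?D\<^esub> ?p t" "?p (s \<succ>\<^bsub>term_algebra\<^esub> t) = ?p s \<succ>\<^bsub>uaug ?D\<^esub> ?p t" for s t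
    using P(1) v bilinD(1)[OF free_dend_facts(7)[of scale]] bilinD(1)[OF free_dend_facts(8)[of scale]]
    by (auto simp: free_dend_facts(5,6)[simplified])
  have "f (?p t) = g (?p t)" for t
    by (rule term_algebra_eqI[OF W.vs lin_hom_comp[OF aug_homD(1)[OF f] pl] lin_hom_comp[OF aug_homD(1)[OF g] pl]])
       (use aug_homD[OF f] aug_homD[OF g] lin_homD(1)[OF pl] eq in \<open>simp_all only: pp term_algebra_simps(1) UNIV_I free_dend_in_def\<close>)
  moreover obtain a t where xx: "x = (a, free_dend_rel scale +>\<^bsub>term_algebra\<^esub> t)"
    using x by (auto simp: free_dend_facts(3))
  then have "x = a \<odot>\<^bsub>uaug ?D\<^esub> \<one>\<^bsub>uaug ?D\<^esub> \<oplus>\<^bsub>uaug ?D\<^esub> ?p t"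
    using v P(1)[of t] by simp
  moreover have "?p t \<in> carrier (uaug ?D)" using lin_homD(1)[OF pl] by simp
  ultimately show ?thesis
    using lin_homD(2,3)[OF aug_homD(1)[OF f]] lin_homD(2,3)[OF aug_homD(1)[OF g]] aug_homD(2)[OF f] aug_homD(2)[OF g]
      D.one_closed vs_smult_closed[OF D.vs D.one_closed, of a] by metis
qed

subsection \<open>The coproduct of the free dendriform algebra\<close>

lemma (in augmented) primitive_lin:
  assumes "g \<in> lin_hom V W" "vs V"
  shows "(\<lambda>x. pure_tensor W W (g x) \<one> \<oplus>\<^bsub>tensor W W\<^esub> pure_tensor W W \<one> (g x)) \<in> lin_hom V (tensor W W)"
  by (intro lin_hom_sum[OF vs_tensor[OF vs vs]] bilin_left[OF bilin_pure[OF vs vs] one_closed assms(1)]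
      bilin_right[OF bilin_pure[OF vs vs] one_closed assms(1)])

text \<open>Freeness gives \<Delta> from its prescribed values on generators, as a morphism into the
  tensor square. Each coalgebra law compares two morphisms out of the free algebra, so it is again
  decided on generators.\<close>

lemma free_dend_coproduct_exists:
  assumes "vector_space scale"
  shows "\<exists>\<Delta>. dendriform_bialgebra (free_dend scale) \<Delta> \<and>
    (\<forall>x. (0, free_dend_in scale x) \<in> primitive (unital (free_dend scale)) \<Delta>)"
proof -
  let ?D = "free_dend scale" and ?W = "uaug (free_dend scale)" and ?i = "\<lambda>x. (0, free_dend_in scale x)"
  let ?T = "aug_tensor ?W ?W"
  note v = free_dend_facts(1)[of scale]
  interpret W: augmented ?W by (rule augmented_uaug[OF dendriform_free_dend])
  note A = W.augmented_axioms
  note aT = augmented_tensor[OF A A]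
  note V = vs_vec_module[OF assms]
  note bp = bilin_pure[OF W.vs W.vs] and vT = vs_tensor[OF W.vs W.vs]
  have il: "?i \<in> lin_hom (vec_module scale) ?W"
    by (rule lin_homI) (use lin_homD[OF free_dend_in_lin[of scale]] in auto)
  have ic: "?i x \<in> carrier ?W" for x using lin_homD(1)[OF il] by (simp del: uaug_simps)
  let ?g = "\<lambda>x. pure_tensor ?W ?W (?i x) \<one>\<^bsub>?W\<^esub> \<oplus>\<^bsub>tensor ?W ?W\<^esub> pure_tensor ?W ?W \<one>\<^bsub>?W\<^esub> (?i x)"
  have gl: "?g \<in> lin_hom (vec_module scale) ?T"
    using W.primitive_lin[OF il V] by simp
  have ge: "counit ?T (?g x) = 0" for x
    using lin_homD(2)[OF aug_tensor_counit_lin[OF A A], of "pure_tensor ?W ?W (?i x) \<one>\<^bsub>?W\<^esub>" "pure_tensor ?W ?W \<one>\<^bsub>?W\<^esub> (?i x)"]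
      pure_closed[OF W.vs W.vs ic W.one_closed] pure_closed[OF W.vs W.vs W.one_closed ic]
      aug_tensor_counit_pure[OF A A ic[of x] W.one_closed] aug_tensor_counit_pure[OF A A W.one_closed ic[of x]] by simp
  obtain \<Delta> where \<Delta>: "\<Delta> \<in> aug_hom ?W ?T" and \<Delta>i: "\<And>x. \<Delta> (?i x) = ?g x"
    using free_dend_lift[OF aT gl ge] by metis
  have \<Delta>l: "\<Delta> \<in> lin_hom ?W (tensor ?W ?W)" using aug_homD(1)[OF \<Delta>] by simp
  have \<Delta>1: "\<Delta> \<one>\<^bsub>?W\<^esub> = pure_tensor ?W ?W \<one>\<^bsub>?W\<^esub> \<one>\<^bsub>?W\<^esub>" using aug_homD(2)[OF \<Delta>] by simp
  have id: "id \<in> aug_hom ?W ?W" using aug_hom_id[of ?W] by (simp add: id_def)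
  note pc = pure_closed[OF W.vs W.vs ic W.one_closed] pure_closed[OF W.vs W.vs W.one_closed ic]
    pure_closed[OF W.vs W.vs W.one_closed W.one_closed]
  have coassoc: "tensor_assoc ?W ?W ?W (tensor_map (tensor ?W ?W) ?W \<Delta> id (\<Delta> x)) = tensor_map ?W (tensor ?W ?W) id \<Delta> (\<Delta> x)"
    if x: "x \<in> carrier ?W" for x
  proof (rule free_dend_hom_eqI[where x = x, OF augmented_tensor[OF A aT] _ _ _ x])
    have m: "tensor_map ?T ?W \<Delta> id = tensor_map (tensor ?W ?W) ?W \<Delta> id" "tensor_map ?W ?T id \<Delta> = tensor_map ?W (tensor ?W ?W) id \<Delta>"
      by (simp_all add: tensor_map_def[abs_def])
    show "(\<lambda>x. tensor_assoc ?W ?W ?W (tensor_map (tensor ?W ?W) ?W \<Delta> id (\<Delta> x))) \<in> aug_hom ?W (aug_tensor ?W ?T)"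
      using aug_hom_comp[OF aug_hom_comp[OF \<Delta> aug_tensor_map[OF A A aT A \<Delta> id]] aug_tensor_assoc[OF A A A]] unfolding m .
    show "(\<lambda>x. tensor_map ?W (tensor ?W ?W) id \<Delta> (\<Delta> x)) \<in> aug_hom ?W (aug_tensor ?W ?T)"
      using aug_hom_comp[OF \<Delta> aug_tensor_map[OF A A A aT id \<Delta>]] unfolding m .
    fix x
    note bT = bilin_pure[OF W.vs vT] bilin_pure[OF vT W.vs]
    note idl = aug_homD(1)[OF id]
    note ml = tensor_map_lin_hom[OF W.vs W.vs vT W.vs \<Delta>l idl] tensor_map_lin_hom[OF W.vs W.vs W.vs vT idl \<Delta>l]
    note mp = tensor_map_pure[OF W.vs W.vs vT W.vs \<Delta>l idl] tensor_map_pure[OF W.vs W.vs W.vs vT idl \<Delta>l]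
    note as = tensor_assoc_lin_hom[OF W.vs W.vs W.vs] tensor_assoc_pure[OF W.vs W.vs W.vs]
    note vTT = vs_tensor[OF W.vs vT] vs_tensor[OF vT W.vs]
    \<comment> \<open>On a generator both sides are x \<otimes> 1 \<otimes> 1 + 1 \<otimes> x
      \<otimes> 1 + 1 \<otimes> 1 \<otimes> x.\<close>
    show "tensor_assoc ?W ?W ?W (tensor_map (tensor ?W ?W) ?W \<Delta> id (\<Delta> (?i x))) = tensor_map ?W (tensor ?W ?W) id \<Delta> (\<Delta> (?i x))"
      using ic W.one_closed
      by (simp add: \<Delta>i \<Delta>1 pc lin_homD[OF ml(1)] lin_homD[OF ml(2)] mp lin_homD[OF as(1)] as(2) bilinD[OF bT(1)] bilinD[OF bT(2)]
          vs_assoc[OF vTT(1)] pure_closed[OF vT W.vs] pure_closed[OF W.vs vT] vTT del: uaug_simps)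
  qed
  have counit: "tensor_lift ?W (\<lambda>y z. counit ?W y \<odot>\<^bsub>?W\<^esub> z) (\<Delta> x) = x" "tensor_lift ?W (\<lambda>y z. counit ?W z \<odot>\<^bsub>?W\<^esub> y) (\<Delta> x) = x"
    if x: "x \<in> carrier ?W" for x
  proof -
    have ci: "counit ?W (?i x) = 0" for x by simp
    show "tensor_lift ?W (\<lambda>y z. counit ?W y \<odot>\<^bsub>?W\<^esub> z) (\<Delta> x) = x"
      by (rule free_dend_hom_eqI[where x = x, OF A aug_hom_comp[OF \<Delta> W.counit_left_aug_hom] aug_hom_id _ x])
         (use ic W.one_closed in \<open>simp add: \<Delta>i pc lin_homD[OF W.counit_left_lin] W.counit_left_pure ci W.counit_one vs_zero_smult[OF W.vs] del: uaug_simps\<close>)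
    show "tensor_lift ?W (\<lambda>y z. counit ?W z \<odot>\<^bsub>?W\<^esub> y) (\<Delta> x) = x"
      by (rule free_dend_hom_eqI[where x = x, OF A aug_hom_comp[OF \<Delta> W.counit_right_aug_hom] aug_hom_id _ x])
         (use ic W.one_closed in \<open>simp add: \<Delta>i pc lin_homD[OF W.counit_right_lin] W.counit_right_pure ci W.counit_one vs_zero_smult[OF W.vs] del: uaug_simps\<close>)
  qed
  have "dendriform_bialgebra ?D \<Delta>"
    by (rule aug_hom_imp_dendriform_bialgebra[OF dendriform_free_dend \<Delta>])
       (use coassoc counit \<Delta>l in \<open>simp only: coalgebra_unital_iff[OF A] uaug_simps(9) conj_absorb; blast\<close>)
  moreover have "?i x \<in> primitive (unital ?D) \<Delta>" for x
    unfolding primitive_def unital_space uaug_ops using ic \<Delta>i by blast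
  ultimately show ?thesis by blast
qed

text \<open>The coproduct is introduced by a choice; the existence proof hands over the two
  properties through which it is accessed from here on.\<close>

lemma free_dend_coproduct:
  assumes "vector_space scale"
  shows "free_dend_coproduct scale \<in> aug_hom (uaug (free_dend scale)) (aug_tensor (uaug (free_dend scale)) (uaug (free_dend scale)))"
    and "(0, free_dend_in scale x) \<in> primitive (unital (free_dend scale)) (free_dend_coproduct scale)"
  using someI_ex[OF free_dend_coproduct_exists[OF assms]] dendriform_bialgebra_imp_aug_hom
  unfolding free_dend_coproduct_def[symmetric] by blast+

section \<open>The tensor coalgebra\<close>

locale word_space = vector_space scale for scale :: "'k::field \<Rightarrow> 'b::ab_group_add \<Rightarrow> 'b"
begin

abbreviation (input) "V \<equiv> vec_module scale"
abbreviation (input) "T \<equiv> tensor_words scale"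
abbreviation (input) "TT \<equiv> tensor (tensor_words scale) (tensor_words scale)"
abbreviation (input) "pt \<equiv> pure_tensor (tensor_words scale) (tensor_words scale)"
abbreviation (input) "wd \<equiv> word scale"

lemma vsV [simp]: "vs V"
  by (rule vs_vec_module) unfold_locales

subsection \<open>Multilinear maps on words\<close>

definition multilin :: "('k, 'p, 'm) module_scheme \<Rightarrow> ('b list \<Rightarrow> 'p) \<Rightarrow> bool" where
  "multilin P F \<longleftrightarrow> (\<forall>w. F w \<in> carrier P) \<and>
     (\<forall>us vs x y. F (us @ (x + y) # vs) = F (us @ x # vs) \<oplus>\<^bsub>P\<^esub> F (us @ y # vs)) \<and>
     (\<forall>us vs c x. F (us @ scale c x # vs) = c \<odot>\<^bsub>P\<^esub> F (us @ x # vs))"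

definition word_gens :: "('b list \<Rightarrow>\<^sub>0 'k) set" where
  "word_gens = {gen (us @ (x + y) # vs) - gen (us @ x # vs) - gen (us @ y # vs) | us vs x y. True} \<union>
      {gen (us @ scale c x # vs) - Poly_Mapping.single (us @ x # vs) c | us vs c x. True}"

lemma word_rel_eq: "word_rel scale = lin_span (free_space UNIV) word_gens"
  by (simp add: word_rel_def word_gens_def)

lemma submodule_word_rel: "submodule (word_rel scale) ground (free_space UNIV)"
  unfolding word_rel_eq by (rule lin_span_submodule[OF vs_free_space]) auto

lemma vsT [simp]: "vs T"
  unfolding tensor_words_def by (rule vs_quot[OF vs_free_space submodule_word_rel])

lemma vsTT [simp]: "vs TT" by simp

lemma word_proj: "(\<lambda>f. word_rel scale +>\<^bsub>free_space UNIV\<^esub> f) \<in> lin_hom (free_space UNIV) T"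
  unfolding tensor_words_def by (rule quot_proj[OF vs_free_space submodule_word_rel])

lemma wd_closed [simp]: "wd w \<in> carrier T"
  unfolding word_def using lin_homD(1)[OF word_proj] by simp

lemma word_proj_eqI:
  assumes "f - g \<in> word_gens"
  shows "word_rel scale +>\<^bsub>free_space UNIV\<^esub> f = word_rel scale +>\<^bsub>free_space UNIV\<^esub> g"
proof -
  have "f - g \<in> word_rel scale"
    unfolding word_rel_eq using assms lin_span_superset[OF vs_free_space, of word_gens] by blast
  then have "word_rel scale +>\<^bsub>free_space UNIV\<^esub> (f - g) = \<zero>\<^bsub>T\<^esub>"
    using quot_proj_eq_zero_iff[OF vs_free_space submodule_word_rel, of "f - g"] by (simp add: tensor_words_def)
  then show ?thesis using lin_hom_free_diff_zero_iff[OF word_proj vsT, of f g] by simp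
qed

lemma multilin_wd: "multilin T wd"
  unfolding multilin_def
proof (intro conjI allI)
  note P = lin_homD[OF word_proj]
  fix us vs x y c
  have "word_rel scale +>\<^bsub>free_space UNIV\<^esub> gen (us @ (x + y) # vs) =
      word_rel scale +>\<^bsub>free_space UNIV\<^esub> (gen (us @ x # vs) + gen (us @ y # vs))"
    by (rule word_proj_eqI) (unfold word_gens_def diff_diff_eq[symmetric], blast)
  then show "wd (us @ (x + y) # vs) = wd (us @ x # vs) \<oplus>\<^bsub>T\<^esub> wd (us @ y # vs)"
    using P(2)[of "gen (us @ x # vs)" "gen (us @ y # vs)"] by (simp add: word_def)
  have "word_rel scale +>\<^bsub>free_space UNIV\<^esub> gen (us @ scale c x # vs) =
      word_rel scale +>\<^bsub>free_space UNIV\<^esub> Poly_Mapping.single (us @ x # vs) c"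
    by (rule word_proj_eqI) (unfold word_gens_def, blast)
  then show "wd (us @ scale c x # vs) = c \<odot>\<^bsub>T\<^esub> wd (us @ x # vs)"
    using P(3)[of "gen (us @ x # vs)" c] by (simp add: word_def)
qed simp

definition word_lift :: "('k, 'p, 'm) module_scheme \<Rightarrow> ('b list \<Rightarrow> 'p) \<Rightarrow> ('b list \<Rightarrow>\<^sub>0 'k) set \<Rightarrow> 'p" where
  "word_lift P F t = the_elem (lin_ext P F ` t)"

context
  fixes P :: "('k, 'p, 'm) module_scheme" and F
  assumes P: "vs P" and F: "multilin P F"
begin

private lemma Fc: "F w \<in> carrier P" using F by (simp add: multilin_def)
private lemma l: "lin_ext P F \<in> lin_hom (free_space UNIV) P" by (rule lin_ext_lin_hom[OF P Fc])
private lemma s: "lin_ext P F (Poly_Mapping.single w c) = c \<odot>\<^bsub>P\<^esub> F w" by (rule lin_ext_single[where g = F, OF P Fc])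
private lemma g: "lin_ext P F (gen w) = F w" using s[of w 1] Fc P by simp

private lemma z: "f \<in> word_rel scale \<Longrightarrow> lin_ext P F f = \<zero>\<^bsub>P\<^esub>"
proof -
  have "word_gens \<subseteq> {f \<in> carrier (free_space UNIV). lin_ext P F f = \<zero>\<^bsub>P\<^esub>}"
    using F lin_hom_free_diff_zero_iff[OF l P] lin_homD(2)[OF l]
    by (auto simp: word_gens_def diff_diff_eq s multilin_def P)
  from lin_span_least[OF vs_free_space submodule_kernel[OF vs_free_space P l] this]
  show "f \<in> word_rel scale \<Longrightarrow> lin_ext P F f = \<zero>\<^bsub>P\<^esub>" unfolding word_rel_eq by auto
qed

lemma word_lift_lin: "word_lift P F \<in> lin_hom T P"
  using quot_lift[OF vs_free_space submodule_word_rel P l z] by (simp add: word_lift_def[abs_def] tensor_words_def)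

lemma word_lift_wd [simp]: "word_lift P F (wd w) = F w"
  unfolding word_lift_def word_def using image_coset[OF vs_free_space submodule_word_rel P l z, of "gen w"] g by simp

end

lemma T_lin_eqI:
  assumes "vs P" "f \<in> lin_hom T P" "g \<in> lin_hom T P" "\<And>w. f (wd w) = g (wd w)" "t \<in> carrier T"
  shows "f t = g t"
  by (rule quot_free_lin_eqI[OF assms(1) submodule_word_rel])
     (use assms in \<open>auto simp: tensor_words_def word_def\<close>)

text \<open>A bilinear map out of words is given by one linear operator per word, depending
  multilinearly on the letters. Appending, concatenation and the product \<open>star\<close> are all
  defined in this way.\<close>

lemma word_op:
  assumes P: "vs P" and Q: "vs Q" and G: "\<And>w. G w \<in> lin_hom Q P" and m: "\<And>t. t \<in> carrier Q \<Longrightarrow> multilin P (\<lambda>w. G w t)"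
  shows "bilin T Q P (\<lambda>t s. word_lift P (\<lambda>w. G w s) t)"
proof (rule bilinI)
  show "(\<lambda>t. word_lift P (\<lambda>w. G w s) t) \<in> lin_hom T P" if "s \<in> carrier Q" for s
    by (rule word_lift_lin[OF P m[OF that]])
  show "(\<lambda>s. word_lift P (\<lambda>w. G w s) t) \<in> lin_hom Q P" if t: "t \<in> carrier T" for t
  proof (rule lin_homI)
    note W = word_lift_lin[OF P m]
    fix s assume s: "s \<in> carrier Q"
    show "word_lift P (\<lambda>w. G w s) t \<in> carrier P" by (rule lin_homD(1)[OF W[OF s] t])
    show "word_lift P (\<lambda>w. G w (s \<oplus>\<^bsub>Q\<^esub> s')) t = word_lift P (\<lambda>w. G w s) t \<oplus>\<^bsub>P\<^esub> word_lift P (\<lambda>w. G w s') t"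
      if s': "s' \<in> carrier Q" for s'
      by (rule T_lin_eqI[OF P W[OF vs_add_closed[OF Q s s']] lin_hom_sum[OF P W[OF s] W[OF s']] _ t])
         (unfold word_lift_wd[OF P m[OF s]] word_lift_wd[OF P m[OF s']] word_lift_wd[OF P m[OF vs_add_closed[OF Q s s']]],
          rule lin_homD(2)[OF G s s'])
    show "word_lift P (\<lambda>w. G w (c \<odot>\<^bsub>Q\<^esub> s)) t = c \<odot>\<^bsub>P\<^esub> word_lift P (\<lambda>w. G w s) t" for c
      by (rule T_lin_eqI[OF P W[OF vs_smult_closed[OF Q s]] lin_hom_smult'[OF P W[OF s]] _ t])
         (unfold word_lift_wd[OF P m[OF s]] word_lift_wd[OF P m[OF vs_smult_closed[OF Q s]]], rule lin_homD(3)[OF G s])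
  qed
qed

section \<open>Appending letters, and induction on the last letter\<close>

lemma multilin_append:
  assumes "multilin P F" shows "multilin P (\<lambda>w. F (us @ w @ ws))"
proof -
  have a: "F ((us @ as) @ (x + y) # (bs @ ws)) = F ((us @ as) @ x # bs @ ws) \<oplus>\<^bsub>P\<^esub> F ((us @ as) @ y # bs @ ws)"
    "F ((us @ as) @ scale c x # (bs @ ws)) = c \<odot>\<^bsub>P\<^esub> F ((us @ as) @ x # bs @ ws)" for as bs x y c
    using assms unfolding multilin_def by blast+
  show ?thesis using assms a by (simp add: multilin_def)
qed

definition snoc where
  "snoc t y = word_lift T (\<lambda>w. wd (w @ [y])) t"

lemma bilin_snoc: "bilin T V T snoc"
proof -
  have *: "multilin T (\<lambda>w. wd (w @ [y]))" for y
    using multilin_append[OF multilin_wd, of "[]" "[y]"] by simp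
  have "(\<lambda>y. wd (w @ [y])) \<in> lin_hom V T" for w
    using multilin_wd unfolding multilin_def by (intro lin_homI) auto
  then show ?thesis
    unfolding snoc_def using * by (intro word_op) auto
qed

lemma snoc_wd [simp]: "snoc (wd w) y = wd (w @ [y])"
  unfolding snoc_def using multilin_append[OF multilin_wd, of "[]" "[y]"] by simp

lemma wd_snoc: "wd (w @ [y]) = snoc (wd w) y" by simp

abbreviation (input) "one_T \<equiv> word scale []"

text \<open>Words are taken apart from the right because t \<succ> s y = (t * s) y acts at the last
  letter. The statement is for arbitrary t in T, with linearity reducing it to words.\<close>

lemma T_lin_induct:
  assumes "vs P" "f \<in> lin_hom T P" "g \<in> lin_hom T P" "f one_T = g one_T"
    "\<And>t y. t \<in> carrier T \<Longrightarrow> f t = g t \<Longrightarrow> f (snoc t y) = g (snoc t y)" "t \<in> carrier T"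
  shows "f t = g t"
proof (rule T_lin_eqI[OF assms(1-3) _ assms(6)])
  show "f (wd w) = g (wd w)" for w
    by (induction w rule: rev_induct) (use assms(4) assms(5)[OF wd_closed] in auto)
qed

lemma T_lin_cases:
  assumes "vs P" "f \<in> lin_hom T P" "g \<in> lin_hom T P" "f one_T = g one_T"
    "\<And>t y. t \<in> carrier T \<Longrightarrow> f (snoc t y) = g (snoc t y)" "t \<in> carrier T"
  shows "f t = g t"
  by (rule T_lin_induct[OF assms(1-4) _ assms(6)]) (rule assms(5))

text \<open>A linear map on words can be prescribed by its value on the empty word and bilinearly on \<open>w \<otimes> y\<close>.\<close>

definition snoc_lift where
  "snoc_lift P c H t = word_lift P (\<lambda>w. if w = [] then c else H (wd (butlast w)) (last w)) t"

context
  fixes P :: "('k, 'p, 'm) module_scheme" and c H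
  assumes P: "vs P" and c: "c \<in> carrier P" and H: "bilin T V P H"
begin

private lemma m: "multilin P (\<lambda>w. if w = [] then c else H (wd (butlast w)) (last w))"
  unfolding multilin_def
proof (intro conjI allI)
  note W = multilin_wd[unfolded multilin_def]
  note h = bilinD[OF H]
  show "(if w = [] then c else H (wd (butlast w)) (last w)) \<in> carrier P" for w
    using c h(1) by simp
  \<comment> \<open>The varied letter is either the last one, where \<open>H\<close> is linear in
    its second argument, or lies in the initial segment, where \<open>H\<close> is linear in its
    first.\<close>
  fix us vs x y and k
  show "(if us @ (x + y) # vs = [] then c else H (wd (butlast (us @ (x + y) # vs))) (last (us @ (x + y) # vs))) =
    (if us @ x # vs = [] then c else H (wd (butlast (us @ x # vs))) (last (us @ x # vs))) \<oplus>\<^bsub>P\<^esub>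
    (if us @ y # vs = [] then c else H (wd (butlast (us @ y # vs))) (last (us @ y # vs)))"
    by (cases vs rule: rev_cases) (use h(3)[of "wd us" x y] W h(2)[OF wd_closed wd_closed] in \<open>auto simp: butlast_append\<close>)
  show "(if us @ scale k x # vs = [] then c else H (wd (butlast (us @ scale k x # vs))) (last (us @ scale k x # vs))) =
    k \<odot>\<^bsub>P\<^esub> (if us @ x # vs = [] then c else H (wd (butlast (us @ x # vs))) (last (us @ x # vs)))"
    by (cases vs rule: rev_cases) (use h(5)[of "wd us" x k] W h(4)[OF wd_closed] in \<open>auto simp: butlast_append\<close>)
qed

lemma snoc_lift_lin: "snoc_lift P c H \<in> lin_hom T P"
  unfolding snoc_lift_def[abs_def] by (rule word_lift_lin[OF P m])

lemma snoc_lift_one: "snoc_lift P c H one_T = c"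
  unfolding snoc_lift_def using word_lift_wd[OF P m] by simp

lemma snoc_lift_snoc: "t \<in> carrier T \<Longrightarrow> snoc_lift P c H (snoc t y) = H t y"
proof -
  assume t: "t \<in> carrier T"
  have 1: "(\<lambda>t. snoc_lift P c H (snoc t y)) \<in> lin_hom T P"
    by (rule lin_hom_comp[OF snoc_lift_lin bilin_left[OF bilin_snoc _ lin_hom_id]]) simp
  have 2: "(\<lambda>t. H t y) \<in> lin_hom T P"
    by (rule bilin_left[OF H _ lin_hom_id]) simp
  show ?thesis
    by (rule T_lin_eqI[OF P 1 2 _ t]) (simp add: snoc_lift_def word_lift_wd[OF P m])
qed

end

subsection \<open>Deconcatenation\<close>

abbreviation (input) "\<Delta> \<equiv> deconcatenation scale"

definition decon :: "'b list \<Rightarrow> (('b list \<Rightarrow>\<^sub>0 'k) set \<times> ('b list \<Rightarrow>\<^sub>0 'k) set \<Rightarrow>\<^sub>0 'k) set" where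
  "decon w = (\<Oplus>\<^bsub>TT\<^esub>i\<in>{..length w}. pt (wd (take i w)) (wd (drop i w)))"

text \<open>Each cut leaves the varied letter in exactly one of the two factors, so every summand is
  linear in it.\<close>

lemma multilin_decon: "multilin TT decon"
  unfolding multilin_def
proof (intro conjI allI)
  note W = multilin_wd[unfolded multilin_def]
  note b = bilinD[OF bilin_pure[OF vsT vsT]]
  show "decon w \<in> carrier TT" for w
    unfolding decon_def by (rule vs_finsum_closed[OF vsTT]) simp
  fix us vs :: "'b list" and x y :: 'b and c
  define f where "f z i = pt (wd (take i (us @ z # vs))) (wd (drop i (us @ z # vs)))" for z i
  have d: "decon (us @ z # vs) = (\<Oplus>\<^bsub>TT\<^esub>i\<in>{..length us + Suc (length vs)}. f z i)" for z
    by (simp add: decon_def f_def)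
  have td: "i \<le> length us \<Longrightarrow> take i (us @ z # vs) = take i us" "i \<le> length us \<Longrightarrow> drop i (us @ z # vs) = drop i us @ z # vs"
    "length us < i \<Longrightarrow> take i (us @ z # vs) = us @ z # take (i - Suc (length us)) vs"
    "length us < i \<Longrightarrow> drop i (us @ z # vs) = drop (i - Suc (length us)) vs" for i z
    by (auto simp: take_Cons' drop_Cons')
  have fc: "f z i \<in> carrier TT" for z i by (simp add: f_def)
  have fa: "f (x + y) i = f x i \<oplus>\<^bsub>TT\<^esub> f y i" for i
    unfolding f_def by (rule le_less_linear[of i "length us", THEN disjE]) (simp_all only: td W b wd_closed)
  have fs: "f (scale c x) i = c \<odot>\<^bsub>TT\<^esub> f x i" for i
    unfolding f_def by (rule le_less_linear[of i "length us", THEN disjE]) (simp_all only: td W b wd_closed)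
  show "decon (us @ (x + y) # vs) = decon (us @ x # vs) \<oplus>\<^bsub>TT\<^esub> decon (us @ y # vs)"
    unfolding d fa by (rule vs_finsum_add[OF vsTT fc fc])
  show "decon (us @ scale c x # vs) = c \<odot>\<^bsub>TT\<^esub> decon (us @ x # vs)"
    unfolding d fs by (rule vs_finsum_smult[OF vsTT _ fc]) simp
qed

lemma deconcatenation_eq: "\<Delta> = word_lift TT decon"
  by (rule ext) (simp add: deconcatenation_def word_lift_def decon_def[abs_def] Let_def)

lemma decon_lin: "\<Delta> \<in> lin_hom T TT"
  unfolding deconcatenation_eq by (rule word_lift_lin[OF vsTT multilin_decon])

lemma decon_closed [simp]: "t \<in> carrier T \<Longrightarrow> \<Delta> t \<in> carrier TT"
  by (rule lin_homD(1)[OF decon_lin])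

lemma decon_wd: "\<Delta> (wd w) = (\<Oplus>\<^bsub>TT\<^esub>i\<in>{..length w}. pt (wd (take i w)) (wd (drop i w)))"
  unfolding deconcatenation_eq word_lift_wd[OF vsTT multilin_decon] decon_def ..

text \<open>\<open>Sw P \<beta> t\<close> is \<open>\<Sum> \<beta> t\<^sub>1 t\<^sub>2\<close> in Sweedler notation.\<close>

definition Sw where "Sw P \<beta> t = tensor_lift P \<beta> (\<Delta> t)"

lemma Sw_lin: "vs P \<Longrightarrow> bilin T T P \<beta> \<Longrightarrow> Sw P \<beta> \<in> lin_hom T P"
  unfolding Sw_def[abs_def] by (rule lin_hom_comp[OF tensor_lift_lin_hom[OF vsT vsT] decon_lin])

lemma Sw_closed: "vs P \<Longrightarrow> bilin T T P \<beta> \<Longrightarrow> t \<in> carrier T \<Longrightarrow> Sw P \<beta> t \<in> carrier P"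
  by (rule lin_homD(1)[OF Sw_lin])

lemma Sw_wd:
  assumes "vs P" "bilin T T P \<beta>"
  shows "Sw P \<beta> (wd w) = (\<Oplus>\<^bsub>P\<^esub>i\<in>{..length w}. \<beta> (wd (take i w)) (wd (drop i w)))"
  unfolding Sw_def decon_wd
  by (subst lin_hom_finsum[OF vsTT assms(1) tensor_lift_lin_hom[OF vsT vsT assms]])
     (simp_all add: tensor_lift_pure[OF vsT vsT assms])

lemma Sw_one: assumes "vs P" "bilin T T P \<beta>" shows "Sw P \<beta> one_T = \<beta> one_T one_T"
  using assms bilinD(1)[OF assms(2)] vs_finsum_singleton[OF assms(1), of "\<lambda>i. \<beta> (wd (take i [])) (wd (drop i []))" 0]
  by (simp add: Sw_wd)

lemma Sw_cong:
  assumes "\<And>u v. u \<in> carrier T \<Longrightarrow> v \<in> carrier T \<Longrightarrow> \<gamma> u v = \<beta> u v" "vs P" "bilin T T P \<beta>" "t \<in> carrier T"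
  shows "Sw P \<gamma> t = Sw P \<beta> t"
  unfolding Sw_def by (rule tensor_lift_cong[OF vsT vsT]) (use assms in auto)

lemma Sw_comp:
  assumes "vs P" "bilin T T P \<beta>" "vs Q" "f \<in> lin_hom P Q" "t \<in> carrier T"
  shows "f (Sw P \<beta> t) = Sw Q (\<lambda>u v. f (\<beta> u v)) t"
  unfolding Sw_def by (rule tensor_lift_comp[OF vsT vsT]) (use assms in auto)

lemma Sw_sum:
  assumes "vs P" "bilin T T P \<beta>" "bilin T T P \<gamma>" "t \<in> carrier T"
  shows "Sw P (\<lambda>u v. \<beta> u v \<oplus>\<^bsub>P\<^esub> \<gamma> u v) t = Sw P \<beta> t \<oplus>\<^bsub>P\<^esub> Sw P \<gamma> t"
  unfolding Sw_def by (rule tensor_lift_sum[OF vsT vsT]) (use assms in auto)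

lemma Sw_smult:
  assumes "vs P" "bilin T T P \<beta>" "t \<in> carrier T"
  shows "Sw P (\<lambda>u v. c \<odot>\<^bsub>P\<^esub> \<beta> u v) t = c \<odot>\<^bsub>P\<^esub> Sw P \<beta> t"
  unfolding Sw_def by (rule tensor_lift_smult[OF vsT vsT]) (use assms in auto)

lemma Sw_param:
  assumes "vs P" "vs Q" "\<And>q. q \<in> carrier Q \<Longrightarrow> bilin T T P (\<beta> q)"
    "\<And>x y. x \<in> carrier T \<Longrightarrow> y \<in> carrier T \<Longrightarrow> (\<lambda>q. \<beta> q x y) \<in> lin_hom Q P" "t \<in> carrier T"
  shows "(\<lambda>q. Sw P (\<beta> q) t) \<in> lin_hom Q P"
  unfolding Sw_def by (rule tensor_lift_param[OF vsT vsT]) (use assms in auto)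

lemma bilin_zero_map: "vs P \<Longrightarrow> bilin M N P (\<lambda>u v. \<zero>\<^bsub>P\<^esub>)"
  by (intro bilinI lin_hom_const_zero)

lemma Sw_zero: assumes "vs P" "t \<in> carrier T" shows "Sw P (\<lambda>u v. \<zero>\<^bsub>P\<^esub>) t = \<zero>\<^bsub>P\<^esub>"
  using Sw_smult[OF assms(1) bilin_zero_map[OF assms(1)] assms(2), of 0]
    Sw_closed[OF assms(1) bilin_zero_map[OF assms(1)] assms(2)] assms(1) by simp

text \<open>A cut of t y either leaves y at the end of the right factor or comes after y, with empty
  right factor. Sweedler identities on words are proved by this recursion.\<close>

lemma Sw_snoc:
  assumes P: "vs P" and b: "bilin T T P \<beta>" and t: "t \<in> carrier T"
  shows "Sw P \<beta> (snoc t y) = Sw P (\<lambda>u v. \<beta> u (snoc v y)) t \<oplus>\<^bsub>P\<^esub> \<beta> (snoc t y) one_T"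
proof -
  have s: "(\<lambda>t. snoc t y) \<in> lin_hom T T" by (rule bilin_left[OF bilin_snoc _ lin_hom_id]) simp
  have b': "bilin T T P (\<lambda>u v. \<beta> u (snoc v y))" by (rule bilin_arg[OF b lin_hom_id s])
  have 1: "(\<lambda>t. Sw P \<beta> (snoc t y)) \<in> lin_hom T P" by (rule lin_hom_comp[OF Sw_lin[OF P b] s])
  have 2: "(\<lambda>t. Sw P (\<lambda>u v. \<beta> u (snoc v y)) t \<oplus>\<^bsub>P\<^esub> \<beta> (snoc t y) one_T) \<in> lin_hom T P"
    by (intro lin_hom_sum[OF P Sw_lin[OF P b']] bilin_left[OF b _ s]) simp
  show ?thesis
  proof (rule T_lin_eqI[OF P 1 2 _ t])
    fix w
    note bc = bilinD(1)[OF b]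
    have "Sw P \<beta> (snoc (wd w) y) = (\<Oplus>\<^bsub>P\<^esub>i\<in>{..Suc (length w)}. \<beta> (wd (take i (w @ [y]))) (wd (drop i (w @ [y]))))"
      by (simp add: Sw_wd[OF P b])
    also have "\<dots> = \<beta> (wd (w @ [y])) one_T \<oplus>\<^bsub>P\<^esub> (\<Oplus>\<^bsub>P\<^esub>i\<in>{..length w}. \<beta> (wd (take i (w @ [y]))) (wd (drop i (w @ [y]))))"
      by (subst vs_finsum_Suc[OF P]) (simp_all add: bc)
    also have "(\<Oplus>\<^bsub>P\<^esub>i\<in>{..length w}. \<beta> (wd (take i (w @ [y]))) (wd (drop i (w @ [y])))) =
        (\<Oplus>\<^bsub>P\<^esub>i\<in>{..length w}. \<beta> (wd (take i w)) (snoc (wd (drop i w)) y))"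
      by (rule vs_finsum_cong[OF P refl]) (simp_all add: bc)
    also have "\<dots> = Sw P (\<lambda>u v. \<beta> u (snoc v y)) (wd w)" by (simp add: Sw_wd[OF P b'])
    finally show "Sw P \<beta> (snoc (wd w) y) = Sw P (\<lambda>u v. \<beta> u (snoc v y)) (wd w) \<oplus>\<^bsub>P\<^esub> \<beta> (snoc (wd w) y) one_T"
      using bc Sw_closed[OF P b' wd_closed] by (simp add: vs_comm[OF P])
  qed
qed

definition trilin where
  "trilin P F \<longleftrightarrow> (\<forall>u\<in>carrier T. bilin T T P (F u)) \<and> (\<forall>v\<in>carrier T. bilin T T P (\<lambda>u w. F u v w)) \<and>
     (\<forall>w\<in>carrier T. bilin T T P (\<lambda>u v. F u v w))"

lemma trilin_Sw:
  assumes P: "vs P" and F: "trilin P F"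
  shows "bilin T T P (\<lambda>u s. Sw P (F u) s)" "bilin T T P (\<lambda>s w. Sw P (\<lambda>u v. F u v w) s)"
proof -
  show "bilin T T P (\<lambda>u s. Sw P (F u) s)"
    by (rule bilinI, rule Sw_lin[OF P], use F in \<open>simp add: trilin_def\<close>, rule Sw_param[OF P vsT])
       (use F in \<open>auto simp: trilin_def bilin_def\<close>)
  show "bilin T T P (\<lambda>s w. Sw P (\<lambda>u v. F u v w) s)"
  proof (rule bilinI)
    show "(\<lambda>w. Sw P (\<lambda>u v. F u v w) s) \<in> lin_hom T P" if "s \<in> carrier T" for s
      by (rule Sw_param[OF P vsT _ _ that]) (use F in \<open>auto simp: trilin_def bilin_def\<close>)
    show "Sw P (\<lambda>u v. F u v w) \<in> lin_hom T P" if "w \<in> carrier T" for w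
      by (rule Sw_lin[OF P]) (use F that in \<open>simp add: trilin_def\<close>)
  qed
qed

text \<open>Both sides sum over two successive cuts. Adding a last letter y splits either sum into
  the same three cases: both cuts before y, one before and one after, both after.\<close>

lemma Sw_coassoc:
  assumes P: "vs P" and F: "trilin P F" and t: "t \<in> carrier T"
  shows "Sw P (\<lambda>u s. Sw P (F u) s) t = Sw P (\<lambda>s w. Sw P (\<lambda>u v. F u v w) s) t"
proof -
  have s: "(\<lambda>t. snoc t y) \<in> lin_hom T T" for y by (rule bilin_left[OF bilin_snoc _ lin_hom_id]) simp
  have "Sw P (\<lambda>u s. Sw P (F u) s) (wd w) = Sw P (\<lambda>s w. Sw P (\<lambda>u v. F u v w) s) (wd w)" if "trilin P F" for w F
    using that
  proof (induction w arbitrary: F rule: rev_induct)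
    case Nil
    note t = trilin_Sw[OF P Nil]
    show ?case using Nil by (simp add: Sw_one[OF P t(1)] Sw_one[OF P t(2)]) (simp add: trilin_def Sw_one[OF P])
  next
    case (snoc y w)
    let ?w = "wd w"
    have F: "u \<in> carrier T \<Longrightarrow> bilin T T P (F u)" "v \<in> carrier T \<Longrightarrow> bilin T T P (\<lambda>u w. F u v w)"
      "w \<in> carrier T \<Longrightarrow> bilin T T P (\<lambda>u v. F u v w)" for u v w
      using snoc.prems by (auto simp: trilin_def)
    have F': "trilin P (\<lambda>u v w. F u v (snoc w y))"
      unfolding trilin_def using F bilin_arg[OF F(1) lin_hom_id s] bilin_arg[OF F(2) lin_hom_id s] lin_homD(1)[OF s] by auto
    note tF = trilin_Sw[OF P snoc.prems] and tF' = trilin_Sw[OF P F']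
    have b1: "bilin T T P (\<lambda>u s. F u (snoc s y) one_T)" by (rule bilin_arg[OF F(3) lin_hom_id s]) simp
    note sc = lin_homD(1)[OF s]
    have "Sw P (\<lambda>u s. Sw P (F u) s) (snoc ?w y) = Sw P (\<lambda>u s. Sw P (F u) (snoc s y)) ?w \<oplus>\<^bsub>P\<^esub> Sw P (F (snoc ?w y)) one_T"
      by (rule Sw_snoc[OF P tF(1) wd_closed])
    also have "Sw P (F (snoc ?w y)) one_T = F (snoc ?w y) one_T one_T"
      by (rule Sw_one[OF P F(1)]) simp
    also have "Sw P (\<lambda>u s. Sw P (F u) (snoc s y)) ?w =
        Sw P (\<lambda>u s. Sw P (\<lambda>v w. F u v (snoc w y)) s \<oplus>\<^bsub>P\<^esub> F u (snoc s y) one_T) ?w"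
      by (rule Sw_cong[OF _ P bilin_sum[OF P tF'(1) b1] wd_closed]) (rule Sw_snoc[OF P F(1)])
    also have "\<dots> = Sw P (\<lambda>u s. Sw P (\<lambda>v w. F u v (snoc w y)) s) ?w \<oplus>\<^bsub>P\<^esub> Sw P (\<lambda>u s. F u (snoc s y) one_T) ?w"
      by (rule Sw_sum[OF P tF'(1) b1 wd_closed])
    also have "Sw P (\<lambda>u s. Sw P (\<lambda>v w. F u v (snoc w y)) s) ?w = Sw P (\<lambda>s w. Sw P (\<lambda>u v. F u v (snoc w y)) s) ?w"
      by (rule snoc.IH[OF F'])
    finally have l: "Sw P (\<lambda>u s. Sw P (F u) s) (snoc ?w y) =
        Sw P (\<lambda>s w. Sw P (\<lambda>u v. F u v (snoc w y)) s) ?w \<oplus>\<^bsub>P\<^esub> Sw P (\<lambda>u s. F u (snoc s y) one_T) ?w \<oplus>\<^bsub>P\<^esub> F (snoc ?w y) one_T one_T" .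
    have "Sw P (\<lambda>s w. Sw P (\<lambda>u v. F u v w) s) (snoc ?w y) =
        Sw P (\<lambda>s w. Sw P (\<lambda>u v. F u v (snoc w y)) s) ?w \<oplus>\<^bsub>P\<^esub> Sw P (\<lambda>u v. F u v one_T) (snoc ?w y)"
      by (rule Sw_snoc[OF P tF(2) wd_closed])
    also have "Sw P (\<lambda>u v. F u v one_T) (snoc ?w y) =
        Sw P (\<lambda>u s. F u (snoc s y) one_T) ?w \<oplus>\<^bsub>P\<^esub> F (snoc ?w y) one_T one_T"
      by (rule Sw_snoc[OF P F(3) wd_closed]) simp
    finally show ?case unfolding wd_snoc l
      using Sw_closed[OF P tF'(2) wd_closed] Sw_closed[OF P b1 wd_closed] bilinD(1)[OF F(1), of "snoc ?w y" one_T one_T] P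
      by (simp add: vs_assoc)
  qed
  from this[OF F] show ?thesis
    by (rule T_lin_eqI[OF P Sw_lin[OF P trilin_Sw(1)[OF P F]] Sw_lin[OF P trilin_Sw(2)[OF P F]] _ t])
qed

text \<open>The cuts of s and of t are independent. Replacing the two coproducts by arbitrary
  tensors makes the claim linear in each, so that the outer one may be taken pure.\<close>

lemma Sw_swap:
  assumes P: "vs P" and 1: "\<And>u v. u \<in> carrier T \<Longrightarrow> v \<in> carrier T \<Longrightarrow> bilin T T P (\<lambda>a b. K u v a b)"
    and 2: "\<And>a b. a \<in> carrier T \<Longrightarrow> b \<in> carrier T \<Longrightarrow> bilin T T P (\<lambda>u v. K u v a b)"
    and t: "t \<in> carrier T" and s: "s \<in> carrier T"
  shows "Sw P (\<lambda>u v. Sw P (\<lambda>a b. K u v a b) t) s = Sw P (\<lambda>a b. Sw P (\<lambda>u v. K u v a b) s) t"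
proof -
  have b1: "bilin T T P (\<lambda>u v. tensor_lift P (\<lambda>a b. K u v a b) t')" if "t' \<in> carrier TT" for t'
    by (rule bilinI; rule tensor_lift_param[OF vsT vsT P vsT]) (use 1 2 that in \<open>auto simp: bilin_def\<close>)
  have b2: "bilin T T P (\<lambda>a b. tensor_lift P (\<lambda>u v. K u v a b) s)" if "s \<in> carrier TT" for s
    by (rule bilinI; rule tensor_lift_param[OF vsT vsT P vsT]) (use 1 2 that in \<open>auto simp: bilin_def\<close>)
  have "tensor_lift P (\<lambda>u v. tensor_lift P (\<lambda>a b. K u v a b) t') s' = tensor_lift P (\<lambda>a b. tensor_lift P (\<lambda>u v. K u v a b) s') t'"
    if s': "s' \<in> carrier TT" and t': "t' \<in> carrier TT" for s' t'
  proof (rule tensor_lin_eqI[OF vsT vsT P tensor_lift_lin_hom[OF vsT vsT P b1[OF t']] _ _ s'])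
    show "(\<lambda>s. tensor_lift P (\<lambda>a b. tensor_lift P (\<lambda>u v. K u v a b) s) t') \<in> lin_hom TT P"
      by (rule tensor_lift_param[OF vsT vsT P vsTT b2 _ t'])
         (auto intro!: tensor_lift_lin_hom 2 P)
    fix u v assume u: "u \<in> carrier T" and v: "v \<in> carrier T"
    have "tensor_lift P (\<lambda>a b. tensor_lift P (\<lambda>u v. K u v a b) (pt u v)) t' = tensor_lift P (\<lambda>a b. K u v a b) t'"
      by (rule tensor_lift_cong[OF vsT vsT P 1[OF u v] _ t']) (rule tensor_lift_pure[OF vsT vsT P 2 u v])
    then show "tensor_lift P (\<lambda>u v. tensor_lift P (\<lambda>a b. K u v a b) t') (pt u v) =
        tensor_lift P (\<lambda>a b. tensor_lift P (\<lambda>u v. K u v a b) (pt u v)) t'"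
      using tensor_lift_pure[OF vsT vsT P b1[OF t'] u v] by simp
  qed
  then show ?thesis using s t by (simp add: Sw_def)
qed

section \<open>The counit of the tensor coalgebra\<close>

lemma multilin_counit: "multilin ground (\<lambda>w. if w = [] then 1 else 0)"
  by (simp add: multilin_def)

text \<open>The definition reads off a coefficient of a representative; as a lift of a multilinear
  function it is seen to be independent of the representative.\<close>

lemma word_counit_eq: "word_counit = word_lift ground (\<lambda>w :: 'b list. if w = [] then 1 else (0 :: 'k))"
proof -
  have "Poly_Mapping.lookup f [] = lin_ext ground (\<lambda>w. if w = [] then 1 else 0) f" for f :: "'b list \<Rightarrow>\<^sub>0 'k"
  proof (rule free_space_lin_eqI[OF vs_ground, where X = UNIV])
    show "(\<lambda>f. Poly_Mapping.lookup f []) \<in> lin_hom (free_space UNIV) (ground :: ('k, 'k) module)"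
      by (rule lin_homI) (auto simp: lookup_add)
    show "lin_ext ground (\<lambda>w. if w = [] then 1 else 0) \<in> lin_hom (free_space UNIV) (ground :: ('k, 'k) module)"
      by (rule lin_ext_lin_hom) auto
    show "Poly_Mapping.lookup (gen w) [] = lin_ext ground (\<lambda>w. if w = [] then 1 else 0) (gen w :: 'b list \<Rightarrow>\<^sub>0 'k)" for w
      by (subst lin_ext_single) (auto simp: lookup_single)
  qed simp
  then show ?thesis by (intro ext) (simp add: word_counit_def word_lift_def)
qed

lemma word_counit_lin: "word_counit \<in> lin_hom T ground"
  unfolding word_counit_eq by (rule word_lift_lin[OF vs_ground multilin_counit])

lemma word_counit_wd: "word_counit (wd w) = (if w = [] then 1 else 0)"
  unfolding word_counit_eq by (rule word_lift_wd[OF vs_ground multilin_counit])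

lemma word_counit_snoc [simp]: "t \<in> carrier T \<Longrightarrow> word_counit (snoc t y) = 0"
  by (rule T_lin_eqI[OF vs_ground lin_hom_comp[OF word_counit_lin bilin_left[OF bilin_snoc _ lin_hom_id]]])
     (auto simp: word_counit_wd intro!: lin_homI)

end

section \<open>The dendriform bialgebra on words in a brace algebra\<close>

context word_space
begin

subsection \<open>Auxiliary linear maps on words\<close>

lemma snoc_closed [simp]: "t \<in> carrier T \<Longrightarrow> snoc t y \<in> carrier T"
  by (rule bilinD(1)[OF bilin_snoc]) auto

lemma multilin_pointwise:
  assumes P: "vs P" and G: "\<And>w. G w \<in> lin_hom T P" and m: "\<And>v. multilin P (\<lambda>w. G w (wd v))" and t: "t \<in> carrier T"
  shows "multilin P (\<lambda>w. G w t)"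
  unfolding multilin_def
proof (intro conjI allI)
  show "G w t \<in> carrier P" for w by (rule lin_homD(1)[OF G t])
  fix us vs x y c
  show "G (us @ (x + y) # vs) t = G (us @ x # vs) t \<oplus>\<^bsub>P\<^esub> G (us @ y # vs) t"
    by (rule T_lin_eqI[OF P G lin_hom_sum[OF P G G] _ t]) (use m in \<open>simp add: multilin_def\<close>)
  show "G (us @ scale c x # vs) t = c \<odot>\<^bsub>P\<^esub> G (us @ x # vs) t"
    by (rule T_lin_eqI[OF P G lin_hom_smult'[OF P G] _ t]) (use m in \<open>simp add: multilin_def\<close>)
qed

definition conc where
  "conc t s = word_lift T (\<lambda>u. word_lift T (\<lambda>v. wd (u @ v)) s) t"

lemma bilin_conc: "bilin T T T conc"
proof -
  have r: "multilin T (\<lambda>v. wd (u @ v))" for u using multilin_append[OF multilin_wd, of u "[]"] by simp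
  have l: "multilin T (\<lambda>u. wd (u @ v))" for v using multilin_append[OF multilin_wd, of "[]" v] by simp
  have rl: "word_lift T (\<lambda>v. wd (u @ v)) \<in> lin_hom T T" for u by (rule word_lift_lin[OF vsT r])
  show ?thesis unfolding conc_def
    by (rule word_op[OF vsT vsT rl], rule multilin_pointwise[OF vsT rl]) (simp_all add: word_lift_wd[OF vsT r] l)
qed

lemma conc_wd: "conc (wd u) (wd v) = wd (u @ v)"
proof -
  have r: "multilin T (\<lambda>v. wd (u @ v))" for u using multilin_append[OF multilin_wd, of u "[]"] by simp
  have l: "multilin T (\<lambda>u. wd (u @ v))" for v using multilin_append[OF multilin_wd, of "[]" v] by simp
  show ?thesis unfolding conc_def
    by (subst word_lift_wd[OF vsT]) (simp_all add: word_lift_wd[OF vsT r] l)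
qed

lemma snoc_lin: "(\<lambda>t. snoc t y) \<in> lin_hom T T"
  by (rule bilin_left[OF bilin_snoc _ lin_hom_id]) simp

lemma conc_one [simp]: "t \<in> carrier T \<Longrightarrow> conc t one_T = t"
  by (rule T_lin_eqI[OF vsT bilin_left[OF bilin_conc wd_closed lin_hom_id] lin_hom_id]) (simp_all add: conc_wd)

lemma conc_snoc: assumes t: "t \<in> carrier T" and s: "s \<in> carrier T" shows "conc t (snoc s y) = snoc (conc t s) y"
proof (rule T_lin_eqI[OF vsT bilin_right[OF bilin_conc t snoc_lin] lin_hom_comp[OF snoc_lin bilin_right[OF bilin_conc t lin_hom_id]] _ s])
  show "conc t (snoc (wd w) y) = snoc (conc t (wd w)) y" for w
    by (rule T_lin_eqI[OF vsT bilin_left[OF bilin_conc _ lin_hom_id] lin_hom_comp[OF snoc_lin bilin_left[OF bilin_conc _ lin_hom_id]] _ t])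
       (simp_all add: conc_wd)
qed

lemma snoc_lift_param:
  assumes P: "vs P" and Q: "vs Q" and H: "\<And>q. q \<in> carrier Q \<Longrightarrow> bilin T V P (H q)"
    and l: "\<And>t y. t \<in> carrier T \<Longrightarrow> (\<lambda>q. H q t y) \<in> lin_hom Q P" and t: "t \<in> carrier T"
  shows "(\<lambda>q. snoc_lift P \<zero>\<^bsub>P\<^esub> (H q) t) \<in> lin_hom Q P"
proof (rule lin_homI)
  have z: "\<zero>\<^bsub>P\<^esub> \<in> carrier P" using P by simp
  note L = snoc_lift_lin[OF P z H] and S = snoc_lift_snoc[OF P z H] and O = snoc_lift_one[OF P z H]
  fix q assume q: "q \<in> carrier Q"
  show "snoc_lift P \<zero>\<^bsub>P\<^esub> (H q) t \<in> carrier P" by (rule lin_homD(1)[OF L[OF q] t])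
  show "snoc_lift P \<zero>\<^bsub>P\<^esub> (H (q \<oplus>\<^bsub>Q\<^esub> q')) t = snoc_lift P \<zero>\<^bsub>P\<^esub> (H q) t \<oplus>\<^bsub>P\<^esub> snoc_lift P \<zero>\<^bsub>P\<^esub> (H q') t"
    if q': "q' \<in> carrier Q" for q'
    by (rule T_lin_cases[OF P L[OF vs_add_closed[OF Q q q']] lin_hom_sum[OF P L[OF q] L[OF q']] _ _ t])
       (simp_all add: S[OF q] S[OF q'] S[OF vs_add_closed[OF Q q q']] O[OF q] O[OF q'] O[OF vs_add_closed[OF Q q q']]
          lin_homD(2)[OF l q q'] P)
  show "snoc_lift P \<zero>\<^bsub>P\<^esub> (H (c \<odot>\<^bsub>Q\<^esub> q)) t = c \<odot>\<^bsub>P\<^esub> snoc_lift P \<zero>\<^bsub>P\<^esub> (H q) t" for c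
    by (rule T_lin_cases[OF P L[OF vs_smult_closed[OF Q q]] lin_hom_smult'[OF P L[OF q]] _ _ t])
       (simp_all add: S[OF q] S[OF vs_smult_closed[OF Q q]] O[OF q] O[OF vs_smult_closed[OF Q q]] lin_homD(3)[OF l q] P)
qed

lemma Sw_arg: "vs P \<Longrightarrow> bilin T T P \<beta> \<Longrightarrow> f \<in> lin_hom Q T \<Longrightarrow> (\<lambda>q. Sw P \<beta> (f q)) \<in> lin_hom Q P"
  by (rule lin_hom_comp[OF Sw_lin])

lemma decon_Sw: assumes "t \<in> carrier T" shows "\<Delta> t = Sw TT pt t"
proof -
  note b = bilin_pure[OF vsT vsT]
  have "tensor_lift TT pt x = x" if "x \<in> carrier TT" for x
    using tensor_lift_unique[OF vsT vsT vsTT b lin_hom_id _ that] by simp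
  then show ?thesis using assms by (simp add: Sw_def)
qed

lemmas lin_T = bilinI lin_hom_id bilin_left[OF bilin_snoc] bilin_right[OF bilin_snoc]
  bilin_left[OF bilin_conc] bilin_right[OF bilin_conc]
  bilin_left[OF bilin_pure[OF vsT vsT]] bilin_right[OF bilin_pure[OF vsT vsT]]
  Sw_param Sw_arg lin_hom_sum[OF vsT] lin_hom_sum[OF vsTT] Sw_closed

end

lemma brace_args_snoc:
  "length Y = 2 * length xs + 1 \<Longrightarrow> brace_args br (xs @ [x]) (Y @ [v, w]) = brace_args br xs Y @ br x v # w"
proof (induction xs arbitrary: Y)
  case Nil
  then show ?case by (cases Y) auto
next
  case (Cons a xs)
  then obtain p q Y' where "Y = p # q # Y'" by (cases Y; cases "tl Y") auto
  then show ?case using Cons by simp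
qed

lemma finite_partitions: "finite {Y. length Y = m \<and> concat Y = ys}"
proof (rule finite_subset)
  let ?S = "{zs. set zs \<subseteq> set ys \<and> length zs \<le> length ys}"
  show "{Y. length Y = m \<and> concat Y = ys} \<subseteq> {Y. set Y \<subseteq> ?S \<and> length Y = m}"
    by (auto simp: length_concat intro!: member_le_sum_list)
  show "finite {Y. set Y \<subseteq> ?S \<and> length Y = m}"
    by (intro finite_lists_length_eq finite_lists_length_le) simp
qed

text \<open>Splitting off the last two intervals of a partition mirrors cutting \<open>ys\<close> at two places.\<close>

lemma sum_partitions_snoc:
  fixes F :: "'b list \<Rightarrow> 'c::comm_monoid_add"
  shows "(\<Sum>Y\<in>{Y. length Y = 2 * length (xs @ [x]) + 1 \<and> concat Y = ys}. F (brace_args br (xs @ [x]) Y)) =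
    (\<Sum>i\<le>length ys. \<Sum>j\<le>length (take i ys). \<Sum>Y\<in>{Y. length Y = 2 * length xs + 1 \<and> concat Y = take j (take i ys)}.
      F (brace_args br xs Y @ br x (drop j (take i ys)) # drop i ys))"
proof -
  let ?K = "\<lambda>i j. {Y. length Y = 2 * length xs + 1 \<and> concat Y = take j (take i ys)}"
  let ?G = "\<lambda>i j Y. F (brace_args br xs Y @ br x (drop j (take i ys)) # drop i ys)"
  have cut: "take j (take i ys) @ drop j (take i ys) @ drop i ys = ys" for i j
    by (metis append_assoc append_take_drop_id)
  have two: "\<exists>Y' v w. Y = Y' @ [v, w]" if "length Y = 2 * length (xs @ [x]) + 1" for Y :: "'b list list"
    using that by (cases Y rule: rev_cases; cases "butlast Y" rule: rev_cases) auto
  have "(\<Sum>i\<le>length ys. \<Sum>j\<le>length (take i ys). \<Sum>Y\<in>?K i j. ?G i j Y) =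
      (\<Sum>i\<le>length ys. \<Sum>(j, Y)\<in>Sigma {..length (take i ys)} (?K i). ?G i j Y)"
    by (intro sum.cong refl sum.Sigma) (auto simp: finite_partitions)
  also have "\<dots> = (\<Sum>(i, j, Y)\<in>Sigma {..length ys} (\<lambda>i. Sigma {..length (take i ys)} (?K i)). ?G i j Y)"
    by (subst sum.Sigma) (auto simp: finite_partitions case_prod_beta)
  also have "\<dots> = (\<Sum>Y\<in>{Y. length Y = 2 * length (xs @ [x]) + 1 \<and> concat Y = ys}. F (brace_args br (xs @ [x]) Y))"
  proof (rule sum.reindex_bij_witness[where
        i = "\<lambda>Y. (length (concat (butlast Y)), length (concat (butlast (butlast Y))), butlast (butlast Y))" and
        j = "\<lambda>(i, j, Y). Y @ [drop j (take i ys), drop i ys]"], goal_cases)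
    case (1 a)
    then show ?case by (auto simp: butlast_append)
  next
    case (2 a)
    then show ?case using cut by (auto simp del: take_take)
  next
    case (3 Y)
    then obtain Y' v w where "Y = Y' @ [v, w]" using two by blast
    then show ?case using 3 by (auto simp: butlast_append)
  next
    case (4 Y)
    then obtain Y' v w where "Y = Y' @ [v, w]" using two by blast
    then show ?case using 4 by (auto simp: butlast_append)
  qed (auto simp: brace_args_snoc)
  finally show ?thesis by simp
qed

sublocale brace_algebra \<subseteq> word_space scale ..

context brace_algebra
begin

declare brace_Nil [simp]

lemma multilin_brace: "multilin V (brace x)"
  by (simp add: multilin_def brace_add brace_scale)

text \<open>The brace {x | t} with its argument sequence extended linearly to T. It makes B a right
  module over the product of words, as \<open>ev_ev\<close> shows.\<close>

definition ev where "ev x t = word_lift V (brace x) t"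

lemma ev_wd [simp]: "ev x (wd ys) = brace x ys"
  unfolding ev_def by (rule word_lift_wd[OF vsV multilin_brace])

lemma bilin_ev: "bilin V T V ev"
proof (rule bilinI)
  have r: "(\<lambda>t. ev x t) \<in> lin_hom T V" for x unfolding ev_def by (rule word_lift_lin[OF vsV multilin_brace])
  then show "(\<lambda>t. ev x t) \<in> lin_hom T V" for x .
  show "(\<lambda>x. ev x t) \<in> lin_hom V V" if t: "t \<in> carrier T" for t
  proof (rule lin_homI)
    show "ev (x \<oplus>\<^bsub>V\<^esub> y) t = ev x t \<oplus>\<^bsub>V\<^esub> ev y t" for x y
      by (rule T_lin_eqI[OF vsV r lin_hom_sum[OF vsV r r] _ t]) (simp add: brace_add_left)
    show "ev (c \<odot>\<^bsub>V\<^esub> x) t = c \<odot>\<^bsub>V\<^esub> ev x t" for c x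
      by (rule T_lin_eqI[OF vsV r lin_hom_smult'[OF vsV r] _ t]) (simp add: brace_scale_left)
  qed simp
qed

lemmas lin_E = lin_T bilin_left[OF bilin_ev] bilin_right[OF bilin_ev]

subsection \<open>The product of words\<close>

text \<open>If a is left multiplication by t, then \<open>pre x a\<close> is s \<mapsto> (t x)
  \<prec> s and \<open>opr x a\<close> is s \<mapsto> (t x) * s. The recursion on the left word is
  phrased with operators because t is applied to every left part u of s, not to s alone.\<close>

definition pre where "pre x a s = Sw T (\<lambda>u v. snoc (a u) (ev x v)) s"
definition opr where "opr x a s = Sw T (\<lambda>u v. conc (pre x a u) v) s"

lemma pre_bilin: "a \<in> lin_hom T T \<Longrightarrow> bilin T T T (\<lambda>u v. snoc (a u) (ev x v))"
  by (intro lin_E) (auto dest: lin_homD(1))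

lemma pre_lin: "a \<in> lin_hom T T \<Longrightarrow> pre x a \<in> lin_hom T T"
  unfolding pre_def[abs_def] by (rule Sw_lin[OF vsT pre_bilin])

lemma opr_bilin: "a \<in> lin_hom T T \<Longrightarrow> bilin T T T (\<lambda>u v. conc (pre x a u) v)"
  by (rule bilin_arg[OF bilin_conc pre_lin lin_hom_id])

lemma opr_lin: "a \<in> lin_hom T T \<Longrightarrow> opr x a \<in> lin_hom T T"
  unfolding opr_def[abs_def] by (rule Sw_lin[OF vsT opr_bilin])

text \<open>\<open>pre\<close> and \<open>opr\<close> are bilinear in the letter and the operator; both slots are checked on sums at once.\<close>

lemma pre_opr_linear:
  assumes a: "a \<in> lin_hom T T" and b: "b \<in> lin_hom T T" and d: "d \<in> lin_hom T T" and s: "s \<in> carrier T"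
    and e: "\<And>u v. u \<in> carrier T \<Longrightarrow> v \<in> carrier T \<Longrightarrow>
      snoc (d u) (ev z v) = c \<odot>\<^bsub>T\<^esub> snoc (a u) (ev x v) \<oplus>\<^bsub>T\<^esub> c' \<odot>\<^bsub>T\<^esub> snoc (b u) (ev y v)"
  shows "opr z d s = c \<odot>\<^bsub>T\<^esub> opr x a s \<oplus>\<^bsub>T\<^esub> c' \<odot>\<^bsub>T\<^esub> opr y b s"
proof -
  note ba = bilin_smult[OF vsT pre_bilin[OF a], of c x] and bb = bilin_smult[OF vsT pre_bilin[OF b], of c' y]
  have p: "pre z d u = c \<odot>\<^bsub>T\<^esub> pre x a u \<oplus>\<^bsub>T\<^esub> c' \<odot>\<^bsub>T\<^esub> pre y b u" if "u \<in> carrier T" for u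
    unfolding pre_def
    by (subst Sw_cong[OF e vsT bilin_sum[OF vsT ba bb] that])
       (simp_all add: Sw_sum[OF vsT ba bb that] Sw_smult[OF vsT pre_bilin[OF a] that] Sw_smult[OF vsT pre_bilin[OF b] that])
  note oa = bilin_smult[OF vsT opr_bilin[OF a], of c x] and ob = bilin_smult[OF vsT opr_bilin[OF b], of c' y]
  note cb = bilinD[OF bilin_conc] and pc = lin_homD(1)[OF pre_lin[OF a]] lin_homD(1)[OF pre_lin[OF b]]
  have q: "conc (pre z d u) v = c \<odot>\<^bsub>T\<^esub> conc (pre x a u) v \<oplus>\<^bsub>T\<^esub> c' \<odot>\<^bsub>T\<^esub> conc (pre y b u) v"
    if "u \<in> carrier T" "v \<in> carrier T" for u v
    using that by (simp add: p cb pc)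
  show ?thesis unfolding opr_def
    by (subst Sw_cong[OF q vsT bilin_sum[OF vsT oa ob] s])
       (simp_all add: Sw_sum[OF vsT oa ob s] Sw_smult[OF vsT opr_bilin[OF a] s] Sw_smult[OF vsT opr_bilin[OF b] s])
qed

text \<open>Left multiplication by a word, given by its reversed list of letters: the recursion
  strips the last letter of the word first.\<close>

primrec act where
  "act [] = (\<lambda>s. s)"
| "act (x # r) = opr x (act r)"

lemma act_lin: "act r \<in> lin_hom T T"
  by (induction r) (simp_all add: opr_lin lin_hom_id)

lemma act_closed [simp]: "s \<in> carrier T \<Longrightarrow> act r s \<in> carrier T"
  by (rule lin_homD(1)[OF act_lin])

text \<open>A general linear combination in one slot covers additivity (c = c' = 1) and homogeneity
  (c' = 0) in a single induction.\<close>

lemma act_linear: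
  assumes "s \<in> carrier T"
  shows "act (us @ (scale c x + scale c' y) # ws) s = c \<odot>\<^bsub>T\<^esub> act (us @ x # ws) s \<oplus>\<^bsub>T\<^esub> c' \<odot>\<^bsub>T\<^esub> act (us @ y # ws) s"
  using assms
proof (induction us arbitrary: s)
  case Nil
  note e = bilinD[OF bilin_ev] and n = bilinD[OF bilin_snoc]
  have ee: "ev (scale c x + scale c' y) v = scale c (ev x v) + scale c' (ev y v)" if "v \<in> carrier T" for v
    using e(2)[of "scale c x" "scale c' y" v] e(4)[of x v c] e(4)[of y v c'] that by simp
  have nn: "snoc t (scale c p + scale c' q) = c \<odot>\<^bsub>T\<^esub> snoc t p \<oplus>\<^bsub>T\<^esub> c' \<odot>\<^bsub>T\<^esub> snoc t q" if "t \<in> carrier T" for t p q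
    using n(3)[of t "scale c p" "scale c' q"] n(5)[of t p c] n(5)[of t q c'] that by simp
  show ?case
    using pre_opr_linear[where z = "scale c x + scale c' y" and c = c and x = x and c' = c' and y = y
        and a = "act ws" and b = "act ws" and d = "act ws", OF act_lin act_lin act_lin Nil] by (simp add: ee nn)
next
  case (Cons u us)
  note n = bilinD[OF bilin_snoc]
  show ?case
    using pre_opr_linear[where z = u and x = u and y = u and c = c and c' = c' and d = "act (us @ (scale c x + scale c' y) # ws)"
        and a = "act (us @ x # ws)" and b = "act (us @ y # ws)", OF act_lin act_lin act_lin Cons.prems] Cons.IH
    by (simp add: n)
qed

lemma multilin_act: assumes s: "s \<in> carrier T" shows "multilin T (\<lambda>w. act (rev w) s)"
  unfolding multilin_def
proof (intro conjI allI)
  fix us vs x y c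
  show "act (rev w) s \<in> carrier T" for w using s by simp
  show "act (rev (us @ (x + y) # vs)) s = act (rev (us @ x # vs)) s \<oplus>\<^bsub>T\<^esub> act (rev (us @ y # vs)) s"
    using act_linear[OF s, of "rev vs" 1 x 1 y "rev us"] s by simp
  show "act (rev (us @ scale c x # vs)) s = c \<odot>\<^bsub>T\<^esub> act (rev (us @ x # vs)) s"
    using act_linear[OF s, of "rev vs" c x 0 x "rev us"] s by simp
qed

definition star where "star t s = word_lift T (\<lambda>w. act (rev w) s) t"

lemma bilin_star: "bilin T T T star"
  unfolding star_def by (rule word_op[OF vsT vsT act_lin multilin_act])

lemma star_closed [simp]: "t \<in> carrier T \<Longrightarrow> s \<in> carrier T \<Longrightarrow> star t s \<in> carrier T"
  by (rule bilinD(1)[OF bilin_star])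

lemma star_wd: "s \<in> carrier T \<Longrightarrow> star (wd w) s = act (rev w) s"
  unfolding star_def by (rule word_lift_wd[OF vsT multilin_act])

lemma star_one_left [simp]: "s \<in> carrier T \<Longrightarrow> star one_T s = s"
  by (simp add: star_wd)

lemmas lin_S = lin_E bilin_left[OF bilin_star] bilin_right[OF bilin_star]

section \<open>The two half-products of words\<close>

lemma star_lin: "t \<in> carrier T \<Longrightarrow> star t \<in> lin_hom T T"
  by (rule bilin_right[OF bilin_star _ lin_hom_id])

text \<open>With \<open>star\<close> available on all of T there is no further recursion: each
  half-product is given by its value at the empty word, 1 \<prec> s = 0 or t \<succ> 1 = 0, and by
  one formula at a last letter.\<close>

definition prec where "prec t s = snoc_lift T \<zero>\<^bsub>T\<^esub> (\<lambda>t x. Sw T (\<lambda>u v. snoc (star t u) (ev x v)) s) t"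
definition succ where "succ t s = snoc_lift T \<zero>\<^bsub>T\<^esub> (\<lambda>s y. snoc (star t s) y) s"

lemma prec_bilin1: "s \<in> carrier T \<Longrightarrow> bilin T V T (\<lambda>t x. Sw T (\<lambda>u v. snoc (star t u) (ev x v)) s)"
  by (intro lin_S) auto

lemma succ_bilin1: "t \<in> carrier T \<Longrightarrow> bilin T V T (\<lambda>s y. snoc (star t s) y)"
  by (intro lin_S) auto

lemma bilin_prec: "bilin T T T prec"
  unfolding prec_def
proof (rule bilinI)
  show "(\<lambda>s. snoc_lift T \<zero>\<^bsub>T\<^esub> (\<lambda>t x. Sw T (\<lambda>u v. snoc (star t u) (ev x v)) s) t) \<in> lin_hom T T" if "t \<in> carrier T" for t
    by (rule snoc_lift_param[OF vsT vsT prec_bilin1 _ that], assumption, (intro lin_S; auto))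
  show "(\<lambda>t. snoc_lift T \<zero>\<^bsub>T\<^esub> (\<lambda>t x. Sw T (\<lambda>u v. snoc (star t u) (ev x v)) s) t) \<in> lin_hom T T" if "s \<in> carrier T" for s
    by (rule snoc_lift_lin[OF vsT _ prec_bilin1[OF that]]) simp
qed

lemma bilin_succ: "bilin T T T succ"
  unfolding succ_def
proof (rule bilinI)
  show "(\<lambda>t. snoc_lift T \<zero>\<^bsub>T\<^esub> (\<lambda>s y. snoc (star t s) y) s) \<in> lin_hom T T" if "s \<in> carrier T" for s
    by (rule snoc_lift_param[OF vsT vsT succ_bilin1 _ that], assumption, (intro lin_S; auto))
  show "(\<lambda>s. snoc_lift T \<zero>\<^bsub>T\<^esub> (\<lambda>s y. snoc (star t s) y) s) \<in> lin_hom T T" if "t \<in> carrier T" for t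
    by (rule snoc_lift_lin[OF vsT _ succ_bilin1[OF that]]) simp
qed

lemmas lin_A = lin_S bilin_left[OF bilin_prec] bilin_right[OF bilin_prec] bilin_left[OF bilin_succ] bilin_right[OF bilin_succ]

lemma prec_closed [simp]: "t \<in> carrier T \<Longrightarrow> s \<in> carrier T \<Longrightarrow> prec t s \<in> carrier T"
  by (rule bilinD(1)[OF bilin_prec])

lemma succ_closed [simp]: "t \<in> carrier T \<Longrightarrow> s \<in> carrier T \<Longrightarrow> succ t s \<in> carrier T"
  by (rule bilinD(1)[OF bilin_succ])

lemma prec_one_left [simp]: "s \<in> carrier T \<Longrightarrow> prec one_T s = \<zero>\<^bsub>T\<^esub>"
  unfolding prec_def by (rule snoc_lift_one[OF vsT _ prec_bilin1]) auto

lemma prec_snoc: "t \<in> carrier T \<Longrightarrow> s \<in> carrier T \<Longrightarrow> prec (snoc t x) s = Sw T (\<lambda>u v. snoc (star t u) (ev x v)) s"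
  unfolding prec_def by (rule snoc_lift_snoc[OF vsT _ prec_bilin1]) auto

lemma succ_one_right [simp]: "t \<in> carrier T \<Longrightarrow> succ t one_T = \<zero>\<^bsub>T\<^esub>"
  unfolding succ_def by (rule snoc_lift_one[OF vsT _ succ_bilin1]) auto

lemma succ_snoc: "t \<in> carrier T \<Longrightarrow> s \<in> carrier T \<Longrightarrow> succ t (snoc s y) = snoc (star t s) y"
  unfolding succ_def by (rule snoc_lift_snoc[OF vsT _ succ_bilin1]) auto

text \<open>The last brace takes its arguments from an initial part of s; the letters behind them
  are appended unchanged. They form the final interval of the brace identity.\<close>

lemma star_snoc:
  assumes t: "t \<in> carrier T" and s: "s \<in> carrier T"
  shows "star (snoc t x) s = Sw T (\<lambda>u v. conc (prec (snoc t x) u) v) s"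
proof (rule T_lin_eqI[OF vsT _ _ _ t])
  show "(\<lambda>t. star (snoc t x) s) \<in> lin_hom T T" using s by (intro lin_A) auto
  show "(\<lambda>t. Sw T (\<lambda>u v. conc (prec (snoc t x) u) v) s) \<in> lin_hom T T" using s by (intro lin_A) auto
  fix w
  have p: "prec (snoc (wd w) x) u = pre x (act (rev w)) u" if u: "u \<in> carrier T" for u
  proof -
    have "prec (snoc (wd w) x) u = Sw T (\<lambda>u v. snoc (star (wd w) u) (ev x v)) u" by (rule prec_snoc[OF wd_closed u])
    also have "\<dots> = pre x (act (rev w)) u" unfolding pre_def
      by (rule Sw_cong[OF _ vsT pre_bilin[OF act_lin] u]) (simp add: star_wd)
    finally show ?thesis .
  qed
  have "star (snoc (wd w) x) s = opr x (act (rev w)) s" using s by (simp add: star_wd)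
  also have "\<dots> = Sw T (\<lambda>u v. conc (prec (snoc (wd w) x) u) v) s"
    unfolding opr_def by (rule Sw_cong[symmetric, OF _ vsT opr_bilin[OF act_lin] s]) (simp only: p)
  finally show "star (snoc (wd w) x) s = Sw T (\<lambda>u v. conc (prec (snoc (wd w) x) u) v) s" .
qed

text \<open>In the sum of \<open>star_snoc\<close> over cuts of s y, the cut with empty right part
  gives the \<prec> term; in all others y is the final letter and factors out.\<close>

lemma star_snoc_snoc:
  assumes t: "t \<in> carrier T" and s: "s \<in> carrier T"
  shows "star (snoc t x) (snoc s y) = prec (snoc t x) (snoc s y) \<oplus>\<^bsub>T\<^esub> snoc (star (snoc t x) s) y"
proof -
  have b: "bilin T T T (\<lambda>u v. conc (prec (snoc t x) u) v)" using t by (intro lin_A) auto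
  have "star (snoc t x) (snoc s y) = Sw T (\<lambda>u v. conc (prec (snoc t x) u) (snoc v y)) s \<oplus>\<^bsub>T\<^esub> prec (snoc t x) (snoc s y)"
    using t s by (simp add: star_snoc Sw_snoc[OF vsT b s])
  also have "Sw T (\<lambda>u v. conc (prec (snoc t x) u) (snoc v y)) s = snoc (star (snoc t x) s) y"
    unfolding star_snoc[OF t s] Sw_comp[OF vsT b vsT snoc_lin s]
    by (rule Sw_cong[OF _ vsT bilin_comp[OF b snoc_lin] s]) (use t in \<open>simp add: conc_snoc\<close>)
  finally show ?thesis using t s by (simp add: vs_comm[OF vsT])
qed

lemma star_one_right [simp]: "t \<in> carrier T \<Longrightarrow> star t one_T = t"
proof (rule T_lin_induct[OF vsT bilin_left[OF bilin_star _ lin_hom_id] lin_hom_id])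
  fix t x assume t: "t \<in> carrier T" "star t one_T = t"
  have b: "bilin T T T (\<lambda>u v. conc (prec (snoc t x) u) v)" "bilin T T T (\<lambda>u v. snoc (star t u) (ev x v))"
    using t(1) by (intro lin_A; auto)+
  show "star (snoc t x) one_T = snoc t x"
    using t by (simp add: star_snoc Sw_one[OF vsT b(1)] prec_snoc Sw_one[OF vsT b(2)])
qed auto

abbreviation (input) "counit_T \<equiv> word_counit :: ('b list \<Rightarrow>\<^sub>0 'k) set \<Rightarrow> 'k"

lemma counit_one_T [simp]: "word_counit one_T = (1 :: 'k)"
  by (simp add: word_counit_wd)

lemma prec_one_right: assumes t: "t \<in> carrier T" shows "prec t one_T = t \<oplus>\<^bsub>T\<^esub> (- counit_T t) \<odot>\<^bsub>T\<^esub> one_T"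
proof (rule T_lin_cases[OF vsT _ _ _ _ t])
  show "(\<lambda>t. prec t one_T) \<in> lin_hom T T" by (intro lin_A) auto
  show "(\<lambda>t. t \<oplus>\<^bsub>T\<^esub> (- counit_T t) \<odot>\<^bsub>T\<^esub> one_T) \<in> lin_hom T T"
    using lin_hom_sum[OF vsT lin_hom_id lin_hom_smult_left[OF vsT lin_hom_ground_mult(2)[OF word_counit_lin] wd_closed], of "- 1" "[]"] by simp
  fix t y assume t: "t \<in> carrier T"
  have b: "bilin T T T (\<lambda>u v. snoc (star t u) (ev y v))" using t by (intro lin_A) auto
  show "prec (snoc t y) one_T = snoc t y \<oplus>\<^bsub>T\<^esub> (- counit_T (snoc t y)) \<odot>\<^bsub>T\<^esub> one_T"
    using t by (simp add: prec_snoc Sw_one[OF vsT b])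
qed simp

lemma one_succ_T: assumes t: "t \<in> carrier T" shows "succ one_T t = t \<oplus>\<^bsub>T\<^esub> (- counit_T t) \<odot>\<^bsub>T\<^esub> one_T"
proof (rule T_lin_cases[OF vsT _ _ _ _ t])
  show "(\<lambda>t. succ one_T t) \<in> lin_hom T T" by (intro lin_A) auto
  show "(\<lambda>t. t \<oplus>\<^bsub>T\<^esub> (- counit_T t) \<odot>\<^bsub>T\<^esub> one_T) \<in> lin_hom T T"
    using lin_hom_sum[OF vsT lin_hom_id lin_hom_smult_left[OF vsT lin_hom_ground_mult(2)[OF word_counit_lin] wd_closed], of "- 1" "[]"] by simp
qed (auto simp: succ_snoc)

text \<open>For two nonempty words this is \<open>star_snoc_snoc\<close>; on words the counit term
  is present only when both are empty.\<close>

lemma star_eq_T: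
  assumes t: "t \<in> carrier T" and s: "s \<in> carrier T"
  shows "star t s = prec t s \<oplus>\<^bsub>T\<^esub> succ t s \<oplus>\<^bsub>T\<^esub> (counit_T t * counit_T s) \<odot>\<^bsub>T\<^esub> one_T"
proof (rule T_lin_cases[OF vsT _ _ _ _ t])
  have c: "bilin T T T (\<lambda>t s. (counit_T t * counit_T s) \<odot>\<^bsub>T\<^esub> one_T)"
    by (intro bilinI lin_hom_smult_left[OF vsT] lin_hom_ground_mult word_counit_lin wd_closed)
  have all: "bilin T T T (\<lambda>t s. prec t s \<oplus>\<^bsub>T\<^esub> succ t s \<oplus>\<^bsub>T\<^esub> (counit_T t * counit_T s) \<odot>\<^bsub>T\<^esub> one_T)"
    by (intro bilin_sum[OF vsT] bilin_prec bilin_succ c)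
  show "(\<lambda>t. star t s) \<in> lin_hom T T" using s by (intro lin_A) auto
  show "(\<lambda>t. prec t s \<oplus>\<^bsub>T\<^esub> succ t s \<oplus>\<^bsub>T\<^esub> (counit_T t * counit_T s) \<odot>\<^bsub>T\<^esub> one_T) \<in> lin_hom T T"
    using bilin_left[OF all s lin_hom_id] .
  show "star one_T s = prec one_T s \<oplus>\<^bsub>T\<^esub> succ one_T s \<oplus>\<^bsub>T\<^esub> (counit_T one_T * counit_T s) \<odot>\<^bsub>T\<^esub> one_T"
    using s by (simp add: one_succ_T vs_assoc[OF vsT])
  fix t x assume t: "t \<in> carrier T"
  show "star (snoc t x) s = prec (snoc t x) s \<oplus>\<^bsub>T\<^esub> succ (snoc t x) s \<oplus>\<^bsub>T\<^esub> (counit_T (snoc t x) * counit_T s) \<odot>\<^bsub>T\<^esub> one_T"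
    by (rule T_lin_cases[OF vsT star_lin bilin_right[OF all _ lin_hom_id] _ _ s])
       (use t in \<open>simp_all add: prec_one_right star_snoc_snoc succ_snoc\<close>)
qed

subsection \<open>The brace identity\<close>

lemma finsum_V: "finite A \<Longrightarrow> finsum V f A = sum f A"
  by (induction A rule: finite_induct) (simp_all add: vs_finsum_empty[OF vsV] vs_finsum_insert[OF vsV])

text \<open>Unwinding \<open>star_snoc\<close> and then \<open>prec_snoc\<close> at the last letter
  x cuts ys twice, which produces the interval inside {x | ...} and the final interval. The linear
  map f moves the sum into B, and the induction needs it general: it is replaced by f after
  appending that brace and that interval.\<close>

lemma star_closed_form:
  assumes "f \<in> lin_hom T V"
  shows "f (star (wd xs) (wd ys)) = (\<Sum>Y\<in>{Y. length Y = 2 * length xs + 1 \<and> concat Y = ys}. f (wd (brace_args brace xs Y)))"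
  using assms
proof (induction xs arbitrary: ys f rule: rev_induct)
  case Nil
  have "{Y. length Y = 1 \<and> concat Y = ys} = {[ys]}"
    by (auto simp: length_Suc_conv)
  then show ?case by simp
next
  case (snoc x xs)
  note f = snoc.prems
  have b1: "bilin T T T (\<lambda>u v. conc (prec (snoc (wd xs) x) u) v)" by (intro lin_A) auto
  have b2: "bilin T T T (\<lambda>u v. snoc (star (wd xs) u) (ev x v))" by (intro lin_A) auto
  have f1: "(\<lambda>t. f (conc t (wd w))) \<in> lin_hom T V" for w
    by (rule lin_hom_comp[OF f bilin_left[OF bilin_conc _ lin_hom_id]]) simp
  have f2: "(\<lambda>t. f (conc (snoc t b) (wd w))) \<in> lin_hom T V" for b w
    by (rule lin_hom_comp[OF f bilin_left[OF bilin_conc _ snoc_lin]]) simp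
  have inner: "f (conc (prec (snoc (wd xs) x) (wd z)) (wd w)) =
      (\<Sum>j\<le>length z. f (conc (snoc (star (wd xs) (wd (take j z))) (brace x (drop j z))) (wd w)))" for z w
    by (simp only: prec_snoc[OF wd_closed wd_closed] Sw_comp[OF vsT b2 vsV f1 wd_closed] Sw_wd[OF vsV bilin_comp[OF b2 f1]]
        finsum_V[OF finite_atMost] ev_wd)
  have "f (star (wd (xs @ [x])) (wd ys)) = f (Sw T (\<lambda>u v. conc (prec (snoc (wd xs) x) u) v) (wd ys))"
    using star_snoc[of "wd xs" "wd ys" x] by simp
  also have "\<dots> = (\<Sum>i\<le>length ys. f (conc (prec (snoc (wd xs) x) (wd (take i ys))) (wd (drop i ys))))"
    by (simp only: Sw_comp[OF vsT b1 vsV f wd_closed] Sw_wd[OF vsV bilin_comp[OF b1 f]] finsum_V[OF finite_atMost])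
  also have "\<dots> = (\<Sum>i\<le>length ys. \<Sum>j\<le>length (take i ys). \<Sum>Y\<in>{Y. length Y = 2 * length xs + 1 \<and> concat Y = take j (take i ys)}.
      f (wd (brace_args brace xs Y @ brace x (drop j (take i ys)) # drop i ys)))"
    by (simp only: inner snoc.IH[OF f2]) (simp add: conc_wd)
  also note sum_partitions_snoc[symmetric, where F = "\<lambda>l. f (wd l)" and br = brace]
  finally show ?case .
qed

text \<open>By the closed form of \<open>star\<close> this is exactly the brace identity on words,
  and it is the only point at which that identity enters.\<close>

lemma ev_ev:
  assumes s: "s \<in> carrier T" and t: "t \<in> carrier T"
  shows "ev (ev z s) t = ev z (star s t)"
proof (rule T_lin_eqI[OF vsV _ _ _ s])
  show "(\<lambda>s. ev (ev z s) t) \<in> lin_hom T V" using t by (intro lin_A) auto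
  show "(\<lambda>s. ev z (star s t)) \<in> lin_hom T V" using t by (intro lin_A) auto
  fix xs
  have evl: "ev z \<in> lin_hom T V" for z by (rule bilin_right[OF bilin_ev _ lin_hom_id]) simp
  show "ev (ev z (wd xs)) t = ev z (star (wd xs) t)"
  proof (rule T_lin_eqI[OF vsV evl lin_hom_comp[OF evl star_lin] _ t])
    show "ev (ev z (wd xs)) (wd ys) = ev z (star (wd xs) (wd ys))" for ys
      using star_closed_form[OF evl, of z xs ys] brace_brace[of xs ys z] by (cases "xs = []"; cases "ys = []") auto
  qed simp
qed

subsection \<open>Multiplicativity of deconcatenation\<close>

text \<open>The sum of (t1 * s1) \<otimes> g t2 s2 over cuts of t and of s, as in the bialgebra
  axioms.\<close>

definition SS where
  "SS g t s = Sw TT (\<lambda>a b. Sw TT (\<lambda>a' b'. pt (star a a') (g b b')) s) t"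

lemma SS_inner:
  assumes "bilin T T T g"
  shows "a \<in> carrier T \<Longrightarrow> b \<in> carrier T \<Longrightarrow> bilin T T TT (\<lambda>a' b'. pt (star a a') (g b b'))"
    and "a' \<in> carrier T \<Longrightarrow> b' \<in> carrier T \<Longrightarrow> bilin T T TT (\<lambda>a b. pt (star a a') (g b b'))"
    and "s \<in> carrier T \<Longrightarrow> bilin T T TT (\<lambda>a b. Sw TT (\<lambda>a' b'. pt (star a a') (g b b')) s)"
proof -
  note L = lin_A bilin_left[OF assms] bilin_right[OF assms]
  show "a \<in> carrier T \<Longrightarrow> b \<in> carrier T \<Longrightarrow> bilin T T TT (\<lambda>a' b'. pt (star a a') (g b b'))"
    "a' \<in> carrier T \<Longrightarrow> b' \<in> carrier T \<Longrightarrow> bilin T T TT (\<lambda>a b. pt (star a a') (g b b'))"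
    "s \<in> carrier T \<Longrightarrow> bilin T T TT (\<lambda>a b. Sw TT (\<lambda>a' b'. pt (star a a') (g b b')) s)"
    using bilinD(1)[OF assms] by (intro L; auto)+
qed

lemma SS_bilin: assumes "bilin T T T g" shows "bilin T T TT (SS g)"
  unfolding SS_def
proof (rule bilinI)
  show "(\<lambda>t. Sw TT (\<lambda>a b. Sw TT (\<lambda>a' b'. pt (star a a') (g b b')) s) t) \<in> lin_hom T TT" if "s \<in> carrier T" for s
    by (rule Sw_lin[OF vsTT SS_inner(3)[OF assms that]])
  show "(\<lambda>s. Sw TT (\<lambda>a b. Sw TT (\<lambda>a' b'. pt (star a a') (g b b')) s) t) \<in> lin_hom T TT" if "t \<in> carrier T" for t
    by (rule Sw_param[OF vsTT vsT SS_inner(3)[OF assms] _ that]) (auto intro: Sw_lin[OF vsTT SS_inner(1)[OF assms]])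
qed

lemma decon_snoc: "t \<in> carrier T \<Longrightarrow> \<Delta> (snoc t y) = Sw TT (\<lambda>u v. pt u (snoc v y)) t \<oplus>\<^bsub>TT\<^esub> pt (snoc t y) one_T"
  using Sw_snoc[OF vsTT bilin_pure[OF vsT vsT]] by (simp add: decon_Sw)

text \<open>A sum over cuts of t * s becomes a double sum over cuts of t and of s. Multiplicativity
  is assumed at this one pair only, so that the rule can serve inside the induction that proves
  it.\<close>

lemma SS_Sw:
  assumes P: "vs P" and \<beta>: "bilin T T P \<beta>" and t: "t \<in> carrier T" and s: "s \<in> carrier T"
    and D: "\<Delta> (star t s) = SS star t s"
  shows "Sw P \<beta> (star t s) = Sw P (\<lambda>a b. Sw P (\<lambda>a' b'. \<beta> (star a a') (star b b')) s) t"
proof -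
  note l = tensor_lift_lin_hom[OF vsT vsT P \<beta>]
  note b = SS_inner[OF bilin_star]
  have "Sw P \<beta> (star t s) = tensor_lift P \<beta> (SS star t s)" by (simp add: Sw_def D)
  also have "\<dots> = Sw P (\<lambda>a b. tensor_lift P \<beta> (Sw TT (\<lambda>a' b'. pt (star a a') (star b b')) s)) t"
    unfolding SS_def by (rule Sw_comp[OF vsTT b(3)[OF s] P l t])
  also have "\<dots> = Sw P (\<lambda>a b. Sw P (\<lambda>a' b'. \<beta> (star a a') (star b b')) s) t"
  proof (rule Sw_cong[symmetric, OF _ P bilin_comp[OF b(3)[OF s] l] t])
    fix a b assume a: "a \<in> carrier T" and b': "b \<in> carrier T"
    show "Sw P (\<lambda>a' b'. \<beta> (star a a') (star b b')) s = tensor_lift P \<beta> (Sw TT (\<lambda>a' b'. pt (star a a') (star b b')) s)"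
      unfolding Sw_comp[OF vsTT b(1)[OF a b'] P l s]
      by (rule Sw_cong[OF _ P bilin_comp[OF b(1)[OF a b'] l] s]) (use a b' in \<open>simp add: tensor_lift_pure[OF vsT vsT P \<beta>]\<close>)
  qed
  finally show ?thesis .
qed

lemma decon_one [simp]: "\<Delta> one_T = pt one_T one_T"
  using Sw_one[OF vsTT bilin_pure[OF vsT vsT]] by (simp add: decon_Sw)

lemma pt_zero_right [simp]: "a \<in> carrier T \<Longrightarrow> pt a \<zero>\<^bsub>T\<^esub> = \<zero>\<^bsub>TT\<^esub>"
  by (rule bilin_zero(2)[OF bilin_pure[OF vsT vsT] vsT vsT vsTT])

lemma pt_zero_left [simp]: "a \<in> carrier T \<Longrightarrow> pt \<zero>\<^bsub>T\<^esub> a = \<zero>\<^bsub>TT\<^esub>"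
  by (rule bilin_zero(1)[OF bilin_pure[OF vsT vsT] vsT vsT vsTT])

lemma decon_zero [simp]: "\<Delta> \<zero>\<^bsub>T\<^esub> = \<zero>\<^bsub>TT\<^esub>"
  by (rule lin_hom_zero[OF vsT vsTT decon_lin])

text \<open>In (t * s) y the letter y ends the second factor at every cut before it, so the formula
  at s y follows from multiplicativity at t and s. The guard on \<open>D\<close> lets the same
  statement cover the empty word.\<close>

lemma decon_succ:
  assumes t: "t \<in> carrier T" and s: "s \<in> carrier T"
    and D: "s' = snoc s y \<Longrightarrow> \<Delta> (star t s) = SS star t s" and s': "s' = one_T \<or> s' = snoc s y"
  shows "\<Delta> (succ t s') = SS succ t s' \<oplus>\<^bsub>TT\<^esub> pt (succ t s') one_T"
proof (cases "s' = one_T")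
  case True
  have "SS succ t one_T = Sw TT (\<lambda>a b. \<zero>\<^bsub>TT\<^esub>) t"
    unfolding SS_def by (rule Sw_cong[OF _ vsTT bilin_zero_map[OF vsTT] t]) (simp add: Sw_one[OF vsTT SS_inner(1)[OF bilin_succ]])
  then show ?thesis using True t by (simp add: Sw_zero[OF vsTT])
next
  case False
  then have s': "s' = snoc s y" using assms by blast
  have sy: "snoc s y \<in> carrier T" using s by simp
  have bp: "bilin T T TT (\<lambda>u v. pt u (snoc v y))" by (rule bilin_arg[OF bilin_pure[OF vsT vsT] lin_hom_id snoc_lin])
  have b3: "bilin T T TT (\<lambda>a b. Sw TT (\<lambda>a' b'. pt (star a a') (snoc (star b b') y)) s)" using s by (intro lin_A) auto
  have b1: "bilin T T TT (\<lambda>a' b'. pt (star a a') (snoc (star b b') y))" if "a \<in> carrier T" "b \<in> carrier T" for a b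
    using that by (intro lin_A) auto
  have "SS succ t (snoc s y) = Sw TT (\<lambda>a b. Sw TT (\<lambda>a' b'. pt (star a a') (snoc (star b b') y)) s) t"
    unfolding SS_def
  proof (rule Sw_cong[OF _ vsTT b3 t])
    fix a b assume a: "a \<in> carrier T" and b: "b \<in> carrier T"
    have "Sw TT (\<lambda>a' b'. pt (star a a') (succ b b')) (snoc s y) =
        Sw TT (\<lambda>a' b'. pt (star a a') (succ b (snoc b' y))) s"
      using a b s Sw_closed[OF vsTT bilin_arg[OF SS_inner(1)[OF bilin_succ a b] lin_hom_id snoc_lin] s]
      by (simp add: Sw_snoc[OF vsTT SS_inner(1)[OF bilin_succ a b] s])
    also have "\<dots> = Sw TT (\<lambda>a' b'. pt (star a a') (snoc (star b b') y)) s"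
      by (rule Sw_cong[OF _ vsTT b1[OF a b] s]) (simp add: succ_snoc b)
    finally show "Sw TT (\<lambda>a' b'. pt (star a a') (succ b b')) (snoc s y) = Sw TT (\<lambda>a' b'. pt (star a a') (snoc (star b b') y)) s" .
  qed
  moreover have "Sw TT (\<lambda>u v. pt u (snoc v y)) (star t s) = Sw TT (\<lambda>a b. Sw TT (\<lambda>a' b'. pt (star a a') (snoc (star b b') y)) s) t"
    by (rule SS_Sw[OF vsTT bp t s D[OF s']])
  ultimately show ?thesis using t s by (simp add: s' succ_snoc decon_snoc)
qed

text \<open>The summands of (t x) \<prec> s are (t * s1) {x | s2}. Cutting before the last letter
  cuts t * s1, which multiplicativity for the shorter word t resolves into cuts of t and of s1;
  regrouping the cuts of s gives the claim.\<close>

lemma decon_prec_snoc: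
  assumes t: "t \<in> carrier T" and s: "s \<in> carrier T" and D: "\<And>s. s \<in> carrier T \<Longrightarrow> \<Delta> (star t s) = SS star t s"
  shows "\<Delta> (prec (snoc t x) s) = SS prec (snoc t x) s \<oplus>\<^bsub>TT\<^esub> pt (prec (snoc t x) s) one_T"
proof -
  have b: "bilin T T T (\<lambda>u v. snoc (star t u) (ev x v))" using t by (intro lin_A) auto
  have bl: "bilin T T TT (\<lambda>u v. pt (snoc (star t u) (ev x v)) one_T)"
    by (rule bilin_comp[OF b bilin_left[OF bilin_pure[OF vsT vsT] _ lin_hom_id]]) simp
  have k1: "bilin T T TT (\<lambda>u v. Sw TT (\<lambda>a b. Sw TT (\<lambda>a' b'. pt (star a a') (snoc (star b b') (ev x v))) u) t)"
    using t by (intro lin_A) auto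
  have bp: "bilin T T TT (\<lambda>u v. pt u (snoc v y))" for y by (rule bilin_arg[OF bilin_pure[OF vsT vsT] lin_hom_id snoc_lin])
  have "\<Delta> (prec (snoc t x) s) = Sw TT (\<lambda>u v. \<Delta> (snoc (star t u) (ev x v))) s"
    unfolding prec_snoc[OF t s] by (rule Sw_comp[OF vsT b vsTT decon_lin s])
  also have "\<dots> = Sw TT (\<lambda>u v. Sw TT (\<lambda>a b. Sw TT (\<lambda>a' b'. pt (star a a') (snoc (star b b') (ev x v))) u) t \<oplus>\<^bsub>TT\<^esub>
      pt (snoc (star t u) (ev x v)) one_T) s"
    by (rule Sw_cong[OF _ vsTT bilin_sum[OF vsTT k1 bl] s])
       (use t in \<open>simp add: decon_snoc SS_Sw[OF vsTT bp t _ D]\<close>)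
  also have "\<dots> = Sw TT (\<lambda>u v. Sw TT (\<lambda>a b. Sw TT (\<lambda>a' b'. pt (star a a') (snoc (star b b') (ev x v))) u) t) s \<oplus>\<^bsub>TT\<^esub>
      Sw TT (\<lambda>u v. pt (snoc (star t u) (ev x v)) one_T) s"
    by (rule Sw_sum[OF vsTT k1 bl s])
  also have "Sw TT (\<lambda>u v. pt (snoc (star t u) (ev x v)) one_T) s = pt (prec (snoc t x) s) one_T"
    unfolding prec_snoc[OF t s]
    by (rule Sw_comp[symmetric, OF vsT b vsTT bilin_left[OF bilin_pure[OF vsT vsT] _ lin_hom_id] s]) simp
  \<comment> \<open>The sum over cuts of t moves outside, so that the two successive cuts of s stand
    together.\<close>
  also have "Sw TT (\<lambda>u v. Sw TT (\<lambda>a b. Sw TT (\<lambda>a' b'. pt (star a a') (snoc (star b b') (ev x v))) u) t) s =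
      Sw TT (\<lambda>a b. Sw TT (\<lambda>u v. Sw TT (\<lambda>a' b'. pt (star a a') (snoc (star b b') (ev x v))) u) s) t"
    by (rule Sw_swap[OF vsTT _ _ t s]) (intro lin_A; auto)+
  also have "\<dots> = SS prec (snoc t x) s"
  proof -
    have b4: "bilin T T TT (\<lambda>a b. Sw TT (\<lambda>a' b'. pt (star a a') (prec (snoc b x) b')) s)" using s by (intro lin_A) auto
    have "SS prec (snoc t x) s = Sw TT (\<lambda>a b. Sw TT (\<lambda>a' b'. pt (star a a') (prec (snoc b x) b')) s) t \<oplus>\<^bsub>TT\<^esub>
        Sw TT (\<lambda>a' b'. pt (star (snoc t x) a') (prec one_T b')) s"
      unfolding SS_def by (rule Sw_snoc[OF vsTT SS_inner(3)[OF bilin_prec s] t])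
    \<comment> \<open>The cut of t x behind x leaves the empty word as second factor, and 1 \<prec>
      b' = 0.\<close>
    also have "Sw TT (\<lambda>a' b'. pt (star (snoc t x) a') (prec one_T b')) s = Sw TT (\<lambda>a' b'. \<zero>\<^bsub>TT\<^esub>) s"
      by (rule Sw_cong[OF _ vsTT bilin_zero_map[OF vsTT] s]) (use t in simp)
    also have "\<dots> = \<zero>\<^bsub>TT\<^esub>" by (rule Sw_zero[OF vsTT s])
    also have "Sw TT (\<lambda>a b. Sw TT (\<lambda>a' b'. pt (star a a') (prec (snoc b x) b')) s) t \<oplus>\<^bsub>TT\<^esub> \<zero>\<^bsub>TT\<^esub> =
        Sw TT (\<lambda>a b. Sw TT (\<lambda>a' b'. pt (star a a') (prec (snoc b x) b')) s) t"
      using Sw_closed[OF vsTT b4 t] by simp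
    also have "\<dots> = Sw TT (\<lambda>a b. Sw TT (\<lambda>u v. Sw TT (\<lambda>a' b'. pt (star a a') (snoc (star b b') (ev x v))) u) s) t"
    proof (rule Sw_cong[symmetric, OF _ vsTT b4 t])
      fix a b assume a: "a \<in> carrier T" and b': "b \<in> carrier T"
      let ?F = "\<lambda>a' c d. pt (star a a') (snoc (star b c) (ev x d))"
      have F: "trilin TT ?F" unfolding trilin_def using a b' by (intro conjI ballI; intro lin_A; auto)
      have b5: "bilin T T TT (\<lambda>a' b''. pt (star a a') (prec (snoc b x) b''))" using a b' by (intro lin_A) auto
      have b6: "bilin T T T (\<lambda>c d. snoc (star b c) (ev x d))" using b' by (intro lin_A) auto
      \<comment> \<open>Coassociativity regroups the three parts of s as a' and a remainder b'';
        summing over cuts of b'' gives (b x) \<prec> b''.\<close>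
      have "Sw TT (\<lambda>u v. Sw TT (\<lambda>a' b'. ?F a' b' v) u) s = Sw TT (\<lambda>a' b''. Sw TT (?F a') b'') s"
        by (rule Sw_coassoc[symmetric, OF vsTT F s])
      also have "\<dots> = Sw TT (\<lambda>a' b''. pt (star a a') (prec (snoc b x) b'')) s"
      proof (rule Sw_cong[OF _ vsTT b5 s])
        fix a' b'' assume a': "a' \<in> carrier T" and b'': "b'' \<in> carrier T"
        show "Sw TT (?F a') b'' = pt (star a a') (prec (snoc b x) b'')"
          unfolding prec_snoc[OF b' b'']
          by (rule Sw_comp[symmetric, OF vsT b6 vsTT bilin_right[OF bilin_pure[OF vsT vsT] _ lin_hom_id] b'']) (use a a' in simp)
      qed
      finally show "Sw TT (\<lambda>u v. Sw TT (\<lambda>a' b'. ?F a' b' v) u) s = Sw TT (\<lambda>a' b''. pt (star a a') (prec (snoc b x) b'')) s" .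
    qed
    finally show ?thesis by simp
  qed
  finally show ?thesis .
qed

text \<open>The product of the second factors is split by \<open>star_eq_T\<close>. Its counit term
  survives only when both second factors are empty, and leaves (t * s) \<otimes> 1.\<close>

lemma SS_star:
  assumes t: "t \<in> carrier T" and s: "s \<in> carrier T"
  shows "SS star t s = SS prec t s \<oplus>\<^bsub>TT\<^esub> SS succ t s \<oplus>\<^bsub>TT\<^esub> pt (star t s) one_T"
proof -
  have bc: "bilin T T T (\<lambda>b b'. (counit_T b * counit_T b') \<odot>\<^bsub>T\<^esub> one_T)"
    by (intro bilinI lin_hom_smult_left[OF vsT] lin_hom_ground_mult word_counit_lin wd_closed)
  note i1 = SS_inner[OF bilin_prec] and i2 = SS_inner[OF bilin_succ] and i3 = SS_inner[OF bc]
  note bp = bilinD[OF bilin_pure[OF vsT vsT]]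
  have "SS star t s = Sw TT (\<lambda>a b. Sw TT (\<lambda>a' b'. pt (star a a') (prec b b')) s \<oplus>\<^bsub>TT\<^esub> Sw TT (\<lambda>a' b'. pt (star a a') (succ b b')) s \<oplus>\<^bsub>TT\<^esub>
      Sw TT (\<lambda>a' b'. pt (star a a') ((counit_T b * counit_T b') \<odot>\<^bsub>T\<^esub> one_T)) s) t"
    unfolding SS_def
  proof (rule Sw_cong[OF _ vsTT bilin_sum[OF vsTT bilin_sum[OF vsTT i1(3)[OF s] i2(3)[OF s]] i3(3)[OF s]] t])
    fix a b assume ab: "a \<in> carrier T" "b \<in> carrier T"
    have "Sw TT (\<lambda>a' b'. pt (star a a') (star b b')) s = Sw TT (\<lambda>a' b'. pt (star a a') (prec b b') \<oplus>\<^bsub>TT\<^esub> pt (star a a') (succ b b')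
        \<oplus>\<^bsub>TT\<^esub> pt (star a a') ((counit_T b * counit_T b') \<odot>\<^bsub>T\<^esub> one_T)) s"
      by (rule Sw_cong[OF _ vsTT bilin_sum[OF vsTT bilin_sum[OF vsTT i1(1)[OF ab] i2(1)[OF ab]] i3(1)[OF ab]] s])
         (use ab in \<open>simp add: star_eq_T bp\<close>)
    then show "Sw TT (\<lambda>a' b'. pt (star a a') (star b b')) s = Sw TT (\<lambda>a' b'. pt (star a a') (prec b b')) s \<oplus>\<^bsub>TT\<^esub>
        Sw TT (\<lambda>a' b'. pt (star a a') (succ b b')) s \<oplus>\<^bsub>TT\<^esub> Sw TT (\<lambda>a' b'. pt (star a a') ((counit_T b * counit_T b') \<odot>\<^bsub>T\<^esub> one_T)) s"
      by (simp only: Sw_sum[OF vsTT bilin_sum[OF vsTT i1(1)[OF ab] i2(1)[OF ab]] i3(1)[OF ab] s] Sw_sum[OF vsTT i1(1)[OF ab] i2(1)[OF ab] s])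
  qed
  also have "\<dots> = SS prec t s \<oplus>\<^bsub>TT\<^esub> SS succ t s \<oplus>\<^bsub>TT\<^esub> SS (\<lambda>b b'. (counit_T b * counit_T b') \<odot>\<^bsub>T\<^esub> one_T) t s"
    unfolding SS_def by (simp only: Sw_sum[OF vsTT bilin_sum[OF vsTT i1(3)[OF s] i2(3)[OF s]] i3(3)[OF s] t] Sw_sum[OF vsTT i1(3)[OF s] i2(3)[OF s] t])
  also have "SS (\<lambda>b b'. (counit_T b * counit_T b') \<odot>\<^bsub>T\<^esub> one_T) t s = pt (star t s) one_T"
  proof -
    let ?g = "\<lambda>b b'. (counit_T b * counit_T b') \<odot>\<^bsub>T\<^esub> one_T"
    have pl: "(\<lambda>t. pt (star t s) one_T) \<in> lin_hom T TT" "(\<lambda>s. pt (star t s) one_T) \<in> lin_hom T TT" if "t \<in> carrier T" for t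
      using s that by (intro lin_A; auto)+
    \<comment> \<open>In the inner sum only the cut at the very end of s has a nonzero counit on the
      right.\<close>
    have c: "Sw TT (\<lambda>a' b'. pt (star a a') (?g b b')) s = counit_T b \<odot>\<^bsub>TT\<^esub> pt (star a s) one_T"
      if a: "a \<in> carrier T" and b: "b \<in> carrier T" for a b
    proof (rule T_lin_cases[OF vsTT Sw_lin[OF vsTT i3(1)[OF a b]] lin_hom_smult'[OF vsTT pl(2)[OF a]] _ _ s])
      show "Sw TT (\<lambda>a' b'. pt (star a a') (?g b b')) one_T = counit_T b \<odot>\<^bsub>TT\<^esub> pt (star a one_T) one_T"
        using a b by (simp add: Sw_one[OF vsTT i3(1)[OF a b]] bp)
      fix s y assume s: "s \<in> carrier T"
      have "Sw TT (\<lambda>a' b'. pt (star a a') (?g b (snoc b' y))) s = Sw TT (\<lambda>a' b'. \<zero>\<^bsub>TT\<^esub>) s"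
        by (rule Sw_cong[OF _ vsTT bilin_zero_map[OF vsTT] s]) (use a b in simp)
      then show "Sw TT (\<lambda>a' b'. pt (star a a') (?g b b')) (snoc s y) = counit_T b \<odot>\<^bsub>TT\<^esub> pt (star a (snoc s y)) one_T"
        using a b s by (simp add: Sw_snoc[OF vsTT i3(1)[OF a b] s] bp Sw_zero[OF vsTT])
    qed
    show ?thesis
    proof (rule T_lin_cases[OF vsTT bilin_left[OF SS_bilin[OF bc] s lin_hom_id] pl(1)[OF wd_closed] _ _ t])
      show "SS ?g one_T s = pt (star one_T s) one_T"
        unfolding SS_def using s by (simp only: Sw_one[OF vsTT i3(3)[OF s]] c wd_closed) simp
      fix t x assume t: "t \<in> carrier T"
      have "Sw TT (\<lambda>a b. Sw TT (\<lambda>a' b'. pt (star a a') (?g (snoc b x) b')) s) t = Sw TT (\<lambda>a b. \<zero>\<^bsub>TT\<^esub>) t"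
        by (rule Sw_cong[OF _ vsTT bilin_zero_map[OF vsTT] t]) (use s in \<open>simp only: c snoc_closed, simp\<close>)
      then have "Sw TT (\<lambda>a b. Sw TT (\<lambda>a' b'. pt (star a a') (?g (snoc b x) b')) s) t = \<zero>\<^bsub>TT\<^esub>" by (simp only: Sw_zero[OF vsTT t])
      then show "SS ?g (snoc t x) s = pt (star (snoc t x) s) one_T"
        unfolding SS_def using s t by (simp only: Sw_snoc[OF vsTT i3(3)[OF s] t] c snoc_closed wd_closed) simp
    qed
  qed
  finally show ?thesis .
qed

end

lemma vs_interchange:
  assumes "vs M" "a \<in> carrier M" "b \<in> carrier M" "c \<in> carrier M" "d \<in> carrier M"
  shows "(a \<oplus>\<^bsub>M\<^esub> b) \<oplus>\<^bsub>M\<^esub> (c \<oplus>\<^bsub>M\<^esub> d) = (a \<oplus>\<^bsub>M\<^esub> c) \<oplus>\<^bsub>M\<^esub> (b \<oplus>\<^bsub>M\<^esub> d)"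
  using assms vs_lcomm[OF assms(1) assms(3,4,5)] by (simp add: vs_assoc)

context brace_algebra
begin

lemma SS_one_right:
  assumes t: "t \<in> carrier T" shows "SS star t one_T = \<Delta> t"
proof -
  note b = bilin_pure[OF vsT vsT]
  have "SS star t one_T = Sw TT pt t"
    unfolding SS_def by (rule Sw_cong[OF _ vsTT b t]) (simp add: Sw_one[OF vsTT SS_inner(1)[OF bilin_star]])
  then show ?thesis using t by (simp add: decon_Sw)
qed

lemma SS_one_left:
  assumes s: "s \<in> carrier T" shows "SS star one_T s = \<Delta> s"
proof -
  note b = bilin_pure[OF vsT vsT]
  have "SS star one_T s = Sw TT (\<lambda>a' b'. pt (star one_T a') (star one_T b')) s"
    unfolding SS_def by (rule Sw_one[OF vsTT SS_inner(3)[OF bilin_star s]])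
  also have "\<dots> = Sw TT pt s" by (rule Sw_cong[OF _ vsTT b s]) simp
  finally show ?thesis using s by (simp add: decon_Sw)
qed

lemma pt_add_left: "a \<in> carrier T \<Longrightarrow> b \<in> carrier T \<Longrightarrow> pt (a \<oplus>\<^bsub>T\<^esub> b) one_T = pt a one_T \<oplus>\<^bsub>TT\<^esub> pt b one_T"
  by (rule bilinD(2)[OF bilin_pure[OF vsT vsT]]) auto

lemma SS_closed: "bilin T T T g \<Longrightarrow> t \<in> carrier T \<Longrightarrow> s \<in> carrier T \<Longrightarrow> SS g t s \<in> carrier TT"
  by (rule bilinD(1)[OF SS_bilin])

text \<open>Two nested inductions. The \<prec> part shortens the left word and needs the claim for
  all s; the \<succ> part keeps the left word and shortens the right one.\<close>

lemma decon_star: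
  assumes t: "t \<in> carrier T" and s: "s \<in> carrier T"
  shows "\<Delta> (star t s) = SS star t s"
proof -
  have "\<Delta> (star (wd w) s) = SS star (wd w) s" if "s \<in> carrier T" for w s
    using that
  proof (induction w arbitrary: s rule: rev_induct)
    case Nil
    then show ?case by (simp add: SS_one_left)
  next
    case (snoc x w)
    let ?t = "wd w" and ?tx = "snoc (wd w) x"
    have "\<Delta> (star ?tx (wd v)) = SS star ?tx (wd v)" for v
    proof (induction v rule: rev_induct)
      case Nil
      then show ?case by (simp add: SS_one_right)
    next
      case (snoc y v)
      let ?s = "snoc (wd v) y"
      have p: "\<Delta> (prec ?tx ?s) = SS prec ?tx ?s \<oplus>\<^bsub>TT\<^esub> pt (prec ?tx ?s) one_T"
        by (rule decon_prec_snoc) (use \<open>\<And>s. s \<in> carrier T \<Longrightarrow> \<Delta> (star ?t s) = SS star ?t s\<close> in auto)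
      have q: "\<Delta> (succ ?tx ?s) = SS succ ?tx ?s \<oplus>\<^bsub>TT\<^esub> pt (succ ?tx ?s) one_T"
        by (rule decon_succ[where s = "wd v" and y = y]) (use snoc.IH in auto)
      have e: "star ?tx ?s = prec ?tx ?s \<oplus>\<^bsub>T\<^esub> succ ?tx ?s"
        by (subst star_eq_T) (simp_all del: snoc_wd)
      have "\<Delta> (star ?tx ?s) = \<Delta> (prec ?tx ?s) \<oplus>\<^bsub>TT\<^esub> \<Delta> (succ ?tx ?s)"
        unfolding e by (rule lin_homD(2)[OF decon_lin]) simp_all
      also have "\<dots> = SS prec ?tx ?s \<oplus>\<^bsub>TT\<^esub> SS succ ?tx ?s \<oplus>\<^bsub>TT\<^esub> pt (star ?tx ?s) one_T"
        unfolding p q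
        by (subst vs_interchange[OF vsTT])
           (simp_all add: e pt_add_left SS_closed bilin_prec bilin_succ del: snoc_wd)
      also have "\<dots> = SS star ?tx ?s" by (simp add: SS_star del: snoc_wd)
      finally show ?case unfolding wd_snoc .
    qed
    then show ?case unfolding wd_snoc
      by (rule T_lin_eqI[OF vsTT lin_hom_comp[OF decon_lin star_lin[OF snoc_closed[OF wd_closed]]]
            bilin_right[OF SS_bilin[OF bilin_star] snoc_closed[OF wd_closed] lin_hom_id] _ snoc.prems])
  qed
  from this[OF s] show ?thesis
    by (rule T_lin_eqI[OF vsTT lin_hom_comp[OF decon_lin bilin_left[OF bilin_star s lin_hom_id]]
          bilin_left[OF SS_bilin[OF bilin_star] s lin_hom_id] _ t])
qed

lemma Sw_star:
  assumes "vs P" "bilin T T P \<beta>" "t \<in> carrier T" "s \<in> carrier T"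
  shows "Sw P \<beta> (star t s) = Sw P (\<lambda>a b. Sw P (\<lambda>a' b'. \<beta> (star a a') (star b b')) s) t"
  by (rule SS_Sw) (use assms decon_star in auto)

lemma decon_prec:
  assumes t: "t \<in> carrier T" and s: "s \<in> carrier T"
  shows "\<Delta> (prec t s) = SS prec t s \<oplus>\<^bsub>TT\<^esub> pt (prec t s) one_T"
proof (rule T_lin_cases[OF vsTT _ _ _ _ t])
  show "(\<lambda>t. \<Delta> (prec t s)) \<in> lin_hom T TT"
    by (rule lin_hom_comp[OF decon_lin bilin_left[OF bilin_prec s lin_hom_id]])
  show "(\<lambda>t. SS prec t s \<oplus>\<^bsub>TT\<^esub> pt (prec t s) one_T) \<in> lin_hom T TT"
    using s by (intro lin_hom_sum[OF vsTT] bilin_left[OF SS_bilin[OF bilin_prec]] bilin_left[OF bilin_pure[OF vsT vsT]] bilin_left[OF bilin_prec] lin_hom_id) auto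
  have "SS prec one_T s = Sw TT (\<lambda>a' b'. pt (star one_T a') (prec one_T b')) s"
    unfolding SS_def by (rule Sw_one[OF vsTT SS_inner(3)[OF bilin_prec s]])
  also have "\<dots> = Sw TT (\<lambda>a' b'. \<zero>\<^bsub>TT\<^esub>) s" by (rule Sw_cong[OF _ vsTT bilin_zero_map[OF vsTT] s]) simp
  finally show "\<Delta> (prec one_T s) = SS prec one_T s \<oplus>\<^bsub>TT\<^esub> pt (prec one_T s) one_T"
    using s by (simp add: Sw_zero[OF vsTT])
qed (simp add: decon_prec_snoc decon_star s)

lemma decon_succ':
  assumes t: "t \<in> carrier T" and s: "s \<in> carrier T"
  shows "\<Delta> (succ t s) = SS succ t s \<oplus>\<^bsub>TT\<^esub> pt (succ t s) one_T"
proof (rule T_lin_cases[OF vsTT _ _ _ _ s])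
  show "(\<lambda>s. \<Delta> (succ t s)) \<in> lin_hom T TT"
    by (rule lin_hom_comp[OF decon_lin bilin_right[OF bilin_succ t lin_hom_id]])
  show "(\<lambda>s. SS succ t s \<oplus>\<^bsub>TT\<^esub> pt (succ t s) one_T) \<in> lin_hom T TT"
    using t by (intro lin_hom_sum[OF vsTT] bilin_right[OF SS_bilin[OF bilin_succ]] bilin_left[OF bilin_pure[OF vsT vsT]] bilin_right[OF bilin_succ] lin_hom_id) auto
  show "\<Delta> (succ t one_T) = SS succ t one_T \<oplus>\<^bsub>TT\<^esub> pt (succ t one_T) one_T"
    by (rule decon_succ[OF t wd_closed]) (auto simp: decon_star t)
  show "\<Delta> (succ t (snoc s y)) = SS succ t (snoc s y) \<oplus>\<^bsub>TT\<^esub> pt (succ t (snoc s y)) one_T" if "s \<in> carrier T" for s y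
    by (rule decon_succ[OF t that, where y = y]) (auto simp: decon_star t that)
qed

subsection \<open>The dendriform axioms on words\<close>

text \<open>Associativity is proved by lexicographic induction on the three words: \<open>prec_prec\<close> at \<open>x\<close> shortens
  the first word, \<open>succ_prec\<close> the second and \<open>succ_succ\<close> the third.\<close>

lemma prec_prec_snoc:
  assumes t: "t \<in> carrier T" and s: "s \<in> carrier T" and r: "r \<in> carrier T"
    and assoc: "\<And>u v. u \<in> carrier T \<Longrightarrow> v \<in> carrier T \<Longrightarrow> star (star t u) v = star t (star u v)"
  shows "prec (prec (snoc t x) s) r = prec (snoc t x) (star s r)"
proof -
  have b1: "bilin T T T (\<lambda>u v. snoc (star t u) (ev x v))" using t by (intro lin_A) auto
  have b2: "bilin T T T (\<lambda>u v. Sw T (\<lambda>u' v'. snoc (star t (star u u')) (ev x (star v v'))) r)" using t r by (intro lin_A) auto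
  have "prec (prec (snoc t x) s) r = Sw T (\<lambda>u v. prec (snoc (star t u) (ev x v)) r) s"
    unfolding prec_snoc[OF t s] by (rule Sw_comp[OF vsT b1 vsT bilin_left[OF bilin_prec r lin_hom_id] s])
  \<comment> \<open>Here \<open>ev_ev\<close> merges {{x | v} | v'} into {x | v * v'}, and
    associativity with the shorter first word t rearranges the left part.\<close>
  also have "\<dots> = Sw T (\<lambda>u v. Sw T (\<lambda>u' v'. snoc (star t (star u u')) (ev x (star v v'))) r) s"
  proof (rule Sw_cong[OF _ vsT b2 s])
    fix u v assume u: "u \<in> carrier T" and v: "v \<in> carrier T"
    have b3: "bilin T T T (\<lambda>u' v'. snoc (star t (star u u')) (ev x (star v v')))" using t u v by (intro lin_A) auto
    show "prec (snoc (star t u) (ev x v)) r = Sw T (\<lambda>u' v'. snoc (star t (star u u')) (ev x (star v v'))) r"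
      unfolding prec_snoc[OF star_closed[OF t u] r]
      by (rule Sw_cong[OF _ vsT b3 r]) (use t u v in \<open>simp add: assoc ev_ev\<close>)
  qed
  \<comment> \<open>Multiplicativity of deconcatenation reads the double sum over cuts of s and of r
    as a sum over cuts of s * r.\<close>
  also have "\<dots> = prec (snoc t x) (star s r)"
    unfolding prec_snoc[OF t star_closed[OF s r]] by (rule Sw_star[symmetric, OF vsT b1 s r])
  finally show ?thesis .
qed

text \<open>Both sides are sums over cuts of r that end in the same letter {y | v}; the words in
  front differ by associativity with s in place of s y.\<close>

lemma succ_prec_snoc:
  assumes t: "t \<in> carrier T" and s: "s \<in> carrier T" and r: "r \<in> carrier T"
    and assoc: "\<And>u. u \<in> carrier T \<Longrightarrow> star (star t s) u = star t (star s u)"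
  shows "prec (succ t (snoc s y)) r = succ t (prec (snoc s y) r)"
proof -
  have b1: "bilin T T T (\<lambda>u v. snoc (star s u) (ev y v))" using s by (intro lin_A) auto
  have "prec (succ t (snoc s y)) r = Sw T (\<lambda>u v. snoc (star (star t s) u) (ev y v)) r"
    using t s r by (simp add: succ_snoc prec_snoc)
  also have "\<dots> = Sw T (\<lambda>u v. succ t (snoc (star s u) (ev y v))) r"
    by (rule Sw_cong[OF _ vsT bilin_comp[OF b1 bilin_right[OF bilin_succ t lin_hom_id]] r])
       (use t s in \<open>simp add: succ_snoc assoc\<close>)
  also have "\<dots> = succ t (prec (snoc s y) r)"
    unfolding prec_snoc[OF s r] by (rule Sw_comp[symmetric, OF vsT b1 vsT bilin_right[OF bilin_succ t lin_hom_id] r])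
  finally show ?thesis .
qed

lemma succ_zero [simp]: "t \<in> carrier T \<Longrightarrow> succ t \<zero>\<^bsub>T\<^esub> = \<zero>\<^bsub>T\<^esub>" "t \<in> carrier T \<Longrightarrow> succ \<zero>\<^bsub>T\<^esub> t = \<zero>\<^bsub>T\<^esub>"
  by (rule bilin_zero[OF bilin_succ vsT vsT vsT]; simp)+

lemma prec_zero [simp]: "t \<in> carrier T \<Longrightarrow> prec t \<zero>\<^bsub>T\<^esub> = \<zero>\<^bsub>T\<^esub>" "t \<in> carrier T \<Longrightarrow> prec \<zero>\<^bsub>T\<^esub> t = \<zero>\<^bsub>T\<^esub>"
  by (rule bilin_zero[OF bilin_prec vsT vsT vsT]; simp)+

lemma counit_ops [simp]:
  assumes t: "t \<in> carrier T" and s: "s \<in> carrier T"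
  shows "counit_T (prec t s) = 0" "counit_T (succ t s) = 0" "counit_T (star t s) = counit_T t * counit_T s"
proof -
  note c = lin_homD[OF word_counit_lin]
  have z: "(\<lambda>t. 0 :: 'k) \<in> lin_hom T ground" using lin_hom_const_zero[OF vs_ground] by simp
  have cz: "counit_T \<zero>\<^bsub>T\<^esub> = 0" using lin_hom_zero[OF vsT vs_ground word_counit_lin] by simp
  show p: "counit_T (prec t s) = 0"
  proof (rule T_lin_cases[OF vs_ground lin_hom_comp[OF word_counit_lin bilin_left[OF bilin_prec s lin_hom_id]] z _ _ t])
    fix t x assume t: "t \<in> carrier T"
    have b: "bilin T T T (\<lambda>u v. snoc (star t u) (ev x v))" using t by (intro lin_A) auto
    have "counit_T (prec (snoc t x) s) = Sw ground (\<lambda>u v. counit_T (snoc (star t u) (ev x v))) s"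
      unfolding prec_snoc[OF t s] by (rule Sw_comp[OF vsT b vs_ground word_counit_lin s])
    also have "\<dots> = Sw ground (\<lambda>u v. \<zero>\<^bsub>ground\<^esub>) s"
      by (rule Sw_cong[OF _ vs_ground bilin_zero_map[OF vs_ground] s]) (use t in simp)
    finally show "counit_T (prec (snoc t x) s) = 0" using s by (simp only: Sw_zero[OF vs_ground]) simp
  qed (use s cz in simp)
  show q: "counit_T (succ t s) = 0"
    by (rule T_lin_cases[OF vs_ground lin_hom_comp[OF word_counit_lin bilin_right[OF bilin_succ t lin_hom_id]] z _ _ s])
       (use t cz in \<open>simp_all add: succ_snoc\<close>)
  show "counit_T (star t s) = counit_T t * counit_T s"
    using t s c(2) c(3)[of one_T] by (simp add: star_eq_T p q)
qed

text \<open>The computation of \<open>star_assoc\<close>, from the three axioms at one triple: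
  during the induction they are known only at certain triples.\<close>

lemma star_assoc_combine:
  assumes t: "t \<in> carrier T" and s: "s \<in> carrier T" and r: "r \<in> carrier T"
    and 1: "prec (prec t s) r = prec t (star s r)" and 2: "prec (succ t s) r = succ t (prec s r)"
    and 3: "succ t (succ s r) = succ (star t s) r"
  shows "star (star t s) r = star t (star s r)"
proof -
  let ?c = "(counit_T t * counit_T s * counit_T r) \<odot>\<^bsub>T\<^esub> one_T"
  note b = bilinD[OF bilin_prec] bilinD[OF bilin_succ]
  have "star (star t s) r = prec (star t s) r \<oplus>\<^bsub>T\<^esub> succ (star t s) r \<oplus>\<^bsub>T\<^esub> ?c"
    using t s r by (subst star_eq_T) auto
  also have "prec (star t s) r = prec t (star s r) \<oplus>\<^bsub>T\<^esub> succ t (prec s r)"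
    using t s r by (simp add: star_eq_T[of t s] b 1 2)
  finally have l: "star (star t s) r = prec t (star s r) \<oplus>\<^bsub>T\<^esub> succ t (prec s r) \<oplus>\<^bsub>T\<^esub> succ (star t s) r \<oplus>\<^bsub>T\<^esub> ?c" .
  have "star t (star s r) = prec t (star s r) \<oplus>\<^bsub>T\<^esub> succ t (star s r) \<oplus>\<^bsub>T\<^esub> ?c"
    using t s r by (subst star_eq_T) (auto simp: mult.assoc)
  also have "succ t (star s r) = succ t (prec s r) \<oplus>\<^bsub>T\<^esub> succ (star t s) r"
    using t s r by (simp add: star_eq_T[of s r] b 3)
  finally show ?thesis using t s r l by (simp add: vs_assoc[OF vsT])
qed

lemma star_assoc_T:
  assumes t: "t \<in> carrier T" and s: "s \<in> carrier T" and r: "r \<in> carrier T"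
  shows "star (star t s) r = star t (star s r)"
proof -
  \<comment> \<open>The inner induction yields the claim for words in the middle position; the outer
    induction hypothesis needs it for every element there.\<close>
  have A: "star (star t s) r = star t (star s r)" if t: "t \<in> carrier T" and r: "r \<in> carrier T" and s: "s \<in> carrier T"
    and w: "\<And>w r. r \<in> carrier T \<Longrightarrow> star (star t (wd w)) r = star t (star (wd w) r)" for t s r
  proof (rule T_lin_eqI[OF vsT _ _ _ s])
    show "(\<lambda>s. star (star t s) r) \<in> lin_hom T T" "(\<lambda>s. star t (star s r)) \<in> lin_hom T T"
      using t r by (intro lin_A; auto)+
  qed (rule w[OF r])
  have "star (star (wd w) s) r = star (wd w) (star s r)" if "s \<in> carrier T" "r \<in> carrier T" for w s r
    using that
  proof (induction w arbitrary: s r rule: rev_induct)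
    case Nil
    then show ?case by simp
  next
    case (snoc x w)
    let ?t = "snoc (wd w) x"
    have "star (star ?t (wd v)) r = star ?t (star (wd v) r)" if "r \<in> carrier T" for v r
      using that
    proof (induction v arbitrary: r rule: rev_induct)
      case Nil
      then show ?case by (simp del: snoc_wd)
    next
      case (snoc y v)
      let ?s = "snoc (wd v) y"
      \<comment> \<open>This uses the outer hypothesis, valid for every second and third argument;
        the next fact uses the hypothesis for the shorter second word.\<close>
      have 1: "prec (prec ?t ?s) r = prec ?t (star ?s r)" if "r \<in> carrier T" for r
        by (rule prec_prec_snoc) (use \<open>\<And>s r. s \<in> carrier T \<Longrightarrow> r \<in> carrier T \<Longrightarrow> star (star (wd w) s) r = star (wd w) (star s r)\<close> that in auto)
      have 2: "prec (succ ?t ?s) r = succ ?t (prec ?s r)" if "r \<in> carrier T" for r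
        by (rule succ_prec_snoc) (use snoc.IH that in auto)
      have l: "(\<lambda>r. star (star ?t ?s) r) \<in> lin_hom T T" "(\<lambda>r. star ?t (star ?s r)) \<in> lin_hom T T"
        by (intro lin_A; simp del: snoc_wd)+
      show ?case unfolding wd_snoc
      \<comment> \<open>The third axiom at r z unfolds to associativity at r, so the innermost
        induction runs over the last letter of the third argument.\<close>
      proof (rule T_lin_induct[OF vsT l _ _ snoc.prems])
        show "star (star ?t ?s) one_T = star ?t (star ?s one_T)" by (simp del: snoc_wd)
        fix r z assume r: "r \<in> carrier T" and IH: "star (star ?t ?s) r = star ?t (star ?s r)"
        show "star (star ?t ?s) (snoc r z) = star ?t (star ?s (snoc r z))"
          by (rule star_assoc_combine[OF _ _ _ 1 2]) (use r IH in \<open>simp_all add: succ_snoc del: snoc_wd\<close>)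
      qed
    qed
    from A[OF _ snoc.prems(2,1) this] show ?case unfolding wd_snoc by simp
  qed
  note words = this[OF s r]
  have l: "(\<lambda>t. star (star t s) r) \<in> lin_hom T T" "(\<lambda>t. star t (star s r)) \<in> lin_hom T T"
    using s r by (intro lin_A; auto)+
  show ?thesis by (rule T_lin_eqI[OF vsT l words t])
qed

section \<open>The augmented dendriform algebra of words\<close>

definition word_aug :: "('k, ('b list \<Rightarrow>\<^sub>0 'k) set) augd" where
  "word_aug = \<lparr>carrier = carrier T, mult = star, one = one_T, zero = \<zero>\<^bsub>T\<^esub>, add = add T, smult = smult T,
     dprec = prec, dsucc = succ, counit = word_counit\<rparr>"

lemma same_space_word_aug: "same_space word_aug T"
  by (simp add: same_space_def word_aug_def)

lemmas word_aug_space [simp] = same_space_lin_hom[OF same_space_word_aug] same_space_tensor[OF same_space_word_aug]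
  same_space_bilin[OF same_space_word_aug] same_space_tensor_lift[OF same_space_word_aug]

lemma word_aug_simps [simp]:
  "carrier word_aug = carrier T" "mult word_aug = star" "one word_aug = one_T" "zero word_aug = \<zero>\<^bsub>T\<^esub>"
  "add word_aug = add T" "smult word_aug = smult T" "dprec word_aug = prec" "dsucc word_aug = succ"
  "counit word_aug = word_counit"
  by (simp_all add: word_aug_def)

text \<open>With associativity established, each axiom holds at a last letter of the word that its
  formula takes apart: the first, second or third argument respectively. At the empty word both
  sides vanish.\<close>

lemma augmented_word_aug: "augmented word_aug"
proof (rule augmented.intro, unfold word_aug_simps word_aug_space)
  show "vs word_aug" by (rule same_space_vs[OF same_space_word_aug vsT])
  fix x y z assume x: "x \<in> carrier T" and y: "y \<in> carrier T" and z: "z \<in> carrier T"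
  show "prec (prec x y) z = prec x (star y z)"
    by (rule T_lin_cases[OF vsT _ _ _ _ x, where f = "\<lambda>x. prec (prec x y) z"])
       (use y z in \<open>(intro lin_A; simp) | simp add: prec_prec_snoc star_assoc_T\<close>)+
  show "prec (succ x y) z = succ x (prec y z)"
    by (rule T_lin_cases[OF vsT _ _ _ _ y, where f = "\<lambda>y. prec (succ x y) z"])
       (use x z in \<open>(intro lin_A; simp) | simp add: succ_prec_snoc star_assoc_T\<close>)+
  show "succ x (succ y z) = succ (star x y) z"
    by (rule T_lin_cases[OF vsT _ _ _ _ z, where f = "\<lambda>z. succ x (succ y z)"])
       (use x y in \<open>(intro lin_A; simp) | simp add: succ_snoc star_assoc_T\<close>)+
qed (auto simp: bilin_star bilin_prec bilin_succ word_counit_lin star_eq_T prec_one_right one_succ_T)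

lemma Sw_counit_right: assumes t: "t \<in> carrier T" shows "Sw T (\<lambda>y z. counit_T z \<odot>\<^bsub>T\<^esub> y) t = t"
proof -
  interpret W: augmented word_aug by (rule augmented_word_aug)
  have b: "bilin T T T (\<lambda>y z. counit_T z \<odot>\<^bsub>T\<^esub> y)" using W.bilin_counit_right by simp
  show ?thesis
  proof (rule T_lin_cases[OF vsT Sw_lin[OF vsT b] lin_hom_id _ _ t])
    fix t y assume t: "t \<in> carrier T"
    have "Sw T (\<lambda>u v. counit_T (snoc v y) \<odot>\<^bsub>T\<^esub> u) t = Sw T (\<lambda>u v. \<zero>\<^bsub>T\<^esub>) t"
      by (rule Sw_cong[OF _ vsT bilin_zero_map[OF vsT] t]) simp
    then show "Sw T (\<lambda>y z. counit_T z \<odot>\<^bsub>T\<^esub> y) (snoc t y) = snoc t y"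
      using t by (simp add: Sw_snoc[OF vsT b t] Sw_zero[OF vsT])
  qed (simp add: Sw_one[OF vsT b])
qed

text \<open>A last letter y stays in the right factor, where it cannot be moved out of f. The
  induction is therefore over all f and passes to f after appending y.\<close>

lemma Sw_counit_left:
  assumes P: "vs P" and f: "f \<in> lin_hom T P" and t: "t \<in> carrier T"
  shows "Sw P (\<lambda>y z. counit_T y \<odot>\<^bsub>P\<^esub> f z) t = f t"
proof -
  have b: "bilin T T P (\<lambda>y z. counit_T y \<odot>\<^bsub>P\<^esub> f z)" if "f \<in> lin_hom T P" for f
    using that by (intro bilinI lin_hom_smult_left[OF P] lin_hom_smult'[OF P] word_counit_lin) (auto simp: lin_homD)
  have "Sw P (\<lambda>y z. counit_T y \<odot>\<^bsub>P\<^esub> f z) (wd w) = f (wd w)" if "f \<in> lin_hom T P" for w f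
    using that
  proof (induction w arbitrary: f rule: rev_induct)
    case Nil
    then show ?case using lin_homD(1)[OF Nil wd_closed] P by (simp add: Sw_one[OF P b[OF Nil]])
  next
    case (snoc y w)
    note f = snoc.prems
    have "Sw P (\<lambda>u v. counit_T u \<odot>\<^bsub>P\<^esub> f (snoc v y)) (wd w) = f (snoc (wd w) y)"
      by (rule snoc.IH[OF lin_hom_comp[OF f snoc_lin]])
    then have "Sw P (\<lambda>y z. counit_T y \<odot>\<^bsub>P\<^esub> f z) (snoc (wd w) y) = f (snoc (wd w) y)"
      using lin_homD(1)[OF f] P by (simp add: Sw_snoc[OF P b[OF f] wd_closed] del: snoc_wd)
    then show ?case by simp
  qed
  from this[OF f] show ?thesis by (rule T_lin_eqI[OF P Sw_lin[OF P b[OF f]] f _ t])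
qed

lemma deconcatenation_aug_hom: "\<Delta> \<in> aug_hom word_aug (aug_tensor word_aug word_aug)"
proof (rule aug_homI[OF augmented_word_aug augmented_tensor[OF augmented_word_aug augmented_word_aug]])
  interpret W: augmented word_aug by (rule augmented_word_aug)
  show "\<Delta> \<in> lin_hom word_aug (aug_tensor word_aug word_aug)" using decon_lin by simp
  show "\<Delta> \<one>\<^bsub>word_aug\<^esub> = \<one>\<^bsub>aug_tensor word_aug word_aug\<^esub>" by simp
  fix x assume x: "x \<in> carrier word_aug"
  have l: "tensor_lift T (\<lambda>y z. counit_T y \<odot>\<^bsub>T\<^esub> z) (\<Delta> x) = x" if "x \<in> carrier T" for x
    using Sw_counit_left[OF vsT lin_hom_id that] by (simp add: Sw_def)
  have r: "tensor_lift T (\<lambda>y z. counit_T z \<odot>\<^bsub>T\<^esub> y) (\<Delta> x) = x" if "x \<in> carrier T" for x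
    using Sw_counit_right[OF that] by (simp add: Sw_def)
  show "counit (aug_tensor word_aug word_aug) (\<Delta> x) = counit word_aug x"
    using W.counit_counit_left[of "\<Delta> x"] x l by simp
  fix y assume y: "y \<in> carrier word_aug"
  show "\<Delta> (x \<prec>\<^bsub>word_aug\<^esub> y) = \<Delta> x \<prec>\<^bsub>aug_tensor word_aug word_aug\<^esub> \<Delta> y"
    using W.sweedler_prec(1)[of "\<Delta> x" "\<Delta> y"] x y by (simp add: r decon_prec SS_def Sw_def tensor_bil_def)
  show "\<Delta> (x \<succ>\<^bsub>word_aug\<^esub> y) = \<Delta> x \<succ>\<^bsub>aug_tensor word_aug word_aug\<^esub> \<Delta> y"
    using W.sweedler_prec(2)[of "\<Delta> x" "\<Delta> y"] x y by (simp add: r decon_succ' SS_def Sw_def tensor_bil_def)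
qed

end

section \<open>Words in an augmented dendriform algebra\<close>

text \<open>A linear map from V into the kernel of the counit. It is used for the free dendriform
  algebra, for the enveloping algebra and for words themselves.\<close>

locale letters = word_space scale + W: augmented W
  for scale :: "'k::field \<Rightarrow> 'b::ab_group_add \<Rightarrow> 'b" and W :: "('k, 'v, 'm) augd_scheme" +
  fixes i :: "'b \<Rightarrow> 'v"
  assumes i_lin: "i \<in> lin_hom V W" and counit_i [simp]: "counit W (i x) = 0"
begin

lemma i_closed [simp]: "i x \<in> carrier W"
  using lin_homD(1)[OF i_lin] by simp

lemma i_add: "i (x + y) = i x \<oplus>\<^bsub>W\<^esub> i y" and i_scale: "i (scale c x) = c \<odot>\<^bsub>W\<^esub> i x"
  using lin_homD(2,3)[OF i_lin] by simp_all

text \<open>The fold starts from the unit: 1 \<succ> i y = i y makes the first letter no exception,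
  and the empty word is sent to 1.\<close>

definition sea where "sea t = word_lift W (\<lambda>w. foldl (\<lambda>a y. a \<succ>\<^bsub>W\<^esub> i y) \<one>\<^bsub>W\<^esub> w) t"

text \<open>The sign of the antipode-like series is built in: a word of length \<open>n\<close> is sent to \<open>(- 1)\<^sup>n\<close> times
  its right-nested \<open>\<prec>\<close>-product.\<close>

definition nea where "nea t = word_lift W (\<lambda>w. foldr (\<lambda>y a. (- 1) \<odot>\<^bsub>W\<^esub> (i y \<prec>\<^bsub>W\<^esub> a)) w \<one>\<^bsub>W\<^esub>) t"

lemma foldl_succ_lin: "(\<lambda>a. foldl (\<lambda>a y. a \<succ>\<^bsub>W\<^esub> i y) a w) \<in> lin_hom W W"
proof (induction w)
  case (Cons y w)
  show ?case using lin_hom_comp[OF Cons bilin_left[OF W.bilin_succ i_closed lin_hom_id]] by simp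
qed (simp add: lin_hom_id)

lemma foldr_prec_lin: "(\<lambda>a. foldr (\<lambda>y a. (- 1) \<odot>\<^bsub>W\<^esub> (i y \<prec>\<^bsub>W\<^esub> a)) w a) \<in> lin_hom W W"
proof (induction w)
  case (Cons y w)
  show ?case
    using lin_hom_smult'[OF W.vs bilin_right[OF W.bilin_prec i_closed Cons]] by simp
qed (simp add: lin_hom_id)

lemma multilin_sea: "multilin W (\<lambda>w. foldl (\<lambda>a y. a \<succ>\<^bsub>W\<^esub> i y) \<one>\<^bsub>W\<^esub> w)"
  using lin_homD[OF foldl_succ_lin] by (simp add: multilin_def i_add i_scale)

lemma multilin_nea: "multilin W (\<lambda>w. foldr (\<lambda>y a. (- 1) \<odot>\<^bsub>W\<^esub> (i y \<prec>\<^bsub>W\<^esub> a)) w \<one>\<^bsub>W\<^esub>)"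
proof -
  note r = lin_homD[OF foldr_prec_lin]
  have c: "c \<odot>\<^bsub>W\<^esub> foldr (\<lambda>y a. (- 1) \<odot>\<^bsub>W\<^esub> (i y \<prec>\<^bsub>W\<^esub> a)) us a = foldr (\<lambda>y a. (- 1) \<odot>\<^bsub>W\<^esub> (i y \<prec>\<^bsub>W\<^esub> a)) us (c \<odot>\<^bsub>W\<^esub> a)"
    if "a \<in> carrier W" for c us a by (simp only: r that)
  show ?thesis
    unfolding multilin_def
    by (auto simp: r i_add i_scale vs_smult_add simp del: vs_smult_smult)
       (auto simp: r i_add i_scale vs_smult_add mult.commute)
qed

lemma sea_lin: "sea \<in> lin_hom T W"
  unfolding sea_def[abs_def] by (rule word_lift_lin[OF W.vs multilin_sea])

lemma nea_lin: "nea \<in> lin_hom T W"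
  unfolding nea_def[abs_def] by (rule word_lift_lin[OF W.vs multilin_nea])

lemma sea_wd: "sea (wd w) = foldl (\<lambda>a y. a \<succ>\<^bsub>W\<^esub> i y) \<one>\<^bsub>W\<^esub> w"
  unfolding sea_def by (rule word_lift_wd[OF W.vs multilin_sea])

lemma nea_wd: "nea (wd w) = foldr (\<lambda>y a. (- 1) \<odot>\<^bsub>W\<^esub> (i y \<prec>\<^bsub>W\<^esub> a)) w \<one>\<^bsub>W\<^esub>"
  unfolding nea_def by (rule word_lift_wd[OF W.vs multilin_nea])

lemma sea_closed [simp]: "t \<in> carrier T \<Longrightarrow> sea t \<in> carrier W"
  by (rule lin_homD(1)[OF sea_lin])

lemma nea_closed [simp]: "t \<in> carrier T \<Longrightarrow> nea t \<in> carrier W"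
  by (rule lin_homD(1)[OF nea_lin])

lemma sea_one [simp]: "sea one_T = \<one>\<^bsub>W\<^esub>" and nea_one [simp]: "nea one_T = \<one>\<^bsub>W\<^esub>"
  by (simp_all add: sea_wd nea_wd)

lemma sea_snoc: assumes t: "t \<in> carrier T" shows "sea (snoc t y) = sea t \<succ>\<^bsub>W\<^esub> i y"
proof -
  have l: "(\<lambda>t. sea (snoc t y)) \<in> lin_hom T W"
    by (rule lin_hom_comp[OF sea_lin bilin_left[OF bilin_snoc _ lin_hom_id]]) simp
  show ?thesis
    by (rule T_lin_eqI[OF W.vs l bilin_left[OF W.bilin_succ i_closed sea_lin] _ t]) (simp add: sea_wd)
qed

lemma sea_letter: "sea (wd [x]) = i x"
  by (simp add: sea_wd W.one_succ)

lemma counit_sea: "w \<noteq> [] \<Longrightarrow> counit W (sea (wd w)) = 0"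
  using sea_snoc[of "wd (butlast w)" "last w"] by simp

text \<open>\<open>sea\<close> and \<open>nea\<close> are convolution inverse: the two halves of each product telescope.\<close>

lemma sea_nea_convolution:
  assumes t: "t \<in> carrier T"
  shows "Sw W (\<lambda>u v. sea u \<otimes>\<^bsub>W\<^esub> nea v) t = word_counit t \<odot>\<^bsub>W\<^esub> \<one>\<^bsub>W\<^esub>"
proof -
  have b: "bilin T T W (\<lambda>u v. sea u \<otimes>\<^bsub>W\<^esub> nea v)" by (rule bilin_arg[OF W.bilin_star sea_lin nea_lin])
  have l: "(\<lambda>t. word_counit t \<odot>\<^bsub>W\<^esub> \<one>\<^bsub>W\<^esub>) \<in> lin_hom T W"
    by (rule lin_hom_smult_left[OF W.vs word_counit_lin W.one_closed])
  show ?thesis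
  proof (rule T_lin_eqI[OF W.vs Sw_lin[OF W.vs b] l _ t])
    fix w
    show "Sw W (\<lambda>u v. sea u \<otimes>\<^bsub>W\<^esub> nea v) (wd w) = word_counit (wd w) \<odot>\<^bsub>W\<^esub> \<one>\<^bsub>W\<^esub>"
    proof (cases "w = []")
      case True
      then show ?thesis by (simp add: Sw_one[OF W.vs b] word_counit_wd)
    next
      case False
      then obtain m where m: "length w = Suc m" by (cases w) auto
      let ?S = "\<lambda>j. sea (wd (take j w))" and ?N = "\<lambda>j. nea (wd (drop j w))"
      \<comment> \<open>A nonempty word has a nonempty part on one side of each cut, so the counit
        term of the product vanishes.\<close>
      have split: "?S j \<otimes>\<^bsub>W\<^esub> ?N j = (?S j \<prec>\<^bsub>W\<^esub> ?N j) \<oplus>\<^bsub>W\<^esub> (?S j \<succ>\<^bsub>W\<^esub> ?N j)" for j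
      proof -
        have "counit W (?S j) * counit W (?N j) = 0"
        proof (cases "take j w = []")
          case True
          then have "drop j w \<noteq> []" using False by (metis append_take_drop_id append_Nil)
          then show ?thesis by (cases "drop j w") (auto simp: nea_wd lin_homD(1)[OF foldr_prec_lin])
        qed (simp add: counit_sea)
        then show ?thesis by (auto simp: W.star_eq)
      qed
      \<comment> \<open>The axiom (a \<succ> b) \<prec> c = a \<succ> (b \<prec> c) hands the letter
        at position j from the right factor to the left one, at the cost of the sign in
        \<open>nea\<close>.\<close>
      have shift: "?S j \<succ>\<^bsub>W\<^esub> ?N j = (- 1) \<odot>\<^bsub>W\<^esub> (?S (Suc j) \<prec>\<^bsub>W\<^esub> ?N (Suc j))" if "j \<le> m" for j
      proof -
        have j: "j < length w" using that m by simp
        have "?N j = (- 1) \<odot>\<^bsub>W\<^esub> (i (w ! j) \<prec>\<^bsub>W\<^esub> ?N (Suc j))"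
          using Cons_nth_drop_Suc[OF j, symmetric] by (simp add: nea_wd)
        moreover have "?S (Suc j) = ?S j \<succ>\<^bsub>W\<^esub> i (w ! j)"
          using j by (simp add: take_Suc_conv_app_nth sea_wd)
        ultimately show ?thesis by (simp add: W.succ_prec)
      qed
      have "Sw W (\<lambda>u v. sea u \<otimes>\<^bsub>W\<^esub> nea v) (wd w) =
          (\<Oplus>\<^bsub>W\<^esub>j\<in>{..Suc m}. (?S j \<prec>\<^bsub>W\<^esub> ?N j) \<oplus>\<^bsub>W\<^esub> (?S j \<succ>\<^bsub>W\<^esub> ?N j))"
        by (simp only: Sw_wd[OF W.vs b] m split)
      also have "\<dots> = (\<Oplus>\<^bsub>W\<^esub>j\<in>{..Suc m}. ?S j \<prec>\<^bsub>W\<^esub> ?N j) \<oplus>\<^bsub>W\<^esub> (\<Oplus>\<^bsub>W\<^esub>j\<in>{..Suc m}. ?S j \<succ>\<^bsub>W\<^esub> ?N j)"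
        by (rule vs_finsum_add[OF W.vs]) simp_all
      \<comment> \<open>The two end terms drop out, since 1 \<prec> a = 0 at the first cut and a
        \<succ> 1 = 0 at the last. After the shift the two sums are negatives of each other.\<close>
      also have "(\<Oplus>\<^bsub>W\<^esub>j\<in>{..Suc m}. ?S j \<prec>\<^bsub>W\<^esub> ?N j) = (\<Oplus>\<^bsub>W\<^esub>j\<in>{..m}. ?S (Suc j) \<prec>\<^bsub>W\<^esub> ?N (Suc j))"
        by (subst vs_finsum_Suc2[OF W.vs]) (simp_all add: vs_finsum_closed)
      also have "(\<Oplus>\<^bsub>W\<^esub>j\<in>{..Suc m}. ?S j \<succ>\<^bsub>W\<^esub> ?N j) = (\<Oplus>\<^bsub>W\<^esub>j\<in>{..m}. ?S j \<succ>\<^bsub>W\<^esub> ?N j)"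
        by (subst vs_finsum_Suc[OF W.vs]) (simp_all add: vs_finsum_closed m[symmetric])
      also have "\<dots> = (\<Oplus>\<^bsub>W\<^esub>j\<in>{..m}. (- 1) \<odot>\<^bsub>W\<^esub> (?S (Suc j) \<prec>\<^bsub>W\<^esub> ?N (Suc j)))"
        by (rule vs_finsum_cong[OF W.vs refl]) (simp_all add: shift)
      also have "\<dots> = (- 1) \<odot>\<^bsub>W\<^esub> (\<Oplus>\<^bsub>W\<^esub>j\<in>{..m}. ?S (Suc j) \<prec>\<^bsub>W\<^esub> ?N (Suc j))"
        by (rule vs_finsum_smult[OF W.vs]) simp_all
      finally show ?thesis using False by (simp add: word_counit_wd vs_finsum_closed)
    qed
  qed
qed

text \<open>The dendriform brace of x, extended linearly to words: \<open>nea\<close> carries the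
  sign, and the unit conventions absorb the two end terms of the alternating sum.\<close>

definition brc where "brc x t = Sw W (\<lambda>u v. (nea u \<succ>\<^bsub>W\<^esub> x) \<prec>\<^bsub>W\<^esub> sea v) t"

lemma brc_bilin: "x \<in> carrier W \<Longrightarrow> bilin T T W (\<lambda>u v. (nea u \<succ>\<^bsub>W\<^esub> x) \<prec>\<^bsub>W\<^esub> sea v)"
  by (rule bilin_arg[OF W.bilin_prec bilin_left[OF W.bilin_succ _ nea_lin] sea_lin])

lemma brc_lin: "x \<in> carrier W \<Longrightarrow> brc x \<in> lin_hom T W"
  unfolding brc_def[abs_def] by (rule Sw_lin[OF W.vs brc_bilin])

lemma brc_closed [simp]: "x \<in> carrier W \<Longrightarrow> t \<in> carrier T \<Longrightarrow> brc x t \<in> carrier W"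
  by (rule lin_homD(1)[OF brc_lin])

lemma counit_brc [simp]:
  assumes x: "x \<in> carrier W" and t: "t \<in> carrier T" shows "counit W (brc x t) = 0"
proof -
  have "counit W (brc x t) = Sw ground (\<lambda>u v. counit W ((nea u \<succ>\<^bsub>W\<^esub> x) \<prec>\<^bsub>W\<^esub> sea v)) t"
    unfolding brc_def by (rule Sw_comp[OF W.vs brc_bilin[OF x] vs_ground W.counit_lin t])
  also have "\<dots> = Sw ground (\<lambda>u v. \<zero>\<^bsub>ground\<^esub>) t"
    by (rule Sw_cong[OF _ vs_ground bilin_zero_map[OF vs_ground] t]) (use x in simp)
  finally show ?thesis using t by (simp only: Sw_zero[OF vs_ground]) simp
qed

lemma brc_one: "x \<in> carrier W \<Longrightarrow> counit W x = 0 \<Longrightarrow> brc x one_T = x"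
  unfolding brc_def by (simp add: Sw_one[OF W.vs brc_bilin] W.one_succ W.prec_one)

text \<open>Inserting the convolution identity in front of x gives the sum of ((sea t1 * nea t2)
  \<succ> x) \<prec> sea t3 over three consecutive parts of t. The axioms turn each term into sea t1
  \<succ> ((nea t2 \<succ> x) \<prec> sea t3), and coassociativity collects the last two parts into
  the brace. The assumption \<open>left\<close> is the left counit law, supplied by
  \<open>letters_prec_sea\<close>.\<close>

lemma prec_sea:
  assumes x: "x \<in> carrier W" and e: "counit W x = 0" and t: "t \<in> carrier T"
    and left: "Sw W (\<lambda>y z. word_counit y \<odot>\<^bsub>W\<^esub> (x \<prec>\<^bsub>W\<^esub> sea z)) t = x \<prec>\<^bsub>W\<^esub> sea t"
  shows "x \<prec>\<^bsub>W\<^esub> sea t = Sw W (\<lambda>u v. sea u \<succ>\<^bsub>W\<^esub> brc x v) t"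
proof -
  let ?F = "\<lambda>u v w. (((sea u \<otimes>\<^bsub>W\<^esub> nea v) \<succ>\<^bsub>W\<^esub> x) \<prec>\<^bsub>W\<^esub> sea w)"
  note L = bilinI bilin_left[OF W.bilin_star] bilin_right[OF W.bilin_star] bilin_left[OF W.bilin_prec] bilin_right[OF W.bilin_prec]
    bilin_left[OF W.bilin_succ] bilin_right[OF W.bilin_succ] sea_lin nea_lin
  have F: "trilin W ?F" unfolding trilin_def using x by (intro conjI ballI; intro L; auto)
  have b: "bilin T T W (\<lambda>u v. sea u \<otimes>\<^bsub>W\<^esub> nea v)" by (rule bilin_arg[OF W.bilin_star sea_lin nea_lin])
  have f: "(\<lambda>a. (a \<succ>\<^bsub>W\<^esub> x) \<prec>\<^bsub>W\<^esub> sea w) \<in> lin_hom W W" if "w \<in> carrier T" for w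
    using x that by (intro L lin_hom_id) auto
  have bl: "bilin T T W (\<lambda>y z. word_counit y \<odot>\<^bsub>W\<^esub> (x \<prec>\<^bsub>W\<^esub> sea z))"
    using x by (intro bilinI lin_hom_smult_left[OF W.vs] lin_hom_smult'[OF W.vs] word_counit_lin bilin_right[OF W.bilin_prec] sea_lin) auto
  have "x \<prec>\<^bsub>W\<^esub> sea t = Sw W (\<lambda>y z. word_counit y \<odot>\<^bsub>W\<^esub> (x \<prec>\<^bsub>W\<^esub> sea z)) t" by (rule left[symmetric])
  also have "\<dots> = Sw W (\<lambda>s w. Sw W (\<lambda>u v. ?F u v w) s) t"
  proof (rule Sw_cong[symmetric, OF _ W.vs bl t])
    fix s w assume s: "s \<in> carrier T" and w: "w \<in> carrier T"
    show "Sw W (\<lambda>u v. ?F u v w) s = word_counit s \<odot>\<^bsub>W\<^esub> (x \<prec>\<^bsub>W\<^esub> sea w)"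
      using Sw_comp[OF W.vs b W.vs f[OF w] s, symmetric] x w by (simp add: sea_nea_convolution[OF s] W.one_succ e)
  qed
  also have "\<dots> = Sw W (\<lambda>u s. Sw W (?F u) s) t" by (rule Sw_coassoc[symmetric, OF W.vs F t])
  also have "\<dots> = Sw W (\<lambda>u v. sea u \<succ>\<^bsub>W\<^esub> brc x v) t"
  proof (rule Sw_cong[symmetric, OF _ W.vs trilin_Sw(1)[OF W.vs F] t])
    fix u s assume u: "u \<in> carrier T" and s: "s \<in> carrier T"
    have "sea u \<succ>\<^bsub>W\<^esub> brc x s = Sw W (\<lambda>v w. sea u \<succ>\<^bsub>W\<^esub> ((nea v \<succ>\<^bsub>W\<^esub> x) \<prec>\<^bsub>W\<^esub> sea w)) s"
      unfolding brc_def by (rule Sw_comp[OF W.vs brc_bilin[OF x] W.vs bilin_right[OF W.bilin_succ _ lin_hom_id] s]) (use u in simp)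
    also have "\<dots> = Sw W (?F u) s"
      by (rule Sw_cong[OF _ W.vs _ s]) (use F u x in \<open>simp_all add: trilin_def flip: W.succ_prec W.succ_succ\<close>)
    finally show "sea u \<succ>\<^bsub>W\<^esub> brc x s = Sw W (?F u) s" .
  qed
  finally show ?thesis .
qed

end

lemma aug_hom_sea_nea:
  assumes l: "letters scale W i" and l': "letters scale W' i'" and f: "f \<in> aug_hom W W'"
    and fi: "\<And>x. f (i x) = i' x" and t: "t \<in> carrier (tensor_words scale)"
  shows "f (letters.sea W i t) = letters.sea W' i' t"
    and "f (letters.nea W i t) = letters.nea W' i' t"
    and "x \<in> carrier W \<Longrightarrow> f (letters.brc scale W i x t) = letters.brc scale W' i' (f x) t"
proof -
  interpret L: letters scale W i by fact
  interpret L': letters scale W' i' by fact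
  note F = aug_homD[OF f]
  have s: "f (L.sea t) = L'.sea t" if "t \<in> carrier (tensor_words scale)" for t
    by (rule L.T_lin_induct[OF L'.W.vs lin_hom_comp[OF F(1) L.sea_lin] L'.sea_lin _ _ that])
       (simp_all add: F fi L.sea_snoc L'.sea_snoc)
  have nw: "f (foldr (\<lambda>y a. (- 1) \<odot>\<^bsub>W\<^esub> (i y \<prec>\<^bsub>W\<^esub> a)) w \<one>\<^bsub>W\<^esub>) = foldr (\<lambda>y a. (- 1) \<odot>\<^bsub>W'\<^esub> (i' y \<prec>\<^bsub>W'\<^esub> a)) w \<one>\<^bsub>W'\<^esub>" for w
    by (induction w) (simp_all add: F fi lin_homD[OF F(1)] lin_homD(1)[OF L.foldr_prec_lin])
  have n: "f (L.nea t) = L'.nea t" if "t \<in> carrier (tensor_words scale)" for t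
    by (rule L.T_lin_eqI[OF L'.W.vs lin_hom_comp[OF F(1) L.nea_lin] L'.nea_lin _ that])
       (simp add: L.nea_wd L'.nea_wd nw)
  show "f (L.sea t) = L'.sea t" "f (L.nea t) = L'.nea t" using s n t by auto
  assume x: "x \<in> carrier W"
  have "f (L.brc x t) = L.Sw W' (\<lambda>u v. f ((L.nea u \<succ>\<^bsub>W\<^esub> x) \<prec>\<^bsub>W\<^esub> L.sea v)) t"
    unfolding L.brc_def by (rule L.Sw_comp[OF L.W.vs L.brc_bilin[OF x] L'.W.vs F(1) t])
  also have "\<dots> = L'.brc (f x) t"
    unfolding L'.brc_def by (rule L.Sw_cong[OF _ L'.W.vs L'.brc_bilin[OF F(6)[OF x]] t]) (simp add: F x s n)
  finally show "f (L.brc x t) = L'.brc (f x) t" .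
qed

section \<open>Dendriform braces of letters compared with the given brace\<close>

context brace_algebra
begin

lemma letters_prec_sea:
  assumes "letters scale W i" and x: "x \<in> carrier W" "counit W x = 0" and t: "t \<in> carrier T"
  shows "x \<prec>\<^bsub>W\<^esub> letters.sea W i t = Sw W (\<lambda>u v. letters.sea W i u \<succ>\<^bsub>W\<^esub> letters.brc scale W i x v) t"
proof -
  interpret L: letters scale W i by fact
  show ?thesis
    by (rule L.prec_sea[OF x t Sw_counit_left[OF L.W.vs bilin_right[OF L.W.bilin_prec x(1) L.sea_lin] t]])
qed

lemma letters_word_aug: "letters scale word_aug (\<lambda>x. wd [x])"
proof -
  have "(\<lambda>x. wd [x]) \<in> lin_hom V word_aug"
    using bilin_right[OF bilin_snoc wd_closed[of "[]"] lin_hom_id] by simp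
  moreover have "counit word_aug (wd [x]) = 0" for x by (simp add: word_counit_wd)
  ultimately show ?thesis
    using augmented_word_aug word_space_axioms by (simp add: letters_def letters_axioms_def)
qed

text \<open>A morphism to words recovers \<open>t\<close> from \<open>sea t\<close>; comparing the two expansions of \<open>x \<prec> sea t\<close>
  inductively identifies the dendriform brace with the given one.\<close>

lemma sea_word_aug:
  assumes "letters scale W i" and f: "f \<in> aug_hom W word_aug" and fi: "\<And>x. f (i x) = wd [x]" and t: "t \<in> carrier T"
  shows "f (letters.sea W i t) = t"
proof -
  interpret L: letters scale W i by fact
  note F = aug_homD[OF f]
  have l: "f \<in> lin_hom W T" using F(1) by simp
  have F': "f \<one>\<^bsub>W\<^esub> = one_T" "\<And>x y. x \<in> carrier W \<Longrightarrow> y \<in> carrier W \<Longrightarrow> f (x \<succ>\<^bsub>W\<^esub> y) = succ (f x) (f y)" using F by simp_all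
  show ?thesis
  proof (rule T_lin_induct[OF vsT lin_hom_comp[OF l L.sea_lin] lin_hom_id _ _ t])
    fix t y assume t: "t \<in> carrier T" and IH: "f (L.sea t) = t"
    show "f (L.sea (snoc t y)) = snoc t y"
      using t succ_snoc[OF t wd_closed, of "[]" y] by (simp add: L.sea_snoc F' fi IH)
  qed (simp add: F')
qed

lemma brc_word_aug:
  assumes "letters scale W i" and f: "f \<in> aug_hom W word_aug" and fi: "\<And>x. f (i x) = wd [x]"
  shows "f (letters.brc scale W i (i x) (wd ys)) = wd [brace x ys]"
proof -
  interpret L: letters scale W i by fact
  note F = aug_homD[OF f]
  have l: "f \<in> lin_hom W T" using F(1) by simp
  have F': "\<And>x y. x \<in> carrier W \<Longrightarrow> y \<in> carrier W \<Longrightarrow> f (x \<succ>\<^bsub>W\<^esub> y) = succ (f x) (f y)"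
    "\<And>x y. x \<in> carrier W \<Longrightarrow> y \<in> carrier W \<Longrightarrow> f (x \<prec>\<^bsub>W\<^esub> y) = prec (f x) (f y)"
    "\<And>x. x \<in> carrier W \<Longrightarrow> counit_T (f x) = counit W x" "\<And>x. x \<in> carrier W \<Longrightarrow> f x \<in> carrier T" using F by simp_all
  let ?c = "\<lambda>v. f (L.brc (i x) v)" and ?d = "\<lambda>v. wd [ev x v]"
  have cl: "?c \<in> lin_hom T T" by (rule lin_hom_comp[OF l L.brc_lin]) simp
  have dl: "?d \<in> lin_hom T T"
    using lin_hom_comp[OF bilin_right[OF bilin_snoc wd_closed[of "[]"] lin_hom_id] bilin_right[OF bilin_ev _ lin_hom_id, of x]] by simp
  have bc: "bilin T T T (\<lambda>u v. succ u (?c v))" by (rule bilin_arg[OF bilin_succ lin_hom_id cl])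
  have bd: "bilin T T T (\<lambda>u v. succ u (?d v))" by (rule bilin_arg[OF bilin_succ lin_hom_id dl])
  \<comment> \<open>Both sums equal f (i x \<prec> sea t): one expands it in W by
    \<open>letters_prec_sea\<close> and then applies f, the other expands x \<prec> t by the
    definition on words.\<close>
  have eq: "Sw T (\<lambda>u v. succ u (?c v)) t = Sw T (\<lambda>u v. succ u (?d v)) t" if t: "t \<in> carrier T" for t
  proof -
    have bs: "bilin T T W (\<lambda>u v. L.sea u \<succ>\<^bsub>W\<^esub> L.brc (i x) v)"
      by (rule bilin_arg[OF L.W.bilin_succ L.sea_lin L.brc_lin]) simp
    have be: "bilin T T T (\<lambda>u v. snoc (star one_T u) (ev x v))" by (intro lin_A) auto
    have "Sw T (\<lambda>u v. succ u (?c v)) t = Sw T (\<lambda>u v. f (L.sea u \<succ>\<^bsub>W\<^esub> L.brc (i x) v)) t"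
      by (rule Sw_cong[OF _ vsT bilin_comp[OF bs l] t]) (simp add: F' sea_word_aug[OF assms(1) f fi])
    also have "\<dots> = f (i x \<prec>\<^bsub>W\<^esub> L.sea t)"
      unfolding letters_prec_sea[OF assms(1) L.i_closed L.counit_i t] by (rule Sw_comp[symmetric, OF L.W.vs bs vsT l t])
    also have "\<dots> = prec (snoc one_T x) t" using t by (simp add: F' fi sea_word_aug[OF assms(1) f fi])
    also have "\<dots> = Sw T (\<lambda>u v. succ u (?d v)) t"
      unfolding prec_snoc[OF wd_closed t]
      by (rule Sw_cong[OF _ vsT bd t]) (use succ_snoc[OF _ wd_closed, of _ "[]"] in simp)
    finally show ?thesis .
  qed
  have "?c (wd ys) = ?d (wd ys)"
  proof (induction "length ys" arbitrary: ys rule: less_induct)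
    case less
    define p where "p j = succ (wd (take j ys)) (?c (wd (drop j ys)))" for j
    define q where "q j = succ (wd (take j ys)) (?d (wd (drop j ys)))" for j
    have pc: "p j \<in> carrier T" and qc: "q j \<in> carrier T" for j
      using lin_homD(1)[OF cl] by (simp_all add: p_def q_def)
    have e: "finsum T p {..length ys} = finsum T q {..length ys}"
      using eq[OF wd_closed, of ys] by (simp only: Sw_wd[OF vsT bc] Sw_wd[OF vsT bd] p_def[abs_def] q_def[abs_def])
    \<comment> \<open>The cut at 0 is the only one whose right part is all of ys. The remaining
      terms agree by the induction hypothesis and cancel.\<close>
    have "p 0 = q 0"
    proof (cases "length ys")
      case 0
      then show ?thesis using e vs_finsum_singleton[where f = p and i = 0, OF vsT pc] vs_finsum_singleton[where f = q and i = 0, OF vsT qc]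
        by simp
    next
      case (Suc m)
      have "(\<Oplus>\<^bsub>T\<^esub>j\<in>{..m}. p (Suc j)) = (\<Oplus>\<^bsub>T\<^esub>j\<in>{..m}. q (Suc j))"
        by (rule vs_finsum_cong[OF vsT refl qc]) (use less.hyps Suc in \<open>simp add: p_def q_def\<close>)
      moreover have "(\<Oplus>\<^bsub>T\<^esub>j\<in>{..m}. p (Suc j)) \<oplus>\<^bsub>T\<^esub> p 0 = (\<Oplus>\<^bsub>T\<^esub>j\<in>{..m}. q (Suc j)) \<oplus>\<^bsub>T\<^esub> q 0"
        using e unfolding Suc vs_finsum_Suc2[where f = p, OF vsT pc] vs_finsum_Suc2[where f = q, OF vsT qc] .
      moreover have "(\<Oplus>\<^bsub>T\<^esub>j\<in>{..m}. q (Suc j)) \<in> carrier T" by (rule vs_finsum_closed[OF vsT qc])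
      ultimately show ?thesis using vs_left_cancel[OF vsT _ pc qc] by metis
    qed
    \<comment> \<open>On elements of counit zero, 1 \<succ> a = a, so the left factor can be
      removed.\<close>
    then have "succ one_T (?c (wd ys)) = succ one_T (?d (wd ys))" by (simp add: p_def q_def)
    moreover have "counit_T (?c (wd ys)) = 0" "counit_T (?d (wd ys)) = 0" by (simp_all add: F' word_counit_wd)
    ultimately show ?case using lin_homD(1)[OF cl wd_closed, of ys] by (simp add: one_succ_T)
  qed
  then show ?thesis by simp
qed

subsection \<open>Braces of generators in a dendriform algebra\<close>

text \<open>If the dendriform braces of the letters are letters, then words span a subalgebra.\<close>

lemma sea_aug_hom:
  assumes "letters scale W j" and brc: "\<And>x t. t \<in> carrier T \<Longrightarrow> letters.brc scale W j (j x) t = j (ev x t)"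
  shows "letters.sea W j \<in> aug_hom word_aug W"
proof -
  interpret L: letters scale W j by fact
  note W = L.W.vs
  have sl: "L.sea \<in> lin_hom T W" by (rule L.sea_lin)
  \<comment> \<open>The braces are letters by assumption, so the convolution formula writes x
    \<prec> sea t through images of words ending in {x | t2}.\<close>
  have jp: "j x \<prec>\<^bsub>W\<^esub> L.sea t = Sw W (\<lambda>u v. L.sea u \<succ>\<^bsub>W\<^esub> j (ev x v)) t" if t: "t \<in> carrier T" for x t
  proof -
    have b: "bilin T T W (\<lambda>u v. L.sea u \<succ>\<^bsub>W\<^esub> L.brc (j x) v)"
      by (rule bilin_arg[OF L.W.bilin_succ L.sea_lin L.brc_lin]) simp
    show ?thesis
      unfolding letters_prec_sea[OF assms(1) L.i_closed L.counit_i t] by (rule Sw_cong[symmetric, OF _ W b t]) (simp add: brc)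
  qed
  \<comment> \<open>The defining sum of (t x) \<prec> s is mapped term by term. Multiplicativity at
    t and \<open>succ_succ\<close> pull out sea t, and \<open>jp\<close> recognises the remaining
    sum.\<close>
  have prec_step: "L.sea (prec (snoc t x) s) = L.sea (snoc t x) \<prec>\<^bsub>W\<^esub> L.sea s"
    if t: "t \<in> carrier T" and s: "s \<in> carrier T"
      and st: "\<And>s. s \<in> carrier T \<Longrightarrow> L.sea (star t s) = L.sea t \<otimes>\<^bsub>W\<^esub> L.sea s" for t s x
  proof -
    have b1: "bilin T T T (\<lambda>u v. snoc (star t u) (ev x v))" using t by (intro lin_A) auto
    have jl: "(\<lambda>v. j (ev x v)) \<in> lin_hom T W"
      by (rule lin_hom_comp[OF L.i_lin bilin_right[OF bilin_ev _ lin_hom_id]]) simp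
    have b2: "bilin T T W (\<lambda>u v. L.sea u \<succ>\<^bsub>W\<^esub> j (ev x v))"
      by (rule bilin_arg[OF L.W.bilin_succ L.sea_lin jl])
    have "L.sea (prec (snoc t x) s) = Sw W (\<lambda>u v. L.sea (snoc (star t u) (ev x v))) s"
      unfolding prec_snoc[OF t s] by (rule Sw_comp[OF vsT b1 W sl s])
    also have "\<dots> = Sw W (\<lambda>u v. L.sea t \<succ>\<^bsub>W\<^esub> (L.sea u \<succ>\<^bsub>W\<^esub> j (ev x v))) s"
      by (rule Sw_cong[OF _ W bilin_comp[OF b2 bilin_right[OF L.W.bilin_succ _ lin_hom_id]] s])
         (use t in \<open>simp_all add: L.sea_snoc st L.W.succ_succ\<close>)
    also have "\<dots> = L.sea t \<succ>\<^bsub>W\<^esub> (j x \<prec>\<^bsub>W\<^esub> L.sea s)"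
      unfolding jp[OF s] by (rule Sw_comp[symmetric, OF W b2 W bilin_right[OF L.W.bilin_succ _ lin_hom_id] s]) (use t in simp)
    also have "\<dots> = L.sea (snoc t x) \<prec>\<^bsub>W\<^esub> L.sea s" using t s by (simp add: L.sea_snoc L.W.succ_prec)
    finally show ?thesis .
  qed
  have cs: "counit W (L.sea (snoc t x)) = 0" if "t \<in> carrier T" for t x using that by (simp add: L.sea_snoc)
  \<comment> \<open>Nested inductions as in \<open>decon_star\<close>: \<open>prec_step\<close>
    needs all right factors for the shorter left word, the \<succ> part needs the shorter right
    factor.\<close>
  have words: "L.sea (star (wd w) s) = L.sea (wd w) \<otimes>\<^bsub>W\<^esub> L.sea s" if "s \<in> carrier T" for w s
    using that
  proof (induction w arbitrary: s rule: rev_induct)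
    case (snoc x w)
    let ?t = "snoc (wd w) x"
    have l: "(\<lambda>s. L.sea (star ?t s)) \<in> lin_hom T W" "(\<lambda>s. L.sea ?t \<otimes>\<^bsub>W\<^esub> L.sea s) \<in> lin_hom T W"
      by (rule lin_hom_comp[OF sl star_lin], simp, rule bilin_right[OF L.W.bilin_star _ sl], simp del: snoc_wd)
    show ?case unfolding wd_snoc
    proof (rule T_lin_induct[OF W l _ _ snoc.prems])
      fix s y assume s: "s \<in> carrier T" and IH: "L.sea (star ?t s) = L.sea ?t \<otimes>\<^bsub>W\<^esub> L.sea s"
      have "star ?t (snoc s y) = prec ?t (snoc s y) \<oplus>\<^bsub>T\<^esub> snoc (star ?t s) y"
        by (rule star_snoc_snoc[OF wd_closed s])
      then have "L.sea (star ?t (snoc s y)) = L.sea (prec ?t (snoc s y)) \<oplus>\<^bsub>W\<^esub> L.sea (snoc (star ?t s) y)"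
        using s by (simp add: lin_homD(2)[OF sl] del: snoc_wd)
      also have "\<dots> = (L.sea ?t \<prec>\<^bsub>W\<^esub> L.sea (snoc s y)) \<oplus>\<^bsub>W\<^esub> (L.sea ?t \<succ>\<^bsub>W\<^esub> L.sea (snoc s y))"
        using s prec_step[OF wd_closed snoc_closed[OF s] snoc.IH] by (simp add: L.sea_snoc[OF star_closed] IH L.sea_snoc[OF s] L.W.succ_succ del: snoc_wd)
      also have "\<dots> = L.sea ?t \<otimes>\<^bsub>W\<^esub> L.sea (snoc s y)"
        using s by (subst L.W.star_eq) (simp_all add: cs del: snoc_wd)
      finally show "L.sea (star ?t (snoc s y)) = L.sea ?t \<otimes>\<^bsub>W\<^esub> L.sea (snoc s y)" .
    qed (simp del: snoc_wd)
  qed simp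
  have star: "L.sea (star t s) = L.sea t \<otimes>\<^bsub>W\<^esub> L.sea s" if t: "t \<in> carrier T" and s: "s \<in> carrier T" for t s
    by (rule T_lin_eqI[OF W lin_hom_comp[OF sl bilin_left[OF bilin_star s lin_hom_id]]
          bilin_left[OF L.W.bilin_star L.sea_closed[OF s] sl] words[OF s] t])
  have p: "L.sea (prec t s) = L.sea t \<prec>\<^bsub>W\<^esub> L.sea s" if t: "t \<in> carrier T" and s: "s \<in> carrier T" for t s
    by (rule T_lin_cases[OF W lin_hom_comp[OF sl bilin_left[OF bilin_prec s lin_hom_id]]
          bilin_left[OF L.W.bilin_prec L.sea_closed[OF s] sl] _ _ t])
       (use s star prec_step in \<open>simp_all add: lin_hom_zero[OF vsT W sl]\<close>)
  have q: "L.sea (succ t s) = L.sea t \<succ>\<^bsub>W\<^esub> L.sea s" if t: "t \<in> carrier T" and s: "s \<in> carrier T" for t s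
    by (rule T_lin_cases[OF W lin_hom_comp[OF sl bilin_right[OF bilin_succ t lin_hom_id]]
          bilin_right[OF L.W.bilin_succ L.sea_closed[OF t] sl] _ _ s])
       (use t star in \<open>simp_all add: lin_hom_zero[OF vsT W sl] succ_snoc L.sea_snoc L.W.succ_succ\<close>)
  have c: "counit W (L.sea t) = counit_T t" if t: "t \<in> carrier T" for t
    by (rule T_lin_cases[OF vs_ground lin_hom_comp[OF L.W.counit_lin sl] word_counit_lin _ _ t]) (simp_all add: cs)
  show ?thesis using sl p q c by (simp add: aug_hom_def)
qed

end

text \<open>The summation index is the position of the cut, and the sign (-1)^k is the one carried
  by \<open>nea\<close> on the first k letters.\<close>

lemma dend_brace_eq_brc:
  assumes A: "dendriform_algebra A" and "letters scale (uaug A) (\<lambda>x. (0, g x))" and ys: "ys \<noteq> []"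
  shows "(0, dend_brace A (g x) (map g ys)) = letters.brc scale (uaug A) (\<lambda>x. (0, g x)) (0, g x) (word scale ys)"
proof -
  interpret L: letters scale "uaug A" "\<lambda>x. (0, g x)" by fact
  note D = dendriform_algebraD[OF A]
  note v = D(1)
  have gc: "g x \<in> carrier A" for x using L.i_closed[of x] by simp
  note ops = bilinD[OF D(2)] bilinD[OF D(3)] bilin_zero[OF D(2) v v v] bilin_zero[OF D(3) v v v]
  have sw: "(foldl (dsucc A) a (map g w)) \<in> carrier A \<and> foldl (\<lambda>a y. a \<succ>\<^bsub>uaug A\<^esub> (0, g y)) (0, a) w = (0, foldl (dsucc A) a (map g w))"
    if "a \<in> carrier A" for a w
    using that by (induction w arbitrary: a) (simp_all add: v gc ops)
  have S: "L.sea (word scale w) = (0, searrow A (map g w))" "searrow A (map g w) \<in> carrier A" if "w \<noteq> []" for w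
    using that sw[OF gc, of "hd w" "tl w"] by (cases w; simp add: L.sea_wd searrow_def v gc ops)+
  have N: "nearrow A (map g w) \<in> carrier A \<and> L.nea (word scale w) = (0, (- 1) ^ length w \<odot>\<^bsub>A\<^esub> nearrow A (map g w))"
    if "w \<noteq> []" for w
    using that
  proof (induction w rule: induct_list012)
    case (3 x y zs)
    let ?w = "y # zs"
    have "L.nea (word scale (x # ?w)) = (- 1) \<odot>\<^bsub>uaug A\<^esub> ((0, g x) \<prec>\<^bsub>uaug A\<^esub> L.nea (word scale ?w))"
      by (simp only: L.nea_wd foldr.simps comp_def)
    then show ?case using 3 by (simp add: v gc ops)
  qed (auto simp: L.nea_wd v gc ops)
  let ?n = "length ys"
  let ?d = "\<lambda>k. (- 1) ^ k \<odot>\<^bsub>A\<^esub> (let l = (if k = 0 then g x else nearrow A (take k (map g ys)) \<succ>\<^bsub>A\<^esub> g x)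
      in if k = ?n then l else l \<prec>\<^bsub>A\<^esub> searrow A (drop k (map g ys)))"
  \<comment> \<open>The case distinctions at k = 0 and k = n in the definition of the brace
    correspond to an empty part of the cut, where 1 \<succ> x = x and x \<prec> 1 = x.\<close>
  have t: "(L.nea (word scale (take k ys)) \<succ>\<^bsub>uaug A\<^esub> (0, g x)) \<prec>\<^bsub>uaug A\<^esub> L.sea (word scale (drop k ys)) = (0, ?d k) \<and> ?d k \<in> carrier A"
    if k: "k \<le> ?n" for k
  proof -
    have 1: "L.nea (word scale (take k ys)) \<succ>\<^bsub>uaug A\<^esub> (0, g x) =
        (0, (- 1) ^ k \<odot>\<^bsub>A\<^esub> (if k = 0 then g x else nearrow A (take k (map g ys)) \<succ>\<^bsub>A\<^esub> g x)) \<and>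
        (if k = 0 then g x else nearrow A (take k (map g ys)) \<succ>\<^bsub>A\<^esub> g x) \<in> carrier A"
    proof (cases "k = 0")
      case True
      then show ?thesis by (simp add: v gc ops)
    next
      case False
      then have "take k ys \<noteq> []" using ys by simp
      then show ?thesis using N[of "take k ys"] False k by (simp add: v gc ops take_map min_absorb2)
    qed
    show ?thesis
    proof (cases "k = ?n")
      case True
      then show ?thesis using 1 by (simp add: v gc ops Let_def)
    next
      case False
      then have "drop k ys \<noteq> []" using k by simp
      then show ?thesis using S[of "drop k ys"] 1 False by (simp add: v gc ops Let_def drop_map)
    qed
  qed
  have "(0, dend_brace A (g x) (map g ys)) = (\<lambda>d. (0, d)) (\<Oplus>\<^bsub>A\<^esub>k\<in>{..?n}. ?d k)"
    by (simp add: dend_brace_def)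
  also have "\<dots> = (\<Oplus>\<^bsub>uaug A\<^esub>k\<in>{..?n}. (0, ?d k))"
    by (rule lin_hom_finsum[OF v L.W.vs]) (use t v in \<open>auto intro!: lin_homI\<close>)
  also have "\<dots> = (\<Oplus>\<^bsub>uaug A\<^esub>k\<in>{..?n}. (L.nea (word scale (take k ys)) \<succ>\<^bsub>uaug A\<^esub> (0, g x)) \<prec>\<^bsub>uaug A\<^esub> L.sea (word scale (drop k ys)))"
    by (rule vs_finsum_cong[OF L.W.vs refl, symmetric]) (use t in auto)
  also have "\<dots> = L.brc (0, g x) (word scale ys)"
    unfolding L.brc_def by (rule L.Sw_wd[symmetric, OF L.W.vs L.brc_bilin]) (use gc in simp)
  finally show ?thesis .
qed

section \<open>The enveloping algebra\<close>

lemma tensor_map_tensor_map: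
  assumes M: "vs M" and N: "vs N" and P: "vs P" and f: "f \<in> lin_hom M N" and g: "g \<in> lin_hom N P"
    and h: "h \<in> lin_hom M P" and eq: "\<And>x. x \<in> carrier M \<Longrightarrow> g (f x) = h x" and t: "t \<in> carrier (tensor M M)"
  shows "tensor_map P P g g (tensor_map N N f f t) = tensor_map P P h h t"
  by (rule tensor_lin_eqI[OF M M vs_tensor[OF P P] lin_hom_comp[OF tensor_map_lin_hom[OF N N P P g g] tensor_map_lin_hom[OF M M N N f f]]
        tensor_map_lin_hom[OF M M P P h h] _ t])
     (simp add: tensor_map_pure[OF M M N N f f] tensor_map_pure[OF N N P P g g] tensor_map_pure[OF M M P P h h] lin_homD(1)[OF f] eq)

lemma tensor_map_id:
  assumes M: "vs M" and t: "t \<in> carrier (tensor M M)"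
  shows "tensor_map M M (\<lambda>x. x) (\<lambda>x. x) t = t"
  by (rule tensor_lin_eqI[OF M M vs_tensor[OF M M] tensor_map_lin_hom[OF M M M M lin_hom_id lin_hom_id] lin_hom_id _ t])
     (simp add: tensor_map_pure[OF M M M M lin_hom_id lin_hom_id])

context brace_algebra
begin

abbreviation (input) "D \<equiv> free_dend scale"
abbreviation (input) "\<iota> \<equiv> free_dend_in scale"
abbreviation (input) "J \<equiv> env_ideal scale brace"
abbreviation (input) "U \<equiv> env scale brace"
abbreviation (input) "\<pi> \<equiv> env1_proj scale brace"

lemma letters_free_dend: "letters scale (uaug D) (\<lambda>x. (0, \<iota> x))"
proof -
  have "(\<lambda>x. (0, \<iota> x)) \<in> lin_hom V (uaug D)"
    by (rule lin_homI) (use lin_homD[OF free_dend_in_lin[of scale]] free_dend_facts(1)[of scale] in auto)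
  then show ?thesis
    using augmented_uaug[OF dendriform_free_dend] word_space_axioms by (simp add: letters_def letters_axioms_def)
qed

definition brace_gens where
  "brace_gens = {dend_brace D (\<iota> x) (map \<iota> ys) \<ominus>\<^bsub>D\<^esub> \<iota> (brace x ys) | x ys. ys \<noteq> []}"

lemma env_ideal_eq: "J = dend_ideal_gen D brace_gens"
  by (simp add: env_ideal_def brace_gens_def Let_def)

lemma \<iota>_closed [simp]: "\<iota> x \<in> carrier D"
  using lin_homD(1)[OF free_dend_in_lin[of scale]] by simp

lemma dend_brace_closed: assumes "ys \<noteq> []" shows "dend_brace D (\<iota> x) (map \<iota> ys) \<in> carrier D"
proof -
  interpret L: letters scale "uaug D" "\<lambda>x. (0, \<iota> x)" by (rule letters_free_dend)
  have "(0, dend_brace D (\<iota> x) (map \<iota> ys)) \<in> carrier (uaug D)"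
    unfolding dend_brace_eq_brc[OF dendriform_free_dend letters_free_dend assms] by (rule L.brc_closed) simp_all
  then show ?thesis by simp
qed

lemmas D_facts = dendriform_algebraD[OF dendriform_free_dend[of scale]]

lemma env_dend_ideal: "dend_ideal D J"
  unfolding env_ideal_eq
  by (rule dend_ideal_gen_ideal[OF D_facts(1-3)]) (auto simp: brace_gens_def dend_brace_closed vs_diff_eq D_facts(1))

lemmas env_facts = dend_quot_proj[OF D_facts(1-3) env_dend_ideal, folded env_def]
  carrier_dend_quot[OF D_facts(1-3) env_dend_ideal, folded env_def]
  dend_quot_ops[OF D_facts(1-3) env_dend_ideal, folded env_def]
  dend_quot_proj_zero_iff[OF D_facts(1-3) env_dend_ideal, folded env_def]

lemma dendriform_env: "dendriform_algebra U"
  unfolding env_def by (rule dendriform_dend_quot[OF D_facts(1-3) env_dend_ideal]) (simp_all only: D_facts(4-6))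

lemma env1_proj_hom: "\<pi> \<in> aug_hom (uaug D) (uaug U)"
proof -
  note p = lin_homD[OF env_facts(1)] lin_hom_zero[OF D_facts(1) dendriform_algebraD(1)[OF dendriform_env] env_facts(1)]
  have v: "vs D" by (rule D_facts(1))
  have ops: "x \<prec>\<^bsub>D\<^esub> y \<in> carrier D" "x \<succ>\<^bsub>D\<^esub> y \<in> carrier D" if "x \<in> carrier D" "y \<in> carrier D" for x y
    using bilinD(1)[OF D_facts(2) that] bilinD(1)[OF D_facts(3) that] by auto
  have "\<pi> \<in> lin_hom (uaug D) (uaug U)"
    by (rule lin_homI) (auto simp: env1_proj_def p)
  moreover have "\<pi> (x \<prec>\<^bsub>uaug D\<^esub> y) = \<pi> x \<prec>\<^bsub>uaug U\<^esub> \<pi> y \<and> \<pi> (x \<succ>\<^bsub>uaug D\<^esub> y) = \<pi> x \<succ>\<^bsub>uaug U\<^esub> \<pi> y"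
    if "x \<in> carrier (uaug D)" "y \<in> carrier (uaug D)" for x y
    using that by (auto simp: env1_proj_def p v ops env_facts(3,4))
  ultimately show ?thesis by (auto simp: aug_hom_def env1_proj_def p(4))
qed

lemma env1_in_eq: "env1_in scale brace = (\<lambda>x. \<pi> (0, \<iota> x))"
  by (rule ext) (simp add: env1_in_def)

lemma letters_env: "letters scale (uaug U) (env1_in scale brace)"
proof -
  interpret L: letters scale "uaug D" "\<lambda>x. (0, \<iota> x)" by (rule letters_free_dend)
  have "env1_in scale brace \<in> lin_hom V (uaug U)"
    unfolding env1_in_eq by (rule lin_hom_comp[OF aug_homD(1)[OF env1_proj_hom] L.i_lin])
  moreover have "counit (uaug U) (env1_in scale brace x) = 0" for x
    by (simp add: env1_in_eq env1_proj_def)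
  ultimately show ?thesis
    using augmented_uaug[OF dendriform_env] word_space_axioms by (simp add: letters_def letters_axioms_def)
qed

text \<open>On a nonempty word this is a defining relation of U(B), carried over from D(B) by the
  compatibility of \<open>brc\<close> with morphisms; on the empty word it is {x | } = x.\<close>

lemma brc_env:
  assumes t: "t \<in> carrier T"
  shows "letters.brc scale (uaug U) (env1_in scale brace) (env1_in scale brace x) t = env1_in scale brace (ev x t)"
proof -
  interpret LD: letters scale "uaug D" "\<lambda>x. (0, \<iota> x)" by (rule letters_free_dend)
  interpret LU: letters scale "uaug U" "env1_in scale brace" by (rule letters_env)
  have evl: "ev x \<in> lin_hom T V" by (rule bilin_right[OF bilin_ev _ lin_hom_id]) simp
  show ?thesis
  proof (rule T_lin_eqI[OF LU.W.vs LU.brc_lin lin_hom_comp[OF LU.i_lin evl] _ t])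
    fix ys
    show "LU.brc (env1_in scale brace x) (wd ys) = env1_in scale brace (ev x (wd ys))"
    proof (cases "ys = []")
      case True
      then show ?thesis using LU.brc_one[OF LU.i_closed LU.counit_i] by simp
    next
      case False
      let ?d = "dend_brace D (\<iota> x) (map \<iota> ys)" and ?e = "\<iota> (brace x ys)"
      have "?d \<ominus>\<^bsub>D\<^esub> ?e \<in> J"
        unfolding env_ideal_eq using dend_ideal_gen_superset[of brace_gens D] False by (auto simp: brace_gens_def)
      then have m: "?d \<oplus>\<^bsub>D\<^esub> (- 1) \<odot>\<^bsub>D\<^esub> ?e \<in> J" by (simp add: vs_diff_eq[OF D_facts(1)] dend_brace_closed False)
      have sub: "submodule J ground D" using env_dend_ideal by (simp add: dend_ideal_def)
      have "\<pi> (0, ?d) = \<pi> (0, ?e)"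
        using coset_eq_iff[OF D_facts(1) sub, of ?d ?e] m by (simp add: env1_proj_def dend_brace_closed False)
      moreover have "\<pi> (0, ?d) = LU.brc (env1_in scale brace x) (wd ys)"
        unfolding dend_brace_eq_brc[OF dendriform_free_dend letters_free_dend False]
        using aug_hom_sea_nea(3)[OF letters_free_dend letters_env env1_proj_hom _ wd_closed LD.i_closed, of x ys]
        by (simp add: env1_in_eq)
      ultimately show ?thesis by (metis env1_in_def ev_wd)
    qed
  qed (rule LU.i_closed)
qed

section \<open>The two morphisms between words and the enveloping algebra\<close>

abbreviation (input) "\<theta> \<equiv> letters.sea (uaug U) (env1_in scale brace)"

lemma \<theta>_hom: "\<theta> \<in> aug_hom word_aug (uaug U)"
  by (rule sea_aug_hom[OF letters_env brc_env])

text \<open>The morphism from the free algebra sends the dendriform brace of letters to the given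
  brace by \<open>brc_word_aug\<close>. Its kernel is a dendriform ideal that contains the
  generators of \<open>J\<close>, so it factors through U(B).\<close>

lemma env_to_words:
  obtains \<Phi> \<phi> where "\<Phi> \<in> aug_hom (uaug D) word_aug" "\<And>x. \<Phi> (0, \<iota> x) = wd [x]"
    "\<phi> \<in> aug_hom (uaug U) word_aug" "\<And>d. d \<in> carrier (uaug D) \<Longrightarrow> \<phi> (\<pi> d) = \<Phi> d"
proof -
  interpret L: letters scale "uaug D" "\<lambda>x. (0, \<iota> x)" by (rule letters_free_dend)
  interpret LT: letters scale word_aug "\<lambda>x. wd [x]" by (rule letters_word_aug)
  obtain \<Phi> where \<Phi>: "\<Phi> \<in> aug_hom (uaug D) word_aug" and \<Phi>i: "\<And>x. \<Phi> (0, \<iota> x) = wd [x]"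
    using free_dend_lift[OF augmented_word_aug LT.i_lin LT.counit_i] by metis
  note F = aug_homD[OF \<Phi>]
  let ?f = "\<lambda>x. \<Phi> (0, x)"
  have zl: "(\<lambda>x. (0, x)) \<in> lin_hom D (uaug D)" by (rule lin_homI) simp_all
  have fl: "?f \<in> lin_hom D T" using lin_hom_comp[OF F(1) zl] by simp
  note v = D_facts(1) and ops = bilinD(1)[OF D_facts(2)] bilinD(1)[OF D_facts(3)]
  have fp: "?f (x \<prec>\<^bsub>D\<^esub> y) = prec (?f x) (?f y)" "?f (x \<succ>\<^bsub>D\<^esub> y) = succ (?f x) (?f y)" if "x \<in> carrier D" "y \<in> carrier D" for x y
    using F(4,5)[of "(0, x)" "(0, y)"] that v ops by simp_all
  have ker: "dend_ideal D {x \<in> carrier D. ?f x = \<zero>\<^bsub>T\<^esub>}"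
    by (rule dend_ideal_kernel[OF v vsT fl D_facts(2,3) bilin_prec bilin_succ fp])
  have "brace_gens \<subseteq> {x \<in> carrier D. ?f x = \<zero>\<^bsub>T\<^esub>}"
  proof
    fix z assume "z \<in> brace_gens"
    then obtain x ys where z: "z = dend_brace D (\<iota> x) (map \<iota> ys) \<ominus>\<^bsub>D\<^esub> \<iota> (brace x ys)" and ys: "ys \<noteq> []"
      by (auto simp: brace_gens_def)
    note c = dend_brace_closed[OF ys, of x]
    have "?f (dend_brace D (\<iota> x) (map \<iota> ys)) = wd [brace x ys]"
      unfolding dend_brace_eq_brc[OF dendriform_free_dend letters_free_dend ys]
      by (rule brc_word_aug[OF letters_free_dend \<Phi> \<Phi>i])
    then show "z \<in> {x \<in> carrier D. ?f x = \<zero>\<^bsub>T\<^esub>}"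
      using c v by (simp add: z vs_diff_eq lin_homD(2,3)[OF fl] \<Phi>i)
  qed
  then have k: "n \<in> J \<Longrightarrow> ?f n = \<zero>\<^bsub>T\<^esub>" for n
    using dend_ideal_gen_least[OF ker] unfolding env_ideal_eq by blast
  obtain h where h: "h \<in> lin_hom U T" and hp: "\<And>x. x \<in> carrier D \<Longrightarrow> h (J +>\<^bsub>D\<^esub> x) = ?f x"
    using dend_quot_lift[OF D_facts(1-3) env_dend_ideal vsT fl k, folded env_def] by blast
  let ?\<phi> = "\<lambda>(a, x). a \<odot>\<^bsub>word_aug\<^esub> \<one>\<^bsub>word_aug\<^esub> \<oplus>\<^bsub>word_aug\<^esub> h x"
  have \<phi>: "?\<phi> \<in> aug_hom (uaug U) word_aug"
  proof (rule unital_extension[OF dendriform_env augmented_word_aug])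
    show "h \<in> lin_hom U word_aug" using h by simp
    show "counit word_aug (h x) = 0" if "x \<in> carrier U" for x
      using that F(3) by (auto simp: env_facts(2) hp)
  qed (use ops in \<open>auto simp: env_facts(2-4) hp fp\<close>)
  have "?\<phi> (\<pi> d) = \<Phi> d" if d: "d \<in> carrier (uaug D)" for d
  proof -
    obtain a x where ax: "d = (a, x)" "x \<in> carrier D" using d by auto
    have o: "\<one>\<^bsub>uaug D\<^esub> \<in> carrier (uaug D)" "(0, x) \<in> carrier (uaug D)" using ax v by simp_all
    have "d = a \<odot>\<^bsub>uaug D\<^esub> \<one>\<^bsub>uaug D\<^esub> \<oplus>\<^bsub>uaug D\<^esub> (0, x)" using ax v by simp
    then have "\<Phi> d = a \<odot>\<^bsub>T\<^esub> one_T \<oplus>\<^bsub>T\<^esub> ?f x"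
      using lin_homD(2)[OF F(1) vs_smult_closed[OF L.W.vs o(1)] o(2), of a] lin_homD(3)[OF F(1) o(1), of a] F(2) by simp
    then show ?thesis using ax by (simp add: env1_proj_def hp)
  qed
  then show ?thesis using that \<Phi> \<Phi>i \<phi> by blast
qed

section \<open>Transport of the coproduct\<close>

lemma deconcatenation_letter: "\<Delta> (wd [x]) = pt (wd [x]) one_T \<oplus>\<^bsub>TT\<^esub> pt one_T (wd [x])"
proof -
  have b: "bilin T T TT (\<lambda>u v. pt u (snoc v x))" by (rule bilin_arg[OF bilin_pure[OF vsT vsT] lin_hom_id snoc_lin])
  have "\<Delta> (wd [x]) = pt one_T (wd [x]) \<oplus>\<^bsub>TT\<^esub> pt (wd [x]) one_T"
    using decon_snoc[OF wd_closed, of "[]" x] by (simp add: Sw_one[OF vsTT b])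
  also have "\<dots> = pt (wd [x]) one_T \<oplus>\<^bsub>TT\<^esub> pt one_T (wd [x])" by (rule vs_comm[OF vsTT]) simp_all
  finally show ?thesis .
qed

text \<open>The induced coproduct is the common value of a map over a fibre of \<pi>. For each d in
  the fibre the value is recovered, through the inverse \<theta>, from its image in words, and that
  image is the deconcatenation of \<phi> u, the same for all d.\<close>

lemma env1_coproduct_eq:
  assumes \<Phi>: "\<Phi> \<in> aug_hom (uaug D) word_aug" and \<Phi>i: "\<And>x. \<Phi> (0, \<iota> x) = wd [x]"
    and \<phi>: "\<phi> \<in> aug_hom (uaug U) word_aug" and \<phi>\<pi>: "\<And>d. d \<in> carrier (uaug D) \<Longrightarrow> \<phi> (\<pi> d) = \<Phi> d"
    and inv: "\<And>u. u \<in> carrier (uaug U) \<Longrightarrow> \<theta> (\<phi> u) = u" and u: "u \<in> carrier (uaug U)"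
  shows "env1_coproduct scale brace u = tensor_map (uaug U) (uaug U) \<theta> \<theta> (\<Delta> (\<phi> u))"
proof -
  interpret LD: letters scale "uaug D" "\<lambda>x. (0, \<iota> x)" by (rule letters_free_dend)
  interpret LU: letters scale "uaug U" "env1_in scale brace" by (rule letters_env)
  let ?\<Delta> = "free_dend_coproduct scale"
  have vsp: "vector_space scale" by unfold_locales
  note \<Delta> = free_dend_coproduct(1)[OF vsp]
  have \<Delta>l: "?\<Delta> \<in> lin_hom (uaug D) (tensor (uaug D) (uaug D))" using aug_homD(1)[OF \<Delta>] by simp
  note vD = LD.W.vs and vU = LU.W.vs
  have \<Phi>l: "\<Phi> \<in> lin_hom (uaug D) T" and \<phi>l: "\<phi> \<in> lin_hom (uaug U) T" and \<theta>l: "\<theta> \<in> lin_hom T (uaug U)"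
    using aug_homD(1)[OF \<Phi>] aug_homD(1)[OF \<phi>] aug_homD(1)[OF \<theta>_hom] by simp_all
  have \<pi>l: "\<pi> \<in> lin_hom (uaug D) (uaug U)" by (rule aug_homD(1)[OF env1_proj_hom])
  have \<Phi>1: "\<Phi> \<one>\<^bsub>uaug D\<^esub> = one_T" using aug_homD(2)[OF \<Phi>] by simp
  have prim: "?\<Delta> (0, \<iota> x) = pure_tensor (uaug D) (uaug D) (0, \<iota> x) \<one>\<^bsub>uaug D\<^esub> \<oplus>\<^bsub>tensor (uaug D) (uaug D)\<^esub>
      pure_tensor (uaug D) (uaug D) \<one>\<^bsub>uaug D\<^esub> (0, \<iota> x)" for x
    using free_dend_coproduct(2)[OF vsp, of x] unfolding primitive_def unital_space uaug_ops by blast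
  \<comment> \<open>Both composites are morphisms from the free algebra into the tensor square of
    words, and on generators both give the primitive expression.\<close>
  have comm: "tensor_map T T \<Phi> \<Phi> (?\<Delta> d) = \<Delta> (\<Phi> d)" if d: "d \<in> carrier (uaug D)" for d
  proof (rule free_dend_hom_eqI[where x = d, OF augmented_tensor[OF augmented_word_aug augmented_word_aug] _ _ _ d])
    show "(\<lambda>d. \<Delta> (\<Phi> d)) \<in> aug_hom (uaug D) (aug_tensor word_aug word_aug)"
      by (rule aug_hom_comp[OF \<Phi> deconcatenation_aug_hom])
    have tm: "tensor_map word_aug word_aug \<Phi> \<Phi> = tensor_map T T \<Phi> \<Phi>" by (simp add: tensor_map_def)
    show "(\<lambda>d. tensor_map T T \<Phi> \<Phi> (?\<Delta> d)) \<in> aug_hom (uaug D) (aug_tensor word_aug word_aug)"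
      using aug_hom_comp[OF \<Delta> aug_tensor_map[OF LD.W.augmented_axioms LD.W.augmented_axioms augmented_word_aug augmented_word_aug \<Phi> \<Phi>]]
      unfolding tm .
    fix x
    note ic = LD.i_closed[of x] and oc = LD.W.one_closed
    show "tensor_map T T \<Phi> \<Phi> (?\<Delta> (0, \<iota> x)) = \<Delta> (\<Phi> (0, \<iota> x))"
      using ic oc deconcatenation_letter[of x] unfolding prim
      by (simp add: lin_homD(2)[OF tensor_map_lin_hom[OF vD vD vsT vsT \<Phi>l \<Phi>l]] tensor_map_pure[OF vD vD vsT vsT \<Phi>l \<Phi>l]
          pure_closed[OF vD vD] \<Phi>1 \<Phi>i del: uaug_simps)
  qed
  \<comment> \<open>The value is pushed to words by \<phi> and back by \<theta>; on tensors this
    round trip is the identity because \<theta> inverts \<phi>.\<close>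
  have fib: "tensor_map (uaug U) (uaug U) \<pi> \<pi> (?\<Delta> d) = tensor_map (uaug U) (uaug U) \<theta> \<theta> (\<Delta> (\<phi> u))"
    if d: "d \<in> carrier (uaug D)" and du: "\<pi> d = u" for d
  proof -
    let ?X = "tensor_map (uaug U) (uaug U) \<pi> \<pi> (?\<Delta> d)"
    have dc: "?\<Delta> d \<in> carrier (tensor (uaug D) (uaug D))" by (rule lin_homD(1)[OF \<Delta>l d])
    have Xc: "?X \<in> carrier (tensor (uaug U) (uaug U))" by (rule tensor_map_closed[OF vD vD vU vU \<pi>l \<pi>l dc])
    have "tensor_map T T \<phi> \<phi> ?X = tensor_map T T \<Phi> \<Phi> (?\<Delta> d)"
      by (rule tensor_map_tensor_map[OF vD vU vsT \<pi>l \<phi>l \<Phi>l \<phi>\<pi> dc])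
    also have "\<dots> = \<Delta> (\<phi> u)" using comm[OF d] \<phi>\<pi>[OF d] du by simp
    finally have "tensor_map (uaug U) (uaug U) \<theta> \<theta> (\<Delta> (\<phi> u)) = tensor_map (uaug U) (uaug U) \<theta> \<theta> (tensor_map T T \<phi> \<phi> ?X)" by simp
    also have "\<dots> = tensor_map (uaug U) (uaug U) (\<lambda>x. x) (\<lambda>x. x) ?X"
      by (rule tensor_map_tensor_map[OF vU vsT vU \<phi>l \<theta>l lin_hom_id inv Xc])
    also have "\<dots> = ?X" by (rule tensor_map_id[OF vU Xc])
    finally show ?thesis by simp
  qed
  have "\<exists>d. d \<in> carrier (uaug D) \<and> \<pi> d = u"
    using u by (auto simp: env_facts(2) env1_proj_def)
  then have "(\<lambda>x. tensor_map (uaug U) (uaug U) \<pi> \<pi> (?\<Delta> x)) ` {x \<in> carrier (uaug D). \<pi> x = u} =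
      {tensor_map (uaug U) (uaug U) \<theta> \<theta> (\<Delta> (\<phi> u))}"
    using fib by (auto simp del: uaug_simps simp: image_iff)
  then show ?thesis
    unfolding env1_coproduct_def Let_def env1_def tensor_map_def unital_space uaug_ops by simp
qed

section \<open>Primitive elements of the tensor coalgebra\<close>

definition letter_part where "letter_part = snoc_lift V 0 (\<lambda>t y. scale (word_counit t) y)"

text \<open>The counit kills every nonempty initial segment, so this is the projection onto words of
  length one.\<close>

lemma letter_part:
  shows letter_part_lin: "letter_part \<in> lin_hom T V" and letter_part_one: "letter_part one_T = 0"
    and letter_part_snoc: "t \<in> carrier T \<Longrightarrow> letter_part (snoc t y) = scale (word_counit t) y"
proof -
  have b: "bilin T V V (\<lambda>t y. scale (word_counit t) y)"
    using lin_hom_smult_left[OF vsV word_counit_lin] lin_hom_smult'[OF vsV lin_hom_id] by (intro bilinI) simp_all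
  show "letter_part \<in> lin_hom T V" unfolding letter_part_def by (rule snoc_lift_lin[OF vsV _ b]) simp
  show "letter_part one_T = 0" unfolding letter_part_def by (rule snoc_lift_one[OF vsV _ b]) simp
  show "t \<in> carrier T \<Longrightarrow> letter_part (snoc t y) = scale (word_counit t) y"
    unfolding letter_part_def by (rule snoc_lift_snoc[OF vsV _ b]) simp
qed

lemma letter_part_letter [simp]: "letter_part (wd [x]) = x"
  using letter_part_snoc[OF wd_closed, of "[]" x] by simp

text \<open>\<open>\<Sum> t\<^sub>1 \<cdot> letter_part t\<^sub>2\<close> reassembles the last letter, whereas on a primitive element only
  \<open>1 \<cdot> letter_part t\<close> survives.\<close>

lemma word_primitive:
  assumes t: "t \<in> carrier T" and p: "\<Delta> t = pt t one_T \<oplus>\<^bsub>TT\<^esub> pt one_T t"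
  shows "t = wd [letter_part t]"
proof -
  have bs: "bilin T T T (\<lambda>u v. snoc u (letter_part v))" by (rule bilin_arg[OF bilin_snoc lin_hom_id letter_part_lin])
  have bc: "bilin T T ground (\<lambda>u v. counit_T u * counit_T v)"
    by (intro bilinI lin_hom_ground_mult word_counit_lin)
  have prim: "Sw P \<beta> t = \<beta> t one_T \<oplus>\<^bsub>P\<^esub> \<beta> one_T t" if P: "vs P" and \<beta>: "bilin T T P \<beta>" for P :: "('k, 'p, 'q) module_scheme" and \<beta>
    unfolding Sw_def p using t
    by (simp add: lin_homD(2)[OF tensor_lift_lin_hom[OF vsT vsT P \<beta>]] tensor_lift_pure[OF vsT vsT P \<beta>])
  \<comment> \<open>The product of the counits of the two factors sums to the counit of t by the
    counit law, and to twice that value by primitivity. Hence it is zero, in any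
    characteristic.\<close>
  have "Sw ground (\<lambda>u v. counit_T u * counit_T v) t = counit_T t"
    using Sw_counit_left[OF vs_ground word_counit_lin t] by simp
  moreover have "Sw ground (\<lambda>u v. counit_T u * counit_T v) t = counit_T t + counit_T t"
    using tensor_lift_pure[OF vsT vsT vs_ground bc] lin_homD(2)[OF tensor_lift_lin_hom[OF vsT vsT vs_ground bc]] t
    by (simp add: Sw_def p)
  ultimately have e: "counit_T t = 0" by (metis add_cancel_right_right)
  have cl: "(\<lambda>t. t \<oplus>\<^bsub>T\<^esub> (- counit_T t) \<odot>\<^bsub>T\<^esub> one_T) \<in> lin_hom T T"
    using lin_hom_sum[OF vsT lin_hom_id lin_hom_smult_left[OF vsT lin_hom_ground_mult(2)[OF word_counit_lin] wd_closed], of "- 1" "[]"] by simp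
  have z: "snoc u 0 = \<zero>\<^bsub>T\<^esub>" if "u \<in> carrier T" for u
    using bilin_zero(2)[OF bilin_snoc vsT vsV vsT that] by simp
  have "Sw T (\<lambda>u v. snoc u (letter_part v)) t = t \<oplus>\<^bsub>T\<^esub> (- counit_T t) \<odot>\<^bsub>T\<^esub> one_T"
  proof (rule T_lin_cases[OF vsT Sw_lin[OF vsT bs] cl _ _ t])
    fix t y assume t: "t \<in> carrier T"
    have s1: "(\<lambda>u. snoc u y) \<in> lin_hom T T" by (rule snoc_lin)
    have br: "bilin T T T (\<lambda>u v. counit_T v \<odot>\<^bsub>T\<^esub> u)"
      by (intro bilinI lin_hom_smult_left[OF vsT] lin_hom_smult'[OF vsT] word_counit_lin lin_hom_id)
    have b2: "bilin T T T (\<lambda>u v. snoc (counit_T v \<odot>\<^bsub>T\<^esub> u) y)" by (rule bilin_comp[OF br s1])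
    \<comment> \<open>Since \<open>letter_part (snoc v y)\<close> is the counit of v times y, only
      the cut right before y contributes, and it reassembles t y.\<close>
    have "Sw T (\<lambda>u v. snoc u (letter_part (snoc v y))) t = Sw T (\<lambda>u v. snoc (counit_T v \<odot>\<^bsub>T\<^esub> u) y) t"
      by (rule Sw_cong[OF _ vsT b2 t])
         (use bilinD(4,5)[OF bilin_snoc] in \<open>simp add: letter_part_snoc\<close>)
    also have "\<dots> = snoc t y"
      using Sw_comp[OF vsT br vsT s1 t] Sw_counit_right[OF t] by simp
    finally show "Sw T (\<lambda>u v. snoc u (letter_part v)) (snoc t y) = snoc t y \<oplus>\<^bsub>T\<^esub> (- counit_T (snoc t y)) \<odot>\<^bsub>T\<^esub> one_T"
      using t by (simp add: Sw_snoc[OF vsT bs t] letter_part_one z)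
  qed (simp add: Sw_one[OF vsT bs] letter_part_one z del: snoc_wd)
  moreover have "Sw T (\<lambda>u v. snoc u (letter_part v)) t = wd [letter_part t]"
    using t by (simp add: prim[OF vsT bs] letter_part_one z)
  ultimately show ?thesis using t e by simp
qed

lemma env1_iso_and_primitives:
  "(\<exists>\<phi>. \<phi> \<in> coalgebra_iso (env1 scale brace) (env1_coproduct scale brace) fst T \<Delta> word_counit) \<and>
    bij_betw (env1_in scale brace) UNIV (primitive (env1 scale brace) (env1_coproduct scale brace))"
proof -
  interpret LD: letters scale "uaug D" "\<lambda>x. (0, \<iota> x)" by (rule letters_free_dend)
  interpret LU: letters scale "uaug U" "env1_in scale brace" by (rule letters_env)
  obtain \<Phi> \<phi> where \<Phi>: "\<Phi> \<in> aug_hom (uaug D) word_aug" and \<Phi>i: "\<And>x. \<Phi> (0, \<iota> x) = wd [x]"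
    and \<phi>: "\<phi> \<in> aug_hom (uaug U) word_aug" and \<phi>\<pi>: "\<And>d. d \<in> carrier (uaug D) \<Longrightarrow> \<phi> (\<pi> d) = \<Phi> d"
    by (rule env_to_words) blast
  note vU = LU.W.vs
  let ?j = "env1_in scale brace"
  have \<phi>j: "\<phi> (?j x) = wd [x]" for x
    using \<phi>\<pi>[OF LD.i_closed[of x]] by (simp add: env1_in_eq \<Phi>i)
  \<comment> \<open>A morphism to words that fixes letters recovers t from the left-nested product
    of its letters.\<close>
  have \<phi>\<theta>: "\<phi> (\<theta> t) = t" if "t \<in> carrier T" for t
    by (rule sea_word_aug[OF letters_env \<phi> \<phi>j that])
  have \<theta>\<phi>: "\<theta> (\<phi> u) = u" if u: "u \<in> carrier (uaug U)" for u
  proof -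
    obtain d where d: "d \<in> carrier (uaug D)" "\<pi> d = u"
      using u by (auto simp: env_facts(2) env1_proj_def)
    \<comment> \<open>The other composite is compared on the free algebra, where two morphisms that
      agree on generators coincide; every u lifts along \<pi>.\<close>
    have "\<theta> (\<Phi> d) = \<pi> d"
    proof (rule free_dend_hom_eqI[OF LU.W.augmented_axioms aug_hom_comp[OF \<Phi> \<theta>_hom] env1_proj_hom _ d(1)])
      show "\<theta> (\<Phi> (0, \<iota> x)) = \<pi> (0, \<iota> x)" for x
        unfolding \<Phi>i LU.sea_letter by (simp add: env1_in_eq)
    qed
    then show ?thesis using d \<phi>\<pi>[OF d(1)] by simp
  qed
  have \<phi>l: "\<phi> \<in> lin_hom (uaug U) T" and \<theta>l: "\<theta> \<in> lin_hom T (uaug U)"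
    using aug_homD(1)[OF \<phi>] aug_homD(1)[OF \<theta>_hom] by simp_all
  have \<phi>1: "\<phi> \<one>\<^bsub>uaug U\<^esub> = one_T" and \<phi>e: "\<And>u. u \<in> carrier (uaug U) \<Longrightarrow> word_counit (\<phi> u) = fst u"
    using aug_homD(2,3)[OF \<phi>] by simp_all
  note \<phi>c = lin_homD(1)[OF \<phi>l] and \<theta>c = lin_homD(1)[OF \<theta>l]
  have co: "env1_coproduct scale brace u = tensor_map (uaug U) (uaug U) \<theta> \<theta> (\<Delta> (\<phi> u))" if "u \<in> carrier (uaug U)" for u
    by (rule env1_coproduct_eq[OF \<Phi> \<Phi>i \<phi> \<phi>\<pi> \<theta>\<phi> that])
  have \<Delta>\<phi>: "\<Delta> (\<phi> u) = tensor_map T T \<phi> \<phi> (env1_coproduct scale brace u)" if u: "u \<in> carrier (uaug U)" for u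
  proof -
    have c: "\<Delta> (\<phi> u) \<in> carrier TT" using \<phi>c[OF u] by simp
    have "tensor_map T T \<phi> \<phi> (env1_coproduct scale brace u) = tensor_map T T (\<lambda>x. x) (\<lambda>x. x) (\<Delta> (\<phi> u))"
      unfolding co[OF u] by (rule tensor_map_tensor_map[OF vsT vU vsT \<theta>l \<phi>l lin_hom_id \<phi>\<theta> c])
    then show ?thesis using tensor_map_id[OF vsT c] by simp
  qed
  have bij: "bij_betw \<phi> (carrier (uaug U)) (carrier T)"
    by (rule bij_betwI[where g = \<theta>]) (use \<phi>c \<theta>c \<phi>\<theta> \<theta>\<phi> in auto)
  have iso: "\<phi> \<in> coalgebra_iso (env1 scale brace) (env1_coproduct scale brace) fst T \<Delta> word_counit"
    unfolding coalgebra_iso_def coalgebra_hom_def env1_def unital_space uaug_ops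
    using bij \<phi>l \<Delta>\<phi> \<phi>e by blast
  have prim: "primitive (env1 scale brace) (env1_coproduct scale brace) = {u \<in> carrier (uaug U).
      env1_coproduct scale brace u = pure_tensor (uaug U) (uaug U) u \<one>\<^bsub>uaug U\<^esub> \<oplus>\<^bsub>tensor (uaug U) (uaug U)\<^esub>
        pure_tensor (uaug U) (uaug U) \<one>\<^bsub>uaug U\<^esub> u}"
    unfolding primitive_def env1_def unital_space uaug_ops ..
  have "bij_betw ?j UNIV (primitive (env1 scale brace) (env1_coproduct scale brace))"
  \<comment> \<open>The inverse sends a primitive u to the single letter that makes up \<phi> u, by
    \<open>word_primitive\<close>.\<close>
  proof (rule bij_betw_byWitness[where f' = "\<lambda>u. letter_part (\<phi> u)"])
    show "\<forall>x\<in>UNIV. letter_part (\<phi> (?j x)) = x" by (simp add: \<phi>j)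
    show "\<forall>u\<in>primitive (env1 scale brace) (env1_coproduct scale brace). ?j (letter_part (\<phi> u)) = u"
    proof
      fix u assume "u \<in> primitive (env1 scale brace) (env1_coproduct scale brace)"
      then have u: "u \<in> carrier (uaug U)" and p: "env1_coproduct scale brace u =
        pure_tensor (uaug U) (uaug U) u \<one>\<^bsub>uaug U\<^esub> \<oplus>\<^bsub>tensor (uaug U) (uaug U)\<^esub> pure_tensor (uaug U) (uaug U) \<one>\<^bsub>uaug U\<^esub> u"
        unfolding prim by blast+
      have "\<Delta> (\<phi> u) = pt (\<phi> u) one_T \<oplus>\<^bsub>TT\<^esub> pt one_T (\<phi> u)"
        unfolding \<Delta>\<phi>[OF u] p using u LU.W.one_closed
        by (simp add: lin_homD(2)[OF tensor_map_lin_hom[OF vU vU vsT vsT \<phi>l \<phi>l]] tensor_map_pure[OF vU vU vsT vsT \<phi>l \<phi>l]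
            pure_closed[OF vU vU] \<phi>1 del: uaug_simps)
      from word_primitive[OF \<phi>c[OF u] this] have "\<phi> u = wd [letter_part (\<phi> u)]" .
      then have "\<theta> (\<phi> u) = ?j (letter_part (\<phi> u))" using LU.sea_letter by metis
      then show "?j (letter_part (\<phi> u)) = u" using \<theta>\<phi>[OF u] by simp
    qed
    show "?j ` UNIV \<subseteq> primitive (env1 scale brace) (env1_coproduct scale brace)"
    proof (rule image_subsetI)
      fix x
      have "env1_coproduct scale brace (?j x) = tensor_map (uaug U) (uaug U) \<theta> \<theta> (pt (wd [x]) one_T \<oplus>\<^bsub>TT\<^esub> pt one_T (wd [x]))"
        unfolding co[OF LU.i_closed] \<phi>j deconcatenation_letter ..
      also have "\<dots> = pure_tensor (uaug U) (uaug U) (?j x) \<one>\<^bsub>uaug U\<^esub> \<oplus>\<^bsub>tensor (uaug U) (uaug U)\<^esub> pure_tensor (uaug U) (uaug U) \<one>\<^bsub>uaug U\<^esub> (?j x)"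
        by (simp add: lin_homD(2)[OF tensor_map_lin_hom[OF vsT vsT vU vU \<theta>l \<theta>l]] tensor_map_pure[OF vsT vsT vU vU \<theta>l \<theta>l] LU.sea_letter LU.sea_one
            del: uaug_simps)
      finally show "?j x \<in> primitive (env1 scale brace) (env1_coproduct scale brace)"
        unfolding prim using LU.i_closed by blast
    qed
  qed simp
  then show ?thesis using iso by blast
qed

end

theorem proposition14:
  fixes scale :: "'k::field \<Rightarrow> 'b::ab_group_add \<Rightarrow> 'b"
    and brace :: "'b \<Rightarrow> 'b list \<Rightarrow> 'b"
  assumes "brace_algebra scale brace"
  shows "(\<exists>\<phi>. \<phi> \<in> coalgebra_iso (env1 scale brace) (env1_coproduct scale brace) fst
                 (tensor_words scale) (deconcatenation scale) word_counit) \<and>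
         bij_betw (env1_in scale brace) UNIV
           (primitive (env1 scale brace) (env1_coproduct scale brace))"
  by (rule brace_algebra.env1_iso_and_primitives[OF assms])

end
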